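(* Let $L>0$ and let $\gamma(s)=(x(s),y(s))$, $s\in[0,L]$, be a smooth, simple, non-closed plane curve parametrized by arc length and symmetric with respect to the $y$-axis, i.e. $x(L-s)=-x(s)$ and $y(L-s)=y(s)$ for $s\in[0,L/2]$. Let $k(s)$ be its signed curvature. Let $\delta>0$ be a constant. Put $$D^F=\{(s,r)\in\mathbb{R}^2: 0<s<L,\ 0<r<\delta\},\qquad D=\{(x(s)+ry'(s),\,y(s)-rx'(s)): (s,r)\in D^F\},$$ and assume that the map $(s,r)\mapsto (x(s)+ry'(s),\,y(s)-rx'(s))$ is one-to-one from $\overline{D^F}$ onto $\overline{D}$. Let $p=2$. Suppose that $k(s)$ is concave on $[0,L]$, that $1+rk(s)>0$ on $\overline{D^F}$, and that one of the following conditions holds: (a) $k(s)\ge 0$ for all $s\in[0,L]$ and $\mu_1(D)<\dfrac{1}{\max_{s\in[0,L]}(2\delta+\delta^2k(s))^2}$; (b) $k(s)<0$ for all $s\in[0,L]$ and $\mu_1(D)<\dfrac{1}{\max_{s\in[0,L]}\frac{4\delta^2}{(1+\delta k(s))^2}}$; (c) $k(s)$ changes its sign in $[0,L]$ and $\mu_1(D)<\dfrac{1}{\max\left\{\max_{s\in[0,L]}(2\delta+\delta^2k(s))^2,\ \max_{s\in[0,L]}\frac{4\delta^2}{(1+\delta k(s))^2}\right\}}$. Then $$\mu_1(D)=\mu_1^{odd}(D)\ge A_2\left(\frac{\pi}{L}\right)^2,\qquad A_2=\min_{(s,r)\in\overline{D^F}}\frac{1}{(1+rk(s))^2}.$$ The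 estimate is sharp: equality holds when $D$ is a rectangle, i.e. when $\gamma$ is a segment (so that $k\equiv 0$) and $\delta$ is constant, with $\mu_1(D)<\dfrac{1}{4\delta^2}$ (which is what condition (a) becomes for $k\equiv 0$).
   Context: Signed curvature: $k(s)=x'(s)y''(s)-x''(s)y'(s)$, so that the Jacobian of the map $(s,r)\mapsto(x(s)+ry'(s),y(s)-rx'(s))$ has absolute value $|1+rk(s)|$. Here $p=2$, so the eigenvalue problem is the Neumann Laplacian problem $-\Delta u=\mu u$ in $D$, $\frac{\partial u}{\partial\mathbf{n}}=0$ on $\partial D$ (in the weak sense). Its first nonzero eigenvalue is $$\mu_1(D)=\min\left\{\frac{\int_D|\nabla v|^2\,dxdy}{\int_D v^2\,dxdy}: v\in W^{1,2}(D)\setminus\{0\},\ \int_D v\,dxdy=0\right\}.$$ $\mu_1^{odd}(D)$ denotes the lowest nonzero eigenvalue having a corresponding eigenfunction that is odd with respect to the $y$-axis ($u(-x,y)=-u(x,y)$); equivalently, it is the minimum of $\int_D|\nabla v|^2\,dxdy\big/\int_D v^2\,dxdy$ over nonzero $v\in W^{1,2}(D)$ odd with respect to the $y$-axis. *)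

theory Defs
  imports "HOL-Analysis.Analysis"
begin

primrec Ck :: "nat \<Rightarrow> ('a::euclidean_space \<Rightarrow> real) \<Rightarrow> bool" where
  "Ck 0 f \<longleftrightarrow> continuous_on UNIV f"
| "Ck (Suc n) f \<longleftrightarrow> (\<forall>z. f differentiable (at z)) \<and>
     (\<forall>b\<in>Basis. Ck n (\<lambda>z. frechet_derivative f (at z) b))"

definition test_function :: "'a::euclidean_space set \<Rightarrow> ('a \<Rightarrow> real) \<Rightarrow> bool" where
  "test_function D \<phi> \<longleftrightarrow>
     (\<forall>n. Ck n \<phi>) \<and> compact (closure {z. \<phi> z \<noteq> 0}) \<and> closure {z. \<phi> z \<noteq> 0} \<subseteq> D"

definition square_integrable :: "'a::euclidean_space set \<Rightarrow> ('a \<Rightarrow> 'b::euclidean_space) \<Rightarrow> bool" where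
  "square_integrable D f \<longleftrightarrow>
     f \<in> borel_measurable (lebesgue_on D) \<and> integrable (lebesgue_on D) (\<lambda>z. (norm (f z))\<^sup>2)"

text \<open>\<open>W12 D v G\<close> says that \<open>v\<close> represents an element of $W^{1,2}(D)$ whose weak gradient is
  (a.e.) \<open>G\<close>. As for Lebesgue functions in general, \<open>v\<close> and \<open>G\<close> are representatives up to null
  sets and their values outside \<open>D\<close> are irrelevant; on an open set the weak gradient is unique up
  to null sets.\<close>

definition W12 :: "'a::euclidean_space set \<Rightarrow> ('a \<Rightarrow> real) \<Rightarrow> ('a \<Rightarrow> 'a) \<Rightarrow> bool" where
  "W12 D v G \<longleftrightarrow> square_integrable D v \<and> square_integrable D G \<and>
     (\<forall>\<phi>. test_function D \<phi> \<longrightarrow> (\<forall>b\<in>Basis.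
        (LINT z|lebesgue_on D. v z * frechet_derivative \<phi> (at z) b) =
        - (LINT z|lebesgue_on D. (G z \<bullet> b) * \<phi> z)))"

definition neumann_eigenfunction ::
    "'a::euclidean_space set \<Rightarrow> real \<Rightarrow> ('a \<Rightarrow> real) \<Rightarrow> bool" where
  "neumann_eigenfunction D \<mu> u \<longleftrightarrow>
     \<not> (AE z in lebesgue_on D. u z = 0) \<and>
     (\<exists>G. W12 D u G \<and>
        (\<forall>v H. W12 D v H \<longrightarrow>
           (LINT z|lebesgue_on D. G z \<bullet> H z) = \<mu> * (LINT z|lebesgue_on D. u z * v z)))"

text \<open>Testing the weak equation with \<open>v = u\<close> shows that eigenvalues are nonnegative, and on the
  strips considered here (bounded connected Lipschitz domains) the least nonzero eigenvalue exists
  and is the minimum of the Rayleigh quotient over the nonzero \<open>v\<close> in $W^{1,2}(D)$ of mean zero.\<close>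

definition mu1 :: "'a::euclidean_space set \<Rightarrow> real" where
  "mu1 D = (LEAST \<mu>. \<mu> \<noteq> 0 \<and> (\<exists>u. neumann_eigenfunction D \<mu> u))"

definition odd_wrt_y_axis :: "(real \<times> real) set \<Rightarrow> (real \<times> real \<Rightarrow> real) \<Rightarrow> bool" where
  "odd_wrt_y_axis D u \<longleftrightarrow> (AE z in lebesgue_on D. u (- fst z, snd z) = - u z)"

definition mu1_odd :: "(real \<times> real) set \<Rightarrow> real" where
  "mu1_odd D =
     (LEAST \<mu>. \<mu> \<noteq> 0 \<and> (\<exists>u. neumann_eigenfunction D \<mu> u \<and> odd_wrt_y_axis D u))"

text \<open>Derivatives are taken relative to the parameter interval, so they are one-sided at its end
  points and values of the curve outside the interval play no role.\<close>

definition deriv_within :: "real set \<Rightarrow> (real \<Rightarrow> real) \<Rightarrow> real \<Rightarrow> real" where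
  "deriv_within S f = (\<lambda>s. vector_derivative f (at s within S))"

definition smooth_within :: "real set \<Rightarrow> (real \<Rightarrow> real) \<Rightarrow> bool" where
  "smooth_within S f \<longleftrightarrow> (\<forall>n. \<forall>s\<in>S. (deriv_within S ^^ n) f differentiable (at s within S))"

definition signed_curvature :: "real \<Rightarrow> (real \<Rightarrow> real) \<Rightarrow> (real \<Rightarrow> real) \<Rightarrow> real \<Rightarrow> real" where
  "signed_curvature L x y s =
     (let d = deriv_within {0..L} in d x s * d (d y) s - d (d x) s * d y s)"

definition param_domain :: "real \<Rightarrow> real \<Rightarrow> (real \<times> real) set" where
  "param_domain L \<delta> = {(s, r). 0 < s \<and> s < L \<and> 0 < r \<and> r < \<delta>}"

definition strip_map ::
    "real \<Rightarrow> (real \<Rightarrow> real) \<Rightarrow> (real \<Rightarrow> real) \<Rightarrow> real \<times> real \<Rightarrow> real \<times> real" where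
  "strip_map L x y =
     (\<lambda>(s, r). (x s + r * deriv_within {0..L} y s, y s - r * deriv_within {0..L} x s))"

definition strip :: "real \<Rightarrow> real \<Rightarrow> (real \<Rightarrow> real) \<Rightarrow> (real \<Rightarrow> real) \<Rightarrow> (real \<times> real) set" where
  "strip L \<delta> x y = strip_map L x y ` param_domain L \<delta>"

end

theory Submission
  imports Defs
begin

text \<open>In the coordinates $(s,r)$ the strip becomes the rectangle $D^F$ with weight
  $w = 1 + r k(s)$: mass and energy turn into $\int f^2 w$ and $\int (f_s^2/w + f_r^2 w)$, and
  Sobolev functions are absolutely continuous on almost every fibre. Let $u$ be a first
  eigenfunction, with $f$ its transport to the rectangle.

  If $u$ is not even, its odd part is an odd first eigenfunction. If $u$ is even and almost no
  fibre $\{s\} \times (0,\delta)$ lies in $\{f > 0\}$, then $f^+$ comes arbitrarily close to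
  zero on almost every fibre, and a one-dimensional Poincare inequality across the strip, applied to $f^+$ in
  the weak equation, contradicts the upper bound on $\mu_1$; the same holds for $-f$. Otherwise, up
  to sign, $f > 0$ on one fibre $s_0$ and $f < 0$ on a fibre $s_1$ with $s_0 < s_1 < L/2$ (after a
  reflection). Then $f^+$ cut off at $s_1$, minus its mirror image, is an odd admissible function with
  Rayleigh quotient $\mu_1$, hence an odd first eigenfunction.

  The lower bound follows by integrating over $r$ a weighted Wirtinger inequality for odd functions
  of $s$, which holds because concavity and symmetry make $w$ nondecreasing on $[0,L/2]$.\<close>

text \<open>Both eigenvalues are defined as least elements, so nothing can be said about them before
  minimizers exist. The compactness this needs comes from a Poincare inequality on a fine grid; an
  abstract minimization argument then works with finitely many functionals.

  The passage between strip and rectangle is the main obstacle. Weak gradients are tested with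
  infinitely smooth functions, while a function carried through the curve coordinates is only
  handled as C1; mollification shows that C1 test functions suffice. The curvature terms produced by
  the turning frame must then cancel, in both directions of the transport.

  An eigenfunction is defined only up to null sets, yet the argument cuts it at one exact fibre.
  This becomes meaningful through the representative c(r) plus the integral of the s-derivative,
  which makes sense on every fibre. The cut is harmless because this representative is nonpositive
  there, and before L/2 the truncation is disjoint from its mirror image. Oddness gives mean zero
  for free, since the weight is symmetric.\<close>

lemmas LINT_cong = Bochner_Integration.integral_cong

section \<open>Products of square-integrable functions and the Cauchy-Schwarz inequality\<close>

lemma integrable_mult_L2:
  fixes f g :: "'a => real"
  assumes [measurable]: "f \<in> borel_measurable M" "g \<in> borel_measurable M"
    and "integrable M (%z. (f z)^2)" "integrable M (%z. (g z)^2)"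
  shows "integrable M (%z. f z * g z)"
proof (rule Bochner_Integration.integrable_bound)
  show "integrable M (%z. (f z)^2 + (g z)^2)" using assms by simp
  show "AE z in M. norm (f z * g z) \<le> norm ((f z)^2 + (g z)^2)"
  proof (rule AE_I2)
    fix z
    have "2 * \<bar>f z * g z\<bar> \<le> (f z)^2 + (g z)^2"
      using sum_squares_bound[of "\<bar>f z\<bar>" "\<bar>g z\<bar>"] by (simp add: abs_mult)
    then show "norm (f z * g z) \<le> norm ((f z)^2 + (g z)^2)" by simp
  qed
qed simp

lemma integrable_add_L2:
  fixes f g :: "'a => real"
  assumes [measurable]: "f \<in> borel_measurable M" "g \<in> borel_measurable M"
    and "integrable M (%z. (f z)^2)" "integrable M (%z. (g z)^2)"
  shows "integrable M (%z. (f z + g z)^2)"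
proof -
  have "integrable M (%z. (f z)^2 + (g z)^2 + 2 * (f z * g z))"
    using assms integrable_mult_L2[of f M g] by simp
  then show ?thesis by (simp add: power2_sum mult.assoc)
qed

text \<open>The integral of \<open>(t * f + g)^2\<close> is a nonnegative quadratic polynomial in
  \<open>t\<close>, and its value at the minimum gives the claim. The degenerate case
  \<open>A = 0\<close> has no minimum point and is treated apart.\<close>

lemma Cauchy_Schwarz_L2:
  fixes f g :: "'a => real"
  assumes [measurable]: "f \<in> borel_measurable M" "g \<in> borel_measurable M"
    and f: "integrable M (%z. (f z)^2)" and g: "integrable M (%z. (g z)^2)"
  shows "(LINT z|M. f z * g z)^2 \<le> (LINT z|M. (f z)^2) * (LINT z|M. (g z)^2)"
proof -
  define A B C where "A = (LINT z|M. (f z)^2)" and "B = (LINT z|M. f z * g z)"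
    and "C = (LINT z|M. (g z)^2)"
  have fg: "integrable M (%z. f z * g z)" by (rule integrable_mult_L2) (use assms in auto)
  have q: "0 \<le> A * t^2 + 2 * B * t + C" for t
  proof -
    have "0 \<le> (LINT z|M. (t * f z + g z)^2)" by simp
    also have "\<dots> = (LINT z|M. t^2 * (f z)^2 + 2 * t * (f z * g z) + (g z)^2)"
      by (simp add: power2_sum power_mult_distrib algebra_simps)
    also have "\<dots> = A * t^2 + 2 * B * t + C" using f g fg by (simp add: A_def B_def C_def)
    finally show ?thesis .
  qed
  have "A \<ge> 0" by (simp add: A_def)
  have "B^2 \<le> A * C"
  proof (cases "A = 0")
    case True
    have "B = 0"
    proof (rule ccontr)
      assume "B \<noteq> 0"
      \<comment> \<open>With \<open>A = 0\<close> the polynomial is \<open>2 * B * t + C\<close>,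
        which equals -1 at this \<open>t\<close>.\<close>
      then show False using q[of "- (C + 1) / (2 * B)"] True by simp
    qed
    then show ?thesis using True by simp
  next
    case False
    then have "A > 0" using \<open>A \<ge> 0\<close> by simp
    have "0 \<le> A * (- B / A)^2 + 2 * B * (- B / A) + C" by (rule q)
    also have "\<dots> = (A * C - B^2) / A" using \<open>A > 0\<close> by (simp add: field_simps power2_eq_square)
    finally show ?thesis using \<open>A > 0\<close> by (simp add: zero_le_divide_iff)
  qed
  then show ?thesis by (simp add: A_def B_def C_def)
qed

section \<open>Absolutely continuous functions on an interval\<close>

text \<open>Borel measure rather than its completion: sections of jointly measurable functions then
  stay measurable, and products of such intervals are planar Borel measure on a rectangle.\<close>

definition iv :: "real => real measure" where "iv a = restrict_space lborel {0<..<a}"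

lemma space_iv [simp]: "space (iv a) = {0<..<a}" by (simp add: iv_def space_restrict_space)

lemma sets_iv: "sets (iv a) = sets (restrict_space borel {0<..<a})"
  by (simp add: iv_def sets_restrict_space)

lemma measurable_iv1: "f \<in> borel_measurable borel ==> f \<in> borel_measurable (iv a)"
  unfolding iv_def by (rule measurable_restrict_space1) simp

lemma measurable_iv_eq: "measurable (iv a) N = measurable (restrict_space borel {0<..<a}) N"
  by (rule measurable_cong_sets) (auto simp: sets_iv)

lemma ident_measurable_iv [measurable (raw)]: "(%x. x) \<in> iv a \<rightarrow>\<^sub>M borel"
  by (rule measurable_iv1) simp

lemma borel_measurable_iv_continuous:
  "continuous_on {0<..<a} f ==> f \<in> borel_measurable (iv a)"
  unfolding measurable_iv_eq by (rule borel_measurable_continuous_on_restrict)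

lemma emeasure_iv: "emeasure (iv a) (space (iv a)) = (if 0 \<le> a then ennreal a else 0)"
  by (auto simp: iv_def emeasure_restrict_space space_restrict_space)

lemma finite_measure_iv: "finite_measure (iv a)"
  by (rule finite_measureI) (use emeasure_iv[of a] in \<open>auto split: if_splits\<close>)

interpretation iv: finite_measure "iv a" for a :: real by (rule finite_measure_iv)

lemma integrable_iv:
  fixes f :: "real => real"
  shows "integrable (iv a) f \<longleftrightarrow> integrable lborel (%x. indicator {0<..<a} x * f x)"
  by (simp add: iv_def integrable_restrict_space)

lemma integral_iv:
  fixes f :: "real => real"
  shows "(LINT x|iv a. f x) = (LINT x|lborel. indicator {0<..<a} x * f x)"
  by (simp add: iv_def integral_restrict_space)

lemma AE_iv: "(AE x in iv a. P x) \<longleftrightarrow> (AE x in lborel. 0 < x \<and> x < a \<longrightarrow> P x)"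
  unfolding iv_def by (subst AE_restrict_space_iff) auto

lemma AE_iv_neq: "AE x in iv a. x \<noteq> c"
  using AE_lborel_singleton[of c] unfolding AE_iv by eventually_elim auto

lemma measure_iv_Ioc:
  assumes "0 \<le> s" "s \<le> t" "t \<le> a"
  shows "(LINT x|iv a. indicator {s<..t} x) = t - s"
proof -
  have "AE x in lborel. indicator {0<..<a} x * indicator {s<..t} x = (indicator {s<..t} x :: real)"
    using AE_lborel_singleton[of a] by eventually_elim (use assms in \<open>auto simp: indicator_def\<close>)
  then have "(LINT x|lborel. indicator {0<..<a} x * indicator {s<..t} x) = (LINT x|lborel. indicator {s<..t} x :: real)"
    by (intro integral_cong_AE) auto
  also have "\<dots> = t - s" using assms by simp
  finally show ?thesis unfolding integral_iv .
qed

lemma measure_iv_space: "0 \<le> a ==> measure (iv a) {0<..<a} = a"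
  using emeasure_iv[of a] by (simp add: measure_def)

lemma integrable_iv_bounded:
  fixes f :: "real => real"
  assumes "f \<in> borel_measurable (iv a)" "\<And>x. 0 < x ==> x < a ==> \<bar>f x\<bar> \<le> B"
  shows "integrable (iv a) f"
  by (rule iv.integrable_const_bound[where B = B]) (use assms in auto)

lemma integrable_iv_continuous:
  fixes f :: "real => real"
  assumes "continuous_on {0..a} f"
  shows "integrable (iv a) f"
proof -
  have "compact (f ` {0..a})" using assms by (intro compact_continuous_image) auto
  then have "bounded (f ` {0..a})" by (rule compact_imp_bounded)
  then obtain B where B: "\<And>x. x \<in> {0..a} ==> \<bar>f x\<bar> \<le> B"
    unfolding bounded_iff by fastforce
  show ?thesis
    by (rule integrable_iv_bounded[of _ _ B])
      (use B in \<open>auto intro!: borel_measurable_iv_continuous continuous_on_subset[OF assms]\<close>)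
qed

text \<open>Absolute continuity with density \<open>p\<close>, expressed by the integral formula
  alone, so that no theorem on almost-everywhere differentiability enters. \<open>F\<close> is fixed
  at every point of the closed interval, whereas \<open>p\<close> matters only up to null
  sets.\<close>

definition AC :: "real => (real => real) => (real => real) => bool" where
  "AC a F p \<longleftrightarrow> integrable (iv a) p \<and>
     (\<forall>s t. 0 \<le> s \<and> s \<le> t \<and> t \<le> a \<longrightarrow> F t - F s = (LINT v|iv a. indicator {s<..t} v * p v))"

lemma integrable_indicator_mult:
  fixes p :: "real => real"
  assumes "integrable (iv a) p" "A \<in> sets borel"
  shows "integrable (iv a) (%v. indicator A v * p v)"
proof (rule Bochner_Integration.integrable_bound[OF assms(1)])
  have [measurable]: "(indicator A :: real => real) \<in> borel_measurable (iv a)"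
    using assms(2) by (intro measurable_iv1) auto
  show "(%v. indicator A v * p v) \<in> borel_measurable (iv a)" using assms(1) by measurable
qed (auto simp: indicator_def)

lemma ACI_primitive:
  assumes p: "integrable (iv a) p"
  shows "AC a (%t. LINT v|iv a. indicator {..t} v * p v) p"
  unfolding AC_def
proof (intro conjI allI impI p)
  fix s t :: real assume st: "0 \<le> s \<and> s \<le> t \<and> t \<le> a"
  have "(LINT v|iv a. indicator {..t} v * p v) - (LINT v|iv a. indicator {..s} v * p v)
    = (LINT v|iv a. indicator {..t} v * p v - indicator {..s} v * p v)"
    by (rule Bochner_Integration.integral_diff[symmetric]) (auto intro!: integrable_indicator_mult p)
  also have "\<dots> = (LINT v|iv a. indicator {s<..t} v * p v)"
    by (rule LINT_cong) (use st in \<open>auto simp: indicator_def\<close>)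
  finally show "(LINT v|iv a. indicator {..t} v * p v) - (LINT v|iv a. indicator {..s} v * p v)
    = (LINT v|iv a. indicator {s<..t} v * p v)" .
qed

lemma AC_integrable: "AC a F p ==> integrable (iv a) p" by (simp add: AC_def)

lemma AC_diff_eq:
  "AC a F p ==> 0 \<le> s ==> s \<le> t ==> t \<le> a ==> F t - F s = (LINT v|iv a. indicator {s<..t} v * p v)"
  by (simp add: AC_def)

lemma AC_const: "AC a (%s. c) (%s. 0)" by (simp add: AC_def)

lemma AC_add:
  assumes "AC a F p" "AC a G q"
  shows "AC a (%s. F s + G s) (%s. p s + q s)"
  unfolding AC_def
proof (intro conjI allI impI)
  note i = assms[THEN AC_integrable]
  show "integrable (iv a) (%s. p s + q s)" using i by simp
  fix s t assume st: "0 \<le> s \<and> s \<le> t \<and> t \<le> a"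
  have "(LINT v|iv a. indicator {s<..t} v * (p v + q v)) =
    (LINT v|iv a. indicator {s<..t} v * p v) + (LINT v|iv a. indicator {s<..t} v * q v)"
    by (simp add: distrib_left integrable_indicator_mult i)
  then show "F t + G t - (F s + G s) = (LINT v|iv a. indicator {s<..t} v * (p v + q v))"
    using assms[THEN AC_diff_eq, of s t] st by simp
qed

lemma AC_cmult:
  assumes "AC a F p"
  shows "AC a (%s. c * F s) (%s. c * p s)"
  unfolding AC_def
proof (intro conjI allI impI)
  show "integrable (iv a) (%s. c * p s)" using AC_integrable[OF assms] by simp
  fix s t assume st: "0 \<le> s \<and> s \<le> t \<and> t \<le> a"
  have "(LINT v|iv a. indicator {s<..t} v * (c * p v)) = c * (LINT v|iv a. indicator {s<..t} v * p v)"
    by (simp add: mult.left_commute)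
  then show "c * F t - c * F s = (LINT v|iv a. indicator {s<..t} v * (c * p v))"
    using assms[THEN AC_diff_eq, of s t] st by (simp flip: right_diff_distrib)
qed

lemma AC_diff:
  assumes "AC a F p" "AC a G q"
  shows "AC a (%s. F s - G s) (%s. p s - q s)"
  using AC_add[OF assms(1) AC_cmult[OF assms(2), of "-1"]] by simp

lemma AC_cong:
  assumes "AC a F p" "\<And>s. 0 \<le> s ==> s \<le> a ==> F s = G s" "AE s in iv a. p s = q s"
    and [measurable]: "q \<in> borel_measurable (iv a)"
  shows "AC a G q"
  unfolding AC_def
proof (intro conjI allI impI)
  have [measurable]: "p \<in> borel_measurable (iv a)" using AC_integrable[OF assms(1)] by simp
  show "integrable (iv a) q"
    using AC_integrable[OF assms(1)] assms(3) by (subst integrable_cong_AE[of _ _ p]) auto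
  fix s t assume st: "0 \<le> s \<and> s \<le> t \<and> t \<le> a"
  have [measurable]: "(indicator {s<..t} :: real => real) \<in> borel_measurable (iv a)"
    by (intro measurable_iv1) auto
  have "(LINT v|iv a. indicator {s<..t} v * p v) = (LINT v|iv a. indicator {s<..t} v * q v)"
    by (rule integral_cong_AE) (use assms(3) in auto)
  then show "G t - G s = (LINT v|iv a. indicator {s<..t} v * q v)"
    using assms(1)[THEN AC_diff_eq, of s t] st assms(2)[of s] assms(2)[of t] by simp
qed

text \<open>Dominated convergence with \<open>\<bar>p\<bar>\<close> as majorant: the indicators of
  \<open>{..x n}\<close> converge to that of \<open>{..c}\<close> except possibly at the single
  point \<open>c\<close>.\<close>

lemma AC_continuous:
  assumes "AC a F p"
  shows "continuous_on {0..a} F"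
proof -
  note p = AC_integrable[OF assms]
  define J where "J t = (LINT v|iv a. indicator {..t} v * p v)" for t
  have 1: "continuous_on {0..a} J"
    unfolding continuous_on_sequentially comp_def
  proof (intro allI ballI impI, elim conjE)
    fix x and c assume c: "c \<in> {0..a}" "\<forall>n. x n \<in> {0..a}" "x \<longlonglongrightarrow> c"
    show "(%n. J (x n)) \<longlonglongrightarrow> J c"
      unfolding J_def
    proof (rule integral_dominated_convergence[where w = "%v. \<bar>p v\<bar>"])
      show "AE v in iv a. (%n. indicator {..x n} v * p v) \<longlonglongrightarrow> indicator {..c} v * p v"
        using AE_iv_neq[where a = a and c = c]
      proof eventually_elim
        case (elim v)
        have "eventually (%n. indicator {..x n} v * p v = indicator {..c} v * p v) sequentially"
        proof (cases "v < c")
          case True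
          show ?thesis using order_tendstoD(1)[OF c(3) True]
            by eventually_elim (use True in \<open>auto simp: indicator_def\<close>)
        next
          case False
          then have "c < v" using elim by simp
          show ?thesis using order_tendstoD(2)[OF c(3) \<open>c < v\<close>]
            by eventually_elim (use \<open>c < v\<close> in \<open>auto simp: indicator_def\<close>)
        qed
        then show ?case by (rule tendsto_eventually)
      qed
      show "(%v. indicator {..c} v * p v) \<in> borel_measurable (iv a)"
        by (rule borel_measurable_integrable[OF integrable_indicator_mult[OF p]]) simp
      show "(%v. indicator {..x n} v * p v) \<in> borel_measurable (iv a)" for n
        by (rule borel_measurable_integrable[OF integrable_indicator_mult[OF p]]) simp
      show "integrable (iv a) (%v. \<bar>p v\<bar>)" using p by (rule integrable_abs)
      show "AE v in iv a. norm (indicator {..x n} v * p v) \<le> \<bar>p v\<bar>" for n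
        by (rule AE_I2) (simp add: indicator_def)
    qed
  qed
  have 2: "F 0 + (J t - J 0) = F t" if "t \<in> {0..a}" for t
  proof -
    have t: "0 \<le> t" "t \<le> a" using that by auto
    show ?thesis
      using AC_diff_eq[OF assms order_refl t] AC_diff_eq[OF ACI_primitive[OF p] order_refl t]
      unfolding J_def by linarith
  qed
  have 3: "continuous_on {0..a} (%t. F 0 + (J t - J 0))"
    using 1 by (intro continuous_on_add continuous_on_diff continuous_on_const)
  show ?thesis
    by (rule continuous_on_eq[OF 3 2])
qed

lemma AC_measurable: "AC a F p ==> F \<in> borel_measurable (iv a)"
  by (rule borel_measurable_iv_continuous, rule continuous_on_subset[OF AC_continuous]) auto

lemma AC_smooth:
  assumes c: "continuous_on {0..a} F" and i: "integrable (iv a) p"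
    and d: "\<And>s. 0 < s ==> s < a ==> (F has_real_derivative p s) (at s)"
  shows "AC a F p"
  unfolding AC_def
proof (intro conjI allI impI i)
  fix s t assume st: "0 \<le> s \<and> s \<le> t \<and> t \<le> a"
  have hk: "(p has_integral (F t - F s)) {s..t}"
    using st d by (intro fundamental_theorem_of_calculus_interior continuous_on_subset[OF c])
      (auto simp: has_real_derivative_iff_has_vector_derivative)
  define q where "q v = indicator {0<..<a} v * p v" for v
  have q: "integrable lborel q" using i unfolding integrable_iv q_def .
  then have [measurable]: "q \<in> borel_measurable borel" using borel_measurable_integrable by force
  have si: "set_integrable lborel {s..t} q"
    unfolding set_integrable_def by (rule integrable_mult_indicator[OF _ q]) simp
  have hq: "(q has_integral (F t - F s)) {s..t}"
  proof (rule has_integral_spike_finite[OF _ _ hk])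
    show "finite {s, t}" by simp
  qed (use st in \<open>auto simp: q_def indicator_def\<close>)
  have "F t - F s = (LINT v:{s..t}|lborel. q v)"
    using set_borel_integral_eq_integral(2)[OF si] hq by (simp add: has_integral_iff)
  also have "\<dots> = (LINT v|lborel. indicator {s<..t} v * q v)"
    unfolding set_lebesgue_integral_def
  proof (rule integral_cong_AE)
    show "AE v in lborel. indicator {s..t} v *\<^sub>R q v = indicator {s<..t} v * q v"
      using AE_lborel_singleton[of s] by eventually_elim (auto simp: indicator_def)
  qed measurable
  also have "\<dots> = (LINT v|iv a. indicator {s<..t} v * p v)"
    unfolding integral_iv q_def by (simp add: mult.left_commute)
  finally show "F t - F s = (LINT v|iv a. indicator {s<..t} v * p v)" .
qed

text \<open>Subdivide the interval into equal steps shorter than \<open>\<eta>\<close> and add up.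
  The right-hand side is an increment, hence additive, so the bound passes from short intervals to
  long ones.\<close>

lemma telescoping_bound:
  fixes Q N :: "real => real"
  assumes "0 < \<eta>" "0 \<le> a"
    and loc: "\<And>s t. 0 \<le> s ==> s \<le> t ==> t \<le> a ==> t - s < \<eta> ==> \<bar>Q t - Q s\<bar> \<le> N t - N s"
    and st: "0 \<le> s" "s \<le> t" "t \<le> a"
  shows "\<bar>Q t - Q s\<bar> \<le> N t - N s"
proof -
  obtain n :: nat where n: "(t - s) / \<eta> < real n" using reals_Archimedean2 by blast
  then have "real n > 0" using assms by (smt (verit) divide_nonneg_pos)
  define h where "h = (t - s) / real n"
  have h: "0 \<le> h" "h < \<eta>" "real n * h = t - s"
    using n \<open>real n > 0\<close> assms by (auto simp: h_def field_simps)
  have "\<bar>Q (s + real i * h) - Q s\<bar> \<le> N (s + real i * h) - N s" if "i \<le> n" for i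
    using that
  proof (induction i)
    case (Suc i)
    have "real (Suc i) * h \<le> real n * h" using Suc.prems h by (intro mult_right_mono) auto
    then have "\<bar>Q (s + real (Suc i) * h) - Q (s + real i * h)\<bar> \<le> N (s + real (Suc i) * h) - N (s + real i * h)"
      using h st by (intro loc) (auto simp: algebra_simps)
    then show ?case using Suc by simp
  qed simp
  from this[of n] show ?thesis using h by simp
qed

text \<open>\<open>F\<close> is never differentiated. The candidate \<open>J\<close> is the
  primitive of \<open>\<beta>' (F s) * p s\<close>, and \<open>Q = \<beta> (F t) - J t\<close> has
  to be constant. Over short intervals the mean value theorem bounds its increments by
  \<open>\<epsilon>\<close> times those of \<open>N\<close>, a primitive of
  \<open>\<bar>p\<bar>\<close>; the bound adds up over long intervals, and \<open>\<epsilon>\<close>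
  tends to 0.\<close>

lemma AC_chain:
  assumes F: "AC a F p" and c: "continuous_on UNIV \<beta>'"
    and d: "\<And>x. (\<beta> has_real_derivative \<beta>' x) (at x)" and a: "0 \<le> a"
  shows "AC a (%s. \<beta> (F s)) (%s. \<beta>' (F s) * p s)"
proof -
  note p = AC_integrable[OF F] and Fc = AC_continuous[OF F]
  have "bounded (F ` {0..a})" using Fc by (intro compact_imp_bounded compact_continuous_image) auto
  then obtain B where B: "\<And>x. x \<in> {0..a} ==> \<bar>F x\<bar> \<le> B"
    unfolding bounded_iff by fastforce
  have cc: "continuous_on {0..a} (%s. \<beta>' (F s))"
    using continuous_on_compose[OF Fc continuous_on_subset[OF c]] by (simp add: o_def)
  have [measurable]: "(%s. \<beta>' (F s)) \<in> borel_measurable (iv a)"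
    by (rule borel_measurable_iv_continuous) (auto intro: continuous_on_subset[OF cc])
  have "bounded ((%s. \<beta>' (F s)) ` {0..a})" using cc by (intro compact_imp_bounded compact_continuous_image) auto
  then obtain C where C: "\<And>x. x \<in> {0..a} ==> \<bar>\<beta>' (F x)\<bar> \<le> C"
    unfolding bounded_iff by fastforce
  define g where "g s = \<beta>' (F s) * p s" for s
  have g: "integrable (iv a) g"
  proof (rule Bochner_Integration.integrable_bound[of _ "%s. C * p s"])
    show "g \<in> borel_measurable (iv a)" unfolding g_def using p by measurable
    show "AE s in iv a. norm (g s) \<le> norm (C * p s)"
    proof (rule AE_I2)
      fix s assume "s \<in> space (iv a)"
      then have "\<bar>\<beta>' (F s)\<bar> \<le> C" using C[of s] by simp
      then have "\<bar>\<beta>' (F s)\<bar> * \<bar>p s\<bar> \<le> \<bar>C\<bar> * \<bar>p s\<bar>" by (intro mult_right_mono) auto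
      then show "norm (g s) \<le> norm (C * p s)" by (simp add: g_def abs_mult)
    qed
  qed (use p in auto)
  define J where "J t = (LINT v|iv a. indicator {..t} v * g v)" for t
  define N where "N t = (LINT v|iv a. indicator {..t} v * \<bar>p v\<bar>)" for t
  have J: "AC a J g" unfolding J_def by (rule ACI_primitive[OF g])
  have N: "AC a N (%s. \<bar>p s\<bar>)" unfolding N_def by (rule ACI_primitive) (use p in auto)
  define Q where "Q t = \<beta> (F t) - J t" for t
  have eps: "\<bar>Q t - Q s\<bar> \<le> \<epsilon> * (N t - N s)" if st: "0 \<le> s" "s \<le> t" "t \<le> a" and e: "\<epsilon> > 0" for s t \<epsilon>
  proof -
    \<comment> \<open>Two uniform continuities are chained: on a step shorter than
      \<open>\<eta>\<close> the values of \<open>F\<close> stay within \<open>\<theta>\<close>, so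
      \<open>\<beta>'\<close> at any value between \<open>F s\<close> and \<open>F t\<close> differs
      from \<open>\<beta>' (F u)\<close> by at most \<open>\<epsilon>\<close>.\<close>
    have "uniformly_continuous_on {-B..B} \<beta>'"
      by (intro compact_uniformly_continuous continuous_on_subset[OF c]) auto
    then obtain \<theta> where th: "\<theta> > 0" "\<And>x y. x \<in> {-B..B} ==> y \<in> {-B..B} ==> dist y x < \<theta> ==> dist (\<beta>' y) (\<beta>' x) < \<epsilon>"
      unfolding uniformly_continuous_on_def using e by metis
    have "uniformly_continuous_on {0..a} F" by (intro compact_uniformly_continuous Fc) auto
    then obtain \<eta> where et: "\<eta> > 0" "\<And>x y. x \<in> {0..a} ==> y \<in> {0..a} ==> dist y x < \<eta> ==> dist (F y) (F x) < \<theta>"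
      unfolding uniformly_continuous_on_def using th(1) by metis
    have "\<bar>Q t - Q s\<bar> \<le> \<epsilon> * N t - \<epsilon> * N s"
    proof (rule telescoping_bound[where Q = Q and N = "%t. \<epsilon> * N t" and \<eta> = \<eta>, OF et(1) a _ st])
      fix s t assume st: "0 \<le> s" "s \<le> t" "t \<le> a" "t - s < \<eta>"
      have IF: "\<bar>F u\<bar> \<le> B" if "s \<le> u" "u \<le> t" for u using B[of u] that st by auto
      have "\<exists>Z. (Z \<in> closed_segment (F s) (F t)) \<and> \<beta> (F t) - \<beta> (F s) = \<beta>' Z * (F t - F s)"
      proof -
        consider "F s < F t" | "F t < F s" | "F s = F t" by linarith
        then show ?thesis
        proof cases
          case 1
          from MVT2[OF 1, of \<beta> \<beta>'] d obtain z where "F s < z" "z < F t" "\<beta> (F t) - \<beta> (F s) = (F t - F s) * \<beta>' z" by blast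
          then show ?thesis by (intro exI[of _ z]) (auto simp: closed_segment_eq_real_ivl)
        next
          case 2
          from MVT2[OF 2, of \<beta> \<beta>'] d obtain z where "F t < z" "z < F s" "\<beta> (F s) - \<beta> (F t) = (F s - F t) * \<beta>' z" by blast
          then show ?thesis by (intro exI[of _ z]) (auto simp: closed_segment_eq_real_ivl algebra_simps)
        next
          case 3 then show ?thesis by auto
        qed
      qed
      then obtain Z where xi: "Z \<in> closed_segment (F s) (F t)" "\<beta> (F t) - \<beta> (F s) = \<beta>' Z * (F t - F s)" by blast
      have xiB: "Z \<in> {-B..B}" using xi(1) IF[of s] IF[of t] st by (auto simp: closed_segment_eq_real_ivl split: if_splits)
      have close: "\<bar>\<beta>' Z - \<beta>' (F u)\<bar> \<le> \<epsilon>" if "s \<le> u" "u \<le> t" for u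
      proof -
        have "\<bar>F s - F u\<bar> < \<theta>" "\<bar>F t - F u\<bar> < \<theta>"
          using et(2)[of u s] et(2)[of u t] that st by (auto simp: dist_real_def)
        then have "dist Z (F u) < \<theta>"
          using xi(1) by (auto simp: dist_real_def closed_segment_eq_real_ivl split: if_splits)
        moreover have "F u \<in> {-B..B}" using IF[OF that] by auto
        ultimately show ?thesis using th(2)[of "F u" Z] xiB by (simp add: dist_real_def)
      qed
      have i1: "integrable (iv a) (%v. indicator {s<..t} v * p v)" "integrable (iv a) (%v. indicator {s<..t} v * g v)"
        "integrable (iv a) (%v. indicator {s<..t} v * \<bar>p v\<bar>)"
        using p g by (auto intro!: integrable_indicator_mult)
      have "Q t - Q s = \<beta>' Z * (LINT v|iv a. indicator {s<..t} v * p v) - (LINT v|iv a. indicator {s<..t} v * g v)"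
        unfolding Q_def AC_diff_eq[OF F st(1-3), symmetric] AC_diff_eq[OF J st(1-3), symmetric] xi(2)[symmetric] by linarith
      also have "\<dots> = (LINT v|iv a. \<beta>' Z * (indicator {s<..t} v * p v) - indicator {s<..t} v * g v)"
        using i1 by simp
      finally have "\<bar>Q t - Q s\<bar> = \<bar>LINT v|iv a. \<beta>' Z * (indicator {s<..t} v * p v) - indicator {s<..t} v * g v\<bar>" by simp
      also have "\<dots> \<le> (LINT v|iv a. \<bar>\<beta>' Z * (indicator {s<..t} v * p v) - indicator {s<..t} v * g v\<bar>)"
        by (rule integral_abs_bound)
      also have "\<dots> \<le> (LINT v|iv a. \<epsilon> * (indicator {s<..t} v * \<bar>p v\<bar>))"
      proof (rule integral_mono)
        fix v :: real
        show "\<bar>\<beta>' Z * (indicator {s<..t} v * p v) - indicator {s<..t} v * g v\<bar> \<le> \<epsilon> * (indicator {s<..t} v * \<bar>p v\<bar>)"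
          using mult_right_mono[OF close[of v], of "\<bar>p v\<bar>"]
          by (auto simp: indicator_def g_def simp flip: left_diff_distrib abs_mult)
      qed (use i1 in auto)
      also have "\<dots> = \<epsilon> * (N t - N s)" using AC_diff_eq[OF N] st by simp
      finally show "\<bar>Q t - Q s\<bar> \<le> \<epsilon> * N t - \<epsilon> * N s" by (simp add: right_diff_distrib)
    qed
    then show ?thesis by (simp add: right_diff_distrib)
  qed
  have "Q t = Q s" if st: "0 \<le> s" "s \<le> t" "t \<le> a" for s t
  proof -
    have "((%\<epsilon>. \<epsilon> * (N t - N s)) \<longlongrightarrow> 0 * (N t - N s)) (at_right 0)" by (intro tendsto_intros)
    moreover have "eventually (%\<epsilon>. \<bar>Q t - Q s\<bar> \<le> \<epsilon> * (N t - N s)) (at_right 0)"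
      using eps[OF st] by (simp add: eventually_at_filter)
    ultimately have "\<bar>Q t - Q s\<bar> \<le> 0 * (N t - N s)"
      by (intro tendsto_lowerbound[where F = "at_right 0"]) auto
    then show ?thesis by simp
  qed
  then show ?thesis
    using AC_diff_eq[OF J] g unfolding AC_def g_def Q_def by (smt (verit, ccfv_SIG))
qed

text \<open>Polarization: a product is a quarter of the difference of the squares of sum and
  difference, so the chain rule for squares suffices.\<close>

lemma AC_mult:
  assumes F: "AC a F p" and G: "AC a G q" and a: "0 \<le> a"
  shows "AC a (%s. F s * G s) (%s. p s * G s + F s * q s)"
proof -
  have sq: "AC a (%s. (H s)^2) (%s. 2 * H s * r s)" if "AC a H r" for H r
    by (rule AC_chain[OF that, where \<beta> = "%x. x^2" and \<beta>' = "%x. 2 * x"])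
       (auto intro!: continuous_intros derivative_eq_intros a)
  have "AC a (%s. (1/4) * ((F s + G s)^2 - (F s - G s)^2))
     (%s. (1/4) * (2 * (F s + G s) * (p s + q s) - 2 * (F s - G s) * (p s - q s)))"
    by (intro AC_cmult AC_diff sq AC_add F G)
  moreover have "(%s. (1/4) * ((F s + G s)^2 - (F s - G s)^2)) = (%s. F s * G s)"
    by (auto simp: power2_eq_square algebra_simps)
  moreover have "(%s. (1/4) * (2 * (F s + G s) * (p s + q s) - 2 * (F s - G s) * (p s - q s)))
    = (%s. p s * G s + F s * q s)" by (auto simp: algebra_simps)
  ultimately show ?thesis by simp
qed

text \<open>The squared positive part is C1 across 0. It is the building block both for smoothing
  \<open>max 0\<close> and for the cut-off functions \<open>bmp\<close>.\<close>

lemma has_derivative_pos_part_square: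
  "((%x::real. (max 0 x)^2) has_real_derivative 2 * max 0 x) (at x)"
proof -
  consider "x > 0" | "x < 0" | "x = 0" by linarith
  then show ?thesis
  proof cases
    case 1
    have "((%x::real. x^2) has_real_derivative 2 * max 0 x) (at x)"
      using 1 by (auto intro!: derivative_eq_intros)
    then show ?thesis
      by (rule has_field_derivative_transform_within_open[where S = "{0<..}"]) (use 1 in auto)
  next
    case 2
    have "((%x::real. 0) has_real_derivative 2 * max 0 x) (at x)"
      using 2 by (auto intro!: derivative_eq_intros)
    then show ?thesis
      by (rule has_field_derivative_transform_within_open[where S = "{..<0}"]) (use 2 in auto)
  next
    case 3
    have "((%h::real. (max 0 h)^2 / h) \<longlongrightarrow> 0) (at 0)"
    proof (rule tendsto_sandwich[of "%h. - \<bar>h\<bar>" _ _ "%h. \<bar>h\<bar>"])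
      show "eventually (%h::real. - \<bar>h\<bar> \<le> (max 0 h)^2 / h) (at 0)"
        by (rule always_eventually) (auto simp: max_def power2_eq_square)
      show "eventually (%h::real. (max 0 h)^2 / h \<le> \<bar>h\<bar>) (at 0)"
        by (rule always_eventually) (auto simp: max_def power2_eq_square)
    qed (auto intro!: tendsto_eq_intros)
    then show ?thesis using 3 by (simp add: DERIV_def)
  qed
qed

text \<open>\<open>max 0\<close> is the limit of the C1 functions \<open>b n\<close>, whose
  derivatives are bounded by 1 and tend to the indicator of the open positive axis. Dominated
  convergence carries the chain rule to the limit; at zeros of \<open>F\<close> all
  \<open>b' n\<close> vanish, which is why the density is 0 there.\<close>

lemma AC_pos_part:
  assumes F: "AC a F p" and a: "0 \<le> a"
  shows "AC a (%s. max 0 (F s)) (%s. if F s > 0 then p s else 0)"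
proof -
  define b where "b n x = sqrt ((max 0 x)^2 + 1 / real (Suc n))" for n and x :: real
  define b' where "b' n x = max 0 x / sqrt ((max 0 x)^2 + 1 / real (Suc n))" for n and x :: real
  have pos: "(max 0 x)^2 + 1 / real (Suc n) > 0" for n and x :: real
    by (intro add_nonneg_pos) auto
  have d: "(b n has_real_derivative b' n x) (at x)" for n x
  proof -
    have "((%x. (max 0 x)^2 + 1 / real (Suc n)) has_real_derivative 2 * max 0 x + 0) (at x)"
      by (intro DERIV_add has_derivative_pos_part_square DERIV_const)
    from DERIV_chain2[OF DERIV_real_sqrt[OF pos] this] show ?thesis
      unfolding b_def b'_def by (simp add: inverse_eq_divide)
  qed
  have c: "continuous_on UNIV (b' n)" for n
    unfolding b'_def using pos[of _ n] by (intro continuous_intros) (auto simp: less_le)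
  have n: "AC a (%s. b n (F s)) (%s. b' n (F s) * p s)" for n
    by (rule AC_chain[OF F c d a])
  have inv: "(%n. 1 / real (Suc n)) \<longlonglongrightarrow> 0" by (rule LIMSEQ_Suc) (rule lim_1_over_n)
  have bl: "(%n. b n x) \<longlonglongrightarrow> max 0 x" for x
  proof -
    have "(%n. b n x) \<longlonglongrightarrow> sqrt ((max 0 x)^2 + 0)" unfolding b_def by (intro tendsto_intros inv)
    then show ?thesis by simp
  qed
  have b'l: "(%n. b' n x) \<longlonglongrightarrow> (if x > 0 then 1 else 0)" for x
  proof (cases "x > 0")
    case True
    have "(%n. b' n x) \<longlonglongrightarrow> max 0 x / sqrt ((max 0 x)^2 + 0)" unfolding b'_def
      by (intro tendsto_intros inv) (use True in auto)
    then show ?thesis using True by simp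
  qed (simp add: b'_def max_def)
  have b'1: "\<bar>b' n x\<bar> \<le> 1" for n x
  proof -
    have "max 0 x \<le> sqrt ((max 0 x)^2 + 1 / real (Suc n))" by (rule real_le_rsqrt) simp
    then show ?thesis using pos[of x n] unfolding b'_def by (simp add: abs_divide)
  qed
  have [measurable]: "p \<in> borel_measurable (iv a)" "F \<in> borel_measurable (iv a)"
    using AC_integrable[OF F] AC_measurable[OF F] by auto
  note pI = AC_integrable[OF F]
  have gm[measurable]: "(%s. if F s > 0 then p s else 0) \<in> borel_measurable (iv a)" by measurable
  show ?thesis
    unfolding AC_def
  proof (intro conjI allI impI)
    show "integrable (iv a) (%s. if F s > 0 then p s else 0)"
      by (rule Bochner_Integration.integrable_bound[OF pI gm]) auto
    fix s t assume st: "0 \<le> s \<and> s \<le> t \<and> t \<le> a"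
    have "(%n. LINT v|iv a. indicator {s<..t} v * (b' n (F v) * p v)) \<longlonglongrightarrow>
      (LINT v|iv a. indicator {s<..t} v * (if F v > 0 then p v else 0))"
    proof (rule integral_dominated_convergence[where w = "%v. \<bar>p v\<bar>"])
      have [measurable]: "(indicator {s<..t} :: real => real) \<in> borel_measurable (iv a)"
        by (intro measurable_iv1) auto
      show "(%v. indicator {s<..t} v * (if F v > 0 then p v else 0)) \<in> borel_measurable (iv a)" by measurable
      show "(%v. indicator {s<..t} v * (b' n (F v) * p v)) \<in> borel_measurable (iv a)" for n
        using AC_integrable[OF n[of n]] by measurable
      show "AE v in iv a. (%n. indicator {s<..t} v * (b' n (F v) * p v)) \<longlonglongrightarrow> indicator {s<..t} v * (if F v > 0 then p v else 0)"
      proof (rule AE_I2)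
        fix v
        have "(%n. indicator {s<..t} v * (b' n (F v) * p v)) \<longlonglongrightarrow> indicator {s<..t} v * ((if F v > 0 then 1 else 0) * p v)"
          by (intro tendsto_mult tendsto_const b'l)
        moreover have "(if F v > 0 then 1 else 0) * p v = (if F v > 0 then p v else 0)" by simp
        ultimately show "(%n. indicator {s<..t} v * (b' n (F v) * p v)) \<longlonglongrightarrow> indicator {s<..t} v * (if F v > 0 then p v else 0)"
          by (simp only:)
      qed
      show "AE v in iv a. norm (indicator {s<..t} v * (b' n (F v) * p v)) \<le> \<bar>p v\<bar>" for n
      proof (rule AE_I2)
        fix v
        show "norm (indicator {s<..t} v * (b' n (F v) * p v)) \<le> \<bar>p v\<bar>"
          using mult_right_mono[OF b'1[of n "F v"], of "\<bar>p v\<bar>"] by (auto simp: indicator_def abs_mult)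
      qed
    qed (use pI in auto)
    moreover have "(%n. b n (F t) - b n (F s)) \<longlonglongrightarrow> max 0 (F t) - max 0 (F s)" by (intro tendsto_intros bl)
    ultimately show "max 0 (F t) - max 0 (F s) = (LINT v|iv a. indicator {s<..t} v * (if F v > 0 then p v else 0))"
      using AC_diff_eq[OF n, of s t] st by (intro LIMSEQ_unique[where X = "%n. b n (F t) - b n (F s)"]) auto
  qed
qed

text \<open>The oscillation estimate behind both the bound on cross-sections where a function has a
  zero and the Poincare inequality on small pieces.\<close>

lemma AC_Cauchy_Schwarz:
  assumes F: "AC a F p" and p2: "integrable (iv a) (%s. (p s)^2)"
    and st: "0 \<le> s" "s \<le> t" "t \<le> a"
  shows "(F t - F s)^2 \<le> (t - s) * (LINT v|iv a. indicator {s<..t} v * (p v)^2)"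
proof -
  have [measurable]: "p \<in> borel_measurable (iv a)" using AC_integrable[OF F] by auto
  have [measurable]: "(indicator {s<..t} :: real => real) \<in> borel_measurable (iv a)"
    by (intro measurable_iv1) auto
  have sq: "(indicator {s<..t} v * p v)^2 = indicator {s<..t} v * (p v)^2" "(indicator {s<..t} v)^2 = (indicator {s<..t} v :: real)"
     "indicator {s<..t} v * (indicator {s<..t} v * p v) = indicator {s<..t} v * p v" for v
    by (auto simp: indicator_def)
  have "(LINT v|iv a. indicator {s<..t} v * (indicator {s<..t} v * p v))^2 \<le>
    (LINT v|iv a. (indicator {s<..t} v)^2) * (LINT v|iv a. (indicator {s<..t} v * p v)^2)"
  proof (rule Cauchy_Schwarz_L2)
    show "integrable (iv a) (%v. (indicator {s<..t} v :: real)^2)" unfolding sq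
      by (rule integrable_iv_bounded[of _ _ 1], fact) (auto simp: indicator_def)
    show "integrable (iv a) (%v. (indicator {s<..t} v * p v)^2)" unfolding sq
      by (rule integrable_indicator_mult[OF p2]) auto
  qed auto
  then show ?thesis unfolding sq using AC_diff_eq[OF F st] measure_iv_Ioc[OF st] by simp
qed

lemma integral_iv_reflect:
  fixes f :: "real => real"
  shows "(LINT s|iv a. f (a - s)) = (LINT s|iv a. f s)"
proof -
  have "(LINT s|iv a. f s) = (LINT x|lborel. indicator {0<..<a} (a + -1 * x) * f (a + -1 * x))"
    unfolding integral_iv by (subst lborel_integral_real_affine[where c = "-1" and t = a]) auto
  also have "\<dots> = (LINT x|lborel. indicator {0<..<a} x * f (a - x))"
    by (rule LINT_cong) (auto simp: indicator_def)
  finally show ?thesis unfolding integral_iv by simp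
qed

lemma integrable_iv_reflect:
  fixes f :: "real => real"
  assumes "integrable (iv a) f"
  shows "integrable (iv a) (%s. f (a - s))"
proof -
  have "integrable lborel (%x. indicator {0<..<a} (a + -1 * x) * f (a + -1 * x))"
    using lborel_integrable_real_affine[OF assms[unfolded integrable_iv], of "-1" a] by simp
  moreover have "(%x. indicator {0<..<a} (a + -1 * x) * f (a + -1 * x)) = (%x. indicator {0<..<a} x * f (a - x))"
    by (auto simp: indicator_def)
  ultimately show ?thesis unfolding integrable_iv by simp
qed

lemma measurable_iv_reflect: "(%s. a - s) \<in> iv a \<rightarrow>\<^sub>M iv a"
  unfolding iv_def by (rule measurable_restrict_space3) auto

lemma distr_iv_reflect: "distr (iv a) (iv a) (%s. a - s) = iv a"
proof (rule measure_eqI)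
  fix A assume "A \<in> sets (distr (iv a) (iv a) (%s. a - s))"
  then have A[measurable]: "A \<in> sets (iv a)" by simp
  note measurable_iv_reflect[measurable]
  have A': "(%s. a - s) -` A \<inter> space (iv a) \<in> sets (iv a)" using A by measurable
  have "measure (iv a) ((%s. a - s) -` A \<inter> space (iv a)) = (LINT s|iv a. indicator A (a - s))"
  proof -
    have "measure (iv a) ((%s. a - s) -` A \<inter> space (iv a)) = (LINT s|iv a. indicator ((%s. a - s) -` A \<inter> space (iv a)) s)"
      using A' by simp
    also have "\<dots> = (LINT s|iv a. indicator A (a - s))"
      by (rule LINT_cong) (auto simp: indicator_def)
    finally show ?thesis .
  qed
  also have "\<dots> = measure (iv a) A" unfolding integral_iv_reflect using A sets.sets_into_space[OF A] by (simp add: Int_absorb2)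
  finally show "emeasure (distr (iv a) (iv a) (%s. a - s)) A = emeasure (iv a) A"
    by (simp add: emeasure_distr iv.emeasure_eq_measure)
qed simp

lemma AE_iv_reflect:
  assumes "AE s in iv a. P s"
  shows "AE s in iv a. P (a - s)"
proof -
  have "AE s in distr (iv a) (iv a) (%s. a - s). P s" unfolding distr_iv_reflect by (rule assms)
  then show ?thesis by (rule AE_distrD[OF measurable_iv_reflect])
qed

lemma integral_iv_Ioc: "(LINT v|iv a. indicator {0<..a} v * p v) = (LINT v|iv a. p v)" for p :: "real => real"
  by (rule LINT_cong) (auto simp: indicator_def)

lemma AC_restrict:
  assumes F: "AC a F p" and h: "0 \<le> h" "h \<le> a"
  shows "AC h F p"
  unfolding AC_def
proof (intro conjI allI impI)
  have "integrable lborel (%x. indicator {0<..<a} x * p x)" using AC_integrable[OF F] unfolding integrable_iv .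
  then have "integrable lborel (%x. indicator {0<..<h} x *\<^sub>R (indicator {0<..<a} x * p x))"
    by (rule integrable_mult_indicator[rotated]) simp
  moreover have "(%x. indicator {0<..<h} x *\<^sub>R (indicator {0<..<a} x * p x)) = (%x. indicator {0<..<h} x * p x)"
    using h by (auto simp: indicator_def)
  ultimately show p: "integrable (iv h) p" unfolding integrable_iv by simp
  fix s t assume st: "0 \<le> s \<and> s \<le> t \<and> t \<le> h"
  have e: "indicator {0<..<h} v * (indicator {s<..t} v * p v) = indicator {s<..t} v * (indicator {0<..<h} v * p v)"
     "indicator {0<..<a} v * (indicator {s<..t} v * p v) = indicator {s<..t} v * (indicator {0<..<a} v * p v)" for v
    by auto
  have [measurable]: "(%x. indicator {0<..<a} x * p x) \<in> borel_measurable lborel" "(%x. indicator {0<..<h} x * p x) \<in> borel_measurable lborel"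
    using AC_integrable[OF F] p unfolding integrable_iv by (auto dest: borel_measurable_integrable simp del: measurable_lborel1)
  have "(LINT v|iv a. indicator {s<..t} v * p v) = (LINT v|iv h. indicator {s<..t} v * p v)"
    unfolding integral_iv e
  proof (rule integral_cong_AE)
    show "AE x in lborel. indicator {s<..t} x * (indicator {0<..<a} x * p x) = indicator {s<..t} x * (indicator {0<..<h} x * p x)"
      using AE_lborel_singleton[of h] by eventually_elim (use st h in \<open>auto simp: indicator_def\<close>)
  qed measurable
  then show "F t - F s = (LINT v|iv h. indicator {s<..t} v * p v)"
    using AC_diff_eq[OF F, of s t] st h by linarith
qed

lemma AC_reflect:
  assumes F: "AC a F p"
  shows "AC a (%s. F (a - s)) (%s. - p (a - s))"
  unfolding AC_def
proof (intro conjI allI impI)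
  show "integrable (iv a) (%s. - p (a - s))" using integrable_iv_reflect[OF AC_integrable[OF F]] by simp
  have [measurable]: "p \<in> borel_measurable (iv a)" "(%s. p (a - s)) \<in> borel_measurable (iv a)"
    using AC_integrable[OF F] integrable_iv_reflect[OF AC_integrable[OF F]] by auto
  fix s t assume st: "0 \<le> s \<and> s \<le> t \<and> t \<le> a"
  have [measurable]: "(indicator {s<..t} :: real => real) \<in> borel_measurable (iv a)"
    "(indicator {a - t<..a-s} :: real => real) \<in> borel_measurable (iv a)"
    by (intro measurable_iv1; auto)+
  have "(LINT v|iv a. indicator {s<..t} v * - p (a - v)) = - (LINT v|iv a. indicator {s<..t} v * p (a - v))" by simp
  also have "(LINT v|iv a. indicator {s<..t} v * p (a - v)) = (LINT v|iv a. indicator {s<..t} (a - (a - v)) * p (a - v))" by simp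
  also have "\<dots> = (LINT v|iv a. indicator {s<..t} (a - v) * p v)"
    by (rule integral_iv_reflect)
  also have "\<dots> = (LINT v|iv a. indicator {a - t<..a - s} v * p v)"
  proof (rule integral_cong_AE)
    have eq: "(%x. indicator {s<..t} (a - x) * p x) = (%x. indicator {a-t..<a-s} x * p x)"
      by (auto simp: indicator_def fun_eq_iff)
    have [measurable]: "(indicator {a - t..<a-s} :: real => real) \<in> borel_measurable (iv a)"
      by (intro measurable_iv1) auto
    show "(%x. indicator {s<..t} (a - x) * p x) \<in> borel_measurable (iv a)" unfolding eq by measurable
    show "AE x in iv a. indicator {s<..t} (a - x) * p x = indicator {a - t<..a - s} x * p x"
      using AE_iv_neq[where c = "a - t" and a = a] AE_iv_neq[where c = "a - s" and a = a]
      by eventually_elim (auto simp: indicator_def)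
  qed measurable
  also have "\<dots> = F (a - s) - F (a - t)" using AC_diff_eq[OF F, of "a - t" "a - s"] st by simp
  finally show "F (a - t) - F (a - s) = (LINT v|iv a. indicator {s<..t} v * - p (a - v))" by simp
qed

text \<open>As \<open>F s1 \<le> 0\<close>, the positive part vanishes at \<open>s1\<close>, and
  cutting it off there is the same as stopping it: the truncation is \<open>P (min s s1)\<close>. No
  jump arises.\<close>

lemma AC_truncate:
  assumes F: "AC a F p" and s1: "0 \<le> s1" "s1 \<le> a" "F s1 \<le> 0"
  shows "AC a (%s. if s < s1 then max 0 (F s) else 0) (%s. if s < s1 \<and> F s > 0 then p s else 0)"
proof -
  define P q where "P s = max 0 (F s)" and "q s = (if F s > 0 then p s else 0)" for s
  have P: "AC a P q" unfolding P_def q_def using AC_pos_part[OF F] s1 by simp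
  note q = AC_integrable[OF P]
  have [measurable]: "q \<in> borel_measurable (iv a)" using q by auto
  have P1: "P s1 = 0" using s1 by (simp add: P_def)
  have eq: "(%s. if s < s1 \<and> F s > 0 then p s else 0) = (%s. indicator {..<s1} s * q s)"
    "(%s. if s < s1 then max 0 (F s) else 0) = (%s. P (min s s1))"
    using P1 by (auto simp: q_def fun_eq_iff P_def min_def)
  show ?thesis
    unfolding eq AC_def
  proof (intro conjI allI impI)
    show "integrable (iv a) (%s. indicator {..<s1} s * q s)"
      by (rule integrable_indicator_mult[OF q]) simp
    fix s t assume st: "0 \<le> s \<and> s \<le> t \<and> t \<le> a"
    have [measurable]: "(indicator {s<..t} :: real => real) \<in> borel_measurable (iv a)"
      "(indicator {..<s1} :: real => real) \<in> borel_measurable (iv a)"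
      "(indicator {min s s1<..min t s1} :: real => real) \<in> borel_measurable (iv a)"
      by (intro measurable_iv1; auto)+
    have "P (min t s1) - P (min s s1) = (LINT v|iv a. indicator {min s s1<..min t s1} v * q v)"
      by (rule AC_diff_eq[OF P]) (use st s1 in auto)
    also have "\<dots> = (LINT v|iv a. indicator {s<..t} v * (indicator {..<s1} v * q v))"
    proof (rule integral_cong_AE)
      show "AE v in iv a. indicator {min s s1<..min t s1} v * q v = indicator {s<..t} v * (indicator {..<s1} v * q v)"
        using AE_iv_neq[where c = s1 and a = a] by eventually_elim (auto simp: indicator_def)
    qed measurable
    finally show "P (min t s1) - P (min s s1) = (LINT v|iv a. indicator {s<..t} v * (indicator {..<s1} v * q v))" .
  qed
qed

lemma integrable_iv_mult_bounded:
  fixes p g :: "real => real"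
  assumes p: "integrable (iv a) p" and [measurable]: "g \<in> borel_measurable (iv a)"
    and B: "\<And>s. 0 < s ==> s < a ==> \<bar>g s\<bar> \<le> B"
  shows "integrable (iv a) (%s. g s * p s)"
proof (rule Bochner_Integration.integrable_bound[of _ "%s. B * p s"])
  have [measurable]: "p \<in> borel_measurable (iv a)" using p by auto
  show "(%s. g s * p s) \<in> borel_measurable (iv a)" by measurable
  show "AE s in iv a. norm (g s * p s) \<le> norm (B * p s)"
  proof (rule AE_I2)
    fix s assume "s \<in> space (iv a)"
    then have "\<bar>g s\<bar> * \<bar>p s\<bar> \<le> \<bar>B\<bar> * \<bar>p s\<bar>" using B[of s] by (intro mult_right_mono) auto
    then show "norm (g s * p s) \<le> norm (B * p s)" by (simp add: abs_mult)
  qed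
qed (use p in auto)

lemma AC_bounded:
  assumes "AC a F p"
  obtains B where "B > 0" "\<And>s. 0 \<le> s ==> s \<le> a ==> \<bar>F s\<bar> \<le> B"
proof -
  have "bounded (F ` {0..a})" using AC_continuous[OF assms] by (intro compact_imp_bounded compact_continuous_image) auto
  then obtain B where "B > 0" "\<forall>y\<in>F ` {0..a}. norm y \<le> B" unfolding bounded_pos by blast
  then show ?thesis by (intro that[of B]) auto
qed

text \<open>Version for functions given up to null sets, as Sobolev functions are; \<open>AC\<close>
  itself prescribes every value.\<close>

definition wAC :: "real => (real => real) => (real => real) => bool" where
  "wAC a g p \<longleftrightarrow> (\<exists>F. AC a F p \<and> (AE s in iv a. g s = F s))"

lemma wACI: "AC a F p ==> AE s in iv a. g s = F s ==> wAC a g p"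
  by (auto simp: wAC_def)

lemma AC_imp_wAC: "AC a F p ==> wAC a F p" by (rule wACI) auto

lemma wAC_integrable: "wAC a g p ==> integrable (iv a) p"
  by (auto simp: wAC_def AC_integrable)

lemma wAC_add:
  assumes "wAC a g p" "wAC a h q"
  shows "wAC a (%s. g s + h s) (%s. p s + q s)"
proof -
  obtain F G where F: "AC a F p" "AE s in iv a. g s = F s" and G: "AC a G q" "AE s in iv a. h s = G s"
    using assms by (auto simp: wAC_def)
  show ?thesis by (rule wACI[OF AC_add[OF F(1) G(1)]]) (use F(2) G(2) in eventually_elim, simp)
qed

lemma wAC_cmult:
  assumes "wAC a g p"
  shows "wAC a (%s. c * g s) (%s. c * p s)"
proof -
  obtain F where F: "AC a F p" "AE s in iv a. g s = F s"
    using assms by (auto simp: wAC_def)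
  show ?thesis by (rule wACI[OF AC_cmult[OF F(1)]]) (use F(2) in eventually_elim, simp)
qed

lemma wAC_diff:
  assumes "wAC a g p" "wAC a h q"
  shows "wAC a (%s. g s - h s) (%s. p s - q s)"
  using wAC_add[OF assms(1) wAC_cmult[OF assms(2), of "-1"]] by simp

lemma wAC_reflect:
  assumes "wAC a g p"
  shows "wAC a (%s. g (a - s)) (%s. - p (a - s))"
proof -
  obtain F where F: "AC a F p" "AE s in iv a. g s = F s"
    using assms by (auto simp: wAC_def)
  show ?thesis by (rule wACI[OF AC_reflect[OF F(1)]]) (rule AE_iv_reflect[OF F(2)])
qed

lemma wAC_cong:
  assumes "wAC a g p" "AE s in iv a. g s = h s" "AE s in iv a. p s = q s" "q \<in> borel_measurable (iv a)"
  shows "wAC a h q"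
proof -
  obtain F where F: "AC a F p" "AE s in iv a. g s = F s"
    using assms by (auto simp: wAC_def)
  show ?thesis
    by (rule wACI[OF AC_cong[OF F(1) refl assms(3,4)]]) (use F(2) assms(2) in eventually_elim, simp)
qed

lemma wAC_pos_part:
  assumes w: "wAC a g p" and [measurable]: "g \<in> borel_measurable (iv a)" and a: "0 \<le> a"
  shows "wAC a (%s. max 0 (g s)) (%s. if g s > 0 then p s else 0)"
proof -
  have [measurable]: "p \<in> borel_measurable (iv a)" using wAC_integrable[OF w] by auto
  obtain F where F: "AC a F p" "AE s in iv a. g s = F s" using w by (auto simp: wAC_def)
  have 1: "wAC a (%s. max 0 (F s)) (%s. if F s > 0 then p s else 0)"
    by (rule AC_imp_wAC[OF AC_pos_part[OF F(1) a]])
  show ?thesis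
    by (rule wAC_cong[OF 1]; (measurable)?) (use F(2) in \<open>eventually_elim, simp\<close>)+
qed

lemma AC_by_parts:
  assumes F: "AC a F p" and X: "AC a \<psi> \<psi>'" and a: "0 \<le> a" and z: "\<psi> 0 = 0" "\<psi> a = 0"
  shows "(LINT s|iv a. F s * \<psi>' s) = - (LINT s|iv a. p s * \<psi> s)"
proof -
  obtain B where B: "\<And>s. 0 \<le> s ==> s \<le> a ==> \<bar>\<psi> s\<bar> \<le> B" using AC_bounded[OF X] by metis
  obtain C where C: "\<And>s. 0 \<le> s ==> s \<le> a ==> \<bar>F s\<bar> \<le> C" using AC_bounded[OF F] by metis
  have "integrable (iv a) (%s. \<psi> s * p s)" "integrable (iv a) (%s. F s * \<psi>' s)"
    by (rule integrable_iv_mult_bounded[OF AC_integrable[OF F] AC_measurable[OF X], of B];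
        simp add: B C)
      (rule integrable_iv_mult_bounded[OF AC_integrable[OF X] AC_measurable[OF F], of C]; simp add: C)
  then have i: "integrable (iv a) (%s. p s * \<psi> s)" "integrable (iv a) (%s. F s * \<psi>' s)" by (simp_all add: mult.commute)
  have "0 = (LINT s|iv a. p s * \<psi> s + F s * \<psi>' s)"
    using AC_diff_eq[OF AC_mult[OF F X a], of 0 a] a z unfolding integral_iv_Ioc by simp
  also have "\<dots> = (LINT s|iv a. p s * \<psi> s) + (LINT s|iv a. F s * \<psi>' s)" using i by simp
  finally show ?thesis by linarith
qed

lemma wAC_by_parts:
  assumes w: "wAC a g p" and X: "AC a \<psi> \<psi>'" and a: "0 \<le> a" and z: "\<psi> 0 = 0" "\<psi> a = 0"
    and [measurable]: "g \<in> borel_measurable (iv a)"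
  shows "(LINT s|iv a. g s * \<psi>' s) = - (LINT s|iv a. p s * \<psi> s)"
proof -
  obtain F where F: "AC a F p" "AE s in iv a. g s = F s" using w by (auto simp: wAC_def)
  have [measurable]: "\<psi>' \<in> borel_measurable (iv a)" "F \<in> borel_measurable (iv a)"
    using AC_integrable[OF X] AC_measurable[OF F(1)] by auto
  have "(LINT s|iv a. g s * \<psi>' s) = (LINT s|iv a. F s * \<psi>' s)"
    by (rule integral_cong_AE) (use F(2) in \<open>auto elim!: eventually_mono\<close>)
  then show ?thesis using AC_by_parts[OF F(1) X a z] by simp
qed

text \<open>The derivative is known only in the open interval, where it might be unbounded; the
  support condition supplies a bound for it and continuity of \<open>\<psi>\<close> at the end
  points.\<close>

lemma AC_compact_support:
  assumes d: "\<And>s. 0 < s ==> s < a ==> (\<psi> has_real_derivative \<psi>' s) (at s)"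
    and c: "continuous_on {0<..<a} \<psi>'" and ab: "0 < \<alpha>" "\<alpha> < \<beta>" "\<beta> < a"
    and z: "\<And>s. s \<notin> {\<alpha>..\<beta>} ==> \<psi> s = 0"
  shows "AC a \<psi> \<psi>'"
proof (rule AC_smooth)
  have z': "\<psi>' s = 0" if "s \<in> {0<..<a} - {\<alpha>..\<beta>}" for s
  proof -
    have "(\<psi> has_real_derivative 0) (at s)"
      by (rule has_field_derivative_transform_within_open[where S = "- {\<alpha>..\<beta>}" and f = "%_. 0"])
        (use that z in auto)
    then show ?thesis using d[of s] that DERIV_unique by fastforce
  qed
  have "bounded (\<psi>' ` {\<alpha>..\<beta>})"
    by (intro compact_imp_bounded compact_continuous_image continuous_on_subset[OF c]) (use ab in auto)
  then obtain B where "B > 0" "\<forall>y\<in>\<psi>' ` {\<alpha>..\<beta>}. norm y \<le> B" unfolding bounded_pos by blast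
  then have B: "\<bar>\<psi>' s\<bar> \<le> B" if "0 < s" "s < a" for s using z'[of s] that by (cases "s \<in> {\<alpha>..\<beta>}") auto
  show "integrable (iv a) \<psi>'"
    by (rule integrable_iv_bounded[OF borel_measurable_iv_continuous[OF c] B])
  show "continuous_on {0..a} \<psi>"
    unfolding continuous_on_eq_continuous_within
  proof
    fix s assume s: "s \<in> {0..a}"
    have "isCont \<psi> s"
    proof (cases "0 < s \<and> s < a")
      case True then show ?thesis using d DERIV_isCont by blast
    next
      case False
      have "isCont (%_. 0::real) s" by simp
      moreover have "eventually (%x. \<psi> x = 0) (nhds s)"
        unfolding eventually_nhds using z by (intro exI[of _ "- {\<alpha>..\<beta>}"]) (use False s ab in auto)
      ultimately show ?thesis using isCont_cong[of \<psi> "%_. 0" s] by simp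
    qed
    then show "continuous (at s within {0..a}) \<psi>" by (rule continuous_at_imp_continuous_at_within)
  qed
qed (use d in auto)

text \<open>If \<open>g\<close> is not almost everywhere positive, its continuous representative is
  nonpositive at some \<open>s0\<close>, so the positive part starts from 0 there. Cauchy-Schwarz on
  the way from \<open>s0\<close> to any other point gives the bound, with the length of the interval
  as constant. This is the inequality used across the strip.\<close>

lemma wAC_zero_bound:
  assumes w: "wAC a g p" and n: "\<not> (AE s in iv a. g s > 0)" and [measurable]: "g \<in> borel_measurable (iv a)"
    and p2: "integrable (iv a) (%s. (p s)^2)"
  shows "AE s in iv a. (max 0 (g s))^2 \<le> a * (LINT s|iv a. (if g s > 0 then p s else 0)^2)"
proof (cases "0 \<le> a")
  case a: True
  obtain F where F: "AC a F p" "AE s in iv a. g s = F s" using w by (auto simp: wAC_def)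
  have [measurable]: "p \<in> borel_measurable (iv a)" "F \<in> borel_measurable (iv a)"
    using AC_integrable[OF F(1)] AC_measurable[OF F(1)] by auto
  define P q where "P s = max 0 (F s)" and "q s = (if F s > 0 then p s else 0)" for s
  have P: "AC a P q" unfolding P_def q_def by (rule AC_pos_part[OF F(1) a])
  have [measurable]: "q \<in> borel_measurable (iv a)" using AC_integrable[OF P] by auto
  have q2: "integrable (iv a) (%s. (q s)^2)"
    by (rule Bochner_Integration.integrable_bound[OF p2]) (auto simp: q_def)
  have "\<exists>s0. 0 < s0 \<and> s0 < a \<and> F s0 \<le> 0"
  proof (rule ccontr)
    assume *: "\<not> ?thesis"
    have "AE s in iv a. g s > 0" using F(2) AE_space by eventually_elim (use * in \<open>auto simp: not_le\<close>)
    then show False using n by simp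
  qed
  then obtain s0 where s0: "0 < s0" "s0 < a" "P s0 = 0" unfolding P_def by (auto simp: max_def)
  have I: "(LINT v|iv a. indicator {s<..t} v * (q v)^2) \<le> (LINT v|iv a. (q v)^2)" for s t
    by (rule integral_mono[OF integrable_indicator_mult[OF q2] q2]) (auto simp: indicator_def)
  have b: "(P s)^2 \<le> a * (LINT s|iv a. (q s)^2)" if s: "0 < s" "s < a" for s
  proof (cases "s \<le> s0")
    case True
    have "(P s0 - P s)^2 \<le> (s0 - s) * (LINT v|iv a. indicator {s<..s0} v * (q v)^2)"
      by (rule AC_Cauchy_Schwarz[OF P q2]) (use True s s0 in auto)
    also have "\<dots> \<le> a * (LINT s|iv a. (q s)^2)" by (rule mult_mono[OF _ I]) (use s s0 in auto)
    finally show ?thesis using s0 by simp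
  next
    case False
    have "(P s - P s0)^2 \<le> (s - s0) * (LINT v|iv a. indicator {s0<..s} v * (q v)^2)"
      by (rule AC_Cauchy_Schwarz[OF P q2]) (use False s s0 in auto)
    also have "\<dots> \<le> a * (LINT s|iv a. (q s)^2)" by (rule mult_mono[OF _ I]) (use s s0 in auto)
    finally show ?thesis using s0 by simp
  qed
  have e: "(LINT s|iv a. (q s)^2) = (LINT s|iv a. (if g s > 0 then p s else 0)^2)"
    by (rule integral_cong_AE) (use F(2) in \<open>auto elim!: eventually_mono simp: q_def\<close>)
  show ?thesis unfolding e[symmetric]
    using F(2) AE_space[of "iv a"] by eventually_elim (use b in \<open>auto simp: P_def\<close>)
next
  case False
  \<comment> \<open>For \<open>a < 0\<close> the interval is empty.\<close>
  then show ?thesis by (intro AE_I2) auto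
qed

section \<open>A sharp weighted Wirtinger inequality for odd functions\<close>

lemma integral_iv_split:
  fixes f :: "real => real"
  assumes f: "integrable (iv L) f" and L: "0 < L"
  shows "integrable (iv (L/2)) f" "integrable (iv (L/2)) (%s. f (L - s))"
    "(LINT s|iv L. f s) = (LINT s|iv (L/2). f s) + (LINT s|iv (L/2). f (L - s))"
proof -
  define g where "g = (%s. indicator {0<..<L} s * f s)"
  have g: "integrable lborel g" using f unfolding integrable_iv g_def .
  have [measurable]: "g \<in> borel_measurable borel" using borel_measurable_integrable[OF g] by simp
  have e1: "(%s. indicator {0<..<L/2} s * f s) = (%s. indicator {0<..<L/2} s * g s)"
    using L by (auto simp: g_def indicator_def)
  have e2: "(%s. indicator {0<..<L/2} s * f (L - s)) = (%s. indicator {L/2<..<L} (L + -1 * s) * g (L + -1 * s))"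
    using L by (auto simp: g_def indicator_def fun_eq_iff)
  have i: "integrable lborel (%s. indicator A s * g s)" if "A \<in> sets borel" for A
    using integrable_mult_indicator[OF _ g, of A] that by simp
  show 1: "integrable (iv (L/2)) f" unfolding integrable_iv e1 by (rule i) simp
  show 2: "integrable (iv (L/2)) (%s. f (L - s))" unfolding integrable_iv e2
    using lborel_integrable_real_affine[OF i[of "{L/2<..<L}"], of "-1" L] by simp
  have "(LINT s|iv L. f s) = (LINT s|lborel. indicator {0<..<L/2} s * g s + indicator {L/2<..<L} s * g s)"
    unfolding integral_iv
  proof (rule integral_cong_AE)
    show "AE s in lborel. indicator {0<..<L} s * f s = indicator {0<..<L/2} s * g s + indicator {L/2<..<L} s * g s"
      using AE_lborel_singleton[of "L/2"] by eventually_elim (use L in \<open>auto simp: g_def indicator_def\<close>)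
  qed (use \<open>g \<in> borel_measurable borel\<close> in \<open>auto simp flip: g_def\<close>)
  also have "\<dots> = (LINT s|lborel. indicator {0<..<L/2} s * g s) + (LINT s|lborel. indicator {L/2<..<L} s * g s)"
    by (rule Bochner_Integration.integral_add) (auto intro!: i)
  also have "(LINT s|lborel. indicator {L/2<..<L} s * g s) = (LINT s|iv (L/2). f (L - s))"
    unfolding integral_iv e2 by (subst lborel_integral_real_affine[where c = "-1" and t = L]) auto
  finally show "(LINT s|iv L. f s) = (LINT s|iv (L/2). f s) + (LINT s|iv (L/2). f (L - s))"
    unfolding integral_iv[where a = "L/2" and f = f] e1 .
qed

text \<open>Riccati method. \<open>T\<close> is the logarithmic derivative of
  \<open>cos (\<theta> * s)\<close> and satisfies \<open>T' = - \<theta>^2 - T^2\<close>. The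
  product \<open>w * T * F^2\<close> vanishes at 0 because of \<open>T\<close> and at
  \<open>h\<close> because of \<open>F\<close>, so its derivative has integral 0. Completing the
  square in \<open>(p - T * F)^2\<close> and dropping the nonpositive term with
  \<open>w' * T\<close> leaves the inequality; the weight enters only through its sign and its
  monotonicity.\<close>

lemma AC_Hardy_half:
  assumes F: "AC h F p" and p2: "integrable (iv h) (%s. (p s)^2)" and Fh: "F h = 0" and h: "0 < h"
    and w: "AC h w w'" and w0: "\<And>s. 0 < s ==> s < h ==> 0 \<le> w s" "\<And>s. 0 < s ==> s < h ==> 0 \<le> w' s"
  shows "(pi / (2 * h))^2 * (LINT s|iv h. (F s)^2 * w s) \<le> (LINT s|iv h. (p s)^2 * w s)"
proof -
  have [measurable]: "p \<in> borel_measurable (iv h)" "w \<in> borel_measurable (iv h)" "F \<in> borel_measurable (iv h)"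
    using AC_integrable[OF F] AC_measurable[OF w] AC_measurable[OF F] by auto
  obtain B where B: "\<And>s. 0 \<le> s ==> s \<le> h ==> \<bar>w s\<bar> \<le> B" using AC_bounded[OF w] by metis
  have "integrable (iv h) (%s. w s * (p s)^2)"
    by (rule integrable_iv_mult_bounded[OF p2, of _ B]) (use B in auto)
  then have ip: "integrable (iv h) (%s. (p s)^2 * w s)" by (simp add: mult.commute)
  have iF: "integrable (iv h) (%s. (F s)^2 * w s)"
    by (rule integrable_iv_continuous) (intro continuous_intros AC_continuous[OF F] AC_continuous[OF w])
  \<comment> \<open>Below the critical value of \<open>\<theta>\<close> the tangent is finite on the
    whole closed interval. The sharp constant is then reached by a limit from the left.\<close>
  have main: "\<theta>^2 * (LINT s|iv h. (F s)^2 * w s) \<le> (LINT s|iv h. (p s)^2 * w s)"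
    if th: "0 < \<theta>" "\<theta> < pi / (2 * h)" for \<theta>
  proof -
    define T T' where "T s = - \<theta> * tan (\<theta> * s)" and "T' s = - (\<theta>^2) - (T s)^2" for s
    have lt: "0 \<le> \<theta> * s" "\<theta> * s < pi / 2" if "0 \<le> s" "s \<le> h" for s
    proof -
      have "\<theta> * s \<le> \<theta> * h" using that th by simp
      also have "\<dots> < pi / 2" using th(2) h by (simp add: field_simps)
      finally show "\<theta> * s < pi / 2" .
    qed (use that th in simp)
    have cz: "cos (\<theta> * s) \<noteq> 0" if "0 \<le> s" "s \<le> h" for s
      using cos_gt_zero_pi[of "\<theta> * s"] lt[OF that] by auto
    have Tc: "continuous_on {0..h} T" unfolding T_def using cz by (intro continuous_intros) auto
    have T: "AC h T T'"
    proof (rule AC_smooth[OF Tc])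
      show "integrable (iv h) T'" unfolding T'_def
        by (intro integrable_iv_continuous continuous_intros Tc)
      fix s assume s: "0 < s" "s < h"
      have "inverse ((cos (\<theta> * s))^2) = 1 + (tan (\<theta> * s))^2"
        using tan_sec[OF cz[of s]] s by (simp add: power_inverse)
      then show "(T has_real_derivative T' s) (at s)"
        unfolding T_def T'_def using cz[of s] s
        by (auto intro!: derivative_eq_intros simp: algebra_simps power2_eq_square)
    qed
    have T0: "T s \<le> 0" if "0 \<le> s" "s \<le> h" for s
    proof -
      have "0 \<le> tan (\<theta> * s)" using lt[OF that] tan_gt_zero[of "\<theta> * s"] by (cases "\<theta> * s = 0") auto
      then show ?thesis using th by (simp add: T_def)
    qed
    note F2 = AC_mult[OF F F less_imp_le[OF h]]
    note TF = AC_mult[OF T F2 less_imp_le[OF h]]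
    note H = AC_mult[OF w TF less_imp_le[OF h]]
    have "0 = (LINT s|iv h. w' s * (T s * (F s * F s)) + w s * (T' s * (F s * F s) + T s * (p s * F s + F s * p s)))"
      using AC_diff_eq[OF H, of 0 h] h Fh unfolding integral_iv_Ioc by (simp add: T_def)
    also have "\<dots> \<le> (LINT s|iv h. (p s)^2 * w s - \<theta>^2 * ((F s)^2 * w s))"
    proof (rule integral_mono)
      fix s assume "s \<in> space (iv h)"
      then have s: "0 < s" "s < h" by auto
      have 1: "w' s * (T s * (F s * F s)) \<le> 0"
        using w0(2)[OF s] T0[of s] s by (intro mult_nonneg_nonpos mult_nonpos_nonneg) auto
      have "0 \<le> (p s - T s * F s)^2" by simp
      then have "T' s * (F s * F s) + T s * (p s * F s + F s * p s) \<le> (p s)^2 - \<theta>^2 * (F s)^2"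
        unfolding T'_def by (simp add: power2_eq_square algebra_simps)
      then have "w s * (T' s * (F s * F s) + T s * (p s * F s + F s * p s)) \<le> w s * ((p s)^2 - \<theta>^2 * (F s)^2)"
        by (rule mult_left_mono) (rule w0(1)[OF s])
      then show "w' s * (T s * (F s * F s)) + w s * (T' s * (F s * F s) + T s * (p s * F s + F s * p s))
        \<le> (p s)^2 * w s - \<theta>^2 * ((F s)^2 * w s)" using 1 by (simp add: algebra_simps)
    qed (use AC_integrable[OF H] ip iF in auto)
    also have "\<dots> = (LINT s|iv h. (p s)^2 * w s) - \<theta>^2 * (LINT s|iv h. (F s)^2 * w s)" using ip iF by simp
    finally show ?thesis by simp
  qed
  have pos: "0 < pi / (2 * h)" using h by simp
  have "((%\<theta>. \<theta>^2 * (LINT s|iv h. (F s)^2 * w s)) \<longlongrightarrow> (pi / (2 * h))^2 * (LINT s|iv h. (F s)^2 * w s)) (at_left (pi / (2 * h)))"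
    by (intro tendsto_intros)
  moreover have "eventually (%\<theta>. \<theta>^2 * (LINT s|iv h. (F s)^2 * w s) \<le> (LINT s|iv h. (p s)^2 * w s)) (at_left (pi / (2 * h)))"
    using eventually_at_left_real[OF pos] by (rule eventually_mono) (use main in auto)
  ultimately show ?thesis by (rule tendsto_upperbound) simp
qed

text \<open>Oddness forces the continuous representative to vanish at the midpoint, so each half is
  an instance of the half-interval inequality with constant \<open>pi / (2 * (L / 2))\<close>. The
  right half is first reflected onto the left one, which the symmetry of \<open>w\<close>
  permits.\<close>

lemma wAC_odd_Wirtinger:
  assumes W: "wAC L g p" and p2: "integrable (iv L) (%s. (p s)^2)" and L: "0 < L"
    and odd: "AE s in iv L. g (L - s) = - g s"
    and w: "AC L w w'" and w0: "\<And>s. 0 \<le> s ==> s \<le> L ==> 0 \<le> w s" "\<And>s. 0 < s ==> s < L/2 ==> 0 \<le> w' s"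
    and sym: "\<And>s. 0 \<le> s ==> s \<le> L ==> w (L - s) = w s"
    and [measurable]: "g \<in> borel_measurable (iv L)"
  shows "(pi / L)^2 * (LINT s|iv L. (g s)^2 * w s) \<le> (LINT s|iv L. (p s)^2 * w s)"
proof -
  obtain F where F: "AC L F p" "AE s in iv L. g s = F s" using W by (auto simp: wAC_def)
  have [measurable]: "F \<in> borel_measurable (iv L)" "w \<in> borel_measurable (iv L)" "p \<in> borel_measurable (iv L)"
    using AC_measurable[OF F(1)] AC_measurable[OF w] AC_integrable[OF F(1)] by auto
  have Fc: "continuous_on {0..L} F" by (rule AC_continuous[OF F(1)])
  have odd': "AE s in iv L. F (L - s) + F s = 0"
    using odd F(2) AE_iv_reflect[OF F(2)] by eventually_elim simp
  have F0: "F (L/2) = 0"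
  proof -
    have c: "continuous_on {0<..<L} (%s. F (L - s) + F s)"
      by (intro continuous_intros continuous_on_compose2[OF Fc] continuous_on_subset[OF Fc]) auto
    have "L/2 \<in> {s. F (L - s) + F s = 0} \<or> F (L/2) + F (L/2) \<noteq> 0" by auto
    \<comment> \<open>The odd relation is given only almost everywhere. If it failed at the
      midpoint, it would by continuity fail on a nonempty open set, which is not null.\<close>
    have "F (L - L/2) + F (L/2) = 0"
    proof (rule ccontr)
      assume ne: "F (L - L/2) + F (L/2) \<noteq> 0"
      have o: "open ({0<..<L} \<inter> (%s. F (L - s) + F s) -` (- {0}))"
        by (rule continuous_open_preimage[OF c]) auto
      have "AE s in lborel. s \<notin> {0<..<L} \<inter> (%s. F (L - s) + F s) -` (- {0})"
        using odd' unfolding AE_iv by eventually_elim auto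
      then have "{0<..<L} \<inter> (%s. F (L - s) + F s) -` (- {0}) \<in> null_sets lborel"
        using o by (subst AE_iff_null_sets) auto
      then have "{0<..<L} \<inter> (%s. F (L - s) + F s) -` (- {0}) = {}"
        using open_not_negligible[OF o] negligible_iff_null_sets null_sets_completionI by blast
      moreover have "L/2 \<in> {0<..<L} \<inter> (%s. F (L - s) + F s) -` (- {0})"
        using ne L by simp
      ultimately show False by blast
    qed
    then show ?thesis by simp
  qed
  obtain B where B: "\<And>s. 0 \<le> s ==> s \<le> L ==> \<bar>w s\<bar> \<le> B" using AC_bounded[OF w] by metis
  have "integrable (iv L) (%s. w s * (p s)^2)"
    by (rule integrable_iv_mult_bounded[OF p2, of _ B]) (use B in auto)
  then have ip: "integrable (iv L) (%s. (p s)^2 * w s)" by (simp add: mult.commute)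
  have iF: "integrable (iv L) (%s. (F s)^2 * w s)"
    by (rule integrable_iv_continuous) (intro continuous_intros Fc AC_continuous[OF w])
  have h: "0 < L/2" "0 \<le> L/2" "L/2 \<le> L" using L by auto
  have R: "AC L (%s. F (L - s)) (%s. - p (L - s))" by (rule AC_reflect[OF F(1)])
  have w': "AC (L/2) w w'" by (rule AC_restrict[OF w h(2,3)])
  have 1: "(pi / (2 * (L/2)))^2 * (LINT s|iv (L/2). (F s)^2 * w s) \<le> (LINT s|iv (L/2). (p s)^2 * w s)"
    by (rule AC_Hardy_half[OF AC_restrict[OF F(1) h(2,3)] integral_iv_split(1)[OF p2 L] F0 h(1) w'])
      (use w0 L in auto)
  have 2: "(pi / (2 * (L/2)))^2 * (LINT s|iv (L/2). (F (L - s))^2 * w s) \<le> (LINT s|iv (L/2). (- p (L - s))^2 * w s)"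
  proof (rule AC_Hardy_half[OF AC_restrict[OF R h(2,3)] _ _ h(1) w'])
    show "integrable (iv (L/2)) (%s. (- p (L - s))^2)" using integral_iv_split(2)[OF p2 L] by simp
  qed (use w0 L F0 in auto)
  have e1: "(LINT s|iv (L/2). (F (L - s))^2 * w s) = (LINT s|iv (L/2). (F (L - s))^2 * w (L - s))"
    by (rule LINT_cong) (use sym in auto)
  have e2: "(LINT s|iv (L/2). (- p (L - s))^2 * w s) = (LINT s|iv (L/2). (p (L - s))^2 * w (L - s))"
    by (rule LINT_cong) (use sym in auto)
  have "(pi / L)^2 * (LINT s|iv L. (F s)^2 * w s) \<le> (LINT s|iv L. (p s)^2 * w s)"
    using 1 2 unfolding e1 e2 integral_iv_split(3)[OF ip L] integral_iv_split(3)[OF iF L]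
    by (simp add: distrib_left)
  moreover have "(LINT s|iv L. (g s)^2 * w s) = (LINT s|iv L. (F s)^2 * w s)"
    by (rule integral_cong_AE) (use F(2) in \<open>auto elim!: eventually_mono\<close>)
  ultimately show ?thesis by simp
qed

section \<open>The product measure on a rectangle\<close>

abbreviation iv2 :: "real => real => (real \<times> real) measure" where
  "iv2 a b \<equiv> iv a \<Otimes>\<^sub>M iv b"

interpretation iv2: pair_sigma_finite "iv a" "iv b" for a b :: real
  by unfold_locales

lemma finite_measure_iv2: "finite_measure (iv2 a b)"
  by (rule finite_measure_pair_measure) (rule finite_measure_iv)+

interpretation iv2: finite_measure "iv2 a b" for a b :: real by (rule finite_measure_iv2)

lemma space_iv2 [simp]: "space (iv2 a b) = {0<..<a} \<times> {0<..<b}"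
  by (simp add: space_pair_measure)

lemma sets_iv_D: "A \<in> sets (iv a) ==> A \<in> sets borel"
  by (auto simp: iv_def sets_restrict_space)

text \<open>Gives two views of one measure: iterated integration comes from the product,
  measurability of continuous functions and arguments with open boxes come from the plane.\<close>

lemma iv2_eq_lborel: "iv2 a b = restrict_space lborel ({0<..<a} \<times> {0<..<b})"
proof (rule pair_measure_eqI)
  show "sigma_finite_measure (iv a)" "sigma_finite_measure (iv b)" by unfold_locales
  have R: "{0<..<a} \<times> {0<..<b} \<in> sets borel" by (intro borel_open open_Times) auto
  show "sets (iv2 a b) = sets (restrict_space lborel ({0<..<a} \<times> {0<..<b}))"
  proof
    show "sets (iv2 a b) \<subseteq> sets (restrict_space lborel ({0<..<a} \<times> {0<..<b}))"
    proof (rule sets_pair_in_sets)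
      fix A B assume A: "A \<in> sets (iv a)" and B: "B \<in> sets (iv b)"
      have "A \<times> B \<in> sets borel" using sets_iv_D[OF A] sets_iv_D[OF B]
        unfolding borel_prod[symmetric] by (rule pair_measureI)
      then show "A \<times> B \<in> sets (restrict_space lborel ({0<..<a} \<times> {0<..<b}))"
        using R sets.sets_into_space[OF A] sets.sets_into_space[OF B]
        by (subst sets_restrict_space_iff) auto
    qed
    have id: "(%z. z) \<in> iv2 a b \<rightarrow>\<^sub>M borel"
    proof -
      have "(%z. (fst z, snd z)) \<in> iv2 a b \<rightarrow>\<^sub>M borel \<Otimes>\<^sub>M borel"
        by (intro measurable_Pair measurable_compose[OF measurable_fst ident_measurable_iv]
            measurable_compose[OF measurable_snd ident_measurable_iv])
      then show ?thesis unfolding borel_prod by simp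
    qed
    show "sets (restrict_space lborel ({0<..<a} \<times> {0<..<b})) \<subseteq> sets (iv2 a b)"
    proof
      fix C assume "C \<in> sets (restrict_space lborel ({0<..<a} \<times> {0<..<b}))"
      then obtain B where B: "B \<in> sets borel" "C = ({0<..<a} \<times> {0<..<b}) \<inter> B"
        by (auto simp: sets_restrict_space)
      have "(%z. z) -` B \<inter> space (iv2 a b) \<in> sets (iv2 a b)" by (rule measurable_sets[OF id B(1)])
      moreover have "(%z. z) -` B \<inter> space (iv2 a b) = C" using B by auto
      ultimately show "C \<in> sets (iv2 a b)" by simp
    qed
  qed
  fix A B assume A: "A \<in> sets (iv a)" and B: "B \<in> sets (iv b)"
  note A' = sets.sets_into_space[OF A] and B' = sets.sets_into_space[OF B]
  have "emeasure (restrict_space lborel ({0<..<a} \<times> {0<..<b})) (A \<times> B) = emeasure (lborel \<Otimes>\<^sub>M lborel) (A \<times> B)"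
    unfolding lborel_prod by (rule emeasure_restrict_space) (use A' B' R in auto)
  also have "\<dots> = emeasure lborel A * emeasure lborel B"
    by (rule lborel.emeasure_pair_measure_Times) (use sets_iv_D[OF A] sets_iv_D[OF B] in auto)
  also have "\<dots> = emeasure (iv a) A * emeasure (iv b) B"
    using A' B' unfolding iv_def by (simp add: emeasure_restrict_space)
  finally show "emeasure (iv a) A * emeasure (iv b) B = emeasure (restrict_space lborel ({0<..<a} \<times> {0<..<b})) (A \<times> B)" by simp
qed

lemma rect_borel: "{0<..<a::real} \<times> {0<..<b::real} \<in> sets borel"
  by (intro borel_open open_Times) auto

lemma integrable_iv2:
  fixes f :: "real \<times> real => real"
  shows "integrable (iv2 a b) f \<longleftrightarrow> integrable lborel (%z. indicator ({0<..<a} \<times> {0<..<b}) z * f z)"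
  unfolding iv2_eq_lborel using rect_borel[of a b] by (simp add: integrable_restrict_space)

lemma integral_iv2:
  fixes f :: "real \<times> real => real"
  shows "(LINT z|iv2 a b. f z) = (LINT z|lborel. indicator ({0<..<a} \<times> {0<..<b}) z * f z)"
  unfolding iv2_eq_lborel using rect_borel[of a b] by (simp add: integral_restrict_space)

lemma AE_iv2: "(AE z in iv2 a b. P z) \<longleftrightarrow> (AE z in lborel. z \<in> {0<..<a} \<times> {0<..<b} \<longrightarrow> P z)"
  unfolding iv2_eq_lborel using rect_borel[of a b] by (simp add: AE_restrict_space_iff)

lemma measurable_iv2_eq: "measurable (iv2 a b) N = measurable (restrict_space borel ({0<..<a} \<times> {0<..<b})) N"
  unfolding iv2_eq_lborel by (rule measurable_cong_sets) (auto intro!: sets_restrict_space_cong)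

lemma borel_measurable_iv2_continuous:
  "continuous_on ({0<..<a} \<times> {0<..<b}) f ==> f \<in> borel_measurable (iv2 a b)"
  unfolding measurable_iv2_eq by (rule borel_measurable_continuous_on_restrict)

text \<open>The sets over which \<open>H\<close> integrates to 0 form a Dynkin system, so an
  intersection-stable generator yields all measurable sets; a density that integrates to 0 over all
  of them vanishes almost everywhere.\<close>

lemma integral_zero_on_generator:
  fixes H :: "'a => real"
  assumes H: "integrable M H" and E: "Int_stable E" "E \<subseteq> Pow (space M)" "sets M = sigma_sets (space M) E"
    and z: "\<And>A. A \<in> E ==> (LINT x|M. indicator A x * H x) = 0" and t: "(LINT x|M. H x) = 0"
  shows "AE x in M. H x = 0"
proof (rule density_unique_real[OF H])
  show "integrable M (%x. 0 :: real)" by simp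
  have i: "integrable M (%x. indicator A x * H x)" if "A \<in> sets M" for A
    using integrable_mult_indicator[OF that H] by simp
  fix A assume "A \<in> sets M"
  then have "A \<in> sigma_sets (space M) E" using E by simp
  from E(1,2) this have "(LINT x|M. indicator A x * H x) = 0"
  proof (induction rule: sigma_sets_induct_disjoint)
    case (basic A) then show ?case by (rule z)
  next
    case (compl A)
    then have A: "A \<in> sets M" using E by simp
    have "(LINT x|M. indicator (space M - A) x * H x) = (LINT x|M. H x - indicator A x * H x)"
      by (rule LINT_cong) (auto simp: indicator_def)
    also have "\<dots> = 0" using H i[OF A] compl t by simp
    finally show ?case .
  next
    case (union A)
    have As: "A i \<in> sets M" for i using union E by auto
    have si: "set_integrable M (\<Union>i. A i) H"
      unfolding set_integrable_def by (rule integrable_mult_indicator[OF _ H]) (use As in auto)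
    have "(LINT x:(\<Union>i. A i)|M. H x) = (\<Sum>i. (LINT x:(A i)|M. H x))"
      by (rule lebesgue_integral_countable_add[OF As _ si]) (use union(1) in \<open>auto simp: disjoint_family_on_def\<close>)
    also have "\<dots> = 0" using union(3) by (simp add: set_lebesgue_integral_def)
    finally show ?case by (simp add: set_lebesgue_integral_def)
  qed simp
  then show "set_lebesgue_integral M A H = set_lebesgue_integral M A (%x. 0)" by (simp add: set_lebesgue_integral_def)
qed

lemma integral_zero_on_boxes:
  fixes H :: "real \<times> real => real"
  assumes H: "integrable (iv2 a b) H"
    and z: "\<And>\<alpha> \<beta> \<alpha>' \<beta>'. 0 \<le> \<alpha> ==> \<alpha> < \<beta> ==> \<beta> \<le> a ==> 0 \<le> \<alpha>' ==> \<alpha>' < \<beta>' ==> \<beta>' \<le> b ==>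
      (LINT z|iv2 a b. (indicator {\<alpha><..<\<beta>} (fst z) * indicator {\<alpha>'<..<\<beta>'} (snd z)) * H z) = 0"
  shows "AE z in iv2 a b. H z = 0"
proof -
  define R where "R = {0<..<a} \<times> {0<..<b}"
  \<comment> \<open>Extended by 0 to the plane, where open boxes generate the Borel sets. A box
    meets the rectangle in a box again, possibly an empty one.\<close>
  define H0 where "H0 z = indicator R z * H z" for z
  have H0: "integrable lborel H0" using H unfolding integrable_iv2 H0_def R_def .
  have z': "(LINT z|iv2 a b. (indicator {\<alpha><..<\<beta>} (fst z) * indicator {\<alpha>'<..<\<beta>'} (snd z)) * H z) = 0"
    if "0 \<le> \<alpha>" "\<beta> \<le> a" "0 \<le> \<alpha>'" "\<beta>' \<le> b" for \<alpha> \<beta> \<alpha>' \<beta>'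
  proof (cases "\<alpha> < \<beta> \<and> \<alpha>' < \<beta>'")
    case True then show ?thesis using z that by simp
  next
    case False
    then have "{\<alpha><..<\<beta>} = {} \<or> {\<alpha>'<..<\<beta>'} = {}" by auto
    then show ?thesis by auto
  qed
  have bx: "(LINT z|lborel. indicator (box u v) z * H0 z) = 0" for u v
  proof -
    have "(LINT z|lborel. indicator (box u v) z * H0 z) = (LINT z|iv2 a b. indicator (box u v) z * H z)"
      unfolding integral_iv2 H0_def R_def by (simp add: mult.left_commute)
    also have "\<dots> = (LINT z|iv2 a b. (indicator {max 0 (fst u)<..<min a (fst v)} (fst z) * indicator {max 0 (snd u)<..<min b (snd v)} (snd z)) * H z)"
      by (rule LINT_cong)
        (auto simp: indicator_def box_def Basis_prod_def inner_prod_def)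
    also have "\<dots> = 0" by (rule z') auto
    finally show ?thesis .
  qed
  have "AE z in lborel. H0 z = 0"
  proof (rule integral_zero_on_generator[OF H0, of "range (%(a, b). box a b)"])
    show "Int_stable (range (%(a, b). box a b :: (real \<times> real) set))"
      by (auto simp: Int_stable_def box_Int_box simp del: box_prod)
    show "sets lborel = sigma_sets (space lborel) (range (%(a, b). box a b :: (real \<times> real) set))"
      by (simp add: borel_eq_box)
    have "(LINT z|lborel. H0 z) = (LINT z|lborel. indicator (box (0,0) (a,b)) z * H0 z)"
      by (rule LINT_cong)
        (auto simp: indicator_def box_def Basis_prod_def inner_prod_def H0_def R_def)
    then show "(LINT z|lborel. H0 z) = 0" using bx by simp
  qed (use bx in auto)
  then show ?thesis unfolding AE_iv2 by eventually_elim (auto simp: H0_def R_def)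
qed

text \<open>Products of such functions in \<open>s\<close> and in \<open>r\<close> serve as test
  functions on the rectangle. The derivative is carried along as a parameter, and C1 is all that is
  required of them.\<close>

definition bump :: "real => (real => real) => (real => real) => bool" where
  "bump a A A' \<longleftrightarrow> (\<forall>s. (A has_real_derivative A' s) (at s)) \<and> continuous_on UNIV A' \<and>
     (\<exists>\<alpha> \<beta>. 0 < \<alpha> \<and> \<alpha> < \<beta> \<and> \<beta> < a \<and> (\<forall>s. s \<notin> {\<alpha>..\<beta>} \<longrightarrow> A s = 0))"

lemma bump_continuous: "bump a A A' ==> continuous_on S A"
  unfolding bump_def by (meson DERIV_isCont continuous_at_imp_continuous_on)

lemma bump_continuous': "bump a A A' ==> continuous_on S A'"
  unfolding bump_def using continuous_on_subset by blast

lemma bump_AC: "bump a A A' ==> AC a A A'"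
  by (rule AC_smooth[OF bump_continuous integrable_iv_continuous[OF bump_continuous']]) (auto simp: bump_def)

lemma bump_ends: "bump a A A' ==> A 0 = 0" "bump a A A' ==> A a = 0"
  by (auto simp: bump_def)

lemma bump_bounded:
  assumes "bump a A A'"
  obtains B where "\<And>s. \<bar>A s\<bar> \<le> B" "\<And>s. s \<in> {0..a} ==> \<bar>A' s\<bar> \<le> B" "B \<ge> 0"
proof -
  have "bounded (A ` {0..a})" by (intro compact_imp_bounded compact_continuous_image bump_continuous[OF assms]) auto
  then obtain B1 where B1: "\<forall>y\<in>A ` {0..a}. norm y \<le> B1" "B1 > 0" unfolding bounded_pos by blast
  have "bounded (A' ` {0..a})" by (intro compact_imp_bounded compact_continuous_image bump_continuous'[OF assms]) auto
  then obtain B2 where B2: "\<forall>y\<in>A' ` {0..a}. norm y \<le> B2" "B2 > 0" unfolding bounded_pos by blast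
  have "\<bar>A s\<bar> \<le> B1" for s
  proof (cases "s \<in> {0..a}")
    case False
    then have "A s = 0" using assms unfolding bump_def by force
    then show ?thesis using B1 by simp
  qed (use B1 in auto)
  then show ?thesis using B2 B1 by (intro that[of "max B1 B2"]) (auto simp: le_max_iff_disj)
qed

text \<open>\<open>n * g / (1 + n * g)\<close> has values in \<open>[0, 1]\<close> and tends to the
  indicator of \<open>g > 0\<close> as \<open>n\<close> grows; squaring the positive part of the
  parabola makes \<open>g\<close> a C1 function.\<close>

definition bmp :: "real => real => nat => real => real" where
  "bmp \<alpha> \<beta> n x = (let g = (max 0 ((x - \<alpha>) * (\<beta> - x)))^2 in real n * g / (1 + real n * g))"

lemma bmp_bounds: "0 \<le> bmp \<alpha> \<beta> n x" "bmp \<alpha> \<beta> n x \<le> 1"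
proof -
  have "0 \<le> real n * (max 0 ((x - \<alpha>) * (\<beta> - x)))^2" by simp
  then show "0 \<le> bmp \<alpha> \<beta> n x" "bmp \<alpha> \<beta> n x \<le> 1"
    unfolding bmp_def Let_def by (auto simp: divide_le_eq_1 add_pos_nonneg)
qed

lemma bmp_bump:
  assumes "0 < \<alpha>" "\<alpha> < \<beta>" "\<beta> < a"
  obtains B' where "bump a (bmp \<alpha> \<beta> n) B'"
proof -
  define g where "g x = (max 0 ((x - \<alpha>) * (\<beta> - x)))^2" for x
  define g' where "g' x = (2 * max 0 ((x - \<alpha>) * (\<beta> - x))) * ((\<beta> - x) - (x - \<alpha>))" for x
  have g: "(g has_real_derivative g' x) (at x)" for x
    unfolding g_def g'_def
    by (rule DERIV_chain2[where f = "%y. (max 0 y)^2", OF has_derivative_pos_part_square])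
      (auto intro!: derivative_eq_intros)
  have p: "1 + real n * g x > 0" for x unfolding g_def by (intro add_pos_nonneg) auto
  then have p': "1 + real n * g x \<noteq> 0" for x by (metis less_irrefl)
  define B' where "B' x = real n * g' x / (1 + real n * g x)^2" for x
  have eq: "bmp \<alpha> \<beta> n = (%x. real n * g x / (1 + real n * g x))" by (auto simp: bmp_def g_def Let_def)
  have d: "(bmp \<alpha> \<beta> n has_real_derivative B' x) (at x)" for x
    unfolding eq B'_def using p'[of x]
    by (auto intro!: derivative_eq_intros g simp: power2_eq_square field_simps)
  have c: "continuous_on UNIV B'"
    unfolding B'_def g'_def using p' unfolding g_def by (intro continuous_intros) auto
  have z: "bmp \<alpha> \<beta> n x = 0" if "x \<notin> {\<alpha>..\<beta>}" for x
  proof -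
    have "(x - \<alpha>) * (\<beta> - x) \<le> 0"
      using that assms mult_nonpos_nonneg[of "x - \<alpha>" "\<beta> - x"] mult_nonneg_nonpos[of "x - \<alpha>" "\<beta> - x"]
      by (cases "x < \<alpha>") auto
    then show ?thesis by (simp add: bmp_def max_def)
  qed
  have "bump a (bmp \<alpha> \<beta> n) B'"
    unfolding bump_def using d c z assms by (intro conjI exI[of _ \<alpha>] exI[of _ \<beta>]) auto
  then show ?thesis by (rule that)
qed

text \<open>The support is shrunk at both ends so that it is compact in the open interval even if
  the latter touches the boundary of the domain. The offset 3 leaves at least a third of the
  interval, while the shrinking tends to 0.\<close>

lemma bmp_tendsto:
  assumes "\<alpha> < \<beta>"
  shows "(%n. bmp (\<alpha> + (\<beta> - \<alpha>) / real (n + 3)) (\<beta> - (\<beta> - \<alpha>) / real (n + 3)) (Suc n) x) \<longlonglongrightarrow> indicator {\<alpha><..<\<beta>} x"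
proof (cases "x \<in> {\<alpha><..<\<beta>}")
  case False
  have "bmp (\<alpha> + (\<beta> - \<alpha>) / real (n + 3)) (\<beta> - (\<beta> - \<alpha>) / real (n + 3)) (Suc n) x = 0" for n
  proof -
    have h: "0 < (\<beta> - \<alpha>) / real (n + 3)" using assms by simp
    have hh: "2 * q \<le> \<beta> - \<alpha>" if "q \<le> (\<beta> - \<alpha>) / 2" for q using that by simp
    have h2: "2 * ((\<beta> - \<alpha>) / real (n + 3)) \<le> \<beta> - \<alpha>"
      by (rule hh, rule divide_left_mono) (use assms in auto)
    have "(x - (\<alpha> + (\<beta> - \<alpha>) / real (n + 3))) * (\<beta> - (\<beta> - \<alpha>) / real (n + 3) - x) \<le> 0"
    proof (cases "x \<le> \<alpha>")
      case True
      then show ?thesis using h h2 assms by (intro mult_nonpos_nonneg) linarith+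
    next
      case False
      then have "\<beta> \<le> x" using \<open>x \<notin> _\<close> by auto
      then show ?thesis using h h2 assms by (intro mult_nonneg_nonpos) linarith+
    qed
    then show ?thesis by (simp add: bmp_def max_def)
  qed
  then show ?thesis using False by simp
next
  case True
  define e where "e n = (\<beta> - \<alpha>) / real (n + 3)" for n
  have e: "e \<longlonglongrightarrow> 0" unfolding e_def
    by (rule LIMSEQ_ignore_initial_segment[OF lim_const_over_n, of _ 3])
  define g where "g n = (max 0 ((x - (\<alpha> + e n)) * (\<beta> - e n - x)))^2" for n
  have "g \<longlonglongrightarrow> (max 0 ((x - (\<alpha> + 0)) * (\<beta> - 0 - x)))^2" unfolding g_def by (intro tendsto_intros e)
  moreover have pos: "0 < (max 0 ((x - (\<alpha> + 0)) * (\<beta> - 0 - x)))^2"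
    using True by (auto simp: max_def not_le mult_le_0_iff)
  ultimately have gl: "filterlim (%n. g n * real (Suc n)) at_top sequentially"
    using filterlim_compose[OF filterlim_real_sequentially filterlim_Suc]
    by (intro filterlim_tendsto_pos_mult_at_top) auto
  have "((%n. 1 - inverse (1 + g n * real (Suc n))) \<longlongrightarrow> 1 - 0) sequentially"
    by (intro tendsto_intros tendsto_inverse_0_at_top filterlim_tendsto_add_at_top[OF tendsto_const gl])
  moreover have "1 - inverse (1 + g n * real (Suc n)) = bmp (\<alpha> + e n) (\<beta> - e n) (Suc n) x" for n
  proof -
    have "1 + g n * real (Suc n) > 0" unfolding g_def by (intro add_pos_nonneg) auto
    then show ?thesis unfolding bmp_def Let_def g_def[symmetric] by (simp add: field_simps)
  qed
  ultimately show ?thesis using True by (simp add: e_def)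
qed

text \<open>The primitive from 0 vanishes to the left of the support trivially and to the right of
  it because the total integral is 0. This is the decomposition tool of the du Bois-Reymond
  argument.\<close>

lemma bump_primitive:
  assumes g: "continuous_on UNIV g" and ab: "0 < \<alpha>" "\<alpha> < \<beta>" "\<beta> < a"
    and z: "\<And>s. s \<notin> {\<alpha>..\<beta>} ==> g s = 0" and i: "(LINT s|iv a. g s) = 0"
  shows "\<exists>A. bump a A g"
proof -
  define A where "A s = integral {0..s} g" for s :: real
  have gI: "g integrable_on {u..v}" for u v
    by (rule integrable_continuous_real) (rule continuous_on_subset[OF g], simp)
  have A0: "A s = 0" if "s < \<alpha>" for s
  proof -
    have "A s = integral {0..s} (%_. 0)" unfolding A_def
      by (rule integral_cong) (use z that in auto)
    then show ?thesis by simp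
  qed
  have ga: "A s = A t" if "\<beta> \<le> s" "s \<le> t" for s t
  proof -
    have "A t = A s + integral {s..t} g" unfolding A_def
      by (rule Henstock_Kurzweil_Integration.integral_combine[symmetric]) (use that ab gI in auto)
    moreover have "integral {s..t} g = integral {s..t} (%_. 0)"
    proof (rule integral_spike[of "{\<beta>}"])
      show "(0::real) = g x" if "x \<in> {s..t} - {\<beta>}" for x using z[of x] that \<open>\<beta> \<le> s\<close> by auto
    qed auto
    ultimately show ?thesis by simp
  qed
  have Aa: "A a = 0"
  proof -
    have "set_integrable lborel {0..a} g"
      by (rule borel_integrable_atLeastAtMost') (rule continuous_on_subset[OF g], simp)
    from set_borel_integral_eq_integral(2)[OF this] have "A a = (LINT s:{0..a}|lborel. g s)" by (simp add: A_def)
    also have "\<dots> = (LINT s|iv a. g s)" unfolding integral_iv set_lebesgue_integral_def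
      by (rule LINT_cong) (use z ab in \<open>auto simp: indicator_def\<close>)
    finally show ?thesis using i by simp
  qed
  have "A s = 0" if "s \<notin> {\<alpha>..\<beta>}" for s
    using A0[of s] ga[of s a] ga[of a s] Aa that ab by (cases "s \<le> a") auto
  moreover have "(A has_real_derivative g s) (at s)" for s
  proof (cases "s < \<alpha>")
    case True
    have "((%_. 0) has_real_derivative g s) (at s)" using z[of s] True by simp
    then show ?thesis
      by (rule has_field_derivative_transform_within_open[where S = "{..<\<alpha>}"]) (use True A0 in auto)
  next
    case False
    have "(A has_real_derivative g s) (at s within {0..s+1})" unfolding A_def
      by (rule integral_has_real_derivative) (use False ab in \<open>auto intro: continuous_on_subset[OF g]\<close>)
    then show ?thesis using at_within_interior[of s "{0..s+1}"] False ab by simp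
  qed
  ultimately have "bump a A g"
    unfolding bump_def using g ab by auto
  then show ?thesis by blast
qed

section \<open>Fubini, null sets and primitives along horizontal lines\<close>

lemma AE_iv2_snd:
  assumes "AE z in iv2 a b. Q z"
  shows "AE r in iv b. AE s in iv a. Q (s, r)"
proof -
  have "AE z in distr (iv2 b a) (iv2 a b) (%(x, y). (y, x)). Q z"
    by (rule subst[where P = "%M. AE z in M. Q z", OF iv2.distr_pair_swap assms])
  then have "AE w in iv2 b a. Q (case w of (x, y) => (y, x))"
    by (rule AE_distrD[rotated]) (rule measurable_pair_swap')
  from iv2.AE_pair[OF this] show ?thesis by simp
qed

lemma AE_iv2_fst: "AE z in iv2 a b. Q z ==> AE s in iv a. AE r in iv b. Q (s, r)"
  by (rule iv2.AE_pair)

text \<open>\<open>Q\<close> may be nonmeasurable, so the argument is routed through a measurable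
  null set \<open>N\<close> containing the exceptional points.\<close>

lemma AE_iv2_of_fst:
  assumes "AE s in iv a. Q s"
  shows "AE z in iv2 a b. Q (fst z)"
proof -
  obtain N where N: "N \<in> sets (iv a)" "emeasure (iv a) N = 0" "{x \<in> space (iv a). \<not> Q x} \<subseteq> N"
    using assms unfolding eventually_ae_filter by auto
  have "AE s in iv a. s \<notin> N" using N by (intro AE_not_in) auto
  then have "AE z in iv2 a b. fst z \<notin> N"
  proof (intro iv2.AE_pair_measure)
    have [measurable]: "N \<in> sets (iv a)" by (rule N(1))
    show "{z \<in> space (iv2 a b). fst z \<notin> N} \<in> sets (iv2 a b)" by measurable
  qed (auto elim: eventually_mono)
  then show ?thesis using AE_space[of "iv2 a b"] by eventually_elim (use N(3) in auto)
qed

lemma AE_iv2_of_snd: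
  assumes "AE r in iv b. Q r"
  shows "AE z in iv2 a b. Q (snd z)"
proof -
  have "AE w in iv2 b a. Q (fst w)" by (rule AE_iv2_of_fst[OF assms])
  then have "AE w in distr (iv2 a b) (iv2 b a) (%(x, y). (y, x)). Q (fst w)"
    by (rule subst[where P = "%M. AE w in M. Q (fst w)", OF iv2.distr_pair_swap])
  then have "AE z in iv2 a b. Q (fst (case z of (x, y) => (y, x)))"
    by (rule AE_distrD[rotated]) (rule measurable_pair_swap')
  then show ?thesis by eventually_elim (auto split: prod.splits)
qed

lemma integral_iv2_snd:
  fixes g :: "real \<times> real => real"
  assumes "integrable (iv2 a b) g"
  shows "AE r in iv b. integrable (iv a) (%s. g (s, r))" "integrable (iv b) (%r. LINT s|iv a. g (s, r))"
    "(LINT z|iv2 a b. g z) = (LINT r|iv b. LINT s|iv a. g (s, r))"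
  using iv2.AE_integrable_snd[of a b "%s r. g (s, r)"] iv2.integrable_snd[of a b "%s r. g (s, r)"]
    iv2.integral_snd[of a b "%s r. g (s, r)"] assms by simp_all

lemma integral_iv2_fst:
  fixes g :: "real \<times> real => real"
  assumes "integrable (iv2 a b) g"
  shows "AE s in iv a. integrable (iv b) (%r. g (s, r))" "integrable (iv a) (%s. LINT r|iv b. g (s, r))"
    "(LINT z|iv2 a b. g z) = (LINT s|iv a. LINT r|iv b. g (s, r))"
  using iv2.AE_integrable_fst[of a b "%s r. g (s, r)"] iv2.integrable_fst[of a b "%s r. g (s, r)"]
    iv2.integral_fst[of a b "%s r. g (s, r)"] assms by simp_all

lemma integrable_iv2_of_fst:
  fixes h :: "real => real"
  assumes h: "integrable (iv a) h"
  shows "integrable (iv2 a b) (%z. h (fst z))"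
proof (rule iv2.Fubini_integrable)
  have [measurable]: "h \<in> borel_measurable (iv a)" using h by auto
  show "(%z. h (fst z)) \<in> borel_measurable (iv2 a b)" by measurable
qed (use h in auto)

lemma integrable_iv2_swap:
  fixes g :: "real \<times> real => real"
  assumes "integrable (iv2 a b) g"
  shows "integrable (iv2 b a) (%z. g (snd z, fst z))"
  using iv2.integrable_product_swap[OF assms] by (simp add: case_prod_beta')

lemma integrable_iv2_of_snd:
  fixes h :: "real => real"
  assumes h: "integrable (iv b) h"
  shows "integrable (iv2 a b) (%z. h (snd z))"
  using integrable_iv2_swap[OF integrable_iv2_of_fst[OF h, of a]] by simp

lemma integrable_iv2_mult_bounded:
  fixes p g :: "real \<times> real => real"
  assumes p: "integrable (iv2 a b) p" and [measurable]: "g \<in> borel_measurable (iv2 a b)"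
    and B: "\<And>z. z \<in> {0<..<a} \<times> {0<..<b} ==> \<bar>g z\<bar> \<le> B"
  shows "integrable (iv2 a b) (%z. p z * g z)"
proof (rule Bochner_Integration.integrable_bound[of _ "%s. B * p s"])
  have [measurable]: "p \<in> borel_measurable (iv2 a b)" using p by auto
  show "(%s. p s * g s) \<in> borel_measurable (iv2 a b)" by measurable
  show "AE s in iv2 a b. norm (p s * g s) \<le> norm (B * p s)"
  proof (rule AE_I2)
    fix s assume "s \<in> space (iv2 a b)"
    then have "\<bar>g s\<bar> * \<bar>p s\<bar> \<le> \<bar>B\<bar> * \<bar>p s\<bar>" using B[of s] by (intro mult_right_mono) auto
    then show "norm (p s * g s) \<le> norm (B * p s)" by (simp add: abs_mult mult.commute)
  qed
qed (use p in auto)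

lemma iv2_fst_measurable [measurable]: "fst \<in> borel_measurable (iv2 a b)"
  by (rule measurable_compose[OF measurable_fst ident_measurable_iv])

lemma iv2_snd_measurable [measurable]: "snd \<in> borel_measurable (iv2 a b)"
  by (rule measurable_compose[OF measurable_snd ident_measurable_iv])

text \<open>A choice of primitive on every horizontal line at once; as a parameter integral it is
  jointly measurable in \<open>s\<close> and \<open>r\<close>.\<close>

definition prim :: "real => (real \<times> real => real) => real => real => real" where
  "prim a p s r = (LINT v|iv a. indicator {..s} v * p (v, r))"

lemma prim_AC: "integrable (iv a) (%s. p (s, r)) ==> AC a (%s. prim a p s r) (%s. p (s, r))"
  unfolding prim_def by (rule ACI_primitive)

lemma prim_measurable:
  assumes [measurable]: "p \<in> borel_measurable (iv2 a b)"
  shows "(%z. prim a p (fst z) (snd z)) \<in> borel_measurable (iv2 a b)"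
proof -
  have [measurable]: "(%w. p (snd w, snd (fst w))) \<in> borel_measurable (iv2 a b \<Otimes>\<^sub>M iv a)"
    by measurable
  have [measurable]: "(%w. snd w) \<in> borel_measurable (iv2 a b \<Otimes>\<^sub>M iv a)"
    by (rule measurable_compose[OF measurable_snd ident_measurable_iv])
  have [measurable]: "(%w. fst (fst w)) \<in> borel_measurable (iv2 a b \<Otimes>\<^sub>M iv a)"
    by (rule measurable_compose[OF measurable_fst iv2_fst_measurable])
  have "(%w. if snd w \<le> fst (fst w) then p (snd w, snd (fst w)) else 0) \<in> borel_measurable (iv2 a b \<Otimes>\<^sub>M iv a)"
    by measurable
  then have "(%(z, v). if v \<le> fst z then p (v, snd z) else 0) \<in> borel_measurable (iv2 a b \<Otimes>\<^sub>M iv a)"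
    by (simp add: case_prod_beta')
  then have "(%z. LINT v|iv a. (if v \<le> fst z then p (v, snd z) else 0)) \<in> borel_measurable (iv2 a b)"
    by (rule iv.borel_measurable_lebesgue_integral)
  moreover have "prim a p s r = (LINT v|iv a. (if v \<le> s then p (v, r) else 0))" for s r
    unfolding prim_def by (rule LINT_cong) (auto simp: indicator_def)
  ultimately show ?thesis by simp
qed

lemma prim_integrable:
  assumes p: "integrable (iv2 a b) p"
  shows "integrable (iv2 a b) (%z. prim a p (fst z) (snd z))"
proof -
  have i: "integrable (iv b) (%r. LINT s|iv a. \<bar>p (s, r)\<bar>)" using p by (intro integral_iv2_snd(2)) auto
  show ?thesis
  proof (rule Bochner_Integration.integrable_bound[OF integrable_iv2_of_snd[OF i, of a]])
    show "(%z. prim a p (fst z) (snd z)) \<in> borel_measurable (iv2 a b)" using p by (intro prim_measurable) auto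
    show "AE z in iv2 a b. norm (prim a p (fst z) (snd z)) \<le> norm (LINT s|iv a. \<bar>p (s, snd z)\<bar>)"
      using AE_iv2_of_snd[OF integral_iv2_snd(1)[OF p]]
    proof eventually_elim
      case (elim z)
      have "\<bar>prim a p (fst z) (snd z)\<bar> \<le> (LINT v|iv a. \<bar>indicator {..fst z} v * p (v, snd z)\<bar>)"
        unfolding prim_def by (rule integral_abs_bound)
      also have "\<dots> \<le> (LINT v|iv a. \<bar>p (v, snd z)\<bar>)"
        by (rule integral_mono)
          (use elim in \<open>auto intro!: integrable_abs integrable_indicator_mult simp del: abs_mult, simp add: indicator_def\<close>)
      finally show ?case by simp
    qed
  qed
qed

text \<open>Du Bois-Reymond lemma with a parameter: subtracting the primitive of \<open>p\<close>
  leaves a function \<open>K\<close> with vanishing weak \<open>s\<close>-derivative, and such a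
  function depends on \<open>r\<close> alone.\<close>

lemma weak_imp_wAC:
  assumes a: "0 < a" and f: "integrable (iv2 a b) f" and p: "integrable (iv2 a b) p"
    and weak: "\<And>A A' B B'. bump a A A' ==> bump b B B' ==>
      (LINT z|iv2 a b. f z * (A' (fst z) * B (snd z))) = - (LINT z|iv2 a b. p z * (A (fst z) * B (snd z)))"
  shows "AE r in iv b. wAC a (%s. f (s, r)) (%s. p (s, r))"
proof -
  define K where "K z = f z - prim a p (fst z) (snd z)" for z
  note J = prim_integrable[OF p]
  have K: "integrable (iv2 a b) K" unfolding K_def using f J by simp
  have bm: "integrable (iv2 a b) (%z. h z * (A (fst z) * B (snd z)))" "integrable (iv2 a b) (%z. h z * (A' (fst z) * B (snd z)))"
    if h: "integrable (iv2 a b) h" and A: "bump a A A'" and B: "bump b B B'" for h A A' B B'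
  proof -
    obtain CA where CA: "\<And>s. \<bar>A s\<bar> \<le> CA" "\<And>s. s \<in> {0..a} ==> \<bar>A' s\<bar> \<le> CA" "CA \<ge> 0" by (rule bump_bounded[OF A], rule that; assumption)
    obtain CB where CB: "\<And>s. \<bar>B s\<bar> \<le> CB" "CB \<ge> 0" by (rule bump_bounded[OF B], rule that; assumption)
    have [measurable]: "A \<in> borel_measurable borel" "A' \<in> borel_measurable borel" "B \<in> borel_measurable borel"
      by (rule borel_measurable_continuous_onI, rule bump_continuous[OF A] bump_continuous'[OF A] bump_continuous[OF B])+
    show "integrable (iv2 a b) (%z. h z * (A (fst z) * B (snd z)))"
    proof (rule integrable_iv2_mult_bounded[OF h, of _ "CA * CB"])
      show "\<bar>A (fst z) * B (snd z)\<bar> \<le> CA * CB" for z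
        unfolding abs_mult by (rule mult_mono[OF CA(1) CB(1) CA(3)]) simp
    qed measurable
    show "integrable (iv2 a b) (%z. h z * (A' (fst z) * B (snd z)))"
    proof (rule integrable_iv2_mult_bounded[OF h, of _ "CA * CB"])
      fix z assume "z \<in> {0<..<a} \<times> {0<..<b}"
      then have "fst z \<in> {0..a}" by auto
      from CA(2)[OF this] show "\<bar>A' (fst z) * B (snd z)\<bar> \<le> CA * CB"
        unfolding abs_mult by (rule mult_mono[OF _ CB(1) CA(3)]) simp
    qed measurable
  qed
  have K0: "(LINT z|iv2 a b. K z * (A' (fst z) * B (snd z))) = 0" if A: "bump a A A'" and B: "bump b B B'" for A A' B B'
  proof -
    have "(LINT z|iv2 a b. prim a p (fst z) (snd z) * (A' (fst z) * B (snd z)))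
      = (LINT r|iv b. LINT s|iv a. prim a p s r * (A' s * B r))"
      using integral_iv2_snd(3)[OF bm(2)[OF J A B]] by simp
    also have "\<dots> = (LINT r|iv b. LINT s|iv a. - (p (s, r) * (A s * B r)))"
    proof (rule integral_cong_AE)
      have 1: "integrable (iv2 a b) (%z. - (p z * (A (fst z) * B (snd z))))" using bm(1)[OF p A B] by simp
      show "(%r. LINT s|iv a. prim a p s r * (A' s * B r)) \<in> borel_measurable (iv b)"
        "(%r. LINT s|iv a. - (p (s, r) * (A s * B r))) \<in> borel_measurable (iv b)"
        using integral_iv2_snd(2)[OF bm(2)[OF J A B]] integral_iv2_snd(2)[OF 1] by auto
      show "AE r in iv b. (LINT s|iv a. prim a p s r * (A' s * B r)) = (LINT s|iv a. - (p (s, r) * (A s * B r)))"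
        using integral_iv2_snd(1)[OF p]
      proof eventually_elim
        case (elim r)
        have "(LINT s|iv a. prim a p s r * A' s) = - (LINT s|iv a. p (s, r) * A s)"
          using bump_ends[OF A] by (intro AC_by_parts[OF prim_AC[OF elim] bump_AC[OF A] less_imp_le[OF a]]) auto
        then have "(LINT s|iv a. prim a p s r * A' s * B r) = (LINT s|iv a. - (p (s, r) * A s) * B r)" by simp
        then show ?case by (simp add: mult.assoc)
      qed
    qed
    also have "\<dots> = - (LINT z|iv2 a b. p z * (A (fst z) * B (snd z)))"
      using integral_iv2_snd(3)[OF bm(1)[OF p A B]] by simp
    finally show ?thesis
      using weak[OF A B] bm(2)[OF f A B] bm(2)[OF J A B] by (simp add: K_def left_diff_distrib)
  qed
  \<comment> \<open>A fixed profile supported in the middle third; divided by its integral it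
    becomes the reference function \<open>U\<close> of integral 1.\<close>
  obtain a1 where a1: "bump a (bmp (a/3) (2*a/3) 1) a1" using bmp_bump[of "a/3" "2*a/3" a 1] a by auto
  define u0 where "u0 = bmp (a/3) (2*a/3) 1"
  have u0c: "continuous_on S u0" for S unfolding u0_def by (rule bump_continuous[OF a1])
  have u0z: "u0 s = 0" if "s \<notin> {a/3..2*a/3}" for s
  proof -
    have "(s - a/3) * (2*a/3 - s) \<le> 0"
      using that a mult_nonpos_nonneg[of "s - a/3" "2*a/3 - s"] mult_nonneg_nonpos[of "s - a/3" "2*a/3 - s"]
      by (cases "s < a/3") auto
    then have "max 0 ((s - a/3) * (2*a/3 - s)) = 0" by simp
    then show ?thesis by (simp add: u0_def bmp_def)
  qed
  have u0i: "integrable (iv a) u0" by (rule integrable_iv_continuous[OF u0c])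
  define \<kappa>0 where "\<kappa>0 = (LINT s|iv a. u0 s)"
  have k0: "\<kappa>0 \<noteq> 0"
  proof
    assume "\<kappa>0 = 0"
    then have "AE s in iv a. u0 s = 0"
      unfolding \<kappa>0_def using u0i bmp_bounds by (subst (asm) integral_nonneg_eq_0_iff_AE) (auto simp: u0_def)
    then have "AE s in lborel. s \<notin> {a/3<..<2*a/3}"
      unfolding AE_iv
    proof eventually_elim
      case (elim s)
      show ?case
      proof
        assume s: "s \<in> {a/3<..<2*a/3}"
        then have "(s - a/3) * (2*a/3 - s) > 0" by simp
        then have "0 < max 0 ((s - a/3) * (2*a/3 - s))" by (rule max.strict_coboundedI2)
        then have "0 < (max 0 ((s - a/3) * (2*a/3 - s)))^2" by (rule zero_less_power)
        then have "u0 s > 0" unfolding u0_def bmp_def Let_def of_nat_1 mult_1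
          by (intro divide_pos_pos add_pos_pos) auto
        then show False using elim s a by auto
      qed
    qed
    then have "{a/3<..<2*a/3} \<in> null_sets lborel" by (subst AE_iff_null_sets) simp_all
    then have "emeasure lborel {a/3<..<2*a/3} = 0" by (rule null_setsD1)
    then show False using a by simp
  qed
  define U where "U s = u0 s / \<kappa>0" for s
  have Uc: "continuous_on S U" for S unfolding U_def by (intro continuous_intros u0c) (simp add: k0)
  have Um[measurable]: "U \<in> borel_measurable borel" by (rule borel_measurable_continuous_onI[OF Uc])
  have Ui: "(LINT s|iv a. U s) = 1" unfolding U_def using k0 by (simp add: \<kappa>0_def)
  have Ub: "\<bar>U s\<bar> \<le> 1 / \<bar>\<kappa>0\<bar>" for s
    unfolding U_def u0_def abs_divide using bmp_bounds[of "a/3" "2*a/3" 1 s] by (intro divide_right_mono) auto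
  have KU: "integrable (iv2 a b) (%z. K z * U (fst z))"
    by (rule integrable_iv2_mult_bounded[OF K, of _ "1 / \<bar>\<kappa>0\<bar>"]) (use Ub in auto)
  \<comment> \<open>If \<open>K\<close> depends on \<open>r\<close> only, averaging it against
    \<open>U\<close> recovers it, so \<open>c\<close> is the only possible candidate.\<close>
  define c where "c r = (LINT s|iv a. K (s, r) * U s)" for r
  have ci: "integrable (iv b) c" unfolding c_def using integral_iv2_snd(2)[OF KU] by simp
  have ci2: "integrable (iv2 a b) (%z. c (snd z))" by (rule integrable_iv2_of_snd[OF ci])
  define H where "H z = K z - c (snd z)" for z
  have H: "integrable (iv2 a b) H" unfolding H_def using K ci2 by simp
  have H0: "(LINT z|iv2 a b. H z * (V (fst z) * B (snd z))) = 0" if V: "bump a V V'" and B: "bump b B B'" for V V' B B'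
  proof -
    define \<kappa> where "\<kappa> = (LINT s|iv a. V s)"
    obtain \<alpha> \<beta> where ab: "0 < \<alpha>" "\<alpha> < \<beta>" "\<beta> < a" "\<And>s. s \<notin> {\<alpha>..\<beta>} ==> V s = 0"
      using V unfolding bump_def by blast
    have Vi: "integrable (iv a) V" by (rule integrable_iv_continuous[OF bump_continuous[OF V]])
    \<comment> \<open>\<open>V\<close> minus \<open>\<kappa> * U\<close> has integral 0, hence is
      the derivative of a bump and pairs to 0 with \<open>K\<close>. What remains is
      \<open>\<kappa> * U\<close>, whose pairing with \<open>K\<close> is expressed by
      \<open>c\<close>.\<close>
    have "\<exists>A. bump a A (%s. V s - \<kappa> * U s)"
    proof (rule bump_primitive[of _ "min \<alpha> (a/3)" "max \<beta> (2*a/3)"])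
      show "continuous_on UNIV (%s. V s - \<kappa> * U s)" by (intro continuous_intros Uc bump_continuous[OF V])
      show "V s - \<kappa> * U s = 0" if "s \<notin> {min \<alpha> (a/3)..max \<beta> (2*a/3)}" for s
      proof -
        have "s \<notin> {\<alpha>..\<beta>}" "s \<notin> {a/3..2*a/3}" using that by auto
        then show ?thesis using ab(4) u0z by (simp add: U_def)
      qed
      have "integrable (iv a) U" by (rule integrable_iv_continuous[OF Uc])
      then show "(LINT s|iv a. V s - \<kappa> * U s) = 0" using Vi Ui by (simp add: \<kappa>_def)
    qed (use ab a in auto)
    then obtain A where A: "bump a A (%s. V s - \<kappa> * U s)" by blast
    have Bm[measurable]: "B \<in> borel_measurable borel"
      by (rule borel_measurable_continuous_onI, rule bump_continuous[OF B])
    obtain CB where CB: "\<And>s. \<bar>B s\<bar> \<le> CB" "CB \<ge> 0" by (rule bump_bounded[OF B], rule that; assumption)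
    have iKUB: "integrable (iv2 a b) (%z. K z * (U (fst z) * B (snd z)))"
      unfolding mult.assoc[symmetric]
      by (rule integrable_iv2_mult_bounded[OF KU, of _ "CB"]) (auto intro!: CB)
    have "0 = (LINT z|iv2 a b. K z * ((V (fst z) - \<kappa> * U (fst z)) * B (snd z)))" using K0[OF A B] by simp
    also have "\<dots> = (LINT z|iv2 a b. K z * (V (fst z) * B (snd z)) - \<kappa> * (K z * (U (fst z) * B (snd z))))"
      by (simp add: algebra_simps)
    also have "\<dots> = (LINT z|iv2 a b. K z * (V (fst z) * B (snd z))) - \<kappa> * (LINT z|iv2 a b. K z * (U (fst z) * B (snd z)))"
      using bm(1)[OF K V B] iKUB by simp
    also have "\<kappa> * (LINT z|iv2 a b. K z * (U (fst z) * B (snd z))) = \<kappa> * (LINT r|iv b. c r * B r)"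
      unfolding c_def integral_iv2_snd(3)[OF iKUB] by (simp add: mult.assoc[symmetric])
    also have "\<dots> = (LINT r|iv b. LINT s|iv a. c r * (V s * B r))"
    proof -
      have "(LINT s|iv a. c r * (V s * B r)) = \<kappa> * (c r * B r)" for r by (simp add: \<kappa>_def mult_ac)
      then show ?thesis by (simp only: Bochner_Integration.integral_mult_right_zero)
    qed
    also have "\<dots> = (LINT z|iv2 a b. c (snd z) * (V (fst z) * B (snd z)))"
      using integral_iv2_snd(3)[OF bm(1)[OF ci2 V B]] by simp
    finally show ?thesis using bm(1)[OF K V B] bm(1)[OF ci2 V B] by (simp add: H_def left_diff_distrib)
  qed
  \<comment> \<open>Bumps tend to indicators of open boxes while staying in \<open>[0, 1]\<close>,
    so \<open>H\<close> integrates to 0 over every box.\<close>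
  have "AE z in iv2 a b. H z = 0"
  proof (rule integral_zero_on_boxes[OF H])
    fix \<alpha> \<beta> \<alpha>' \<beta>' assume o: "0 \<le> \<alpha>" "\<alpha> < \<beta>" "\<beta> \<le> a" "0 \<le> \<alpha>'" "\<alpha>' < \<beta>'" "\<beta>' \<le> b"
    define V W where "V n = bmp (\<alpha> + (\<beta> - \<alpha>) / real (n + 3)) (\<beta> - (\<beta> - \<alpha>) / real (n + 3)) (Suc n)"
      and "W n = bmp (\<alpha>' + (\<beta>' - \<alpha>') / real (n + 3)) (\<beta>' - (\<beta>' - \<alpha>') / real (n + 3)) (Suc n)" for n
    have ex: "\<exists>V'. bump A (bmp (x + (y - x) / real (n + 3)) (y - (y - x) / real (n + 3)) (Suc n)) V'"
      if "0 \<le> x" "x < y" "y \<le> A" for x y A n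
    proof -
      have h: "0 < (y - x) / real (n + 3)" using that by simp
      have hh: "2 * q < y - x" if "q \<le> (y - x) / 3" for q using that \<open>x < y\<close> by argo
      have h2: "2 * ((y - x) / real (n + 3)) < y - x"
        by (rule hh, rule divide_left_mono) (use that in auto)
      show ?thesis
        by (rule bmp_bump[of "x + (y - x) / real (n + 3)" "y - (y - x) / real (n + 3)" A "Suc n"])
          (use h h2 that in \<open>linarith, linarith, linarith, blast\<close>)
    qed
    have VW: "\<exists>V'. bump a (V n) V'" "\<exists>W'. bump b (W n) W'" for n
      unfolding V_def W_def using ex o by auto
    have [measurable]: "V n \<in> borel_measurable borel" "W n \<in> borel_measurable borel" for n
      using VW[of n] by (auto intro!: borel_measurable_continuous_onI intro: bump_continuous)
    have [measurable]: "H \<in> borel_measurable (iv2 a b)" using H by auto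
    have "(%n. LINT z|iv2 a b. (V n (fst z) * W n (snd z)) * H z) \<longlonglongrightarrow>
      (LINT z|iv2 a b. (indicator {\<alpha><..<\<beta>} (fst z) * indicator {\<alpha>'<..<\<beta>'} (snd z)) * H z)"
    proof (rule integral_dominated_convergence[where w = "%z. \<bar>H z\<bar>"])
      show "AE z in iv2 a b. (%n. (V n (fst z) * W n (snd z)) * H z) \<longlonglongrightarrow>
        (indicator {\<alpha><..<\<beta>} (fst z) * indicator {\<alpha>'<..<\<beta>'} (snd z)) * H z"
        unfolding V_def W_def by (rule AE_I2) (intro tendsto_intros bmp_tendsto o)
      show "AE z in iv2 a b. norm ((V n (fst z) * W n (snd z)) * H z) \<le> \<bar>H z\<bar>" for n
      proof (rule AE_I2)
        fix z
        have "\<bar>V n (fst z)\<bar> * \<bar>W n (snd z)\<bar> \<le> 1 * 1"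
          by (rule mult_mono) (auto simp: V_def W_def bmp_bounds)
        then show "norm ((V n (fst z) * W n (snd z)) * H z) \<le> \<bar>H z\<bar>"
          by (simp add: abs_mult mult_left_le_one_le)
      qed
      show "(%z. (indicator {\<alpha><..<\<beta>} (fst z) * indicator {\<alpha>'<..<\<beta>'} (snd z)) * H z) \<in> borel_measurable (iv2 a b)" by measurable
      show "(%z. (V n (fst z) * W n (snd z)) * H z) \<in> borel_measurable (iv2 a b)" for n by measurable
    qed (use H in auto)
    moreover have "(LINT z|iv2 a b. (V n (fst z) * W n (snd z)) * H z) = 0" for n
      using VW[of n] H0 by (auto simp: mult.commute)
    ultimately show "(LINT z|iv2 a b. (indicator {\<alpha><..<\<beta>} (fst z) * indicator {\<alpha>'<..<\<beta>'} (snd z)) * H z) = 0"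
      using LIMSEQ_unique[OF tendsto_const] by fastforce
  qed
  from AE_iv2_snd[OF this] integral_iv2_snd(1)[OF p]
  show ?thesis
  proof eventually_elim
    case (elim r)
    have "AC a (%s. c r + prim a p s r) (%s. 0 + p (s, r))"
      by (rule AC_add[OF AC_const prim_AC[OF elim(2)]])
    then show ?case using elim(1) by (intro wACI[of a "%s. c r + prim a p s r"]) (auto simp: H_def K_def)
  qed
qed

text \<open>\<open>wAC\<close> selects a representative for each \<open>r\<close> separately,
  without any measurability in \<open>r\<close>. The constant of integration is recovered measurably
  as the mean over \<open>s\<close> of \<open>f - prim\<close>; the result is one representative on
  the rectangle that makes sense on each single fibre \<open>s\<close>.\<close>

lemma wAC_joint_rep:
  assumes a: "0 < a" and f: "integrable (iv2 a b) f" and p: "integrable (iv2 a b) p"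
    and w: "AE r in iv b. wAC a (%s. f (s, r)) (%s. p (s, r))"
  obtains c where "integrable (iv b) c" "AE z in iv2 a b. f z = c (snd z) + prim a p (fst z) (snd z)"
proof -
  define c where "c r = (1/a) * (LINT s|iv a. f (s, r) - prim a p s r)" for r
  note J = prim_integrable[OF p]
  have fJ: "integrable (iv2 a b) (%z. f z - prim a p (fst z) (snd z))" using f J by simp
  have c: "integrable (iv b) c" unfolding c_def using integral_iv2_snd(2)[OF fJ] by simp
  have [measurable]: "c \<in> borel_measurable (iv b)" "f \<in> borel_measurable (iv2 a b)"
    "(%z. prim a p (fst z) (snd z)) \<in> borel_measurable (iv2 a b)"
    using c f J by auto
  have "AE r in iv b. AE s in iv a. f (s, r) = c r + prim a p s r"
    using w AE_space[of "iv b"]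
  proof eventually_elim
    case (elim r)
    then obtain F where F: "AC a F (%s. p (s, r))" "AE s in iv a. f (s, r) = F s" by (auto simp: wAC_def)
    note P = prim_AC[OF AC_integrable[OF F(1)]]
    have *: "F s - prim a p s r = F 0 - prim a p 0 r" if "0 \<le> s" "s \<le> a" for s
      using AC_diff_eq[OF F(1) order_refl that] AC_diff_eq[OF P order_refl that] by linarith
    define d where "d = F 0 - prim a p 0 r"
    have ae: "AE s in iv a. f (s, r) - prim a p s r = d"
      using F(2) AE_space[of "iv a"]
    proof eventually_elim
      case (elim s)
      then have "0 \<le> s" "s \<le> a" by auto
      from *[OF this] elim(1) show ?case unfolding d_def by linarith
    qed
    have "(%s. (%z. f z - prim a p (fst z) (snd z)) (s, r)) \<in> borel_measurable (iv a)"
      by (rule measurable_compose[OF measurable_Pair2'[OF elim(2)]]) measurable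
    then have "(LINT s|iv a. f (s, r) - prim a p s r) = (LINT s|iv a. d)"
      using ae by (intro integral_cong_AE) auto
    also have "\<dots> = a * d" using a measure_iv_space[of a] by simp
    finally have "c r = d" using a by (simp add: c_def)
    then show ?case using ae by (auto elim!: eventually_mono)
  qed
  moreover have ms: "{z \<in> space (iv2 a b). f z = c (snd z) + prim a p (fst z) (snd z)} \<in> sets (iv2 a b)"
    by measurable
  \<comment> \<open>Agreement holds line by line; measurability of the set of agreement allows the
    quantifiers to be exchanged and then merged into one over the product.\<close>
  ultimately have "AE s in iv a. AE r in iv b. f (s, r) = c r + prim a p s r"
    by (subst iv2.AE_commute) (auto simp del: space_iv2)
  then have "AE z in iv2 a b. f z = c (snd z) + prim a p (fst z) (snd z)"
    by (intro iv2.AE_pair_measure ms) auto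
  then show ?thesis using c by (intro that)
qed

lemma integrable_of_L2:
  fixes f :: "'a => real"
  assumes "finite_measure M" "f \<in> borel_measurable M" "integrable M (%x. (f x)^2)"
  shows "integrable M f"
  using finite_measure.square_integrable_imp_integrable[OF assms] .

text \<open>Exchanging the integrations over \<open>r\<close> and over \<open>v \<le> s\<close>
  exhibits the average as a constant plus a primitive. Averages over horizontal strips thus have an
  \<open>s\<close>-derivative, which the two-step Poincare inequality relies on.\<close>

lemma wAC_average:
  assumes a: "0 < a" and f: "integrable (iv2 a b) f" and p: "integrable (iv2 a b) p"
    and w: "AE r in iv b. wAC a (%s. f (s, r)) (%s. p (s, r))" and B: "B \<in> sets borel"
  shows "wAC a (%s. LINT r|iv b. indicator B r * f (s, r)) (%s. LINT r|iv b. indicator B r * p (s, r))"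
proof -
  obtain c where c: "integrable (iv b) c" "AE z in iv2 a b. f z = c (snd z) + prim a p (fst z) (snd z)"
    using wAC_joint_rep[OF a f p w] .
  note J = prim_integrable[OF p]
  have [measurable]: "(indicator B :: real => real) \<in> borel_measurable (iv b)" "c \<in> borel_measurable (iv b)"
    "p \<in> borel_measurable (iv2 a b)" "f \<in> borel_measurable (iv2 a b)"
    using B c(1) p f by (auto intro!: measurable_iv1)
  have iB: "integrable (iv2 a b) (%z. h z * indicator B (snd z))" if "integrable (iv2 a b) h" for h :: "real \<times> real => real"
    by (rule integrable_iv2_mult_bounded[OF that measurable_compose[OF measurable_snd], of _ 1], fact) (simp add: indicator_def)
  define Q where "Q s = (LINT r|iv b. indicator B r * p (s, r))" for s
  have Q: "integrable (iv a) Q" unfolding Q_def using integral_iv2_fst(2)[OF iB[OF p]] by (simp add: mult.commute)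
  define C where "C = (LINT r|iv b. indicator B r * c r)"
  have AC: "AC a (%s. C + (LINT v|iv a. indicator {..s} v * Q v)) (%s. 0 + Q s)"
    by (rule AC_add[OF AC_const ACI_primitive[OF Q]])
  have "AE s in iv a. (LINT r|iv b. indicator B r * f (s, r)) = C + (LINT v|iv a. indicator {..s} v * Q v)"
    using AE_iv2_fst[OF c(2)] integral_iv2_fst(1)[OF iB[OF J]] integral_iv2_fst(1)[OF iB[OF f]] AE_space[of "iv a"]
  proof eventually_elim
    case (elim s)
    have ic: "integrable (iv b) (%r. indicator B r * c r)" by (rule integrable_indicator_mult[OF c(1) B])
    have iJ: "integrable (iv b) (%r. indicator B r * prim a p s r)" using elim(2) by (simp add: mult.commute)
    have [measurable]: "(%r. f (s, r)) \<in> borel_measurable (iv b)" by (rule measurable_compose[OF measurable_Pair1'[OF elim(4)]]) measurable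
    have "(LINT r|iv b. indicator B r * f (s, r)) = (LINT r|iv b. indicator B r * c r + indicator B r * prim a p s r)"
    proof (rule integral_cong_AE)
      show "AE r in iv b. indicator B r * f (s, r) = indicator B r * c r + indicator B r * prim a p s r"
        using elim(1) by eventually_elim (simp add: distrib_left)
    qed (use ic iJ in measurable)
    also have "\<dots> = C + (LINT r|iv b. indicator B r * prim a p s r)" using ic iJ by (simp add: C_def)
    also have "(LINT r|iv b. indicator B r * prim a p s r) = (LINT r|iv b. LINT v|iv a. (indicator {..s} v * (p (v, r) * indicator B r)))"
      unfolding prim_def by (subst integral_mult_right_zero[symmetric]) (simp add: mult_ac)
    also have "\<dots> = (LINT v|iv a. LINT r|iv b. (indicator {..s} v * (p (v, r) * indicator B r)))"
    proof -
      have [measurable]: "(indicator {..s} :: real => real) \<in> borel_measurable (iv a)" by (intro measurable_iv1) auto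
      have i2: "integrable (iv2 a b) (%z. (p z * indicator B (snd z)) * indicator {..s} (fst z))"
        by (rule integrable_iv2_mult_bounded[OF iB[OF p] measurable_compose[OF measurable_fst], of _ 1], fact) (simp add: indicator_def)
      show ?thesis
        using integral_iv2_fst(3)[OF i2] integral_iv2_snd(3)[OF i2] by (simp add: mult_ac)
    qed
    also have "\<dots> = (LINT v|iv a. indicator {..s} v * Q v)"
    proof -
      have "Q v = (LINT r|iv b. p (v, r) * indicator B r)" for v by (simp add: Q_def mult.commute)
      then show ?thesis by simp
    qed
    finally show ?case .
  qed
  from wACI[OF AC this] show ?thesis unfolding Q_def by simp
qed

section \<open>Poincare inequalities on a grid\<close>

definition piece :: "real => nat => nat => real set" where
  "piece a n i = {a * real i / real n <.. a * real (Suc i) / real n}"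

lemma piece_borel [measurable, simp]: "piece a n i \<in> sets borel" by (simp add: piece_def)

lemma sum_piece:
  assumes "0 < a" "0 < n" "0 < s" "s < a"
  shows "(\<Sum>i<n. indicator (piece a n i) s :: real) = 1"
proof -
  have "(\<Sum>i<m. indicator (piece a n i) s :: real) = indicator {0<..a * real m / real n} s" if "m \<le> n" for m
    using that
  proof (induction m)
    case (Suc m)
    have "a * real m / real n \<le> a * real (Suc m) / real n" using assms by (intro divide_right_mono mult_left_mono) auto
    moreover have "0 \<le> a * real m / real n" using assms by simp
    ultimately show ?case using Suc by (simp add: piece_def indicator_def)
  qed (use assms in auto)
  from this[of n] show ?thesis using assms by simp
qed

text \<open>On a piece of length \<open>h\<close> the function differs from its mean by at most its
  oscillation, and Cauchy-Schwarz bounds the square of the oscillation by \<open>h\<close> times the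
  energy of the piece. The factors 2 come from splitting the square into mean and deviation.\<close>

lemma wAC_piece_bound:
  assumes w: "wAC a g p" and p2: "integrable (iv a) (%s. (p s)^2)" and a: "0 < a" and n: "0 < n"
    and [measurable]: "g \<in> borel_measurable (iv a)"
  shows "(LINT s|iv a. (g s)^2) \<le> 2 * (a / real n)^2 * (LINT s|iv a. (p s)^2)
     + 2 * (real n / a) * (\<Sum>i<n. (LINT s|iv a. indicator (piece a n i) s * g s)^2)"
proof -
  obtain F where F: "AC a F p" "AE s in iv a. g s = F s" using w by (auto simp: wAC_def)
  have Fc: "continuous_on {0..a} F" by (rule AC_continuous[OF F(1)])
  have [measurable]: "F \<in> borel_measurable (iv a)" "p \<in> borel_measurable (iv a)"
    using AC_measurable[OF F(1)] AC_integrable[OF F(1)] by auto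
  have Im[measurable]: "(indicator (piece a n i) :: real => real) \<in> borel_measurable (iv a)" for i
    by (rule measurable_iv1) auto
  have Fi: "integrable (iv a) F" by (rule integrable_iv_continuous[OF Fc])
  have F2i: "integrable (iv a) (%s. (F s)^2)" by (intro integrable_iv_continuous continuous_intros Fc)
  define h where "h = a / real n"
  have h: "h > 0" using a n by (simp add: h_def)
  note ii = integrable_indicator_mult[OF _ piece_borel]
  have one: "(LINT s|iv a. (\<Sum>i<n. indicator (piece a n i) s) * f s) = (LINT s|iv a. f s)" for f :: "real => real"
    by (rule LINT_cong) (use sum_piece a n in auto)
  have split: "(LINT s|iv a. f s) = (\<Sum>i<n. LINT s|iv a. indicator (piece a n i) s * f s)" if "integrable (iv a) f" for f :: "real => real"
    unfolding one[of f, symmetric] sum_distrib_right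
    by (rule Bochner_Integration.integral_sum) (rule ii[OF that])
  have pc: "(LINT s|iv a. indicator (piece a n i) s * (F s)^2) \<le>
     2 / h * (LINT s|iv a. indicator (piece a n i) s * F s)^2 + 2 * h^2 * (LINT s|iv a. indicator (piece a n i) s * (p s)^2)"
    if i: "i < n" for i
  proof -
    define x y where "x = a * real i / real n" and "y = a * real (Suc i) / real n"
    have xy: "0 \<le> x" "x \<le> y" "y \<le> a" "y - x = h" "piece a n i = {x<..y}"
    proof -
      show "0 \<le> x" using a by (simp add: x_def)
      show "y - x = h" by (simp add: x_def y_def h_def algebra_simps flip: diff_divide_distrib)
      then show "x \<le> y" using h by simp
      have "a * real (Suc i) \<le> a * real n" using i a by (intro mult_left_mono) auto
      then show "y \<le> a" using n by (simp add: y_def field_simps)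
      show "piece a n i = {x<..y}" by (simp add: piece_def x_def y_def)
    qed
    define I where "I = (indicator {x<..y} :: real => real)"
    have Im'[measurable]: "I \<in> borel_measurable (iv a)" unfolding I_def using Im[of i] xy(5) by simp
    have I1: "(LINT s|iv a. I s) = h" unfolding I_def using measure_iv_Ioc[OF xy(1-3)] xy(4) by simp
    have Ii: "integrable (iv a) I" by (rule integrable_iv_bounded[OF Im', of 1]) (auto simp: I_def indicator_def)
    define K where "K = h * (LINT s|iv a. I s * (p s)^2)"
    have ip: "integrable (iv a) (%s. I s * (p s)^2)" "integrable (iv a) (%s. I s * F s)" "integrable (iv a) (%s. I s * (F s)^2)"
      unfolding I_def using integrable_indicator_mult[OF p2] integrable_indicator_mult[OF Fi] integrable_indicator_mult[OF F2i] by auto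
    have osc: "\<bar>F s - F t\<bar> \<le> sqrt K" if "s \<in> {x<..y}" "t \<in> {x<..y}" for s t
    proof -
      have *: "(F t - F s)^2 \<le> K" if "x < s" "s \<le> t" "t \<le> y" for s t
      proof -
        have "(F t - F s)^2 \<le> (t - s) * (LINT v|iv a. indicator {s<..t} v * (p v)^2)"
          by (rule AC_Cauchy_Schwarz[OF F(1) p2]) (use that xy in auto)
        also have "\<dots> \<le> h * (LINT v|iv a. I v * (p v)^2)"
        proof (rule mult_mono)
          show "(LINT v|iv a. indicator {s<..t} v * (p v)^2) \<le> (LINT v|iv a. I v * (p v)^2)"
            by (rule integral_mono[OF integrable_indicator_mult[OF p2] ip(1)]) (use that in \<open>auto simp: I_def indicator_def\<close>)
        qed (use that xy h in auto)
        finally show ?thesis by (simp add: K_def)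
      qed
      have "(F s - F t)^2 \<le> K"
        using *[of s t] *[of t s] that by (cases "s \<le> t") (auto simp: power2_commute)
      then show ?thesis using real_le_rsqrt by (metis power2_abs)
    qed
    have K0: "0 \<le> K" unfolding K_def using h by (intro mult_nonneg_nonneg integral_nonneg_AE) (auto simp: I_def)
    define m where "m = (LINT s|iv a. I s * F s)"
    have pt: "(F s)^2 \<le> 2 / h^2 * m^2 + 2 * K" if s: "s \<in> {x<..y}" for s
    proof -
      have "\<bar>h * F s - m\<bar> = \<bar>LINT t|iv a. I t * F s - I t * F t\<bar>"
        using Ii ip(2) I1 by (simp add: m_def)
      also have "\<dots> \<le> (LINT t|iv a. \<bar>I t * F s - I t * F t\<bar>)" by (rule integral_abs_bound)
      also have "\<dots> \<le> (LINT t|iv a. I t * sqrt K)"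
      proof (rule integral_mono)
        fix t
        show "\<bar>I t * F s - I t * F t\<bar> \<le> I t * sqrt K"
          using osc[OF s, of t] by (auto simp: I_def indicator_def)
      qed (use Ii ip(2) in auto)
      also have "\<dots> = h * sqrt K" using I1 by simp
      finally have "\<bar>h * F s - m\<bar>^2 \<le> (h * sqrt K)^2" by (rule power_mono) simp
      then have "(h * F s - m)^2 \<le> (h * sqrt K)^2" by simp
      then have "(h * F s - m)^2 \<le> h^2 * K" using K0 by (simp add: power_mult_distrib)
      moreover have "(h * F s)^2 \<le> 2 * m^2 + 2 * (h * F s - m)^2"
        using zero_le_power2[of "h * F s - 2 * m"] by (simp add: power2_eq_square algebra_simps)
      ultimately have "h^2 * (F s)^2 \<le> 2 * m^2 + 2 * h^2 * K" by (simp add: power_mult_distrib)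
      then show ?thesis using h by (simp add: field_simps)
    qed
    have "(LINT s|iv a. I s * (F s)^2) \<le> (LINT s|iv a. I s * (2 / h^2 * m^2 + 2 * K))"
    proof (rule integral_mono[OF ip(3)])
      show "integrable (iv a) (%s. I s * (2 / h^2 * m^2 + 2 * K))" using Ii by (rule integrable_mult_left)
      show "I s * (F s)^2 \<le> I s * (2 / h^2 * m^2 + 2 * K)" for s
        using pt[of s] by (cases "s \<in> {x<..y}") (auto simp: I_def)
    qed
    also have "\<dots> = h * (2 / h^2 * m^2 + 2 * K)" using I1 by simp
    also have "\<dots> = 2 / h * m^2 + 2 * h^2 * (LINT s|iv a. I s * (p s)^2)"
      using h by (simp add: K_def field_simps power2_eq_square)
    finally show ?thesis unfolding xy(5) I_def m_def .
  qed
  have "(LINT s|iv a. (F s)^2) = (\<Sum>i<n. LINT s|iv a. indicator (piece a n i) s * (F s)^2)" by (rule split[OF F2i])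
  also have "\<dots> \<le> (\<Sum>i<n. 2 / h * (LINT s|iv a. indicator (piece a n i) s * F s)^2 + 2 * h^2 * (LINT s|iv a. indicator (piece a n i) s * (p s)^2))"
    by (rule sum_mono) (use pc in auto)
  also have "\<dots> = 2 / h * (\<Sum>i<n. (LINT s|iv a. indicator (piece a n i) s * F s)^2) + 2 * h^2 * (LINT s|iv a. (p s)^2)"
    unfolding split[OF p2] by (simp add: sum.distrib sum_distrib_left)
  finally have "(LINT s|iv a. (F s)^2) \<le> 2 / h * (\<Sum>i<n. (LINT s|iv a. indicator (piece a n i) s * F s)^2) + 2 * h^2 * (LINT s|iv a. (p s)^2)" .
  moreover have "(LINT s|iv a. (g s)^2) = (LINT s|iv a. (F s)^2)"
    by (rule integral_cong_AE) (use F(2) in \<open>auto elim!: eventually_mono\<close>)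
  moreover have "(LINT s|iv a. indicator (piece a n i) s * g s) = (LINT s|iv a. indicator (piece a n i) s * F s)" for i
    by (rule integral_cong_AE) (use F(2) in \<open>auto elim!: eventually_mono\<close>)
  ultimately show ?thesis using h by (simp add: h_def mult.commute)
qed

section \<open>Sobolev functions on a rectangle\<close>

text \<open>Sobolev functions described by absolute continuity on almost every line parallel to an
  axis, \<open>p\<close> and \<open>q\<close> being the derivatives in \<open>s\<close> and in
  \<open>r\<close>. In this form positive parts, truncations and reflections are one-dimensional
  matters.\<close>

definition Sob :: "real => real => (real \<times> real => real) => (real \<times> real => real) => (real \<times> real => real) => bool" where
  "Sob a b f p q \<longleftrightarrow>
     f \<in> borel_measurable (iv2 a b) \<and> p \<in> borel_measurable (iv2 a b) \<and> q \<in> borel_measurable (iv2 a b) \<and>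
     integrable (iv2 a b) (%z. (f z)^2) \<and> integrable (iv2 a b) (%z. (p z)^2) \<and> integrable (iv2 a b) (%z. (q z)^2) \<and>
     (AE r in iv b. wAC a (%s. f (s, r)) (%s. p (s, r))) \<and>
     (AE s in iv a. wAC b (%r. f (s, r)) (%r. q (s, r)))"

lemma SobD:
  assumes "Sob a b f p q"
  shows "f \<in> borel_measurable (iv2 a b)" "p \<in> borel_measurable (iv2 a b)" "q \<in> borel_measurable (iv2 a b)"
    "integrable (iv2 a b) (%z. (f z)^2)" "integrable (iv2 a b) (%z. (p z)^2)" "integrable (iv2 a b) (%z. (q z)^2)"
    "AE r in iv b. wAC a (%s. f (s, r)) (%s. p (s, r))"
    "AE s in iv a. wAC b (%r. f (s, r)) (%r. q (s, r))"
    "integrable (iv2 a b) f" "integrable (iv2 a b) p" "integrable (iv2 a b) q"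
  using assms unfolding Sob_def by (auto intro!: integrable_of_L2 finite_measure_iv2)

lemma measurable_section_fst:
  assumes "f \<in> borel_measurable (iv2 a b)" "r \<in> space (iv b)"
  shows "(%s. f (s, r)) \<in> borel_measurable (iv a)"
  by (rule measurable_compose[OF measurable_Pair2'[OF assms(2)] assms(1)])

lemma measurable_section_snd:
  assumes "f \<in> borel_measurable (iv2 a b)" "s \<in> space (iv a)"
  shows "(%r. f (s, r)) \<in> borel_measurable (iv b)"
  by (rule measurable_compose[OF measurable_Pair1'[OF assms(2)] assms(1)])

text \<open>One variable at a time. The bound in \<open>r\<close> on each fibre leaves the averages
  \<open>m j\<close> over horizontal strips, which are absolutely continuous in \<open>s\<close>;
  the same bound in \<open>s\<close> turns them into integrals over cells. The factor 4 collects a 2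
  from each step.\<close>

lemma Sob_Poincare:
  assumes S: "Sob a b f p q" and a: "0 < a" and b: "0 < b" and n: "0 < n" and k: "0 < k"
  shows "(LINT z|iv2 a b. (f z)^2) \<le> 4 * (a / real n)^2 * (LINT z|iv2 a b. (p z)^2) + 2 * (b / real k)^2 * (LINT z|iv2 a b. (q z)^2)
    + 4 * (real n / a) * (real k / b) *
       (\<Sum>j<k. \<Sum>i<n. (LINT z|iv2 a b. indicator (piece a n i \<times> piece b k j) z * f z)^2)"
proof -
  note [measurable] = SobD(1,2,3)[OF S]
  have Im[measurable]: "(indicator (piece b k j) :: real => real) \<in> borel_measurable (iv b)" for j
    by (rule measurable_iv1) auto
  have Im'[measurable]: "(indicator (piece a n j) :: real => real) \<in> borel_measurable (iv a)" for j
    by (rule measurable_iv1) auto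
  have iB: "integrable (iv2 a b) (%z. h z * indicator (piece b k j) (snd z))" if "integrable (iv2 a b) h" for h :: "real \<times> real => real" and j
    by (rule integrable_iv2_mult_bounded[OF that measurable_compose[OF measurable_snd Im], where B = 1]) (simp add: indicator_def)
  have iAB: "integrable (iv2 a b) (%z. h z * indicator (piece b k j) (snd z) * indicator (piece a n i) (fst z))" if "integrable (iv2 a b) h" for h :: "real \<times> real => real" and i j
    by (rule integrable_iv2_mult_bounded[OF iB[OF that] measurable_compose[OF measurable_fst Im'], where B = 1]) (simp add: indicator_def)
  define m where "m j s = (LINT r|iv b. indicator (piece b k j) r * f (s, r))" for j s
  define pm where "pm j s = (LINT r|iv b. indicator (piece b k j) r * p (s, r))" for j s
  have mi: "integrable (iv a) (m j)" for j
    unfolding m_def using integral_iv2_fst(2)[OF iB[OF SobD(9)[OF S]]] by (simp add: mult.commute)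
  have pmi: "integrable (iv a) (pm j)" for j
    unfolding pm_def using integral_iv2_fst(2)[OF iB[OF SobD(10)[OF S]]] by (simp add: mult.commute)
  have [measurable]: "m j \<in> borel_measurable (iv a)" "pm j \<in> borel_measurable (iv a)" for j
    using mi pmi by auto
  have mw: "wAC a (m j) (pm j)" for j
    unfolding m_def pm_def by (rule wAC_average[OF a SobD(9)[OF S] SobD(10)[OF S] SobD(7)[OF S]]) simp
  define P2 where "P2 j s = (LINT r|iv b. indicator (piece b k j) r * (p (s, r))^2)" for j s
  have P2i: "integrable (iv a) (P2 j)" for j
    unfolding P2_def using integral_iv2_fst(2)[OF iB[OF SobD(5)[OF S]]] by (simp add: mult.commute)
  \<comment> \<open>Cauchy-Schwarz on a piece of length \<open>b / k\<close>: the derivative of a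
    strip average is controlled by the energy inside the strip.\<close>
  have pm2: "AE s in iv a. (pm j s)^2 \<le> b / real k * P2 j s" if j: "j < k" for j
    using integral_iv2_fst(1)[OF SobD(5)[OF S]] AE_space[of "iv a"]
  proof eventually_elim
    case (elim s)
    define I where "I = (indicator (piece b k j) :: real => real)"
    have [measurable]: "I \<in> borel_measurable (iv b)" unfolding I_def by measurable
    have [measurable]: "(%r. p (s, r)) \<in> borel_measurable (iv b)" by (rule measurable_section_snd[OF _ elim(2)]) measurable
    have sq: "(I r)^2 = I r" "(I r * p (s, r))^2 = I r * (p (s, r))^2" "I r * (I r * p (s, r)) = I r * p (s, r)" for r
      by (auto simp: I_def indicator_def)
    have len: "(LINT r|iv b. I r) = b / real k"
    proof -
      have "b * real (Suc j) \<le> b * real k" using j b by (intro mult_left_mono) auto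
      then have "b * real (Suc j) / real k \<le> b" using k by (simp add: field_simps)
      moreover have "b * real j / real k \<le> b * real (Suc j) / real k" using b by (intro divide_right_mono mult_left_mono) auto
      ultimately have "(LINT r|iv b. I r) = b * real (Suc j) / real k - b * real j / real k"
        unfolding I_def piece_def using b by (intro measure_iv_Ioc) auto
      also have "\<dots> = b / real k" by (simp add: algebra_simps flip: diff_divide_distrib)
      finally show ?thesis .
    qed
    have "(LINT r|iv b. I r * (I r * p (s, r)))^2 \<le> (LINT r|iv b. (I r)^2) * (LINT r|iv b. (I r * p (s, r))^2)"
    proof (rule Cauchy_Schwarz_L2)
      show "integrable (iv b) (%r. (I r)^2)" unfolding sq
        by (rule integrable_iv_bounded[of _ _ 1], fact) (auto simp: I_def indicator_def)
      show "integrable (iv b) (%r. (I r * p (s, r))^2)" unfolding sq unfolding I_def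
        by (rule integrable_indicator_mult[OF elim(1)]) simp
    qed measurable
    then show ?case unfolding sq len by (simp add: pm_def P2_def I_def)
  qed
  have pm2i: "integrable (iv a) (%s. (pm j s)^2)" if j: "j < k" for j
  proof (rule Bochner_Integration.integrable_bound[of _ "%s. b / real k * P2 j s"])
    show "AE s in iv a. norm ((pm j s)^2) \<le> norm (b / real k * P2 j s)"
      using pm2[OF j]
    proof eventually_elim
      case (elim s)
      from order_trans[OF elim abs_ge_self] show ?case by (simp only: real_norm_def abs_power2)
    qed
  qed (use P2i in auto)
  have Mb: "(LINT s|iv a. (m j s)^2) \<le> 2 * (a / real n)^2 * (b / real k * (LINT s|iv a. P2 j s))
     + 2 * (real n / a) * (\<Sum>i<n. (LINT s|iv a. indicator (piece a n i) s * m j s)^2)" if j: "j < k" for j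
  proof -
    have "(LINT s|iv a. (pm j s)^2) \<le> (LINT s|iv a. b / real k * P2 j s)"
      by (rule integral_mono_AE[OF pm2i[OF j] _ pm2[OF j]]) (use P2i in auto)
    then have "(LINT s|iv a. (pm j s)^2) \<le> b / real k * (LINT s|iv a. P2 j s)" by simp
    then have "2 * (a / real n)^2 * (LINT s|iv a. (pm j s)^2) \<le> 2 * (a / real n)^2 * (b / real k * (LINT s|iv a. P2 j s))"
      by (rule mult_left_mono) simp
    then show ?thesis using wAC_piece_bound[OF mw[of j] pm2i[OF j] a n] by simp
  qed
  have mcell: "(LINT s|iv a. indicator (piece a n i) s * m j s) = (LINT z|iv2 a b. indicator (piece a n i \<times> piece b k j) z * f z)" for i j
  proof -
    have e: "f z * indicator (piece b k j) (snd z) * indicator (piece a n i) (fst z) = indicator (piece a n i \<times> piece b k j) z * f z" for z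
      by (cases z) (auto simp: indicator_def)
    from integral_iv2_fst(3)[OF iAB[OF SobD(9)[OF S], of j i]]
    have "(LINT z|iv2 a b. f z * indicator (piece b k j) (snd z) * indicator (piece a n i) (fst z)) =
      (LINT s|iv a. (LINT r|iv b. f (s, r) * indicator (piece b k j) r) * indicator (piece a n i) s)"
      by simp
    then show ?thesis unfolding e m_def by (simp add: mult.commute)
  qed
  have sP2: "(\<Sum>j<k. LINT s|iv a. P2 j s) = (LINT z|iv2 a b. (p z)^2)"
  proof -
    have "(LINT s|iv a. P2 j s) = (LINT z|iv2 a b. (p z)^2 * indicator (piece b k j) (snd z))" for j
      unfolding P2_def integral_iv2_fst(3)[OF iB[OF SobD(5)[OF S]]] by (simp add: mult.commute)
    then have "(\<Sum>j<k. LINT s|iv a. P2 j s) = (LINT z|iv2 a b. (\<Sum>j<k. (p z)^2 * indicator (piece b k j) (snd z)))"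
      by (simp only: Bochner_Integration.integral_sum[OF iB[OF SobD(5)[OF S]]])
    also have "\<dots> = (LINT z|iv2 a b. (p z)^2)"
    proof (rule LINT_cong)
      fix z assume "z \<in> space (iv2 a b)"
      then have "(\<Sum>j<k. indicator (piece b k j) (snd z) :: real) = 1" by (intro sum_piece b k) auto
      then show "(\<Sum>j<k. (p z)^2 * indicator (piece b k j) (snd z)) = (p z)^2" by (simp flip: sum_distrib_left)
    qed simp
    finally show ?thesis .
  qed
  define mm where "mm j s = (m j s)^2" for j s
  have mm2: "integrable (iv a) (%s. (m j s)^2)" for j
  proof -
    obtain F where F: "AC a F (pm j)" "AE s in iv a. m j s = F s" using mw[of j] by (auto simp: wAC_def)
    have [measurable]: "F \<in> borel_measurable (iv a)" by (rule AC_measurable[OF F(1)])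
    have "integrable (iv a) (%s. (F s)^2)" by (intro integrable_iv_continuous continuous_intros AC_continuous[OF F(1)])
    then show ?thesis by (subst integrable_cong_AE[of _ _ "%s. (F s)^2"]) (use F(2) in \<open>auto elim!: eventually_mono\<close>)
  qed
  have row: "AE s in iv a. (LINT r|iv b. (f (s, r))^2) \<le> 2 * (b / real k)^2 * (LINT r|iv b. (q (s, r))^2)
     + 2 * (real k / b) * (\<Sum>j<k. (m j s)^2)"
    using SobD(8)[OF S] integral_iv2_fst(1)[OF SobD(6)[OF S]] AE_space[of "iv a"]
  proof eventually_elim
    case (elim s)
    show ?case unfolding m_def
      by (rule wAC_piece_bound[OF elim(1,2) b k]) (rule measurable_section_snd[OF SobD(1)[OF S] elim(3)])
  qed
  have "(LINT z|iv2 a b. (f z)^2) = (LINT s|iv a. LINT r|iv b. (f (s, r))^2)"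
    by (rule integral_iv2_fst(3)[OF SobD(4)[OF S]])
  also have "\<dots> \<le> (LINT s|iv a. 2 * (b / real k)^2 * (LINT r|iv b. (q (s, r))^2) + 2 * (real k / b) * (\<Sum>j<k. (m j s)^2))"
    by (rule integral_mono_AE[OF integral_iv2_fst(2)[OF SobD(4)[OF S]] _ row])
      (use integral_iv2_fst(2)[OF SobD(6)[OF S]] mm2 in auto)
  also have "\<dots> = 2 * (b / real k)^2 * (LINT z|iv2 a b. (q z)^2) + 2 * (real k / b) * (\<Sum>j<k. LINT s|iv a. (m j s)^2)"
    using integral_iv2_fst(2,3)[OF SobD(6)[OF S]] mm2 by (simp add: integral_sum)
  also have "\<dots> \<le> 2 * (b / real k)^2 * (LINT z|iv2 a b. (q z)^2) + 2 * (real k / b) *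
      (\<Sum>j<k. 2 * (a / real n)^2 * (b / real k * (LINT s|iv a. P2 j s))
     + 2 * (real n / a) * (\<Sum>i<n. (LINT s|iv a. indicator (piece a n i) s * m j s)^2))"
    by (intro add_left_mono mult_left_mono sum_mono Mb) (use b in auto)
  also have "\<dots> = 2 * (b / real k)^2 * (LINT z|iv2 a b. (q z)^2)
     + 2 * (real k / b) * (2 * (a / real n)^2 * (b / real k * (LINT z|iv2 a b. (p z)^2)))
     + 2 * (real k / b) * (2 * (real n / a) * (\<Sum>j<k. \<Sum>i<n. (LINT s|iv a. indicator (piece a n i) s * m j s)^2))"
    unfolding sP2[symmetric] by (simp add: sum.distrib sum_distrib_left distrib_left)
  also have "2 * (real k / b) * (2 * (a / real n)^2 * (b / real k * (LINT z|iv2 a b. (p z)^2))) = 4 * (a / real n)^2 * (LINT z|iv2 a b. (p z)^2)"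
    using b k by simp
  finally show ?thesis unfolding mcell by (simp add: mult_ac)
qed

lemma Sob_diff:
  assumes S: "Sob a b f p q" and T: "Sob a b f' p' q'"
  shows "Sob a b (%z. f z - f' z) (%z. p z - p' z) (%z. q z - q' z)"
proof -
  note [measurable] = SobD(1,2,3)[OF S] SobD(1,2,3)[OF T]
  have d: "integrable (iv2 a b) (%z. (g z - h z)^2)" if "integrable (iv2 a b) (%z. (g z)^2)" "integrable (iv2 a b) (%z. (h z)^2)"
     "g \<in> borel_measurable (iv2 a b)" "h \<in> borel_measurable (iv2 a b)" for g h :: "real \<times> real => real"
    using integrable_add_L2[of g "iv2 a b" "%z. - h z"] that by simp
  have "AE r in iv b. wAC a (%s. f (s, r) - f' (s, r)) (%s. p (s, r) - p' (s, r))"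
    using SobD(7)[OF S] SobD(7)[OF T] by eventually_elim (rule wAC_diff)
  moreover have "AE s in iv a. wAC b (%r. f (s, r) - f' (s, r)) (%r. q (s, r) - q' (s, r))"
    using SobD(8)[OF S] SobD(8)[OF T] by eventually_elim (rule wAC_diff)
  ultimately show ?thesis
    unfolding Sob_def using SobD(4-6)[OF S] SobD(4-6)[OF T] by (auto intro!: d)
qed

lemma Sob_const: "Sob a b (%z. c) (%z. 0) (%z. 0)"
  unfolding Sob_def by (auto intro!: AC_imp_wAC AC_const)

lemma Sob_cmult:
  assumes S: "Sob a b f p q"
  shows "Sob a b (%z. c * f z) (%z. c * p z) (%z. c * q z)"
proof -
  note [measurable] = SobD(1,2,3)[OF S]
  have "AE r in iv b. wAC a (%s. c * f (s, r)) (%s. c * p (s, r))"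
    using SobD(7)[OF S] by eventually_elim (rule wAC_cmult)
  moreover have "AE s in iv a. wAC b (%r. c * f (s, r)) (%r. c * q (s, r))"
    using SobD(8)[OF S] by eventually_elim (rule wAC_cmult)
  ultimately show ?thesis
    unfolding Sob_def using SobD(4-6)[OF S] by (auto simp: power_mult_distrib)
qed

lemma Sob_pos_part:
  assumes S: "Sob a b f p q" and a: "0 < a" and b: "0 < b"
  shows "Sob a b (%z. max 0 (f z)) (%z. if f z > 0 then p z else 0) (%z. if f z > 0 then q z else 0)"
proof -
  note [measurable] = SobD(1,2,3)[OF S]
  have "AE r in iv b. wAC a (%s. max 0 (f (s, r))) (%s. if f (s, r) > 0 then p (s, r) else 0)"
    using SobD(7)[OF S] AE_space[of "iv b"]
  proof eventually_elim
    case (elim r)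
    show ?case by (rule wAC_pos_part[OF elim(1) measurable_section_fst[OF SobD(1)[OF S] elim(2)]]) (use a in simp)
  qed
  moreover have "AE s in iv a. wAC b (%r. max 0 (f (s, r))) (%r. if f (s, r) > 0 then q (s, r) else 0)"
    using SobD(8)[OF S] AE_space[of "iv a"]
  proof eventually_elim
    case (elim s)
    show ?case by (rule wAC_pos_part[OF elim(1) measurable_section_snd[OF SobD(1)[OF S] elim(2)]]) (use b in simp)
  qed
  moreover have "integrable (iv2 a b) (%z. (max 0 (f z))^2)"
    by (rule Bochner_Integration.integrable_bound[OF SobD(4)[OF S]]) (auto simp: max_def)
  moreover have "integrable (iv2 a b) (%z. (if f z > 0 then p z else 0)^2)"
    by (rule Bochner_Integration.integrable_bound[OF SobD(5)[OF S]]) auto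
  moreover have "integrable (iv2 a b) (%z. (if f z > 0 then q z else 0)^2)"
    by (rule Bochner_Integration.integrable_bound[OF SobD(6)[OF S]]) auto
  ultimately show ?thesis unfolding Sob_def by simp
qed

section \<open>Continuously differentiable test functions\<close>

text \<open>The derivative is quantified instead of computed, so closure under products and affine
  substitutions is a plain induction. These functions supply the kernels of the
  mollification.\<close>

primrec Dn :: "nat => (real => real) => bool" where
  "Dn 0 f \<longleftrightarrow> continuous_on UNIV f"
| "Dn (Suc n) f \<longleftrightarrow> (\<exists>f'. (\<forall>x. (f has_real_derivative f' x) (at x)) \<and> Dn n f')"

lemma Dn_continuous: "Dn n f ==> continuous_on UNIV f"
  by (cases n) (auto dest!: spec intro: DERIV_isCont intro!: continuous_at_imp_continuous_on)

lemma Dn_SucD: "Dn (Suc n) f ==> Dn n f"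
proof (induction n arbitrary: f)
  case 0
  then show ?case by (simp only: Dn_continuous Dn.simps(1))
next
  case (Suc n)
  then show ?case by (metis Dn.simps(2))
qed

lemma Dn_SucI: "(\<And>x. (f has_real_derivative f' x) (at x)) ==> Dn n f' ==> Dn (Suc n) f"
  by auto

lemma Dn_add: "Dn n f ==> Dn n g ==> Dn n (%x. f x + g x)"
proof (induction n arbitrary: f g)
  case 0
  then show ?case by (simp add: continuous_on_add)
next
  case (Suc n)
  then obtain f' g' where d: "\<And>x. (f has_real_derivative f' x) (at x)" "Dn n f'"
    "\<And>x. (g has_real_derivative g' x) (at x)" "Dn n g'" by auto
  show ?case by (rule Dn_SucI[OF DERIV_add[OF d(1) d(3)] Suc.IH[OF d(2) d(4)]])
qed

lemma Dn_mult: "Dn n f ==> Dn n g ==> Dn n (%x. f x * g x)"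
proof (induction n arbitrary: f g)
  case 0
  then show ?case by (simp add: continuous_on_mult)
next
  case (Suc n)
  then obtain f' g' where d: "\<And>x. (f has_real_derivative f' x) (at x)" "Dn n f'"
    "\<And>x. (g has_real_derivative g' x) (at x)" "Dn n g'" by auto
  have 1: "Dn n (%x. f' x * g x + g' x * f x)"
    by (rule Dn_add[OF Suc.IH[OF d(2) Dn_SucD[OF Suc.prems(2)]] Suc.IH[OF d(4) Dn_SucD[OF Suc.prems(1)]]])
  show ?case by (rule Dn_SucI[OF DERIV_mult[OF d(1) d(3)] 1])
qed

lemma Dn_const: "Dn n (%x. c)"
  by (induction n arbitrary: c) (auto intro!: exI[of _ "%x. 0"])

lemma Dn_affine: "Dn n f ==> Dn n (%x. f (a * x + b))"
proof (induction n arbitrary: f)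
  case 0
  then show ?case by (auto intro!: continuous_on_compose2[of UNIV f] continuous_intros)
next
  case (Suc n)
  then obtain f' where d: "\<forall>x. (f has_real_derivative f' x) (at x)" "Dn n f'" by auto
  have "Dn n (%x. f' (a * x + b) * a)" by (rule Dn_mult[OF Suc.IH[OF d(2)] Dn_const])
  moreover have "\<forall>x. ((%x. f (a * x + b)) has_real_derivative f' (a * x + b) * a) (at x)"
    using d(1) by (auto intro!: DERIV_chain2[where f = f] derivative_eq_intros)
  ultimately show ?case by auto
qed

definition Cinf :: "(real => real) => bool" where "Cinf f \<longleftrightarrow> (\<forall>n. Dn n f)"

lemma Cinf_deriv:
  assumes "Cinf f"
  obtains f' where "\<And>x. (f has_real_derivative f' x) (at x)" "Cinf f'"
proof -
  have "Dn (Suc 0) f" using assms by (simp only: Cinf_def)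
  then obtain f' where f': "\<forall>x. (f has_real_derivative f' x) (at x)" by auto
  have "Dn n f'" for n
  proof -
    have "Dn (Suc n) f" using assms by (simp only: Cinf_def)
    then obtain g where g: "\<forall>x. (f has_real_derivative g x) (at x)" "Dn n g" by auto
    have "g = f'" using f' g(1) DERIV_unique by blast
    then show ?thesis using g by simp
  qed
  then show ?thesis using f' by (intro that[of f']) (auto simp: Cinf_def)
qed

lemma Cinf_continuous: "Cinf f ==> continuous_on S f"
  using Dn_continuous[of 0 f] continuous_on_subset unfolding Cinf_def by blast

text \<open>For \<open>P = 1\<close> this is the classical function that is flat at 0. Admitting all
  polynomials makes the family closed under differentiation, so smoothness of every order is an
  induction with \<open>P\<close> arbitrary.\<close>

definition expinv :: "real poly => real => real" where
  "expinv P x = (if x > 0 then poly P (1/x) * exp (- (1/x)) else 0)"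

text \<open>The power \<open>t ^ n\<close> is carried along because peeling off one coefficient of
  the polynomial raises it by one.\<close>

lemma poly_exp_tendsto_0: "((%t::real. t ^ n * poly P t * exp (- t)) \<longlongrightarrow> 0) at_top"
proof (induction P arbitrary: n)
  case 0
  then show ?case by simp
next
  case (pCons a P)
  have "((%t::real. a * (t ^ n / exp t) + t ^ Suc n * poly P t * exp (- t)) \<longlongrightarrow> a * 0 + 0) at_top"
    by (intro tendsto_intros pCons.IH tendsto_power_div_exp_0)
  then show ?case by (simp add: exp_minus field_simps)
qed

text \<open>With \<open>t = 1/x\<close> one has \<open>dt/dx = - t^2\<close>, and
  \<open>P t * exp (- t)\<close> has \<open>t\<close>-derivative
  \<open>(P' - P) t * exp (- t)\<close>; this explains the polynomial \<open>t^2 * (P - P')\<close>.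
  At 0 both one-sided difference quotients tend to 0.\<close>

lemma expinv_deriv:
  "(expinv P has_real_derivative expinv ([:0, 0, 1:] * (P - pderiv P)) x) (at x)"
proof -
  consider "x > 0" | "x < 0" | "x = 0" by linarith
  then show ?thesis
  proof cases
    case 1
    have "((%x. poly P (1/x) * exp (- (1/x))) has_real_derivative
        (poly (pderiv P) (1/x) * (- 1 / x^2)) * exp (- (1/x)) + exp (- (1/x)) * (1 / x^2) * poly P (1/x)) (at x)"
      using 1 by (auto intro!: derivative_eq_intros DERIV_chain2[OF poly_DERIV] simp: power2_eq_square)
    moreover have "(poly (pderiv P) (1/x) * (- 1 / x^2)) * exp (- (1/x)) + exp (- (1/x)) * (1 / x^2) * poly P (1/x)
      = expinv ([:0, 0, 1:] * (P - pderiv P)) x"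
      using 1 by (simp add: expinv_def power2_eq_square algebra_simps)
    ultimately have "((%x. poly P (1/x) * exp (- (1/x))) has_real_derivative expinv ([:0, 0, 1:] * (P - pderiv P)) x) (at x)"
      by simp
    then show ?thesis
      by (rule has_field_derivative_transform_within_open[where S = "{0<..}"]) (use 1 in \<open>auto simp: expinv_def\<close>)
  next
    case 2
    have "((%_. 0) has_real_derivative expinv ([:0, 0, 1:] * (P - pderiv P)) x) (at x)"
      using 2 by (simp add: expinv_def)
    then show ?thesis
      by (rule has_field_derivative_transform_within_open[where S = "{..<0}"]) (use 2 in \<open>auto simp: expinv_def\<close>)
  next
    case 3
    have "((%t::real. t ^ 1 * poly P t * exp (- t)) \<longlongrightarrow> 0) at_top" by (rule poly_exp_tendsto_0)
    then have "((%h::real. inverse h ^ 1 * poly P (inverse h) * exp (- inverse h)) \<longlongrightarrow> 0) (at_right 0)"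
      by (rule filterlim_compose) (rule filterlim_inverse_at_top_right)
    then have r: "((%h. expinv P h / h) \<longlongrightarrow> 0) (at_right 0)"
      by (rule Lim_transform_eventually)
        (auto simp: eventually_at_filter expinv_def field_simps intro!: always_eventually)
    have l: "((%h. expinv P h / h) \<longlongrightarrow> 0) (at_left 0)"
      by (rule Lim_transform_eventually[OF tendsto_const])
        (auto simp: eventually_at_filter expinv_def intro!: always_eventually)
    show ?thesis using 3 filterlim_split_at[OF l r] by (simp add: DERIV_def expinv_def)
  qed
qed

lemma Cinf_expinv: "Cinf (expinv P)"
proof -
  have "Dn n (expinv P)" for n
  proof (induction n arbitrary: P)
    case 0
    show ?case unfolding Dn.simps
      by (intro continuous_at_imp_continuous_on ballI) (rule DERIV_isCont[OF expinv_deriv])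
  next
    case (Suc n)
    then show ?case using expinv_deriv by (simp only: Dn.simps) blast
  qed
  then show ?thesis by (simp add: Cinf_def)
qed

definition bump1 :: "real => real" where
  "bump1 x = expinv 1 (1 * x + 1) * expinv 1 (- 1 * x + 1)"

lemma Cinf_bump1: "Cinf (%x. c * bump1 (m * x + 0))"
proof -
  have e: "Dn n (expinv 1)" for n using Cinf_expinv[of 1] by (simp add: Cinf_def)
  have "Dn n (%x. expinv 1 (1 * x + 1) * expinv 1 (- 1 * x + 1))" for n
    by (rule Dn_mult[OF Dn_affine[OF e] Dn_affine[OF e]])
  then have b: "Dn n bump1" for n unfolding bump1_def[abs_def] .
  show ?thesis unfolding Cinf_def by (intro allI Dn_mult[OF Dn_const Dn_affine[OF b]])
qed

lemma bump1_nonneg: "0 \<le> bump1 x"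
  by (simp add: bump1_def expinv_def)

lemma bump1_support: "\<bar>x\<bar> \<ge> 1 ==> bump1 x = 0"
  by (auto simp: bump1_def expinv_def)

lemma bump1_0: "bump1 0 > 0"
  by (simp add: bump1_def expinv_def)

text \<open>The derivative is assembled from the two coordinate functionals into an operator-valued
  integrand, to which the general rule for differentiation under the integral applies.\<close>

lemma leibniz_plane:
  fixes g g1 g2 :: "real \<times> real => real \<times> real => real"
  assumes d: "\<And>z y. ((%z. g z y) has_derivative (%h. g1 z y * fst h + g2 z y * snd h)) (at z)"
    and c: "continuous_on UNIV (%(z, y). g z y)" "continuous_on UNIV (%(z, y). g1 z y)" "continuous_on UNIV (%(z, y). g2 z y)"
  shows "((%z. integral (cbox A B) (g z)) has_derivative
     (%h. integral (cbox A B) (g1 z) * fst h + integral (cbox A B) (g2 z) * snd h)) (at z)"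
proof -
  define X Y :: "(real \<times> real) \<Rightarrow>\<^sub>L real" where "X = Blinfun fst" and "Y = Blinfun snd"
  have X: "blinfun_apply X h = fst h" and Y: "blinfun_apply Y h = snd h" for h
    by (simp_all add: X_def Y_def bounded_linear_Blinfun_apply bounded_linear_fst bounded_linear_snd)
  define fx where "fx z y = g1 z y *\<^sub>R X + g2 z y *\<^sub>R Y" for z y
  have cs: "continuous_on (cbox A B) (g z)" "continuous_on (cbox A B) (g1 z)" "continuous_on (cbox A B) (g2 z)" for z
  proof -
    have P: "continuous_on (cbox A B) (%y. (z, y))" by (intro continuous_on_Pair continuous_on_const continuous_on_id)
    show "continuous_on (cbox A B) (g z)" "continuous_on (cbox A B) (g1 z)" "continuous_on (cbox A B) (g2 z)"
      using continuous_on_compose2[OF c(1) P] continuous_on_compose2[OF c(2) P] continuous_on_compose2[OF c(3) P] by auto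
  qed
  have cf: "continuous_on (UNIV \<times> cbox A B) (%(z, y). fx z y)"
    using continuous_on_subset[OF c(2), of "UNIV \<times> cbox A B"] continuous_on_subset[OF c(3), of "UNIV \<times> cbox A B"]
    unfolding fx_def case_prod_beta by (intro continuous_intros) auto
  have "((%z. integral (cbox A B) (g z)) has_derivative blinfun_apply (integral (cbox A B) (fx z))) (at z within UNIV)"
  proof (rule leibniz_rule[OF _ _ cf])
    show "((%z. g z t) has_derivative blinfun_apply (fx z t)) (at z within UNIV)" for z t
    proof -
      have "blinfun_apply (fx z t) = (%h. g1 z t * fst h + g2 z t * snd h)"
        by (auto simp: fun_eq_iff fx_def X Y blinfun.bilinear_simps)
      then show ?thesis using d[of t z] by simp
    qed
    show "g z integrable_on cbox A B" for z by (rule integrable_continuous[OF cs(1)])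
  qed auto
  moreover have "blinfun_apply (integral (cbox A B) (fx z)) h = integral (cbox A B) (g1 z) * fst h + integral (cbox A B) (g2 z) * snd h" for h
  proof -
    have "continuous_on (cbox A B) (fx z)" unfolding fx_def by (intro continuous_intros cs)
    then have i: "fx z integrable_on cbox A B" by (rule integrable_continuous)
    have "blinfun_apply (integral (cbox A B) (fx z)) h = integral (cbox A B) ((%F. blinfun_apply F h) \<circ> fx z)"
      by (rule integral_linear[OF i, symmetric]) (rule blinfun.bounded_linear_left)
    also have "\<dots> = integral (cbox A B) (%y. g1 z y * fst h + g2 z y * snd h)"
      by (simp add: o_def fx_def X Y blinfun.bilinear_simps)
    also have "\<dots> = integral (cbox A B) (%y. g1 z y * fst h) + integral (cbox A B) (%y. g2 z y * snd h)"
      by (rule Henstock_Kurzweil_Integration.integral_add) (intro integrable_continuous continuous_intros cs)+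
    finally show ?thesis by simp
  qed
  then have "blinfun_apply (integral (cbox A B) (fx z)) = (%h. integral (cbox A B) (g1 z) * fst h + integral (cbox A B) (g2 z) * snd h)"
    by (rule ext)
  ultimately show ?thesis by simp
qed

text \<open>Convolution with a product kernel. A partial derivative merely replaces \<open>a\<close>
  or \<open>b\<close> by its derivative, so the family is closed under differentiation and a
  continuous \<open>\<phi>\<close> already gives smoothness of all orders.\<close>

definition conv2 :: "(real \<times> real => real) => real \<times> real => real \<times> real => (real => real) => (real => real) => real \<times> real => real" where
  "conv2 \<phi> A B a b z = integral (cbox A B) (%y. \<phi> y * (a (fst z - fst y) * b (snd z - snd y)))"

lemma conv2_deriv:
  assumes p: "continuous_on UNIV \<phi>" and a: "Cinf a" "\<And>x. (a has_real_derivative a' x) (at x)" "Cinf a'"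
    and b: "Cinf b" "\<And>x. (b has_real_derivative b' x) (at x)" "Cinf b'"
  shows "(conv2 \<phi> A B a b has_derivative (%h. conv2 \<phi> A B a' b z * fst h + conv2 \<phi> A B a b' z * snd h)) (at z)"
  unfolding conv2_def[abs_def]
proof (rule leibniz_plane)
  fix z y :: "real \<times> real"
  have 1: "((%z. a (fst z - fst y)) has_derivative (%h. a' (fst z - fst y) * fst h)) (at z)"
    by (rule has_derivative_compose[of "%z. fst z - fst y" "%h. fst h" z UNIV a, OF _ a(2)[unfolded has_field_derivative_def]])
      (auto intro!: derivative_eq_intros)
  have 2: "((%z. b (snd z - snd y)) has_derivative (%h. b' (snd z - snd y) * snd h)) (at z)"
    by (rule has_derivative_compose[of "%z. snd z - snd y" "%h. snd h" z UNIV b, OF _ b(2)[unfolded has_field_derivative_def]])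
      (auto intro!: derivative_eq_intros)
  show "((%z. \<phi> y * (a (fst z - fst y) * b (snd z - snd y))) has_derivative
      (%h. \<phi> y * (a' (fst z - fst y) * b (snd z - snd y)) * fst h + \<phi> y * (a (fst z - fst y) * b' (snd z - snd y)) * snd h)) (at z)"
    by (auto intro!: derivative_eq_intros 1 2 simp: algebra_simps)
qed (auto simp: case_prod_beta intro!: continuous_intros continuous_on_compose2[OF p]
    continuous_on_compose2[OF Cinf_continuous[OF a(1), of UNIV]] continuous_on_compose2[OF Cinf_continuous[OF a(3), of UNIV]]
    continuous_on_compose2[OF Cinf_continuous[OF b(1), of UNIV]] continuous_on_compose2[OF Cinf_continuous[OF b(3), of UNIV]])

lemma Basis_plane: "Basis = {(1, 0), (0, 1) :: real \<times> real}"
  by (auto simp: Basis_prod_def)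

lemma Ck_conv2:
  assumes p: "continuous_on UNIV \<phi>" and "Cinf a" "Cinf b"
  shows "Ck n (conv2 \<phi> A B a b)"
  using assms(2,3)
proof (induction n arbitrary: a b)
  case 0
  obtain a' where a': "\<And>x. (a has_real_derivative a' x) (at x)" "Cinf a'" using Cinf_deriv[OF 0(1)] by metis
  obtain b' where b': "\<And>x. (b has_real_derivative b' x) (at x)" "Cinf b'" using Cinf_deriv[OF 0(2)] by metis
  have "continuous_on UNIV (conv2 \<phi> A B a b)"
    by (intro continuous_at_imp_continuous_on ballI) (rule has_derivative_continuous[OF conv2_deriv[OF p 0(1) a' 0(2) b']])
  then show ?case by simp
next
  case (Suc n)
  obtain a' where a': "\<And>x. (a has_real_derivative a' x) (at x)" "Cinf a'" using Cinf_deriv[OF Suc.prems(1)] by metis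
  obtain b' where b': "\<And>x. (b has_real_derivative b' x) (at x)" "Cinf b'" using Cinf_deriv[OF Suc.prems(2)] by metis
  note d = conv2_deriv[OF p Suc.prems(1) a' Suc.prems(2) b', of A B]
  have f: "frechet_derivative (conv2 \<phi> A B a b) (at z) = (%h. conv2 \<phi> A B a' b z * fst h + conv2 \<phi> A B a b' z * snd h)" for z
    by (rule frechet_derivative_at[symmetric, OF d])
  have "(%z. frechet_derivative (conv2 \<phi> A B a b) (at z) (1, 0)) = conv2 \<phi> A B a' b"
    "(%z. frechet_derivative (conv2 \<phi> A B a b) (at z) (0, 1)) = conv2 \<phi> A B a b'"
    by (auto simp: f)
  then show ?case
    using d Suc.IH[OF a'(2) Suc.prems(2)] Suc.IH[OF Suc.prems(1) b'(2)]
    by (auto simp: Basis_plane differentiable_def)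
qed

text \<open>The substitution \<open>w = z - y\<close> moves the variable from the kernel to
  \<open>\<phi>\<close>. The kernel form shows smoothness; in the other form the derivative may fall
  on \<open>\<phi>\<close>.\<close>

lemma conv2_reflect:
  assumes p: "continuous_on UNIV \<phi>" and a: "Cinf a" and b: "Cinf b"
    and sp: "\<And>z. z \<notin> cbox A B ==> \<phi> z = 0" and sa: "\<And>w. w \<notin> cbox A' B' ==> a (fst w) * b (snd w) = 0"
  shows "conv2 \<phi> A B a b z = integral (cbox A' B') (%w. \<phi> (z - w) * (a (fst w) * b (snd w)))"
proof -
  define f where "f y = \<phi> y * (a (fst z - fst y) * b (snd z - snd y))" for y
  define g where "g w = \<phi> (z - w) * (a (fst w) * b (snd w))" for w
  have "continuous_on (cbox A B) f"
    unfolding f_def by (intro continuous_intros continuous_on_compose2[OF p]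
      continuous_on_compose2[OF Cinf_continuous[OF a, of UNIV]] continuous_on_compose2[OF Cinf_continuous[OF b, of UNIV]]) auto
  then have "(f has_integral conv2 \<phi> A B a b z) (cbox A B)"
    unfolding conv2_def f_def by (intro integrable_integral integrable_continuous)
  from has_integral_affinity[OF this, of "-1" z]
  have "((%x. f (-1 *\<^sub>R x + z)) has_integral conv2 \<phi> A B a b z) ((%x. - x + z) ` cbox A B)" by simp
  moreover have "f (-1 *\<^sub>R x + z) = g x" for x by (simp add: f_def g_def)
  ultimately have "(g has_integral conv2 \<phi> A B a b z) ((%x. - x + z) ` cbox A B)" by simp
  then have 1: "(g has_integral conv2 \<phi> A B a b z) UNIV"
  proof (rule has_integral_on_superset)
    fix x assume x: "x \<notin> (%x. - x + z) ` cbox A B"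
    have "z - x \<notin> cbox A B"
    proof
      assume "z - x \<in> cbox A B"
      then have "- (z - x) + z \<in> (%x. - x + z) ` cbox A B" by (rule imageI)
      then show False using x by simp
    qed
    then show "g x = 0" by (simp add: g_def sp)
  qed simp
  have "(g has_integral integral UNIV g) UNIV" using 1 by (auto simp: has_integral_iff)
  moreover have "integral UNIV g = integral (cbox A' B') g"
    unfolding integral_restrict_UNIV[of "cbox A' B'" g, symmetric]
    by (rule integral_cong) (auto simp: g_def sa)
  ultimately show ?thesis using 1 unfolding g_def[symmetric, abs_def] by (simp add: has_integral_iff)
qed

abbreviation unit_cbox :: "(real \<times> real) set" where "unit_cbox \<equiv> cbox (-1, -1) (1, 1)"

definition mollifier :: "real => (real => real) => (real => real) => bool" where
  "mollifier \<rho> a b \<longleftrightarrow> Cinf a \<and> Cinf b \<and> (\<forall>w. 0 \<le> a (fst w) * b (snd w)) \<and>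
     (\<forall>w. \<bar>fst w\<bar> \<ge> \<rho> \<or> \<bar>snd w\<bar> \<ge> \<rho> \<longrightarrow> a (fst w) * b (snd w) = 0) \<and>
     integral unit_cbox (%w. a (fst w) * b (snd w)) = 1"

lemma mollifier_exists:
  assumes "0 < \<rho>"
  shows "\<exists>a b. mollifier \<rho> a b"
proof -
  \<comment> \<open>Scaling by \<open>1 / \<rho>\<close> puts the support into the square of
    half-width \<open>\<rho>\<close>. The normalizing constant \<open>N\<close> is positive because
    the nonnegative continuous kernel is positive at the origin.\<close>
  define m where "m = 1 / \<rho>"
  have m: "m > 0" using assms by (simp add: m_def)
  define h where "h x = bump1 (m * x + 0)" for x
  have hC: "Cinf h" using Cinf_bump1[of 1 m] by (simp add: h_def[abs_def])
  have hc: "continuous_on S h" for S by (rule Cinf_continuous[OF hC])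
  have c: "continuous_on S (%w::real \<times> real. h (fst w) * h (snd w))" for S
    by (intro continuous_on_mult continuous_on_compose2[OF hc[of UNIV]] continuous_on_fst continuous_on_snd continuous_on_id) auto
  define N where "N = integral unit_cbox (%w. h (fst w) * h (snd w))"
  have hi: "(%w. h (fst w) * h (snd w)) integrable_on unit_cbox" by (rule integrable_continuous[OF c])
  have hn: "0 \<le> h x" for x by (simp add: h_def bump1_nonneg)
  have "N \<noteq> 0"
  proof
    assume "N = 0"
    then have "((%w. h (fst w) * h (snd w)) has_integral 0) unit_cbox" using hi by (simp add: N_def has_integral_iff)
    from c _ this have "(%w. h (fst w) * h (snd w)) (0, 0) = 0"
    proof (rule has_integral_0_cbox_imp_0)
      show "(0, 0) \<in> unit_cbox" by (simp add: cbox_Pair_eq)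
      show "box (-1, -1) (1::real, 1::real) \<noteq> {}"
      proof -
        have "(0, 0) \<in> box (-1, -1) (1::real, 1::real)" by (simp add: box_def Basis_plane inner_prod_def)
        then show ?thesis by blast
      qed
    qed (use hn in auto)
    then show False using bump1_0 by (simp add: h_def)
  qed
  moreover have "N \<ge> 0" unfolding N_def by (rule Henstock_Kurzweil_Integration.integral_nonneg[OF hi]) (use hn in auto)
  ultimately have N: "N > 0" by simp
  have "mollifier \<rho> (%x. (1/N) * bump1 (m * x + 0)) (%x. 1 * bump1 (m * x + 0))"
    unfolding mollifier_def
  proof (intro conjI allI impI Cinf_bump1)
    fix w :: "real \<times> real"
    show "0 \<le> 1/N * bump1 (m * fst w + 0) * (1 * bump1 (m * snd w + 0))" using N bump1_nonneg by simp
    assume w: "\<rho> \<le> \<bar>fst w\<bar> \<or> \<rho> \<le> \<bar>snd w\<bar>"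
    have "1 \<le> \<bar>m * x + 0\<bar>" if "\<rho> \<le> \<bar>x\<bar>" for x
      using that assms by (simp add: m_def abs_mult field_simps)
    then show "1/N * bump1 (m * fst w + 0) * (1 * bump1 (m * snd w + 0)) = 0"
      using w bump1_support by auto
  next
    have "(%w. 1/N * bump1 (m * fst w + 0) * (1 * bump1 (m * snd w + 0))) = (%w. (1/N) * (h (fst w) * h (snd w)))"
      by (simp add: h_def fun_eq_iff)
    then show "integral unit_cbox (%w. 1/N * bump1 (m * fst w + 0) * (1 * bump1 (m * snd w + 0))) = 1"
      using N by (simp add: N_def)
  qed
  then show ?thesis by blast
qed

lemma mollifier_continuous:
  assumes "mollifier \<rho> a b"
  shows "continuous_on S (%w::real \<times> real. a (fst w) * b (snd w))"
proof -
  have c: "continuous_on UNIV a" "continuous_on UNIV b" using assms by (auto simp: mollifier_def intro: Cinf_continuous)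
  show ?thesis
    by (intro continuous_on_mult continuous_on_compose2[OF c(1)] continuous_on_compose2[OF c(2)]
        continuous_on_fst continuous_on_snd continuous_on_id) auto
qed

text \<open>Averaging with nonnegative weights of total mass 1 cannot leave the range seen by the
  kernel. It is used with \<open>c = 0\<close> for uniform bounds and with
  \<open>c = \<psi> z\<close> for convergence.\<close>

lemma mollify_bound:
  assumes M: "mollifier \<rho> a b" and p: "continuous_on UNIV \<psi>"
    and e: "\<And>w. \<bar>fst w\<bar> < \<rho> ==> \<bar>snd w\<bar> < \<rho> ==> \<bar>\<psi> (z - w) - c\<bar> \<le> \<epsilon>"
  shows "\<bar>integral unit_cbox (%w. \<psi> (z - w) * (a (fst w) * b (snd w))) - c\<bar> \<le> \<epsilon>"
proof -
  define k where "k w = a (fst w) * b (snd w)" for w :: "real \<times> real"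
  have kc: "continuous_on S k" for S unfolding k_def by (rule mollifier_continuous[OF M])
  have k: "0 \<le> k w" "integral unit_cbox k = 1" for w using M by (auto simp: mollifier_def k_def[abs_def])
  have ck: "(%w. x * k w) integrable_on unit_cbox" for x
    by (intro integrable_continuous continuous_on_mult continuous_on_const kc)
  have pc: "continuous_on S (%w. \<psi> (z - w))" for S
    by (rule continuous_on_compose2[OF p]) (auto intro: continuous_intros)
  have pk: "(%w. \<psi> (z - w) * k w) integrable_on unit_cbox"
    by (intro integrable_continuous continuous_on_mult pc kc)
  have "integral unit_cbox (%w. \<psi> (z - w) * k w) - c = integral unit_cbox (%w. \<psi> (z - w) * k w) - integral unit_cbox (%w. c * k w)"
    by (simp add: k(2))
  also have "\<dots> = integral unit_cbox (%w. \<psi> (z - w) * k w - c * k w)"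
    by (rule Henstock_Kurzweil_Integration.integral_diff[symmetric, OF pk ck])
  finally have eq: "integral unit_cbox (%w. \<psi> (z - w) * k w) - c = integral unit_cbox (%w. \<psi> (z - w) * k w - c * k w)" .
  have "norm (integral unit_cbox (%w. \<psi> (z - w) * k w - c * k w)) \<le> integral unit_cbox (%w. \<epsilon> * k w)"
  proof (rule integral_norm_bound_integral)
    show "(%w. \<psi> (z - w) * k w - c * k w) integrable_on unit_cbox"
      by (rule integrable_diff[OF pk ck])
    show "(%w. \<epsilon> * k w) integrable_on unit_cbox" by (rule ck)
    fix w
    show "norm (\<psi> (z - w) * k w - c * k w) \<le> \<epsilon> * k w"
    proof (cases "\<bar>fst w\<bar> < \<rho> \<and> \<bar>snd w\<bar> < \<rho>")
      case True
      then have "\<bar>\<psi> (z - w) - c\<bar> * k w \<le> \<epsilon> * k w" using e k(1) by (intro mult_right_mono) auto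
      then show ?thesis using k(1)[of w] by (simp add: abs_mult flip: left_diff_distrib)
    next
      case False
      then have "\<bar>fst w\<bar> \<ge> \<rho> \<or> \<bar>snd w\<bar> \<ge> \<rho>" by linarith
      then have "k w = 0" using M unfolding mollifier_def k_def by blast
      then show ?thesis by simp
    qed
  qed
  also have "\<dots> = \<epsilon>" using k(2) by simp
  finally show ?thesis unfolding k_def[symmetric] eq by simp
qed

section \<open>Weak gradients tested with C1 functions\<close>

lemma integrable_of_square_integrable:
  fixes v :: "'a::euclidean_space => real"
  assumes "finite_measure (lebesgue_on D)" "square_integrable D v"
  shows "integrable (lebesgue_on D) v"
  by (rule integrable_of_L2) (use assms in \<open>auto simp: square_integrable_def\<close>)

lemma square_integrable_inner:
  fixes G :: "'a::euclidean_space => 'a"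
  assumes G: "square_integrable D G" and b: "b \<in> Basis"
  shows "square_integrable D (%z. G z \<bullet> b)"
  unfolding square_integrable_def
proof
  have [measurable]: "G \<in> borel_measurable (lebesgue_on D)" using G by (simp add: square_integrable_def)
  show m: "(%z. G z \<bullet> b) \<in> borel_measurable (lebesgue_on D)" by measurable
  have le: "(norm (G z \<bullet> b))^2 \<le> (norm (G z))^2" for z
    using Basis_le_norm[OF b, of "G z"] by (intro power_mono) auto
  show "integrable (lebesgue_on D) (%z. (norm (G z \<bullet> b))^2)"
  proof (rule Bochner_Integration.integrable_bound)
    show "integrable (lebesgue_on D) (%z. (norm (G z))^2)" using G by (simp add: square_integrable_def)
    show "AE z in lebesgue_on D. norm ((norm (G z \<bullet> b))^2) \<le> norm ((norm (G z))^2)"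
      using le by (intro AE_I2) simp
  qed measurable
qed

text \<open>\<open>W12\<close> admits only infinitely smooth test functions, but a test function
  carried through the strip coordinates is controlled in C1 only. Mollification commutes with the
  partial derivatives of a C1 function, and dominated convergence carries the weak identity to the
  limit.\<close>

theorem W12_C1_test:
  fixes D :: "(real \<times> real) set"
  assumes W: "W12 D v G" and D: "open D" "finite_measure (lebesgue_on D)"
    and d: "\<And>z. (\<phi> has_derivative (%h. \<phi>1 z * fst h + \<phi>2 z * snd h)) (at z)"
    and c: "continuous_on UNIV \<phi>1" "continuous_on UNIV \<phi>2"
    and K: "compact K" "K \<subseteq> D" and z: "\<And>z. z \<notin> K ==> \<phi> z = 0"
  shows "(LINT z|lebesgue_on D. v z * \<phi>1 z) = - (LINT z|lebesgue_on D. (G z \<bullet> (1, 0)) * \<phi> z)"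
    "(LINT z|lebesgue_on D. v z * \<phi>2 z) = - (LINT z|lebesgue_on D. (G z \<bullet> (0, 1)) * \<phi> z)"
proof -
  have pc: "continuous_on UNIV \<phi>"
    by (intro continuous_at_imp_continuous_on ballI) (rule has_derivative_continuous[OF d])
  obtain e where e: "e > 0" "(\<Union>x\<in>K. cball x e) \<subseteq> D"
    using compact_subset_open_imp_cball_epsilon_subset[OF K(1) D(1) K(2)] by blast
  obtain B where B: "K \<subseteq> cbox (- B) B" using bounded_subset_cbox_symmetric[OF compact_imp_bounded[OF K(1)]] by blast
  have z12: "\<phi>1 w = 0 \<and> \<phi>2 w = 0" if "w \<notin> K" for w
  proof -
    have "(\<phi> has_derivative (%h. 0)) (at w)"
      by (rule has_derivative_transform_within_open[where s = "- K" and f = "%_. 0"])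
        (use that z compact_imp_closed[OF K(1)] in auto)
    from has_derivative_unique[OF this d[of w]] have "(%h. 0) = (%h. \<phi>1 w * fst h + \<phi>2 w * snd h)" .
    from fun_cong[OF this, of "(1, 0)"] fun_cong[OF this, of "(0, 1)"] show ?thesis by simp
  qed
  have bd: "\<exists>C. \<forall>w. \<bar>\<psi> w\<bar> \<le> C" if "continuous_on UNIV \<psi>" "\<And>w. w \<notin> K ==> \<psi> w = 0" for \<psi> :: "real \<times> real => real"
  proof -
    have "bounded (\<psi> ` K)" by (intro compact_imp_bounded compact_continuous_image K continuous_on_subset[OF that(1)]) auto
    then obtain C where C: "C > 0" "\<forall>y\<in>\<psi> ` K. norm y \<le> C" unfolding bounded_pos by blast
    have "\<bar>\<psi> w\<bar> \<le> C" for w using C that(2)[of w] by (cases "w \<in> K") auto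
    then show ?thesis by blast
  qed
  \<comment> \<open>The bound \<open>e / 2\<close> keeps the mollified support in \<open>D\<close>,
    since a point of the square with half-width \<open>e / 2\<close> has norm at most
    \<open>e\<close>. The bound \<open>1 / real (Suc m)\<close> gives convergence and fits the
    kernel into \<open>unit_cbox\<close>.\<close>
  define \<rho> where "\<rho> m = min (e/2) (1 / real (Suc m))" for m
  have r: "0 < \<rho> m" "\<rho> m \<le> e/2" "\<rho> m \<le> 1 / real (Suc m)" for m using e by (auto simp: \<rho>_def)
  have "\<exists>f. \<forall>m. mollifier (\<rho> m) (fst (f m)) (snd (f m))"
    using mollifier_exists[OF r(1)] by (intro choice) auto
  then obtain f where M: "\<And>m. mollifier (\<rho> m) (fst (f m)) (snd (f m))" by blast
  define S where "S \<psi> m z = integral unit_cbox (%w. \<psi> (z - w) * (fst (f m) (fst w) * snd (f m) (snd w)))" for \<psi> m z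
  have Sb: "\<bar>S \<psi> m z\<bar> \<le> C" if "continuous_on UNIV \<psi>" "\<forall>w. \<bar>\<psi> w\<bar> \<le> C" for \<psi> m z C
    using mollify_bound[OF M[of m] that(1), of z 0 C] that(2) by (simp add: S_def)
  have Sl: "(%m. S \<psi> m z) \<longlonglongrightarrow> \<psi> z" if "continuous_on UNIV \<psi>" for \<psi> z
  proof (rule LIMSEQ_I)
    fix \<epsilon> :: real assume ep: "\<epsilon> > 0"
    have "isCont \<psi> z" using that unfolding continuous_on_eq_continuous_at[OF open_UNIV] by blast
    then obtain \<eta> where et: "\<eta> > 0" "\<And>y. dist y z < \<eta> ==> dist (\<psi> y) (\<psi> z) < \<epsilon>/2"
      unfolding continuous_at_eps_delta using ep by (meson half_gt_zero)
    obtain N :: nat where N: "2 / \<eta> < real N" using reals_Archimedean2 by blast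
    have "norm (S \<psi> m z - \<psi> z) < \<epsilon>" if m: "N \<le> m" for m
    proof -
      have "\<bar>S \<psi> m z - \<psi> z\<bar> \<le> \<epsilon>/2" unfolding S_def
      proof (rule mollify_bound[OF M \<open>continuous_on UNIV \<psi>\<close>])
        fix w :: "real \<times> real" assume w: "\<bar>fst w\<bar> < \<rho> m" "\<bar>snd w\<bar> < \<rho> m"
        have "norm w \<le> \<bar>fst w\<bar> + \<bar>snd w\<bar>" using norm_Pair_le[of "fst w" "snd w"] by simp
        also have "\<dots> < 2 / real (Suc m)" using w r(3)[of m] by simp
        also have "\<dots> < \<eta>"
        proof -
          have "2 / \<eta> < real (Suc m)" using N m by linarith
          then show ?thesis using et(1) by (simp add: field_simps)
        qed
        finally have "dist (z - w) z < \<eta>" by (simp add: dist_norm)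
        from et(2)[OF this] show "\<bar>\<psi> (z - w) - \<psi> z\<bar> \<le> \<epsilon>/2" by (simp add: dist_real_def)
      qed
      then show ?thesis using ep by simp
    qed
    then show "\<exists>N. \<forall>m\<ge>N. norm (S \<psi> m z - \<psi> z) < \<epsilon>" by blast
  qed
  have Ck: "\<forall>n. Ck n (S \<psi> m)" if pc: "continuous_on UNIV \<psi>" and pz: "\<And>w. w \<notin> K ==> \<psi> w = 0" for \<psi> m
  proof -
    have "S \<psi> m z = conv2 \<psi> (- B) B (fst (f m)) (snd (f m)) z" for z
      unfolding S_def
    proof (rule conv2_reflect[symmetric, OF pc])
      show "fst (f m) (fst w) * snd (f m) (snd w) = 0" if "w \<notin> unit_cbox" for w
      proof -
        have "\<bar>fst w\<bar> \<ge> 1 \<or> \<bar>snd w\<bar> \<ge> 1" using that by (cases w) (auto simp: cbox_Pair_eq)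
        moreover have "\<rho> m \<le> 1" using r(3)[of m] by (rule order_trans) simp
        ultimately have "\<bar>fst w\<bar> \<ge> \<rho> m \<or> \<bar>snd w\<bar> \<ge> \<rho> m" by linarith
        then show ?thesis using M[of m] unfolding mollifier_def by blast
      qed
      show "\<psi> z = 0" if "z \<notin> cbox (- B) B" for z using that B pz by blast
      show "Cinf (fst (f m))" "Cinf (snd (f m))" using M[of m] by (simp_all add: mollifier_def)
    qed
    then have eq: "S \<psi> m = conv2 \<psi> (- B) B (fst (f m)) (snd (f m))" by (rule ext)
    show ?thesis unfolding eq using M[of m] Ck_conv2[OF pc] by (simp add: mollifier_def)
  qed
  have Scont: "continuous_on UNIV (S \<psi> m)" if "continuous_on UNIV \<psi>" "\<And>w. w \<notin> K ==> \<psi> w = 0" for \<psi> m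
  proof -
    have "Ck 0 (S \<psi> m)" using Ck[OF that] by blast
    then show ?thesis by simp
  qed
  \<comment> \<open>Here the derivative falls on \<open>\<phi>\<close>, in contrast to
    \<open>Ck\<close>, where it falls on the kernel.\<close>
  have der: "(S \<phi> m has_derivative (%h. S \<phi>1 m z * fst h + S \<phi>2 m z * snd h)) (at z)" for m z
    unfolding S_def[abs_def]
  proof (rule leibniz_plane)
    define k where "k w = fst (f m) (fst w) * snd (f m) (snd w)" for w :: "real \<times> real"
    have kc: "continuous_on S k" for S unfolding k_def by (rule mollifier_continuous[OF M])
    show "((%z. \<phi> (z - y) * (fst (f m) (fst y) * snd (f m) (snd y))) has_derivative
      (%h. \<phi>1 (z - y) * (fst (f m) (fst y) * snd (f m) (snd y)) * fst h + \<phi>2 (z - y) * (fst (f m) (fst y) * snd (f m) (snd y)) * snd h)) (at z)" for z y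
    proof -
      have "((%z. \<phi> (z - y)) has_derivative (%h. \<phi>1 (z - y) * fst h + \<phi>2 (z - y) * snd h)) (at z)"
        by (rule has_derivative_compose[of "%z. z - y" "%h. h" z UNIV \<phi>, OF _ d]) (auto intro!: derivative_eq_intros)
      from has_derivative_mult_left[OF this, of "k y"] show ?thesis by (simp add: k_def algebra_simps)
    qed
    have "continuous_on UNIV (%(z, y). \<psi> (z - y) * k y)" if "continuous_on UNIV \<psi>" for \<psi> :: "real \<times> real => real"
      unfolding case_prod_beta
      by (intro continuous_on_mult continuous_on_compose2[OF that] continuous_on_compose2[OF kc[of UNIV]]
          continuous_on_diff continuous_on_fst continuous_on_snd continuous_on_id) auto
    from this[OF pc] this[OF c(1)] this[OF c(2)]
    show "continuous_on UNIV (%(z, y). \<phi> (z - y) * (fst (f m) (fst y) * snd (f m) (snd y)))"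
      "continuous_on UNIV (%(z, y). \<phi>1 (z - y) * (fst (f m) (fst y) * snd (f m) (snd y)))"
      "continuous_on UNIV (%(z, y). \<phi>2 (z - y) * (fst (f m) (fst y) * snd (f m) (snd y)))" unfolding k_def .
  qed
  have fr: "frechet_derivative (S \<phi> m) (at z) = (%h. S \<phi>1 m z * fst h + S \<phi>2 m z * snd h)" for m z
    by (rule frechet_derivative_at[symmetric, OF der])
  have test: "test_function D (S \<phi> m)" for m
    unfolding test_function_def
  proof (intro conjI)
    show "\<forall>n. Ck n (S \<phi> m)" by (rule Ck[OF pc z])
    have sub: "{z. S \<phi> m z \<noteq> 0} \<subseteq> {x + y |x y. x \<in> K \<and> y \<in> cbox (- (\<rho> m), - (\<rho> m)) (\<rho> m, \<rho> m)}" (is "_ \<subseteq> ?C")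
    proof (rule subsetI, rule ccontr)
      fix u assume u: "u \<in> {z. S \<phi> m z \<noteq> 0}" and nu: "u \<notin> ?C"
      have "\<phi> (u - w) * (fst (f m) (fst w) * snd (f m) (snd w)) = 0" for w
      proof (cases "w \<in> cbox (- (\<rho> m), - (\<rho> m)) (\<rho> m, \<rho> m)")
        case True
        have "u - w \<notin> K"
        proof
          assume k: "u - w \<in> K"
          have "u = (u - w) + w" by simp
          then show False using nu True k by blast
        qed
        then show ?thesis using z by simp
      next
        case False
        then have "\<bar>fst w\<bar> \<ge> \<rho> m \<or> \<bar>snd w\<bar> \<ge> \<rho> m" by (cases w) (auto simp: cbox_Pair_eq)
        then have "fst (f m) (fst w) * snd (f m) (snd w) = 0" using M[of m] unfolding mollifier_def by blast
        then show ?thesis by simp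
      qed
      then have "S \<phi> m u = integral unit_cbox (%w. 0)" unfolding S_def by (rule integral_cong)
      then show False using u by simp
    qed
    have C: "compact ?C" by (rule compact_sums[OF K(1) compact_cbox])
    have cl: "closure {z. S \<phi> m z \<noteq> 0} \<subseteq> ?C" by (rule closure_minimal[OF sub compact_imp_closed[OF C]])
    show "compact (closure {z. S \<phi> m z \<noteq> 0})"
      using compact_Int_closed[OF C closed_closure[of "{z. S \<phi> m z \<noteq> 0}"]] cl by (simp add: Int_absorb1)
    have "?C \<subseteq> D"
    proof
      fix u assume "u \<in> ?C"
      then obtain x y where u: "u = x + y" "x \<in> K" "y \<in> cbox (- (\<rho> m), - (\<rho> m)) (\<rho> m, \<rho> m)" by blast
      have "norm y \<le> \<bar>fst y\<bar> + \<bar>snd y\<bar>" using norm_Pair_le[of "fst y" "snd y"] by simp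
      also have "\<dots> \<le> e" using u(3) r(2)[of m] by (cases y) (auto simp: cbox_Pair_eq)
      finally have "u \<in> cball x e" by (simp add: u dist_norm)
      then show "u \<in> D" using e(2) u(2) by blast
    qed
    then show "closure {z. S \<phi> m z \<noteq> 0} \<subseteq> D" using cl by blast
  qed
  have vi: "integrable (lebesgue_on D) v"
    using W by (intro integrable_of_square_integrable[OF D(2)]) (simp add: W12_def)
  have gi: "integrable (lebesgue_on D) (%z. G z \<bullet> b)" if "b \<in> Basis" for b
    using W that by (intro integrable_of_square_integrable[OF D(2)] square_integrable_inner) (auto simp: W12_def)
  have cm: "\<psi> \<in> borel_measurable (lebesgue_on D)" if "continuous_on UNIV \<psi>" for \<psi> :: "real \<times> real => real"
    by (rule continuous_imp_measurable_on_sets_lebesgue) (use D(1) in \<open>auto intro: continuous_on_subset[OF that]\<close>)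
  have lim: "(%m. LINT z|lebesgue_on D. u z * S \<psi> m z) \<longlonglongrightarrow> (LINT z|lebesgue_on D. u z * \<psi> z)"
    if u: "integrable (lebesgue_on D) u" and c': "continuous_on UNIV \<psi>" and z': "\<And>w. w \<notin> K ==> \<psi> w = 0" for u \<psi>
  proof -
    obtain C where C: "\<forall>w. \<bar>\<psi> w\<bar> \<le> C" using bd[OF c' z'] by blast
    have [measurable]: "u \<in> borel_measurable (lebesgue_on D)" using u by auto
    have [measurable]: "\<psi> \<in> borel_measurable (lebesgue_on D)" "\<And>m. S \<psi> m \<in> borel_measurable (lebesgue_on D)"
      using cm[OF c'] cm[OF Scont[OF c' z']] by auto
    show ?thesis
    proof (rule integral_dominated_convergence[where w = "%z. \<bar>u z\<bar> * C"])
      show "AE x in lebesgue_on D. (%m. u x * S \<psi> m x) \<longlonglongrightarrow> u x * \<psi> x"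
        by (rule AE_I2) (intro tendsto_mult tendsto_const Sl[OF c'])
      show "AE x in lebesgue_on D. norm (u x * S \<psi> m x) \<le> \<bar>u x\<bar> * C" for m
        by (rule AE_I2) (simp add: abs_mult mult_left_mono Sb[OF c' C])
      show "integrable (lebesgue_on D) (%z. \<bar>u z\<bar> * C)" using u by auto
    qed measurable
  qed
  have key: "(LINT z|lebesgue_on D. v z * \<psi> z) = - (LINT z|lebesgue_on D. (G z \<bullet> b) * \<phi> z)"
    if b: "b \<in> Basis" and c': "continuous_on UNIV \<psi>" and z': "\<And>w. w \<notin> K ==> \<psi> w = 0"
      and f: "\<And>m z. frechet_derivative (S \<phi> m) (at z) b = S \<psi> m z" for \<psi> b
  proof -
    have "(LINT z|lebesgue_on D. v z * S \<psi> m z) = - (LINT z|lebesgue_on D. (G z \<bullet> b) * S \<phi> m z)" for m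
      using W test[of m] b unfolding W12_def f[symmetric] by blast
    then have "(%m. LINT z|lebesgue_on D. v z * S \<psi> m z) \<longlonglongrightarrow> - (LINT z|lebesgue_on D. (G z \<bullet> b) * \<phi> z)"
      using tendsto_minus[OF lim[OF gi[OF b] pc z]] by simp
    then show ?thesis using LIMSEQ_unique lim[OF vi c' z'] by blast
  qed
  show "(LINT z|lebesgue_on D. v z * \<phi>1 z) = - (LINT z|lebesgue_on D. (G z \<bullet> (1, 0)) * \<phi> z)"
    by (rule key) (use c z12 in \<open>auto simp: Basis_plane fr\<close>)
  show "(LINT z|lebesgue_on D. v z * \<phi>2 z) = - (LINT z|lebesgue_on D. (G z \<bullet> (0, 1)) * \<phi> z)"
    by (rule key) (use c z12 in \<open>auto simp: Basis_plane fr\<close>)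
qed

section \<open>Existence of the first nonzero eigenvalue\<close>

text \<open>Vector-valued, so that a function paired with its weak gradient can be treated as a
  single element when passing to limits.\<close>

definition L2 :: "'a measure => ('a => 'b::euclidean_space) => bool" where
  "L2 M f \<longleftrightarrow> f \<in> borel_measurable M \<and> integrable M (%z. (norm (f z))^2)"

lemma square_integrable_L2: "square_integrable D f \<longleftrightarrow> L2 (lebesgue_on D) f"
  by (simp add: square_integrable_def L2_def)

lemma L2_measurable: "L2 M f ==> f \<in> borel_measurable M" by (simp add: L2_def)

lemma L2_inner:
  assumes f: "L2 M f" and g: "L2 M g"
  shows "integrable M (%z. f z \<bullet> g z)"
    "(LINT z|M. f z \<bullet> g z)^2 \<le> (LINT z|M. (norm (f z))^2) * (LINT z|M. (norm (g z))^2)"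
proof -
  have [measurable]: "f \<in> borel_measurable M" "g \<in> borel_measurable M" using f g by (auto simp: L2_def)
  have n: "integrable M (%z. norm (f z) * norm (g z))"
    by (rule integrable_mult_L2) (use f g in \<open>auto simp: L2_def\<close>)
  show i: "integrable M (%z. f z \<bullet> g z)"
    by (rule Bochner_Integration.integrable_bound[OF n]) (auto intro!: AE_I2 simp: Cauchy_Schwarz_ineq2)
  have "\<bar>LINT z|M. f z \<bullet> g z\<bar> \<le> (LINT z|M. \<bar>f z \<bullet> g z\<bar>)" by (rule integral_abs_bound)
  also have "\<dots> \<le> (LINT z|M. norm (f z) * norm (g z))"
    by (rule integral_mono) (use i n in \<open>auto simp: Cauchy_Schwarz_ineq2\<close>)
  finally have "\<bar>LINT z|M. f z \<bullet> g z\<bar>^2 \<le> (LINT z|M. norm (f z) * norm (g z))^2" by (rule power_mono) simp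
  also have "\<dots> \<le> (LINT z|M. (norm (f z))^2) * (LINT z|M. (norm (g z))^2)"
    by (rule Cauchy_Schwarz_L2) (use f g in \<open>auto simp: L2_def\<close>)
  finally show "(LINT z|M. f z \<bullet> g z)^2 \<le> (LINT z|M. (norm (f z))^2) * (LINT z|M. (norm (g z))^2)" by simp
qed

lemma L2_add:
  assumes "L2 M f" "L2 M g"
  shows "L2 M (%z. f z + g z)"
proof -
  have [measurable]: "f \<in> borel_measurable M" "g \<in> borel_measurable M" using assms by (auto simp: L2_def)
  have "integrable M (%z. (norm (f z))^2 + (norm (g z))^2 + 2 * (f z \<bullet> g z))"
    using assms L2_inner(1)[OF assms] by (auto simp: L2_def)
  then show ?thesis unfolding L2_def by (simp add: power2_norm_eq_inner inner_simps inner_commute algebra_simps)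
qed

lemma L2_scaleR:
  assumes "L2 M f"
  shows "L2 M (%z. c *\<^sub>R f z)"
proof -
  have [measurable]: "f \<in> borel_measurable M" using assms by (auto simp: L2_def)
  show ?thesis using assms unfolding L2_def by (simp add: power_mult_distrib)
qed

lemma L2_diff: "L2 M f ==> L2 M g ==> L2 M (%z. f z - g z)"
  using L2_add[of M f "%z. (-1) *\<^sub>R g z"] L2_scaleR[of M g "-1"] by simp

lemma L2_norm_diff:
  assumes f: "L2 M f" and g: "L2 M g"
  shows "(LINT z|M. (norm (f z - g z))^2) = (LINT z|M. f z \<bullet> f z) + (LINT z|M. g z \<bullet> g z) - 2 * (LINT z|M. f z \<bullet> g z)"
    "(LINT z|M. (norm (f z + g z))^2) = (LINT z|M. f z \<bullet> f z) + (LINT z|M. g z \<bullet> g z) + 2 * (LINT z|M. f z \<bullet> g z)"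
proof -
  note i = L2_inner(1)[OF f f] L2_inner(1)[OF g g] L2_inner(1)[OF f g]
  have "(LINT z|M. (norm (f z - g z))^2) = (LINT z|M. f z \<bullet> f z + g z \<bullet> g z - 2 * (f z \<bullet> g z))"
    by (simp add: power2_norm_eq_inner inner_simps inner_commute algebra_simps)
  then show "(LINT z|M. (norm (f z - g z))^2) = (LINT z|M. f z \<bullet> f z) + (LINT z|M. g z \<bullet> g z) - 2 * (LINT z|M. f z \<bullet> g z)"
    using i by simp
  have "(LINT z|M. (norm (f z + g z))^2) = (LINT z|M. f z \<bullet> f z + g z \<bullet> g z + 2 * (f z \<bullet> g z))"
    by (simp add: power2_norm_eq_inner inner_simps inner_commute algebra_simps)
  then show "(LINT z|M. (norm (f z + g z))^2) = (LINT z|M. f z \<bullet> f z) + (LINT z|M. g z \<bullet> g z) + 2 * (LINT z|M. f z \<bullet> g z)"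
    using i by simp
qed

lemma L2_tendsto_inner:
  assumes F: "\<And>n. L2 M (F n)" and f: "L2 M f" and g: "L2 M g"
    and l: "(%n. LINT z|M. (norm (F n z - f z))^2) \<longlonglongrightarrow> 0"
  shows "(%n. LINT z|M. F n z \<bullet> g z) \<longlonglongrightarrow> (LINT z|M. f z \<bullet> g z)"
proof -
  have "(%n. (LINT z|M. (norm (F n z - f z))^2) * (LINT z|M. (norm (g z))^2)) \<longlonglongrightarrow> 0 * (LINT z|M. (norm (g z))^2)"
    by (intro tendsto_intros l)
  then have u: "(%n. (LINT z|M. (norm (F n z - f z))^2) * (LINT z|M. (norm (g z))^2)) \<longlonglongrightarrow> 0" by simp
  have "(%n. (LINT z|M. (F n z - f z) \<bullet> g z)^2) \<longlonglongrightarrow> 0"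
  proof (rule tendsto_sandwich[OF _ _ tendsto_const u])
    show "\<forall>\<^sub>F n in sequentially. (LINT z|M. (F n z - f z) \<bullet> g z)^2 \<le> (LINT z|M. (norm (F n z - f z))^2) * (LINT z|M. (norm (g z))^2)"
      by (intro always_eventually allI L2_inner(2) L2_diff F f g)
  qed simp
  then have "(%n. LINT z|M. (F n z - f z) \<bullet> g z) \<longlonglongrightarrow> 0" by (simp add: power_tendsto_0_iff)
  moreover have "(LINT z|M. (F n z - f z) \<bullet> g z) = (LINT z|M. F n z \<bullet> g z) - (LINT z|M. f z \<bullet> g z)" for n
    using L2_inner(1)[OF F g] L2_inner(1)[OF f g] by (simp add: inner_diff_left)
  ultimately show ?thesis using LIM_zero_iff by auto
qed

lemma L2_tendsto_norm:
  assumes F: "\<And>n. L2 M (F n)" and f: "L2 M f"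
    and l: "(%n. LINT z|M. (norm (F n z - f z))^2) \<longlonglongrightarrow> 0"
  shows "(%n. LINT z|M. F n z \<bullet> F n z) \<longlonglongrightarrow> (LINT z|M. f z \<bullet> f z)"
proof -
  have "(LINT z|M. F n z \<bullet> F n z) = (LINT z|M. (norm (F n z - f z))^2) - (LINT z|M. f z \<bullet> f z) + 2 * (LINT z|M. F n z \<bullet> f z)" for n
    using L2_norm_diff(1)[OF F[of n] f] by simp
  moreover have "(%n. (LINT z|M. (norm (F n z - f z))^2) - (LINT z|M. f z \<bullet> f z) + 2 * (LINT z|M. F n z \<bullet> f z)) \<longlonglongrightarrow>
     0 - (LINT z|M. f z \<bullet> f z) + 2 * (LINT z|M. f z \<bullet> f z)"
    by (intro tendsto_intros l L2_tendsto_inner F f)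
  ultimately show ?thesis by simp
qed

text \<open>Completing a square gives \<open>a k \<le> 2 ^ k * (a k)^2 + (1/2) ^ k\<close>.\<close>

lemma summable_of_weighted_square:
  fixes a :: "nat => real"
  assumes "\<And>k. 0 \<le> a k" "summable (%k. 2 ^ k * (a k)^2)"
  shows "summable a"
proof (rule summable_comparison_test)
  show "summable (%k. 2 ^ k * (a k)^2 + (1/2) ^ k)" using assms by (intro summable_add) auto
  have "a k \<le> 2 ^ k * (a k)^2 + (1/2) ^ k" for k
  proof -
    have "0 \<le> (2 ^ k * a k - 1)^2" by simp
    then have "2 * (2 ^ k * a k) \<le> (2 ^ k * a k)^2 + 1" by (simp add: power2_diff)
    moreover have "0 \<le> 2 ^ k * a k" using assms by simp
    ultimately have "2 ^ k * a k \<le> (2 ^ k * a k)^2 + 1" by linarith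
    then have "2 ^ k * a k \<le> 2 ^ k * (2 ^ k * (a k)^2 + (1/2) ^ k)"
      by (simp add: power2_eq_square algebra_simps power_one_over)
    then show ?thesis by simp
  qed
  then show "\<exists>N. \<forall>n\<ge>N. norm (a n) \<le> 2 ^ n * (a n)^2 + (1/2) ^ n" using assms by simp
qed

text \<open>Riesz-Fischer. Along a fast subsequence the weighted series of squared differences has a
  finite integral, so the subsequence converges almost everywhere; Fatou's lemma along it then gives
  convergence of the whole sequence in mean square.\<close>

lemma L2_complete:
  fixes F :: "nat => 'a => 'b::euclidean_space"
  assumes F: "\<And>n. L2 M (F n)"
    and C: "\<And>e. e > 0 ==> \<exists>N. \<forall>m\<ge>N. \<forall>n\<ge>N. (LINT z|M. (norm (F m z - F n z))^2) < e"
  obtains f where "L2 M f" "(%n. LINT z|M. (norm (F n z - f z))^2) \<longlonglongrightarrow> 0"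
proof -
  have [measurable]: "F n \<in> borel_measurable M" for n using F by (simp add: L2_def)
  have di: "integrable M (%z. (norm (F m z - F n z))^2)" for m n using L2_diff[OF F F] by (simp add: L2_def)
  have dn: "(\<integral>\<^sup>+z. ennreal ((norm (F m z - F n z))^2) \<partial>M) = ennreal (LINT z|M. (norm (F m z - F n z))^2)" for m n
    by (rule nn_integral_eq_integral[OF di]) simp
  have "\<forall>k. \<exists>N. \<forall>m\<ge>N. \<forall>n\<ge>N. (LINT z|M. (norm (F m z - F n z))^2) < (1/4) ^ k" using C by simp
  then obtain N where "\<forall>k. \<forall>m\<ge>N k. \<forall>n\<ge>N k. (LINT z|M. (norm (F m z - F n z))^2) < (1/4) ^ k"
    by (rule choice[THEN exE])
  then have N: "\<And>k m n. N k \<le> m ==> N k \<le> n ==> (LINT z|M. (norm (F m z - F n z))^2) < (1/4) ^ k"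
    by blast
  \<comment> \<open>The sum places \<open>r k\<close> beyond \<open>N k\<close>; the added
    \<open>k\<close> makes \<open>r\<close> strictly increasing.\<close>
  define r where "r k = (\<Sum>i\<le>k. N i) + k" for k
  have rN: "N k \<le> r k" for k unfolding r_def using member_le_sum[of k "{..k}" N] by simp
  have rm: "r k < r (Suc k)" for k by (simp add: r_def)
  have sm: "strict_mono r" using rm by (simp add: strict_mono_Suc_iff)
  \<comment> \<open>The square integral of \<open>a k\<close> is below \<open>(1/4) ^ k\<close>,
    which against the weight \<open>2 ^ k\<close> leaves a geometric series.\<close>
  define a where "a k z = norm (F (r (Suc k)) z - F (r k) z)" for k z
  have [measurable]: "a k \<in> borel_measurable M" for k unfolding a_def by measurable
  have "(\<integral>\<^sup>+z. ennreal (2 ^ k * (a k z)^2) \<partial>M) \<le> ennreal ((1/2) ^ k)" for k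
  proof -
    have "(\<integral>\<^sup>+z. ennreal (2 ^ k * (a k z)^2) \<partial>M) = ennreal (2 ^ k) * (\<integral>\<^sup>+z. ennreal ((a k z)^2) \<partial>M)"
      by (subst nn_integral_cmult[symmetric]) (auto simp: ennreal_mult)
    also have "\<dots> = ennreal (2 ^ k * (LINT z|M. (a k z)^2))"
      unfolding a_def dn by (simp add: ennreal_mult)
    also have "\<dots> \<le> ennreal (2 ^ k * (1/4) ^ k)"
    proof (intro ennreal_leI mult_left_mono less_imp_le)
      show "(LINT z|M. (a k z)^2) < (1/4) ^ k" unfolding a_def
        by (rule N) (use rN[of k] rm[of k] in auto)
    qed simp
    also have "2 ^ k * (1/4) ^ k = (1/2 :: real) ^ k" by (simp flip: power_mult_distrib)
    finally show ?thesis .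
  qed
  then have "(\<Sum>k. \<integral>\<^sup>+z. ennreal (2 ^ k * (a k z)^2) \<partial>M) \<le> (\<Sum>k. ennreal ((1/2) ^ k))"
    by (intro suminf_le) auto
  also have "\<dots> = ennreal (\<Sum>k. (1/2) ^ k)" by (rule suminf_ennreal2) auto
  finally have "(\<integral>\<^sup>+z. (\<Sum>k. ennreal (2 ^ k * (a k z)^2)) \<partial>M) \<le> ennreal (\<Sum>k. (1/2) ^ k)"
    by (subst nn_integral_suminf) auto
  then have "(\<integral>\<^sup>+z. (\<Sum>k. ennreal (2 ^ k * (a k z)^2)) \<partial>M) \<noteq> \<infinity>" by (auto simp: top_unique)
  then have "AE z in M. (\<Sum>k. ennreal (2 ^ k * (a k z)^2)) \<noteq> \<infinity>" by (intro nn_integral_noteq_infinite) auto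
  then have cv: "AE z in M. convergent (%k. F (r k) z)"
  proof eventually_elim
    case (elim z)
    have "summable (%k. 2 ^ k * (a k z)^2)"
      by (rule summable_suminf_not_top) (use elim in \<open>auto simp: infinity_ennreal_def\<close>)
    then have "summable (%k. a k z)" by (rule summable_of_weighted_square[rotated]) (simp add: a_def)
    then have "summable (%k. F (r (Suc k)) z - F (r k) z)" unfolding a_def by (rule summable_norm_cancel)
    then have "convergent (%n. \<Sum>k<n. F (r (Suc k)) z - F (r k) z)" by (simp add: summable_iff_convergent)
    then have "convergent (%n. F (r n) z - F (r 0) z)" unfolding sum_lessThan_telescope[of "%k. F (r k) z"] .
    then have "convergent (%n. (F (r n) z - F (r 0) z) + F (r 0) z)" by (intro convergent_add convergent_const)
    then show ?case by simp
  qed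
  define f where "f z = lim (%k. F (r k) z)" for z
  have [measurable]: "f \<in> borel_measurable M" unfolding f_def by measurable
  have fl: "AE z in M. (%k. F (r k) z) \<longlonglongrightarrow> f z"
    using cv by eventually_elim (simp add: f_def convergent_LIMSEQ_iff)
  have bnd: "(\<integral>\<^sup>+z. ennreal ((norm (F n z - f z))^2) \<partial>M) \<le> ennreal e"
    if e: "e > 0" and K: "\<And>m. m \<ge> K ==> (LINT z|M. (norm (F n z - F m z))^2) < e" for n e K
  proof -
    have "(\<integral>\<^sup>+z. ennreal ((norm (F n z - f z))^2) \<partial>M) = (\<integral>\<^sup>+z. liminf (%k. ennreal ((norm (F n z - F (r k) z))^2)) \<partial>M)"
    proof (rule nn_integral_cong_AE)
      show "AE z in M. ennreal ((norm (F n z - f z))^2) = liminf (%k. ennreal ((norm (F n z - F (r k) z))^2))"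
        using fl
      proof eventually_elim
        case (elim z)
        have "(%k. ennreal ((norm (F n z - F (r k) z))^2)) \<longlonglongrightarrow> ennreal ((norm (F n z - f z))^2)"
          by (intro tendsto_intros elim)
        from lim_imp_Liminf[OF sequentially_bot this] show ?case by simp
      qed
    qed
    also have "\<dots> \<le> liminf (%k. \<integral>\<^sup>+z. ennreal ((norm (F n z - F (r k) z))^2) \<partial>M)"
      by (rule nn_integral_liminf) measurable
    also have "\<dots> \<le> ennreal e"
    proof (rule Liminf_le)
      have "eventually (%k. k \<ge> K) sequentially" by (rule eventually_ge_at_top)
      then show "eventually (%k. (\<integral>\<^sup>+z. ennreal ((norm (F n z - F (r k) z))^2) \<partial>M) \<le> ennreal e) sequentially"
      proof eventually_elim
        case (elim k)
        have "K \<le> r k" using elim seq_suble[OF sm, of k] by linarith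
        from K[OF this] show ?case unfolding dn by (intro ennreal_leI) simp
      qed
    qed simp
    finally show ?thesis .
  qed
  have "\<exists>K. \<forall>n\<ge>K. (\<integral>\<^sup>+z. ennreal ((norm (F n z - f z))^2) \<partial>M) \<le> ennreal e" if e: "e > 0" for e
  proof -
    obtain K where K: "\<forall>m\<ge>K. \<forall>n\<ge>K. (LINT z|M. (norm (F m z - F n z))^2) < e" using C[OF e] by blast
    then show ?thesis using bnd[OF e] by blast
  qed note lim = this
  obtain K where "(\<integral>\<^sup>+z. ennreal ((norm (F K z - f z))^2) \<partial>M) \<le> ennreal 1" using lim[of 1] by auto
  then have "(\<integral>\<^sup>+z. ennreal ((norm (F K z - f z))^2) \<partial>M) < top"
    using ennreal_less_top by (rule order_le_less_trans)
  then have "integrable M (%z. (norm (F K z - f z))^2)"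
    by (intro integrableI_bounded) auto
  then have "L2 M (%z. F K z - f z)" by (simp add: L2_def)
  from L2_diff[OF F[of K] this] have f: "L2 M f" by simp
  have "(%n. LINT z|M. (norm (F n z - f z))^2) \<longlonglongrightarrow> 0"
  proof (rule LIMSEQ_I)
    fix e :: real assume e: "e > 0"
    obtain K where K: "\<forall>n\<ge>K. (\<integral>\<^sup>+z. ennreal ((norm (F n z - f z))^2) \<partial>M) \<le> ennreal (e/2)" using lim[of "e/2"] e by auto
    have "norm ((LINT z|M. (norm (F n z - f z))^2) - 0) < e" if "n \<ge> K" for n
    proof -
      have i: "integrable M (%z. (norm (F n z - f z))^2)" using L2_diff[OF F f] by (simp add: L2_def)
      have "ennreal (LINT z|M. (norm (F n z - f z))^2) \<le> ennreal (e/2)"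
      proof -
        have "(\<integral>\<^sup>+z. ennreal ((norm (F n z - f z))^2) \<partial>M) = ennreal (LINT z|M. (norm (F n z - f z))^2)"
          by (rule nn_integral_eq_integral[OF i]) simp
        moreover have "(\<integral>\<^sup>+z. ennreal ((norm (F n z - f z))^2) \<partial>M) \<le> ennreal (e/2)" using K that by blast
        ultimately show ?thesis by (simp only:)
      qed
      then have "(LINT z|M. (norm (F n z - f z))^2) \<le> e/2" using e by (simp add: ennreal_le_iff)
      then show ?thesis using e by simp
    qed
    then show "\<exists>K. \<forall>n\<ge>K. norm ((LINT z|M. (norm (F n z - f z))^2) - 0) < e" by blast
  qed
  with f show ?thesis by (rule that)
qed

section \<open>Linear combinations and limits of weakly differentiable functions\<close>

lemma test_function_facts:
  assumes t: "test_function D \<phi>" and b: "b \<in> Basis"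
  obtains C where "\<And>z. \<bar>\<phi> z\<bar> \<le> C" "\<And>z. \<bar>frechet_derivative \<phi> (at z) b\<bar> \<le> C"
    "continuous_on UNIV \<phi>" "continuous_on UNIV (%z. frechet_derivative \<phi> (at z) b)"
proof -
  have Ck: "\<And>n. Ck n \<phi>" and K: "compact (closure {z. \<phi> z \<noteq> 0})" using t by (auto simp: test_function_def)
  have c0: "continuous_on UNIV \<phi>" using Ck[of 0] by simp
  have "Ck (Suc 0) \<phi>" by (rule Ck)
  then have c1: "continuous_on UNIV (%z. frechet_derivative \<phi> (at z) b)" using b by simp
  define S where "S = closure {z. \<phi> z \<noteq> 0}"
  have S: "compact S" "closed S" using K by (simp_all add: S_def)
  have z: "\<phi> z = 0" if "z \<notin> S" for z
  proof (rule ccontr)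
    assume "\<phi> z \<noteq> 0"
    then have "z \<in> {z. \<phi> z \<noteq> 0}" by simp
    from subsetD[OF closure_subset this] that show False unfolding S_def by contradiction
  qed
  have z1: "frechet_derivative \<phi> (at z) b = 0" if "z \<notin> S" for z
  proof -
    have "(\<phi> has_derivative (%h. 0)) (at z)"
      by (rule has_derivative_transform_within_open[where s = "- S" and f = "%_. 0"])
        (use that z S in auto)
    from fun_cong[OF frechet_derivative_at[OF this], of b] show ?thesis by simp
  qed
  have bd: "\<exists>C. \<forall>w. \<bar>\<psi> w\<bar> \<le> C" if "continuous_on UNIV \<psi>" "\<And>w. w \<notin> S ==> \<psi> w = 0" for \<psi> :: "'a => real"
  proof -
    have "bounded (\<psi> ` S)" by (intro compact_imp_bounded compact_continuous_image S continuous_on_subset[OF that(1)]) auto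
    then obtain C where C: "C > 0" "\<forall>y\<in>\<psi> ` S. norm y \<le> C" unfolding bounded_pos by blast
    have "\<bar>\<psi> w\<bar> \<le> C" for w using C that(2)[of w] by (cases "w \<in> S") auto
    then show ?thesis by blast
  qed
  obtain C1 C2 where "\<forall>w. \<bar>\<phi> w\<bar> \<le> C1" "\<forall>w. \<bar>frechet_derivative \<phi> (at w) b\<bar> \<le> C2"
  proof -
    have "\<exists>C. \<forall>w. \<bar>\<phi> w\<bar> \<le> C" by (rule bd[OF c0]) (rule z)
    moreover have "\<exists>C. \<forall>w. \<bar>frechet_derivative \<phi> (at w) b\<bar> \<le> C" by (rule bd[OF c1]) (rule z1)
    ultimately show ?thesis using that by blast
  qed
  then show ?thesis by (intro that[of "max C1 C2", OF _ _ c0 c1]) (simp_all add: le_max_iff_disj)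
qed

lemma L2_bounded:
  fixes f :: "'a => real"
  assumes "finite_measure M" "f \<in> borel_measurable M" "\<And>z. \<bar>f z\<bar> \<le> C"
  shows "L2 M f"
  unfolding L2_def
proof
  have "(norm (f z))^2 \<le> C^2" for z using assms(3)[of z] by (intro power_mono) auto
  then show "integrable M (%z. (norm (f z))^2)"
    by (intro finite_measure.integrable_const_bound[OF assms(1), of _ "C^2"]) (use assms(2) in auto)
qed (rule assms)

lemma test_function_L2:
  fixes D :: "'a::euclidean_space set"
  assumes t: "test_function D \<phi>" and b: "b \<in> Basis" and D: "D \<in> sets lebesgue" "finite_measure (lebesgue_on D)"
  shows "L2 (lebesgue_on D) \<phi>" "L2 (lebesgue_on D) (%z. frechet_derivative \<phi> (at z) b)"
proof -
  obtain C where C: "\<And>z. \<bar>\<phi> z\<bar> \<le> C" "\<And>z. \<bar>frechet_derivative \<phi> (at z) b\<bar> \<le> C"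
    "continuous_on UNIV \<phi>" "continuous_on UNIV (%z. frechet_derivative \<phi> (at z) b)"
    by (rule test_function_facts[OF t b], rule that; assumption)
  have m: "f \<in> borel_measurable (lebesgue_on D)" if "continuous_on UNIV f" for f :: "'a => real"
    by (rule continuous_imp_measurable_on_sets_lebesgue[OF continuous_on_subset[OF that] D(1)]) simp
  show "L2 (lebesgue_on D) \<phi>" "L2 (lebesgue_on D) (%z. frechet_derivative \<phi> (at z) b)"
    by (rule L2_bounded[OF D(2) m[OF C(3)] C(1)]) (rule L2_bounded[OF D(2) m[OF C(4)] C(2)])
qed

context
  fixes D :: "'a::euclidean_space set"
  assumes D: "D \<in> sets lebesgue" "finite_measure (lebesgue_on D)"
begin

lemma W12_L2: "W12 D v G ==> L2 (lebesgue_on D) v" "W12 D v G ==> L2 (lebesgue_on D) G"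
  by (simp_all add: W12_def square_integrable_L2)

lemma L2_inner_Basis: "L2 (lebesgue_on D) G ==> b \<in> Basis ==> L2 (lebesgue_on D) (%z. G z \<bullet> b)" for G :: "'a => 'a"
  using square_integrable_inner by (simp add: square_integrable_L2)

lemma W12_weak:
  assumes "W12 D v G" "test_function D \<phi>" "b \<in> Basis"
  shows "(LINT z|lebesgue_on D. v z \<bullet> frechet_derivative \<phi> (at z) b) = - (LINT z|lebesgue_on D. (G z \<bullet> b) \<bullet> \<phi> z)"
  using assms by (simp add: W12_def)

lemma W12_lincomb:
  assumes v: "W12 D v G" and u: "W12 D u H"
  shows "W12 D (%z. v z + c * u z) (%z. G z + c *\<^sub>R H z)"
  unfolding W12_def square_integrable_L2
proof (intro conjI allI impI ballI)
  note L = W12_L2[OF v] W12_L2[OF u]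
  show "L2 (lebesgue_on D) (%z. v z + c * u z)" using L2_add[OF L(1) L2_scaleR[OF L(3), of c]] by simp
  show "L2 (lebesgue_on D) (%z. G z + c *\<^sub>R H z)" by (rule L2_add[OF L(2) L2_scaleR[OF L(4)]])
  fix \<phi> and b :: 'a assume t: "test_function D \<phi>" and b: "b \<in> Basis"
  note T = test_function_L2[OF t b D]
  have i: "integrable (lebesgue_on D) (%z. v z * frechet_derivative \<phi> (at z) b)" "integrable (lebesgue_on D) (%z. u z * frechet_derivative \<phi> (at z) b)"
    "integrable (lebesgue_on D) (%z. (G z \<bullet> b) * \<phi> z)" "integrable (lebesgue_on D) (%z. (H z \<bullet> b) * \<phi> z)"
    using L2_inner(1)[OF L(1) T(2)] L2_inner(1)[OF L(3) T(2)] L2_inner(1)[OF L2_inner_Basis[OF L(2) b] T(1)]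
      L2_inner(1)[OF L2_inner_Basis[OF L(4) b] T(1)] by simp_all
  have "(LINT z|lebesgue_on D. (v z + c * u z) * frechet_derivative \<phi> (at z) b) =
    (LINT z|lebesgue_on D. v z * frechet_derivative \<phi> (at z) b + c * (u z * frechet_derivative \<phi> (at z) b))"
    by (simp add: algebra_simps)
  also have "\<dots> = - (LINT z|lebesgue_on D. (G z \<bullet> b) * \<phi> z + c * ((H z \<bullet> b) * \<phi> z))"
    using i W12_weak[OF v t b] W12_weak[OF u t b] by simp
  also have "\<dots> = - (LINT z|lebesgue_on D. ((G z + c *\<^sub>R H z) \<bullet> b) * \<phi> z)"
    by (simp add: inner_add_left algebra_simps)
  finally show "(LINT z|lebesgue_on D. (v z + c * u z) * frechet_derivative \<phi> (at z) b) = - (LINT z|lebesgue_on D. ((G z + c *\<^sub>R H z) \<bullet> b) * \<phi> z)" .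
qed

text \<open>Each side of the weak identity is a pairing with a fixed square-integrable function,
  hence continuous under convergence in mean square.\<close>

lemma W12_limit:
  assumes W: "\<And>n. W12 D (v n) (G n)" and L: "L2 (lebesgue_on D) u" "L2 (lebesgue_on D) H"
    and lv: "(%n. LINT z|lebesgue_on D. (norm (v n z - u z))^2) \<longlonglongrightarrow> 0"
    and lG: "(%n. LINT z|lebesgue_on D. (norm (G n z - H z))^2) \<longlonglongrightarrow> 0"
  shows "W12 D u H"
  unfolding W12_def square_integrable_L2
proof (intro conjI allI impI ballI L)
  fix \<phi> and b :: 'a assume t: "test_function D \<phi>" and b: "b \<in> Basis"
  note T = test_function_L2[OF t b D]
  have 1: "(%n. LINT z|lebesgue_on D. v n z \<bullet> frechet_derivative \<phi> (at z) b) \<longlonglongrightarrow> (LINT z|lebesgue_on D. u z \<bullet> frechet_derivative \<phi> (at z) b)"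
    by (rule L2_tendsto_inner[OF W12_L2(1)[OF W] L(1) T(2) lv])
  have Tb: "L2 (lebesgue_on D) (%z. \<phi> z *\<^sub>R b)"
  proof -
    have [measurable]: "\<phi> \<in> borel_measurable (lebesgue_on D)" using T(1) by (rule L2_measurable)
    show ?thesis using T(1) b by (simp add: L2_def)
  qed
  have "(%n. LINT z|lebesgue_on D. G n z \<bullet> (\<phi> z *\<^sub>R b)) \<longlonglongrightarrow> (LINT z|lebesgue_on D. H z \<bullet> (\<phi> z *\<^sub>R b))"
    by (rule L2_tendsto_inner[OF W12_L2(2)[OF W] L(2) Tb lG])
  then have "(%n. - (LINT z|lebesgue_on D. (G n z \<bullet> b) * \<phi> z)) \<longlonglongrightarrow> - (LINT z|lebesgue_on D. (H z \<bullet> b) * \<phi> z)"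
    by (intro tendsto_minus) (simp add: mult.commute)
  moreover have "(LINT z|lebesgue_on D. v n z \<bullet> frechet_derivative \<phi> (at z) b) = - (LINT z|lebesgue_on D. (G n z \<bullet> b) * \<phi> z)" for n
    using W12_weak[OF W t b] by simp
  ultimately have "(LINT z|lebesgue_on D. u z \<bullet> frechet_derivative \<phi> (at z) b) = - (LINT z|lebesgue_on D. (H z \<bullet> b) * \<phi> z)"
    using 1 LIMSEQ_unique by auto
  then show "(LINT z|lebesgue_on D. u z * frechet_derivative \<phi> (at z) b) = - (LINT z|lebesgue_on D. (H z \<bullet> b) * \<phi> z)" by simp
qed

end

lemma convergent_subseq_finite:
  fixes l :: "nat => nat => real"
  assumes b: "\<And>i n. i < N ==> \<bar>l i n\<bar> \<le> B i"
  shows "\<exists>r. strict_mono (r :: nat => nat) \<and> (\<forall>i<N. convergent (%n. l i (r n)))"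
  using b
proof (induction N)
  case 0
  show ?case by (intro exI[of _ id]) (auto simp: strict_mono_def)
next
  case (Suc N)
  then obtain r where r: "strict_mono (r :: nat => nat)" "\<forall>i<N. convergent (%n. l i (r n))" by auto
  have "bounded (range (%n. l N (r n)))" unfolding bounded_iff using Suc.prems[of N] by auto
  from bounded_imp_convergent_subsequence[OF this]
  obtain L q where q: "strict_mono (q :: nat => nat)" "((%n. l N (r n)) \<circ> q) \<longlonglongrightarrow> L" by blast
  have "convergent (%n. l i ((r \<circ> q) n))" if "i < Suc N" for i
  proof (cases "i = N")
    case True
    then show ?thesis using q(2) by (auto simp: convergent_def o_def)
  next
    case False
    then have "convergent (%n. l i (r n))" using r that by simp
    then show ?thesis using convergent_subseq_convergent[OF _ q(1), of "%n. l i (r n)"] by (simp add: o_def)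
  qed
  then show ?case using strict_mono_o[OF r(1) q(1)] by blast
qed

lemma L2_Pair:
  fixes v :: "'a => 'b::euclidean_space" and G :: "'a => 'c::euclidean_space"
  assumes "L2 M v" "L2 M G"
  shows "L2 M (%z. (v z, G z))"
proof -
  have [measurable]: "v \<in> borel_measurable M" "G \<in> borel_measurable M" using assms by (auto simp: L2_def)
  show ?thesis using assms unfolding L2_def by (auto simp: norm_Pair)
qed

lemma L2_fst_snd:
  fixes f :: "'a => 'b::euclidean_space \<times> 'c::euclidean_space"
  assumes "L2 M f"
  shows "L2 M (%z. fst (f z))" "L2 M (%z. snd (f z))"
    "(LINT z|M. (norm (fst (f z)))^2) \<le> (LINT z|M. (norm (f z))^2)"
    "(LINT z|M. (norm (snd (f z)))^2) \<le> (LINT z|M. (norm (f z))^2)"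
    "(LINT z|M. (norm (f z))^2) = (LINT z|M. (norm (fst (f z)))^2) + (LINT z|M. (norm (snd (f z)))^2)"
proof -
  have [measurable]: "f \<in> borel_measurable M" using assms by (auto simp: L2_def)
  have [measurable]: "(%z. fst (f z)) \<in> borel_measurable M" "(%z. snd (f z)) \<in> borel_measurable M"
    by (rule measurable_compose[OF \<open>f \<in> borel_measurable M\<close> borel_measurable_continuous_onI],
        intro continuous_on_fst continuous_on_snd continuous_on_id)+
  have le: "(norm (fst (f z)))^2 \<le> (norm (f z))^2" "(norm (snd (f z)))^2 \<le> (norm (f z))^2" for z
    by (cases "f z"; simp add: norm_Pair)+
  have i: "integrable M (%z. (norm (f z))^2)" using assms by (simp add: L2_def)
  show 1: "L2 M (%z. fst (f z))" unfolding L2_def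
    by (auto intro!: Bochner_Integration.integrable_bound[OF i] AE_I2 simp: le)
  show 2: "L2 M (%z. snd (f z))" unfolding L2_def
    by (auto intro!: Bochner_Integration.integrable_bound[OF i] AE_I2 simp: le)
  show "(LINT z|M. (norm (fst (f z)))^2) \<le> (LINT z|M. (norm (f z))^2)"
    by (rule integral_mono) (use 1 i le in \<open>auto simp: L2_def\<close>)
  show "(LINT z|M. (norm (snd (f z)))^2) \<le> (LINT z|M. (norm (f z))^2)"
    by (rule integral_mono) (use 2 i le in \<open>auto simp: L2_def\<close>)
  have "(LINT z|M. (norm (f z))^2) = (LINT z|M. (norm (fst (f z)))^2 + (norm (snd (f z)))^2)"
    by (rule LINT_cong) (auto simp: norm_prod_def)
  also have "\<dots> = (LINT z|M. (norm (fst (f z)))^2) + (LINT z|M. (norm (snd (f z)))^2)"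
    by (rule Bochner_Integration.integral_add) (use 1 2 in \<open>auto simp: L2_def\<close>)
  finally show "(LINT z|M. (norm (f z))^2) = (LINT z|M. (norm (fst (f z)))^2) + (LINT z|M. (norm (snd (f z)))^2)" .
qed

section \<open>Rayleigh quotients, minimizers and eigenfunctions\<close>

definition mass :: "'a::euclidean_space set => ('a => real) => real" where
  "mass D v = (LINT z|lebesgue_on D. v z * v z)"

definition energy :: "'a::euclidean_space set => ('a => 'a) => real" where
  "energy D G = (LINT z|lebesgue_on D. G z \<bullet> G z)"

definition mean_zero :: "'a::euclidean_space set => ('a => real) => bool" where
  "mean_zero D v \<longleftrightarrow> (LINT z|lebesgue_on D. v z) = 0"

lemma mass_nonneg: "0 \<le> mass D v" by (simp add: mass_def)
lemma energy_nonneg: "0 \<le> energy D G" by (simp add: energy_def)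

text \<open>Written without a quotient. It expresses that \<open>\<Lambda>\<close> does not exceed
  the least Rayleigh quotient and is the only form in which minimality is passed on.\<close>

definition rayleigh_bound :: "'a::euclidean_space set => real => bool" where
  "rayleigh_bound D \<Lambda> \<longleftrightarrow> (\<forall>v G. W12 D v G \<and> mean_zero D v \<longrightarrow> \<Lambda> * mass D v \<le> energy D G)"

context
  fixes D :: "'a::euclidean_space set"
  assumes D: "D \<in> sets lebesgue" "finite_measure (lebesgue_on D)" and one: "W12 D (%z. 1) (%z. 0)"
begin

lemma const_L2: "L2 (lebesgue_on D) (%z. c :: real)"
  by (rule L2_bounded[OF D(2), of _ "\<bar>c\<bar>"]) auto

lemma W12_integrable: "W12 D v G ==> integrable (lebesgue_on D) v"
  using L2_inner(1)[OF W12_L2(1)[OF D] const_L2[of 1], of v G] by simp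

lemma mean_zero_lincomb:
  assumes "W12 D v G" "W12 D u H" "mean_zero D v" "mean_zero D u"
  shows "mean_zero D (%z. v z + c * u z)"
  using assms W12_integrable[OF assms(1)] W12_integrable[OF assms(2)] by (simp add: mean_zero_def)

lemma mass_lincomb:
  assumes v: "W12 D v G" and u: "W12 D u H"
  shows "mass D (%z. v z + c * u z) = mass D v + 2 * c * (LINT z|lebesgue_on D. v z * u z) + c^2 * mass D u"
proof -
  note L = W12_L2(1)[OF D v] W12_L2(1)[OF D u]
  have i: "integrable (lebesgue_on D) (%z. v z * v z)" "integrable (lebesgue_on D) (%z. v z * u z)" "integrable (lebesgue_on D) (%z. u z * u z)"
    using L2_inner(1)[OF L(1) L(1)] L2_inner(1)[OF L(1) L(2)] L2_inner(1)[OF L(2) L(2)] by simp_all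
  have "mass D (%z. v z + c * u z) = (LINT z|lebesgue_on D. v z * v z + 2 * c * (v z * u z) + c^2 * (u z * u z))"
    unfolding mass_def by (simp add: algebra_simps power2_eq_square)
  then show ?thesis using i by (simp add: mass_def)
qed

lemma energy_lincomb:
  assumes v: "W12 D v G" and u: "W12 D u H"
  shows "energy D (%z. G z + c *\<^sub>R H z) = energy D G + 2 * c * (LINT z|lebesgue_on D. G z \<bullet> H z) + c^2 * energy D H"
proof -
  note L = W12_L2(2)[OF D v] W12_L2(2)[OF D u]
  note i = L2_inner(1)[OF L(1) L(1)] L2_inner(1)[OF L(1) L(2)] L2_inner(1)[OF L(2) L(2)]
  have "energy D (%z. G z + c *\<^sub>R H z) = (LINT z|lebesgue_on D. G z \<bullet> G z + 2 * c * (G z \<bullet> H z) + c^2 * (H z \<bullet> H z))"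
    unfolding energy_def by (simp add: inner_simps inner_commute algebra_simps power2_eq_square)
  then show ?thesis using i by (simp add: energy_def)
qed

text \<open>First variation: \<open>energy - \<Lambda> * mass\<close> is nonnegative on mean-zero
  functions and 0 at \<open>u\<close>, so its linear part at \<open>u\<close> vanishes in every
  mean-zero direction. Constants may be added to the direction, since they change neither the
  gradient nor the product with the mean-zero function \<open>u\<close>.\<close>

lemma minimizer_eigenfunction:
  assumes R: "rayleigh_bound D \<Lambda>" and u: "W12 D u G" and m: "mean_zero D u"
    and e: "energy D G = \<Lambda> * mass D u" and nz: "mass D u \<noteq> 0"
  shows "neumann_eigenfunction D \<Lambda> u"
  unfolding neumann_eigenfunction_def
proof (intro conjI exI[of _ G] allI impI u)
  show "\<not> (AE z in lebesgue_on D. u z = 0)"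
  proof
    assume ae: "AE z in lebesgue_on D. u z = 0"
    have [measurable]: "u \<in> borel_measurable (lebesgue_on D)" by (rule L2_measurable[OF W12_L2(1)[OF D u]])
    have "mass D u = (LINT z|lebesgue_on D. 0)" unfolding mass_def
      by (rule integral_cong_AE) (use ae in \<open>auto elim!: eventually_mono\<close>)
    then show False using nz by simp
  qed
  fix v H assume v: "W12 D v H"
  define a where "a = (LINT z|lebesgue_on D. v z)"
  define V where "V = measure lebesgue D"
  have one_int: "(LINT z|lebesgue_on D. 1) = measure (lebesgue_on D) D" by (simp add: space_restrict_space)
  define S where "S = (LINT z|lebesgue_on D. 1 :: real)"
  have S0: "S \<noteq> 0"
  proof
    assume "S = 0"
    then have "AE z in lebesgue_on D. (1::real) = 0" unfolding S_def
      using integral_nonneg_eq_0_iff_AE[of "lebesgue_on D" "%z. 1::real"] W12_integrable[OF one] by simp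
    then have n: "AE z in lebesgue_on D. False" by simp
    have "mass D u = (LINT z|lebesgue_on D. 0)" unfolding mass_def
    proof (rule integral_cong_AE)
      have [measurable]: "u \<in> borel_measurable (lebesgue_on D)" by (rule L2_measurable[OF W12_L2(1)[OF D u]])
      show "(%z. u z * u z) \<in> borel_measurable (lebesgue_on D)" by measurable
      show "AE z in lebesgue_on D. u z * u z = 0" using n by eventually_elim simp
    qed simp
    then show False using nz by simp
  qed
  \<comment> \<open>Subtracting the mean turns \<open>v\<close> into an admissible direction with
    the same gradient \<open>H\<close>.\<close>
  define w where "w z = v z + (- (a / S)) * 1" for z
  have w: "W12 D w H" unfolding w_def using W12_lincomb[OF D v one, of "- (a / S)"] by simp
  have wm: "mean_zero D w"
  proof -
    have "(LINT z|lebesgue_on D. w z) = (LINT z|lebesgue_on D. v z) + (LINT z|lebesgue_on D. (- (a / S)) * 1)"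
      unfolding w_def by (intro Bochner_Integration.integral_add integrable_mult_right W12_integrable[OF v] W12_integrable[OF one])
    also have "\<dots> = a + (- (a / S)) * S" unfolding a_def S_def by (simp only: Bochner_Integration.integral_mult_right_zero)
    finally show ?thesis using S0 by (simp add: mean_zero_def)
  qed
  define p q where "p = (LINT z|lebesgue_on D. G z \<bullet> H z)" and "q = (LINT z|lebesgue_on D. u z * w z)"
  have pol: "0 \<le> 2 * t * (p - \<Lambda> * q) + t^2 * (energy D H - \<Lambda> * mass D w)" for t
  proof -
    have "\<Lambda> * mass D (%z. u z + t * w z) \<le> energy D (%z. G z + t *\<^sub>R H z)"
      using R W12_lincomb[OF D u w] mean_zero_lincomb[OF u w m wm] unfolding rayleigh_bound_def by blast
    then show ?thesis unfolding mass_lincomb[OF u w] energy_lincomb[OF u w] p_def[symmetric] q_def[symmetric] e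
      by (simp add: algebra_simps)
  qed
  have "p = \<Lambda> * q"
  proof (rule ccontr)
    assume "p \<noteq> \<Lambda> * q"
    define A B where "A = p - \<Lambda> * q" and "B = energy D H - \<Lambda> * mass D w"
    have A: "A \<noteq> 0" using \<open>p \<noteq> \<Lambda> * q\<close> by (simp add: A_def)
    \<comment> \<open>Opposite in sign to the linear coefficient, and so small that the quadratic
      term consumes at most half of the linear gain.\<close>
    define t where "t = - A / (\<bar>B\<bar> + 1)"
    have "\<bar>B\<bar> + 1 > 0" by simp
    have "t^2 * B \<le> t^2 * (\<bar>B\<bar> + 1)" by (rule mult_left_mono) auto
    also have "\<dots> = - t * A" unfolding t_def using \<open>\<bar>B\<bar> + 1 > 0\<close> by (simp add: power2_eq_square)
    finally have "2 * t * A + t^2 * B \<le> t * A" by (simp add: algebra_simps)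
    also have "t * A = - (A^2 / (\<bar>B\<bar> + 1))" by (simp add: t_def power2_eq_square)
    also have "\<dots> < 0" using A \<open>\<bar>B\<bar> + 1 > 0\<close> by simp
    finally show False using pol[of t] by (simp add: A_def B_def)
  qed
  moreover have "q = (LINT z|lebesgue_on D. u z * v z)"
  proof -
    have "integrable (lebesgue_on D) (%z. u z * v z)" using L2_inner(1)[OF W12_L2(1)[OF D u] W12_L2(1)[OF D v]] by simp
    then have "q = (LINT z|lebesgue_on D. u z * v z) - (a / S) * (LINT z|lebesgue_on D. u z)"
      unfolding q_def w_def using W12_integrable[OF u] by (simp add: right_diff_distrib)
    then show ?thesis using m by (simp add: mean_zero_def)
  qed
  ultimately show "(LINT z|lebesgue_on D. G z \<bullet> H z) = \<Lambda> * (LINT z|lebesgue_on D. u z * v z)" by (simp add: p_def)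
qed

lemma eigenfunction_facts:
  assumes E: "neumann_eigenfunction D \<mu> u" and mu: "\<mu> \<noteq> 0"
  obtains G where "W12 D u G" "mean_zero D u" "energy D G = \<mu> * mass D u" "mass D u > 0"
    "\<And>v H. W12 D v H ==> (LINT z|lebesgue_on D. G z \<bullet> H z) = \<mu> * (LINT z|lebesgue_on D. u z * v z)"
proof -
  obtain G where G: "W12 D u G" and eq: "\<And>v H. W12 D v H ==> (LINT z|lebesgue_on D. G z \<bullet> H z) = \<mu> * (LINT z|lebesgue_on D. u z * v z)"
    and n: "\<not> (AE z in lebesgue_on D. u z = 0)"
    using E unfolding neumann_eigenfunction_def by blast
  have m: "mean_zero D u" using eq[OF one] mu by (simp add: mean_zero_def)
  have e: "energy D G = \<mu> * mass D u" using eq[OF G] by (simp add: energy_def mass_def)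
  have i: "integrable (lebesgue_on D) (%z. u z * u z)" using L2_inner(1)[OF W12_L2(1)[OF D G] W12_L2(1)[OF D G]] by simp
  have "mass D u \<noteq> 0"
    using n integral_nonneg_eq_0_iff_AE[OF i] by (auto simp: mass_def)
  then have "mass D u > 0" using mass_nonneg[of D u] by simp
  then show ?thesis using that G m e eq by blast
qed

text \<open>The side condition \<open>P\<close> lets one argument serve both minima: the trivial one
  gives \<open>mu1\<close>, oddness gives \<open>mu1_odd\<close>. An eigenfunction for a nonzero
  eigenvalue has mean zero, so \<open>rayleigh_bound\<close> applies to every competitor.\<close>

lemma least_eigenvalue:
  assumes R: "rayleigh_bound D \<Lambda>" and l: "\<Lambda> > 0" and P: "neumann_eigenfunction D \<Lambda> u" "P u"
  shows "(LEAST \<mu>. \<mu> \<noteq> 0 \<and> (\<exists>u. neumann_eigenfunction D \<mu> u \<and> P u)) = \<Lambda>"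
proof (rule Least_equality)
  show "\<Lambda> \<noteq> 0 \<and> (\<exists>u. neumann_eigenfunction D \<Lambda> u \<and> P u)" using l P by auto
  fix \<mu> assume "\<mu> \<noteq> 0 \<and> (\<exists>u. neumann_eigenfunction D \<mu> u \<and> P u)"
  then obtain u where "\<mu> \<noteq> 0" "neumann_eigenfunction D \<mu> u" by blast
  then obtain G where G: "W12 D u G" "mean_zero D u" "energy D G = \<mu> * mass D u" "mass D u > 0"
    using eigenfunction_facts by metis
  then have "\<Lambda> * mass D u \<le> \<mu> * mass D u" using R unfolding rayleigh_bound_def by metis
  then show "\<Lambda> \<le> \<mu>" using G(4) by simp
qed

text \<open>Direct method with compactness replaced by \<open>comp\<close>. For a minimizing
  sequence the parallelogram law bounds the energy of a difference by \<open>\<Lambda>\<close> times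
  its mass plus an error; \<open>comp\<close> bounds that mass by a small multiple of the same
  energy plus finitely many functionals, which converge along a subsequence. Absorbing one estimate
  into the other gives a Cauchy sequence in mass and energy together.\<close>

theorem minimizer_exists:
  assumes nt: "\<exists>v G. W12 D v G \<and> mean_zero D v \<and> mass D v \<noteq> 0"
    and comp: "\<And>\<epsilon>. \<epsilon> > 0 ==> \<exists>(n::nat) c. (\<forall>i<n. L2 (lebesgue_on D) (c i)) \<and>
       (\<forall>v G. W12 D v G \<longrightarrow> mass D v \<le> \<epsilon> * energy D G + (\<Sum>i<n. (LINT z|lebesgue_on D. v z * c i z)^2))"
  obtains \<Lambda> u G where "rayleigh_bound D \<Lambda>" "W12 D u G" "mean_zero D u" "mass D u = 1" "energy D G = \<Lambda>"
proof -
  define A where "A = {energy D G |v G. W12 D v G \<and> mean_zero D v \<and> mass D v = 1}"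
  define \<Lambda> where "\<Lambda> = Inf A"
  have bb: "bdd_below A" unfolding A_def bdd_below_def using energy_nonneg by (intro exI[of _ 0]) auto
  have zero: "W12 D (%z. 0) (%z. 0)" using W12_lincomb[OF D one one, of "-1"] by simp
  have norm1: "\<exists>w H. W12 D w H \<and> mean_zero D w \<and> mass D w = 1 \<and> energy D H = energy D G / mass D v"
    if v: "W12 D v G" "mean_zero D v" "mass D v \<noteq> 0" for v G
  proof -
    have pos: "mass D v > 0" using mass_nonneg[of D v] that(3) by simp
    define c where "c = 1 / sqrt (mass D v)"
    have c2: "c^2 = 1 / mass D v" using pos by (simp add: c_def power_divide)
    have "W12 D (%z. 0 + c * v z) (%z. 0 + c *\<^sub>R G z)" by (rule W12_lincomb[OF D zero v(1)])
    moreover have "mean_zero D (%z. 0 + c * v z)" by (rule mean_zero_lincomb[OF zero v(1) _ v(2)]) (simp add: mean_zero_def)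
    moreover have "mass D (%z. 0 + c * v z) = 1" unfolding mass_lincomb[OF zero v(1)] c2 using pos by (simp add: mass_def)
    moreover have "energy D (%z. 0 + c *\<^sub>R G z) = energy D G / mass D v"
      unfolding energy_lincomb[OF zero v(1)] c2 by (simp add: energy_def)
    ultimately show ?thesis by blast
  qed
  have ne: "A \<noteq> {}" using nt norm1 unfolding A_def by blast
  have R: "rayleigh_bound D \<Lambda>"
    unfolding rayleigh_bound_def
  proof (intro allI impI, elim conjE)
    fix v G assume v: "W12 D v G" "mean_zero D v"
    show "\<Lambda> * mass D v \<le> energy D G"
    proof (cases "mass D v = 0")
      case True then show ?thesis using energy_nonneg by simp
    next
      case False
      then have pos: "mass D v > 0" using mass_nonneg[of D v] by simp
      have "energy D G / mass D v \<in> A" unfolding A_def using norm1[OF v False] by force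
      then have "\<Lambda> \<le> energy D G / mass D v" unfolding \<Lambda>_def using bb by (rule cInf_lower)
      then show ?thesis using pos by (simp add: field_simps)
    qed
  qed
  have l0: "0 \<le> \<Lambda>" unfolding \<Lambda>_def using ne energy_nonneg by (intro cInf_greatest) (auto simp: A_def)
  have "\<exists>v G. W12 D v G \<and> mean_zero D v \<and> mass D v = 1 \<and> energy D G < \<Lambda> + 1 / real (Suc n)" for n
  proof -
    have "\<Lambda> < \<Lambda> + 1 / real (Suc n)" by simp
    then obtain a where "a \<in> A" "a < \<Lambda> + 1 / real (Suc n)" unfolding \<Lambda>_def using cInf_lessD[OF ne] by blast
    then show ?thesis unfolding A_def by blast
  qed
  then obtain v0 G0 where v0: "\<And>n. W12 D (v0 n) (G0 n)" "\<And>n. mean_zero D (v0 n)" "\<And>n. mass D (v0 n) = 1"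
    "\<And>n. energy D (G0 n) < \<Lambda> + 1 / real (Suc n)" by metis
  \<comment> \<open>Chosen so that \<open>\<epsilon> * \<Lambda> \<le> 1/2\<close>; the mass of a
    difference can then be absorbed on the left.\<close>
  define \<epsilon> where "\<epsilon> = 1 / (2 * (\<Lambda> + 1))"
  have ep: "\<epsilon> > 0" "\<epsilon> * \<Lambda> \<le> 1/2" using l0 by (auto simp: \<epsilon>_def field_simps)
  obtain N :: nat and c where c: "\<And>i. i < N ==> L2 (lebesgue_on D) (c i)"
    and cb: "\<And>v G. W12 D v G ==> mass D v \<le> \<epsilon> * energy D G + (\<Sum>i<N. (LINT z|lebesgue_on D. v z * c i z)^2)"
    using comp[OF ep(1)] by metis
  define l where "l i n = (LINT z|lebesgue_on D. v0 n z * c i z)" for i n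
  have lb: "\<bar>l i n\<bar> \<le> sqrt (LINT z|lebesgue_on D. (norm (c i z))^2)" if "i < N" for i n
  proof -
    have "(l i n)^2 \<le> mass D (v0 n) * (LINT z|lebesgue_on D. (norm (c i z))^2)"
      using L2_inner(2)[OF W12_L2(1)[OF D v0(1)] c[OF that]] by (simp add: l_def mass_def power2_eq_square)
    then show ?thesis using v0(3) by (simp add: real_le_rsqrt)
  qed
  obtain r where r: "strict_mono (r :: nat => nat)" "\<And>i. i < N ==> convergent (%n. l i (r n))"
    using convergent_subseq_finite[of N l, OF lb] by blast
  define v G where "v n = v0 (r n)" and "G n = G0 (r n)" for n
  have v: "W12 D (v n) (G n)" "mean_zero D (v n)" "mass D (v n) = 1" for n
    using v0 by (auto simp: v_def G_def)
  define \<eta> where "\<eta> n = energy D (G n) - \<Lambda>" for n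
  have et: "0 \<le> \<eta> n" "\<eta> n \<le> 1 / real (Suc n)" for n
  proof -
    show "0 \<le> \<eta> n" using R v[of n] unfolding rayleigh_bound_def \<eta>_def by (metis diff_ge_0_iff_ge mult.right_neutral)
    have "1 / real (Suc (r n)) \<le> 1 / real (Suc n)" using seq_suble[OF r(1), of n] by (intro divide_left_mono) auto
    then show "\<eta> n \<le> 1 / real (Suc n)" using v0(4)[of "r n"] unfolding \<eta>_def G_def by simp
  qed
  have etl: "\<eta> \<longlonglongrightarrow> 0"
    by (rule tendsto_sandwich[OF _ _ tendsto_const LIMSEQ_Suc[OF lim_1_over_n]]) (use et in \<open>auto intro!: always_eventually\<close>)
  define dm de where "dm m n = mass D (%z. v m z + (-1) * v n z)" and "de m n = energy D (%z. G m z + (-1) *\<^sub>R G n z)" for m n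
  define S where "S m n = (\<Sum>i<N. (l i (r m) - l i (r n))^2)" for m n
  \<comment> \<open>Masses are normalized to 1, so by the parallelogram law the sum of two members
    has mass \<open>4 - dm m n\<close>; the Rayleigh bound for this sum limits \<open>de m n\<close>
    from above.\<close>
  have e1: "de m n \<le> 2 * \<eta> m + 2 * \<eta> n + \<Lambda> * dm m n" for m n
  proof -
    have "\<Lambda> * mass D (%z. v m z + 1 * v n z) \<le> energy D (%z. G m z + 1 *\<^sub>R G n z)"
      using R W12_lincomb[OF D v(1) v(1)] mean_zero_lincomb[OF v(1) v(1) v(2) v(2)] unfolding rayleigh_bound_def by blast
    then show ?thesis unfolding dm_def de_def mass_lincomb[OF v(1) v(1)] energy_lincomb[OF v(1) v(1)] v(3) \<eta>_def
      by (simp add: algebra_simps)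
  qed
  have e2: "dm m n \<le> \<epsilon> * de m n + S m n" for m n
  proof -
    have "(LINT z|lebesgue_on D. (v m z + (-1) * v n z) * c i z) = l i (r m) - l i (r n)" if "i < N" for i
      using L2_inner(1)[OF W12_L2(1)[OF D v(1)[of m]] c[OF that]] L2_inner(1)[OF W12_L2(1)[OF D v(1)[of n]] c[OF that]]
      by (simp add: l_def v_def algebra_simps)
    then show ?thesis using cb[OF W12_lincomb[OF D v(1)[of m] v(1)[of n], of "-1"]] by (simp add: dm_def de_def S_def)
  qed
  have e3: "dm m n \<le> 4 * \<epsilon> * (\<eta> m + \<eta> n) + 2 * S m n" for m n
  proof -
    have "\<epsilon> * de m n \<le> \<epsilon> * (2 * \<eta> m + 2 * \<eta> n + \<Lambda> * dm m n)" using e1 ep by (intro mult_left_mono) auto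
    moreover have "(\<epsilon> * \<Lambda>) * dm m n \<le> 1/2 * dm m n"
      using ep mass_nonneg by (intro mult_right_mono) (auto simp: dm_def)
    ultimately show ?thesis using e2[of m n] by (simp add: algebra_simps)
  qed
  \<comment> \<open>Function and gradient are paired, so that one appeal to completeness yields both
    limits.\<close>
  define F where "F n z = (v n z, G n z)" for n z
  have F: "L2 (lebesgue_on D) (F n)" for n unfolding F_def by (rule L2_Pair[OF W12_L2[OF D v(1)]])
  have Fd: "(LINT z|lebesgue_on D. (norm (F m z - F n z))^2) = dm m n + de m n" for m n
    using L2_fst_snd(5)[OF L2_diff[OF F[of m] F[of n]]]
    by (simp add: F_def dm_def de_def mass_def energy_def power2_norm_eq_inner flip: power2_eq_square)
  have CS: "\<exists>K. \<forall>m\<ge>K. \<forall>n\<ge>K. (LINT z|lebesgue_on D. (norm (F m z - F n z))^2) < e" if e: "e > 0" for e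
  proof -
    \<comment> \<open>The choices below let the \<open>\<eta>\<close> terms use at most
      \<open>e / 2\<close> and the functionals at most \<open>e / 4\<close>.\<close>
    define B where "B = (1 + \<Lambda>) * (4 * \<epsilon>) + 2"
    have B: "B > 0" unfolding B_def using l0 ep by (intro add_nonneg_pos mult_nonneg_nonneg) auto
    define e' where "e' = e / (4 * B)"
    have e': "e' > 0" using e B by (simp add: e'_def)
    define e'' where "e'' = e / (8 * (1 + \<Lambda>) * (real N + 1))"
    have e'': "e'' > 0" using e l0 by (simp add: e''_def)
    have "\<forall>\<^sub>F n in sequentially. \<eta> n < e'" by (rule order_tendstoD(2)[OF etl e'])
    then obtain K1 where K1: "\<And>n. n \<ge> K1 ==> \<eta> n < e'" unfolding eventually_sequentially by blast
    have "\<exists>K. \<forall>m\<ge>K. \<forall>n\<ge>K. (l i (r m) - l i (r n))^2 < e''" if i: "i < N" for i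
    proof -
      have "Cauchy (%n. l i (r n))" by (rule convergent_Cauchy[OF r(2)[OF i]])
      then obtain K where K: "\<forall>m\<ge>K. \<forall>n\<ge>K. norm (l i (r m) - l i (r n)) < sqrt e''"
        using e'' unfolding Cauchy_iff by (meson real_sqrt_gt_zero)
      have "(l i (r m) - l i (r n))^2 < e''" if "m \<ge> K" "n \<ge> K" for m n
      proof -
        have "\<bar>l i (r m) - l i (r n)\<bar> < sqrt e''" using K that by auto
        then have "\<bar>l i (r m) - l i (r n)\<bar>^2 < (sqrt e'')^2" by (intro power_strict_mono) auto
        then show ?thesis using e'' by simp
      qed
      then show ?thesis by blast
    qed
    then have "\<forall>i. \<exists>K. i < N \<longrightarrow> (\<forall>m\<ge>K. \<forall>n\<ge>K. (l i (r m) - l i (r n))^2 < e'')" by auto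
    from choice[OF this] obtain K2 where K2: "\<And>i m n. i < N ==> m \<ge> K2 i ==> n \<ge> K2 i ==> (l i (r m) - l i (r n))^2 < e''" by blast
    define K where "K = K1 + (\<Sum>i<N. K2 i)"
    have KK: "K1 \<le> K" "\<And>i. i < N ==> K2 i \<le> K"
      unfolding K_def using member_le_sum[of _ "{..<N}" K2] by (auto simp: trans_le_add2)
    have "(LINT z|lebesgue_on D. (norm (F m z - F n z))^2) < e" if mn: "m \<ge> K" "n \<ge> K" for m n
    proof -
      have em: "\<eta> m < e'" "\<eta> n < e'" using K1 KK mn by auto
      have "S m n \<le> (\<Sum>i<N. e'')" unfolding S_def
      proof (rule sum_mono)
        fix i assume "i \<in> {..<N}"
        then have "(l i (r m) - l i (r n))^2 < e''" using KK(2)[of i] mn by (intro K2) auto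
        then show "(l i (r m) - l i (r n))^2 \<le> e''" by simp
      qed
      also have "\<dots> \<le> (real N + 1) * e''" using e'' by (simp add: algebra_simps)
      also have "\<dots> = e / (8 * (1 + \<Lambda>))" using l0 by (simp add: e''_def)
      finally have Sm: "S m n \<le> e / (8 * (1 + \<Lambda>))" .
      have "dm m n + de m n \<le> (1 + \<Lambda>) * dm m n + 2 * (\<eta> m + \<eta> n)" using e1[of m n] by (simp add: algebra_simps)
      also have "\<dots> \<le> (1 + \<Lambda>) * (4 * \<epsilon> * (\<eta> m + \<eta> n) + 2 * S m n) + 2 * (\<eta> m + \<eta> n)"
        using e3[of m n] l0 by (intro add_right_mono mult_left_mono) auto
      also have "\<dots> = B * (\<eta> m + \<eta> n) + 2 * (1 + \<Lambda>) * S m n" by (simp add: B_def algebra_simps)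
      also have "\<dots> \<le> B * (2 * e') + 2 * (1 + \<Lambda>) * (e / (8 * (1 + \<Lambda>)))"
        using em B Sm l0 by (intro add_mono mult_left_mono) auto
      also have "\<dots> = e / 2 + e / 4" using B l0 by (simp add: e'_def field_simps)
      also have "\<dots> < e" using e by simp
      finally show ?thesis unfolding Fd .
    qed
    then show ?thesis by blast
  qed
  obtain f where f: "L2 (lebesgue_on D) f" "(%n. LINT z|lebesgue_on D. (norm (F n z - f z))^2) \<longlonglongrightarrow> 0"
    by (rule L2_complete[OF F CS]) (assumption | rule that)+
  define u H where "u z = fst (f z)" and "H z = snd (f z)" for z
  have uH: "L2 (lebesgue_on D) u" "L2 (lebesgue_on D) H" unfolding u_def H_def by (rule L2_fst_snd[OF f(1)])+
  have lv: "(%n. LINT z|lebesgue_on D. (norm (v n z - u z))^2) \<longlonglongrightarrow> 0"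
    by (rule tendsto_sandwich[OF _ _ tendsto_const f(2)])
      (use L2_fst_snd(3)[OF L2_diff[OF F f(1)]] in \<open>auto simp: F_def u_def intro!: always_eventually\<close>)
  have lG: "(%n. LINT z|lebesgue_on D. (norm (G n z - H z))^2) \<longlonglongrightarrow> 0"
    by (rule tendsto_sandwich[OF _ _ tendsto_const f(2)])
      (use L2_fst_snd(4)[OF L2_diff[OF F f(1)]] in \<open>auto simp: F_def H_def intro!: always_eventually\<close>)
  have "W12 D u H" by (rule W12_limit[OF D v(1) uH lv lG])
  moreover have "mean_zero D u"
    using L2_tendsto_inner[OF W12_L2(1)[OF D v(1)] uH(1) const_L2[of 1] lv] v(2) by (simp add: mean_zero_def LIMSEQ_const_iff)
  moreover have "mass D u = 1"
    using L2_tendsto_norm[OF W12_L2(1)[OF D v(1)] uH(1) lv] v(3) by (simp add: mass_def LIMSEQ_const_iff)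
  moreover have "energy D H = \<Lambda>"
  proof -
    have "(%n. energy D (G n)) \<longlonglongrightarrow> energy D H"
      using L2_tendsto_norm[OF W12_L2(2)[OF D v(1)] uH(2) lG] by (simp add: energy_def)
    moreover have "(%n. energy D (G n)) \<longlonglongrightarrow> \<Lambda>" using etl unfolding \<eta>_def by (simp add: LIM_zero_iff)
    ultimately show ?thesis by (rule LIMSEQ_unique)
  qed
  ultimately show ?thesis using that R by blast
qed

end

section \<open>Change of variables\<close>

lemma borel_plane_of_vec: "(%v::real^2. (v $ 1, v $ 2)) \<in> borel_measurable borel"
  by (intro borel_measurable_continuous_onI continuous_intros)

text \<open>Carries Lebesgue measure from coordinate vectors, where Jacobian determinants are at
  hand, to pairs of reals.\<close>

lemma lborel_plane: "distr lborel borel (%v::real^2. (v $ 1, v $ 2)) = (lborel :: (real \<times> real) measure)"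
proof (rule lborel_eqI[symmetric])
  fix l u :: "real \<times> real" assume le: "\<And>b. b \<in> Basis ==> l \<bullet> b \<le> u \<bullet> b"
  have le': "fst l \<le> fst u" "snd l \<le> snd u" using le[of "(1,0)"] le[of "(0,1)"] by (auto simp: Basis_plane inner_prod_def)
  define a b :: "real^2" where "a = vector [fst l, snd l]" and "b = vector [fst u, snd u]"
  have eq: "(%v::real^2. (v $ 1, v $ 2)) -` box l u = box a b"
    by (auto simp: box_def Basis_plane inner_prod_def mem_box_cart a_def b_def forall_2 vector_2 Basis_vec_def cart_eq_inner_axis[symmetric])
  have "emeasure (distr lborel borel (%v::real^2. (v $ 1, v $ 2))) (box l u) = emeasure lborel (box a b)"
    using borel_plane_of_vec by (simp add: emeasure_distr eq)
  also have "\<dots> = (\<Prod>i\<in>Basis. (b - a) \<bullet> i)"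
  proof (rule emeasure_lborel_box)
    fix i :: "real^2" assume "i \<in> Basis"
    then obtain j where "i = axis j 1" by (auto simp: Basis_vec_def)
    then show "a \<bullet> i \<le> b \<bullet> i" using le' exhaust_2[of j] by (auto simp: a_def b_def inner_axis)
  qed
  also have "(\<Prod>i\<in>Basis. (b - a) \<bullet> i) = (\<Prod>j\<in>UNIV. (b - a) $ j)"
  proof -
    have 1: "(Basis :: (real^2) set) = (%j. axis j 1) ` UNIV" by (auto simp: Basis_vec_def)
    have 2: "inj (%j::2. axis j (1::real))" by (auto simp: inj_on_def axis_eq_axis)
    show ?thesis unfolding 1 prod.reindex[OF 2] by (simp add: inner_axis)
  qed
  also have "\<dots> = (\<Prod>b\<in>Basis. (u - l) \<bullet> b)"
    by (simp add: UNIV_2 a_def b_def Basis_plane inner_prod_def)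
  finally show "emeasure (distr lborel borel (%v::real^2. (v $ 1, v $ 2))) (box l u) = ennreal (\<Prod>b\<in>Basis. (u - l) \<bullet> b)" by simp
qed simp

text \<open>\<open>a\<close>, \<open>b\<close>, \<open>c\<close>, \<open>e\<close> are the entries
  of the Jacobian matrix, row by row. The map is conjugated with the identification of pairs and
  vectors, where the volume formula for injective differentiable maps applies.\<close>

lemma emeasure_image_plane:
  fixes \<Phi> :: "real \<times> real => real \<times> real" and d :: "real \<times> real => real"
  assumes B: "B \<in> sets borel" and inj: "inj_on \<Phi> B" and im: "\<Phi> ` B \<in> sets borel"
    and d: "\<And>z. z \<in> B ==> (\<Phi> has_derivative (%h. (a z * fst h + b z * snd h, c z * fst h + e z * snd h))) (at z)"
    and J: "\<And>z. z \<in> B ==> \<bar>a z * e z - b z * c z\<bar> = J z" and Ji: "integrable lborel (%z. indicator B z * J z)"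
  shows "emeasure lborel (\<Phi> ` B) = ennreal (LINT z|lborel. indicator B z * J z)"
proof -
  define P where "P = (%v::real^2. (v $ 1, v $ 2))"
  define Q where "Q z = (\<chi> i::2. if i = 1 then fst z else snd z)" for z :: "real \<times> real"
  have PQ: "P (Q z) = z" "Q (P v) = v" for z v by (auto simp: P_def Q_def vec_eq_iff forall_2)
  have Pm: "P \<in> borel_measurable borel" unfolding P_def by (rule borel_plane_of_vec)
  have Pl: "bounded_linear P" unfolding P_def
    by (intro bounded_linear_Pair bounded_linear_vec_nth)
  have Ql: "bounded_linear Q"
  proof -
    have "linear Q" by (rule linearI) (auto simp: Q_def vec_eq_iff)
    then show ?thesis by (simp add: linear_conv_bounded_linear)
  qed
  define S where "S = P -` B"
  have S: "S \<in> sets borel" using measurable_sets[OF Pm B] by (simp add: S_def)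
  define F where "F v = Q (\<Phi> (P v))" for v
  define F' where "F' v = (%h. Q (a (P v) * fst (P h) + b (P v) * snd (P h), c (P v) * fst (P h) + e (P v) * snd (P h)))" for v
  have der: "(F has_derivative F' v) (at v within S)" if "v \<in> S" for v
  proof -
    have "P v \<in> B" using that by (simp add: S_def)
    from d[OF this] have 1: "((%v. \<Phi> (P v)) has_derivative (%h. (a (P v) * fst (P h) + b (P v) * snd (P h), c (P v) * fst (P h) + e (P v) * snd (P h)))) (at v within S)"
      by (rule has_derivative_compose[OF bounded_linear_imp_has_derivative[OF Pl]])
    show ?thesis unfolding F_def F'_def by (rule bounded_linear.has_derivative[OF Ql 1])
  qed
  have det: "\<bar>det (matrix (F' v))\<bar> = J (P v)" if "v \<in> S" for v
  proof -
    have "det (matrix (F' v)) = a (P v) * e (P v) - b (P v) * c (P v)"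
      by (simp add: det_2 matrix_def F'_def P_def Q_def axis_def)
    then show ?thesis using J[of "P v"] that by (simp add: S_def)
  qed
  have injF: "inj_on F S"
  proof (rule inj_onI)
    fix u v assume uv: "u \<in> S" "v \<in> S" "F u = F v"
    then have "\<Phi> (P u) = \<Phi> (P v)" unfolding F_def by (metis PQ(1))
    then have "P u = P v" using inj_onD[OF inj] uv by (simp add: S_def)
    then show "u = v" by (metis PQ(2))
  qed
  have FS: "F ` S = P -` (\<Phi> ` B)"
  proof
    show "F ` S \<subseteq> P -` (\<Phi> ` B)" by (auto simp: F_def S_def PQ)
    show "P -` (\<Phi> ` B) \<subseteq> F ` S"
    proof
      fix v assume "v \<in> P -` (\<Phi> ` B)"
      then obtain z where z: "z \<in> B" "P v = \<Phi> z" by auto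
      then have "v = F (Q z)" unfolding F_def by (metis PQ)
      then show "v \<in> F ` S" using z by (auto simp: S_def PQ)
    qed
  qed
  have fm: "(%z. indicator B z * J z) \<in> borel_measurable lborel" using Ji by auto
  have dl: "distr lborel lborel P = lborel"
  proof -
    have "distr lborel lborel P = distr lborel borel P" by (rule distr_cong) simp_all
    then show ?thesis using lborel_plane unfolding P_def by simp
  qed
  have Pm': "P \<in> lborel \<rightarrow>\<^sub>M lborel" using Pm by simp
  have i2: "integrable lborel (%v. indicator S v * J (P v))"
  proof -
    have "integrable (distr lborel lborel P) (%z. indicator B z * J z)" unfolding dl by (rule Ji)
    from integrable_distr[OF Pm' this] show ?thesis by (simp add: S_def indicator_def)
  qed
  have e2: "(LINT v|lborel. indicator S v * J (P v)) = (LINT z|lborel. indicator B z * J z)"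
    using integral_distr[OF Pm' fm] unfolding dl by (simp add: S_def indicator_def)
  define m where "m = (LINT z|lborel. indicator B z * J z)"
  have "((%v. indicator S v * J (P v)) has_integral m) UNIV"
    using has_integral_integral_lborel[OF i2] unfolding e2 m_def .
  then have "((%v. if v \<in> S then \<bar>det (matrix (F' v))\<bar> else 0) has_integral m) UNIV"
    by (rule has_integral_eq[rotated]) (auto simp: det)
  then have "((%v. \<bar>det (matrix (F' v))\<bar>) has_integral m) S" by (simp only: has_integral_restrict_UNIV)
  then have "F ` S \<in> lmeasurable \<and> measure lebesgue (F ` S) = m"
    using has_measure_differentiable_image[OF _ der injF, of m] S by (simp add: sets_completionI_sets)
  moreover have FSb: "F ` S \<in> sets borel" unfolding FS using measurable_sets[OF Pm im] by simp
  ultimately have "emeasure lborel (F ` S) = ennreal m"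
    by (auto simp: fmeasurable_def emeasure_eq_ennreal_measure)
  moreover have "emeasure lborel (\<Phi> ` B) = emeasure lborel (F ` S)"
  proof -
    have "emeasure lborel (\<Phi> ` B) = emeasure (distr lborel lborel P) (\<Phi> ` B)" unfolding dl ..
    also have "\<dots> = emeasure lborel (P -` (\<Phi> ` B) \<inter> space lborel)"
      by (rule emeasure_distr[OF Pm']) (use im in simp)
    finally show ?thesis using FS by simp
  qed
  ultimately show ?thesis by (simp add: m_def)
qed

lemma compact_in_open_interval:
  assumes "compact (K :: real set)" "K \<subseteq> {0<..<a}" "0 < a"
  obtains \<alpha> \<beta> where "0 < \<alpha>" "\<alpha> < \<beta>" "\<beta> < a" "K \<subseteq> {\<alpha>..\<beta>}"
proof (cases "K = {}")
  case True
  then show ?thesis using assms by (intro that[of "a/3" "2*a/3"]) auto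
next
  case False
  obtain m M where m: "m \<in> K" "\<forall>t\<in>K. m \<le> t" and M: "M \<in> K" "\<forall>t\<in>K. t \<le> M"
    using compact_attains_inf[OF assms(1) False] compact_attains_sup[OF assms(1) False] by metis
  have "0 < m" "M < a" "m \<le> M" using m M assms(2) by auto
  then show ?thesis using m M by (intro that[of "m/2" "(M + a)/2"]) (auto simp: field_simps intro: order_trans, (smt (verit))+)
qed

text \<open>Interface to the geometry. \<open>(tx, ty)\<close> is the unit tangent, its two
  derivative laws are the Frenet equations, and the strip leaves the curve along
  \<open>(ty, - tx)\<close>. The derivative \<open>k'\<close> is included because test functions on
  the rectangle will be divided by the weight \<open>w\<close>.\<close>

locale curved_strip =
  fixes L \<delta> :: real and x y tx ty k k' :: "real => real"
  assumes L: "0 < L" and \<delta>: "0 < \<delta>"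
    and x': "\<And>s. 0 < s ==> s < L ==> (x has_real_derivative tx s) (at s)"
    and y': "\<And>s. 0 < s ==> s < L ==> (y has_real_derivative ty s) (at s)"
    and tx': "\<And>s. 0 < s ==> s < L ==> (tx has_real_derivative - k s * ty s) (at s)"
    and ty': "\<And>s. 0 < s ==> s < L ==> (ty has_real_derivative k s * tx s) (at s)"
    and k': "\<And>s. 0 < s ==> s < L ==> (k has_real_derivative k' s) (at s)"
    and cont: "continuous_on {0..L} x" "continuous_on {0..L} y" "continuous_on {0..L} tx"
      "continuous_on {0..L} ty" "continuous_on {0..L} k" "continuous_on {0..L} k'"
    and unit: "\<And>s. 0 \<le> s ==> s \<le> L ==> (tx s)^2 + (ty s)^2 = 1"
    and wpos: "\<And>s r. 0 \<le> s ==> s \<le> L ==> 0 \<le> r ==> r \<le> \<delta> ==> 0 < 1 + r * k s"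
    and inj: "inj_on (%(s, r). (x s + r * ty s, y s - r * tx s)) ({0..L} \<times> {0..\<delta>})"
begin

abbreviation "\<mu> \<equiv> iv2 L \<delta>"

definition \<Phi> :: "real \<times> real => real \<times> real" where
  "\<Phi> z = (x (fst z) + snd z * ty (fst z), y (fst z) - snd z * tx (fst z))"

definition w :: "real \<times> real => real" where "w z = 1 + snd z * k (fst z)"

abbreviation R where "R \<equiv> {0<..<L} \<times> {0<..<\<delta>}"
abbreviation Rc where "Rc \<equiv> {0..L} \<times> {0..\<delta>}"

definition D where "D = \<Phi> ` R"
definition \<Psi> where "\<Psi> = inv_into Rc \<Phi>"

lemma inj_\<Phi>: "inj_on \<Phi> Rc"
proof -
  have "\<Phi> = (%(s, r). (x s + r * ty s, y s - r * tx s))" by (auto simp: \<Phi>_def fun_eq_iff)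
  then show ?thesis using inj by simp
qed

lemma continuous_of_fst: "continuous_on {0..L} f ==> continuous_on Rc (%z. f (fst z))" for f :: "real => real"
  by (rule continuous_on_compose2[of "{0..L}" f]) (auto intro: continuous_on_fst continuous_on_id)

lemma w_cont: "continuous_on Rc w"
  unfolding w_def[abs_def]
  by (intro continuous_on_add continuous_on_mult continuous_on_const continuous_on_snd continuous_on_id continuous_of_fst cont)

lemma \<Phi>_cont: "continuous_on Rc \<Phi>"
  unfolding \<Phi>_def[abs_def]
  by (intro continuous_on_Pair continuous_on_add continuous_on_diff continuous_on_mult continuous_on_snd continuous_on_id continuous_of_fst cont)

lemma R_sub: "R \<subseteq> Rc" by auto

lemma w_pos: "z \<in> Rc ==> 0 < w z"
  using wpos[of "fst z" "snd z"] by (auto simp: w_def)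

lemma w_bounds: obtains c C where "0 < c" "0 < C" "\<And>z. z \<in> Rc ==> c \<le> w z" "\<And>z. z \<in> Rc ==> w z \<le> C"
proof -
  have K: "compact (w ` Rc)" by (intro compact_continuous_image w_cont compact_Times compact_Icc)
  have ne: "w ` Rc \<noteq> {}" using L \<delta> by auto
  obtain c where c: "c \<in> w ` Rc" "\<forall>t\<in>w ` Rc. c \<le> t" using compact_attains_inf[OF K ne] by blast
  obtain C where C: "C \<in> w ` Rc" "\<forall>t\<in>w ` Rc. t \<le> C" using compact_attains_sup[OF K ne] by blast
  show ?thesis using c C w_pos by (intro that[of c C]) auto
qed

lemma R_open: "open R" by (intro open_Times) auto

text \<open>The columns are \<open>w\<close> times the tangent and the unit vector
  \<open>(ty, - tx)\<close>. They are orthogonal, so the determinant is \<open>- w\<close> and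
  inversion is easy.\<close>

lemma \<Phi>_deriv:
  assumes "z \<in> R"
  shows "(\<Phi> has_derivative (%h. (w z * tx (fst z) * fst h + ty (fst z) * snd h, w z * ty (fst z) * fst h + (- tx (fst z)) * snd h))) (at z)"
proof -
  have s: "0 < fst z" "fst z < L" using assms by auto
  have c: "((%z. f (fst z)) has_derivative (%h. f' * fst h)) (at z)"
    if "(f has_real_derivative f') (at (fst z))" for f f'
    by (rule has_derivative_compose[of fst fst z UNIV f, OF _ that[unfolded has_field_derivative_def]])
      (auto intro!: derivative_eq_intros)
  show ?thesis unfolding \<Phi>_def[abs_def]
    by (auto intro!: derivative_eq_intros c[OF x'[OF s]] c[OF y'[OF s]] c[OF tx'[OF s]] c[OF ty'[OF s]]
        simp: w_def algebra_simps)
qed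

lemma D_open: "open D"
  unfolding D_def by (rule invariance_of_domain[OF continuous_on_subset[OF \<Phi>_cont R_sub] R_open inj_on_subset[OF inj_\<Phi> R_sub]])

lemma \<Psi>_\<Phi>: "z \<in> Rc ==> \<Psi> (\<Phi> z) = z"
  unfolding \<Psi>_def by (rule inv_into_f_f[OF inj_\<Phi>])

lemma \<Psi>_R: "z \<in> D ==> \<Psi> z \<in> R" and \<Phi>_\<Psi>: "z \<in> D ==> \<Phi> (\<Psi> z) = z"
proof -
  have "\<Psi> z \<in> R \<and> \<Phi> (\<Psi> z) = z" if zD: "z \<in> D"
  proof -
    obtain u where u: "z = \<Phi> u" "u \<in> R" by (rule imageE[OF zD[unfolded D_def]])
    have "\<Psi> z = u" unfolding u(1) by (rule \<Psi>_\<Phi>[OF subsetD[OF R_sub u(2)]])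
    then show ?thesis using u by (simp only:)
  qed
  then show "z \<in> D ==> \<Psi> z \<in> R" "z \<in> D ==> \<Phi> (\<Psi> z) = z" by blast+
qed

lemma \<Psi>_cont: "continuous_on (\<Phi> ` Rc) \<Psi>"
  by (rule continuous_on_inv[OF \<Phi>_cont]) (auto intro!: compact_Times \<Psi>_\<Phi>)

lemma D_sub: "D \<subseteq> \<Phi> ` Rc" unfolding D_def using R_sub by (rule image_mono)

text \<open>A matrix with orthogonal columns of lengths \<open>w\<close> and 1 is inverted by
  transposing and dividing the first row by \<open>w\<close>. Differentiability of the inverse map
  only needs its continuity, which compactness of the closed rectangle provides.\<close>

lemma \<Psi>_deriv:
  assumes z: "z \<in> D"
  shows "(\<Psi> has_derivative (%h. ((tx (fst (\<Psi> z)) * fst h + ty (fst (\<Psi> z)) * snd h) / w (\<Psi> z),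
    ty (fst (\<Psi> z)) * fst h - tx (fst (\<Psi> z)) * snd h))) (at z)"
proof (rule has_derivative_inverse_basic[where f = \<Phi> and T = D])
  have R: "\<Psi> z \<in> R" by (rule \<Psi>_R[OF z])
  show "(\<Phi> has_derivative (%h. (w (\<Psi> z) * tx (fst (\<Psi> z)) * fst h + ty (fst (\<Psi> z)) * snd h,
      w (\<Psi> z) * ty (fst (\<Psi> z)) * fst h + (- tx (fst (\<Psi> z))) * snd h))) (at (\<Psi> z))"
    by (rule \<Phi>_deriv[OF R])
  have "linear (%h. ((tx (fst (\<Psi> z)) * fst h + ty (fst (\<Psi> z)) * snd h) / w (\<Psi> z),
    ty (fst (\<Psi> z)) * fst h - tx (fst (\<Psi> z)) * snd h))"
    by (rule linearI) (simp_all add: algebra_simps add_divide_distrib diff_divide_distrib)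
  then show "bounded_linear (%h. ((tx (fst (\<Psi> z)) * fst h + ty (fst (\<Psi> z)) * snd h) / w (\<Psi> z),
    ty (fst (\<Psi> z)) * fst h - tx (fst (\<Psi> z)) * snd h))" by (simp add: linear_conv_bounded_linear)
  have wz: "w (\<Psi> z) > 0" by (rule w_pos[OF subsetD[OF R_sub R]])
  have u: "tx (fst (\<Psi> z)) * tx (fst (\<Psi> z)) + ty (fst (\<Psi> z)) * ty (fst (\<Psi> z)) = 1"
    using unit[of "fst (\<Psi> z)"] R by (auto simp: power2_eq_square)
  have alg: "(t1 * (W * t1 * h1 + t2 * h2) + t2 * (W * t2 * h1 + (- t1) * h2)) / W = h1"
    "t2 * (W * t1 * h1 + t2 * h2) - t1 * (W * t2 * h1 + (- t1) * h2) = h2"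
    if "t1 * t1 + t2 * t2 = 1" "W > 0" for t1 t2 W h1 h2 :: real
  proof -
    have "t1 * (W * t1 * h1 + t2 * h2) + t2 * (W * t2 * h1 + (- t1) * h2) = W * h1 * (t1 * t1 + t2 * t2)"
      by (simp add: algebra_simps)
    then show "(t1 * (W * t1 * h1 + t2 * h2) + t2 * (W * t2 * h1 + (- t1) * h2)) / W = h1" using that by simp
    have "t2 * (W * t1 * h1 + t2 * h2) - t1 * (W * t2 * h1 + (- t1) * h2) = h2 * (t1 * t1 + t2 * t2)"
      by (simp add: algebra_simps)
    then show "t2 * (W * t1 * h1 + t2 * h2) - t1 * (W * t2 * h1 + (- t1) * h2) = h2" using that by simp
  qed
  show "(%h. ((tx (fst (\<Psi> z)) * fst h + ty (fst (\<Psi> z)) * snd h) / w (\<Psi> z),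
    ty (fst (\<Psi> z)) * fst h - tx (fst (\<Psi> z)) * snd h)) \<circ> (%h. (w (\<Psi> z) * tx (fst (\<Psi> z)) * fst h + ty (fst (\<Psi> z)) * snd h,
      w (\<Psi> z) * ty (fst (\<Psi> z)) * fst h + (- tx (fst (\<Psi> z))) * snd h)) = id"
    using alg[OF u wz] by (simp add: fun_eq_iff)
  show "continuous (at z) \<Psi>"
    using continuous_on_subset[OF \<Psi>_cont D_sub] D_open z by (simp add: continuous_on_eq_continuous_at)
qed (use D_open z \<Phi>_\<Psi> in auto)

lemma D_borel: "D \<in> sets borel" using D_open by simp

lemma w_measurable [measurable]: "w \<in> borel_measurable \<mu>"
  by (rule borel_measurable_iv2_continuous[OF continuous_on_subset[OF w_cont R_sub]])

lemma \<Phi>_measurable: "\<Phi> \<in> \<mu> \<rightarrow>\<^sub>M restrict_space lborel D"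
  by (rule measurable_restrict_space2)
    (auto simp: D_def intro!: borel_measurable_iv2_continuous[OF continuous_on_subset[OF \<Phi>_cont R_sub]] simp del: split_paired_All)

lemma \<Psi>_measurable: "\<Psi> \<in> restrict_space lborel D \<rightarrow>\<^sub>M \<mu>"
  unfolding iv2_eq_lborel
proof (rule measurable_restrict_space2)
  show "\<Psi> \<in> space (restrict_space lborel D) \<rightarrow> R" using \<Psi>_R by (auto simp: space_restrict_space)
  have "\<Psi> \<in> borel_measurable (restrict_space borel D)"
    by (rule borel_measurable_continuous_on_restrict[OF continuous_on_subset[OF \<Psi>_cont D_sub]])
  then show "\<Psi> \<in> restrict_space lborel D \<rightarrow>\<^sub>M lborel"
    by (simp add: measurable_cong_sets[OF sets_restrict_space_cong[OF sets_lborel] refl])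
qed

definition MR where "MR = density \<mu> (%z. ennreal (w z))"

text \<open>Checked on each Borel set by the area formula for its preimage, with absolute Jacobian
  determinant \<open>w\<close>. From here on integrals over \<open>D\<close> are weighted integrals
  over the rectangle.\<close>

lemma distr_\<Phi>: "distr MR (restrict_space lborel D) \<Phi> = restrict_space lborel D"
proof (rule measure_eqI)
  have Pm: "\<Phi> \<in> MR \<rightarrow>\<^sub>M restrict_space lborel D" using \<Phi>_measurable by (simp add: MR_def)
  fix A assume "A \<in> sets (distr MR (restrict_space lborel D) \<Phi>)"
  then have A: "A \<in> sets (restrict_space lborel D)" by simp
  then have Ab: "A \<in> sets borel" "A \<subseteq> D" using D_borel by (auto simp: sets_restrict_space_iff)
  define B where "B = \<Phi> -` A \<inter> R"
  have B: "B \<in> sets \<mu>" using measurable_sets[OF \<Phi>_measurable A] by (simp add: B_def)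
  then have Bb: "B \<in> sets borel" unfolding iv2_eq_lborel using rect_borel by (auto simp: sets_restrict_space)
  have im: "\<Phi> ` B = A"
  proof
    show "\<Phi> ` B \<subseteq> A" by (rule image_subsetI) (simp add: B_def)
    show "A \<subseteq> \<Phi> ` B"
    proof
      fix z assume z: "z \<in> A"
      then have "z \<in> D" using Ab(2) by blast
      then have "\<Psi> z \<in> B" "z = \<Phi> (\<Psi> z)" using z \<Psi>_R \<Phi>_\<Psi> by (simp_all add: B_def)
      then show "z \<in> \<Phi> ` B" by (rule image_eqI[rotated])
    qed
  qed
  obtain c C where C: "0 < C" "\<And>z. z \<in> Rc ==> w z \<le> C" using w_bounds by metis
  have [measurable]: "(indicator B :: _ => real) \<in> borel_measurable \<mu>" using B by simp
  have Bi: "integrable \<mu> (%z. indicator B z * w z)"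
  proof (rule iv2.integrable_const_bound[where B = C])
    show "AE z in \<mu>. norm (indicator B z * w z) \<le> C"
    proof (rule AE_I2)
      fix z assume "z \<in> space \<mu>"
      then have "z \<in> Rc" using R_sub by auto
      then show "norm (indicator B z * w z) \<le> C" using C w_pos[of z] by (auto simp: indicator_def)
    qed
  qed measurable
  have e: "indicator R z * (indicator B z * w z) = indicator B z * w z" for z by (auto simp: indicator_def B_def)
  have "emeasure (distr MR (restrict_space lborel D) \<Phi>) A = emeasure MR B"
    unfolding emeasure_distr[OF Pm A] by (simp add: B_def MR_def)
  also have "\<dots> = (\<integral>\<^sup>+z. ennreal (w z) * indicator B z \<partial>\<mu>)"
    unfolding MR_def by (rule emeasure_density) (use B in auto)
  also have "\<dots> = (\<integral>\<^sup>+z. ennreal (indicator B z * w z) \<partial>\<mu>)"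
    by (rule nn_integral_cong) (auto simp: indicator_def)
  also have "\<dots> = ennreal (LINT z|\<mu>. indicator B z * w z)"
  proof (rule nn_integral_eq_integral[OF Bi])
    show "AE z in \<mu>. 0 \<le> indicator B z * w z"
    proof (rule AE_I2)
      fix z assume "z \<in> space \<mu>"
      then have "z \<in> Rc" using R_sub by auto
      then show "0 \<le> indicator B z * w z" using w_pos[of z] by (auto simp: indicator_def)
    qed
  qed
  also have "\<dots> = ennreal (LINT z|lborel. indicator B z * w z)" unfolding integral_iv2 e ..
  also have "\<dots> = emeasure lborel (\<Phi> ` B)"
  proof (rule emeasure_image_plane[symmetric, OF Bb])
    show "inj_on \<Phi> B" by (rule inj_on_subset[OF inj_\<Phi>]) (use R_sub in \<open>auto simp: B_def\<close>)
    show "\<Phi> ` B \<in> sets borel" using im Ab by simp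
    show "(\<Phi> has_derivative (%h. (w z * tx (fst z) * fst h + ty (fst z) * snd h, w z * ty (fst z) * fst h + (- tx (fst z)) * snd h))) (at z)"
      if "z \<in> B" for z using that by (intro \<Phi>_deriv) (simp add: B_def)
    show "integrable lborel (%z. indicator B z * w z)" using Bi unfolding integrable_iv2 e .
    show "\<bar>w z * tx (fst z) * - tx (fst z) - ty (fst z) * (w z * ty (fst z))\<bar> = w z" if "z \<in> B" for z
    proof -
      have z: "z \<in> R" using that by (simp add: B_def)
      have "w z * tx (fst z) * - tx (fst z) - ty (fst z) * (w z * ty (fst z)) = - w z * ((tx (fst z))^2 + (ty (fst z))^2)"
        by (simp add: power2_eq_square algebra_simps)
      also have "\<dots> = - w z" using unit[of "fst z"] z by auto
      finally show ?thesis using w_pos[of z] z R_sub by auto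
    qed
  qed
  also have "\<dots> = emeasure (restrict_space lborel D) A" unfolding im using D_borel Ab by (simp add: emeasure_restrict_space)
  finally show "emeasure (distr MR (restrict_space lborel D) \<Phi>) A = emeasure (restrict_space lborel D) A" .
qed simp

lemma distr_\<Psi>: "distr (restrict_space lborel D) \<mu> \<Psi> = MR"
proof -
  have Pm: "\<Phi> \<in> MR \<rightarrow>\<^sub>M restrict_space lborel D" using \<Phi>_measurable by (simp add: MR_def)
  have "distr (restrict_space lborel D) \<mu> \<Psi> = distr (distr MR (restrict_space lborel D) \<Phi>) \<mu> \<Psi>"
    unfolding distr_\<Phi> ..
  also have "\<dots> = distr MR \<mu> (\<Psi> \<circ> \<Phi>)" by (rule distr_distr[OF \<Psi>_measurable Pm])
  also have "\<dots> = distr MR MR (%z. z)"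
  proof (rule distr_cong)
    fix z assume "z \<in> space MR"
    then have "z \<in> Rc" using R_sub by (auto simp: MR_def)
    then show "(\<Psi> \<circ> \<Phi>) z = z" by (simp add: \<Psi>_\<Phi>)
  qed (auto simp: MR_def)
  also have "\<dots> = MR" by (rule distr_id)
  finally show ?thesis .
qed

text \<open>\<open>W12\<close> lives on the completed measure, the coordinate calculus on Borel
  measure; both have the same almost-everywhere statements.\<close>

lemma AE_lebesgue_D: "(AE z in lebesgue_on D. Q z) \<longleftrightarrow> (AE z in restrict_space lborel D. Q z)"
proof -
  have "(AE z in lebesgue_on D. Q z) \<longleftrightarrow> (AE z in lebesgue. z \<in> D \<longrightarrow> Q z)"
    by (rule AE_restrict_space_iff) (use D_borel in \<open>simp add: sets_completionI_sets\<close>)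
  also have "\<dots> \<longleftrightarrow> (AE z in lborel. z \<in> D \<longrightarrow> Q z)" by (rule AE_completion_iff)
  also have "\<dots> \<longleftrightarrow> (AE z in restrict_space lborel D. Q z)"
    by (rule AE_restrict_space_iff[symmetric]) (use D_borel in simp)
  finally show ?thesis .
qed

lemma AE_MR: "(AE z in MR. Q z) \<longleftrightarrow> (AE z in \<mu>. Q z)"
proof -
  have "(AE z in MR. Q z) \<longleftrightarrow> (AE z in \<mu>. 0 < ennreal (w z) \<longrightarrow> Q z)"
    unfolding MR_def by (rule AE_density) measurable
  also have "\<dots> \<longleftrightarrow> (AE z in \<mu>. Q z)"
  proof -
    have "0 < w z" if "z \<in> space \<mu>" for z using that R_sub by (intro w_pos) auto
    then show ?thesis by (intro AE_cong) auto
  qed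
  finally show ?thesis .
qed

lemma AE_D_imp: "AE z in lebesgue_on D. Q z ==> AE Z in \<mu>. Q (\<Phi> Z)"
proof -
  have Pm: "\<Phi> \<in> MR \<rightarrow>\<^sub>M restrict_space lborel D" using \<Phi>_measurable by (simp add: MR_def)
  assume "AE z in lebesgue_on D. Q z"
  then have "AE z in distr MR (restrict_space lborel D) \<Phi>. Q z" unfolding AE_lebesgue_D distr_\<Phi> .
  from AE_distrD[OF Pm this] show ?thesis unfolding AE_MR .
qed

lemma measurable_\<Psi>:
  fixes h :: "real \<times> real => real"
  assumes "h \<in> borel_measurable \<mu>"
  shows "(%z. h (\<Psi> z)) \<in> borel_measurable (restrict_space lborel D)"
    "(%z. h (\<Psi> z)) \<in> borel_measurable (lebesgue_on D)"
proof -
  show 1: "(%z. h (\<Psi> z)) \<in> borel_measurable (restrict_space lborel D)" by (rule measurable_compose[OF \<Psi>_measurable assms])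
  show "(%z. h (\<Psi> z)) \<in> borel_measurable (lebesgue_on D)"
  proof (rule measurableI)
    fix A :: "real set" assume "A \<in> sets borel"
    from measurable_sets[OF 1 this] show "(%z. h (\<Psi> z)) -` A \<inter> space (lebesgue_on D) \<in> sets (lebesgue_on D)"
      using D_borel by (auto simp: sets_restrict_space space_restrict_space sets_completionI_sets)
  qed auto
qed

lemma integral_D:
  fixes h :: "real \<times> real => real"
  assumes h: "h \<in> borel_measurable \<mu>"
  shows "integrable (lebesgue_on D) (%z. h (\<Psi> z)) \<longleftrightarrow> integrable \<mu> (%z. w z * h z)"
    "(LINT z|lebesgue_on D. h (\<Psi> z)) = (LINT z|\<mu>. w z * h z)"
proof -
  define g where "g z = indicator D z * h (\<Psi> z)" for z
  have gm: "g \<in> borel_measurable borel"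
    using measurable_\<Psi>(1)[OF h] D_borel
    by (subst (asm) borel_measurable_restrict_space_iff) (auto simp: g_def[abs_def])
  have a: "integrable (lebesgue_on D) (%z. h (\<Psi> z)) \<longleftrightarrow> integrable (restrict_space lborel D) (%z. h (\<Psi> z))"
    using D_borel integrable_completion[of g lborel] gm
    by (simp add: integrable_restrict_space sets_completionI_sets g_def[abs_def])
  have b: "(LINT z|lebesgue_on D. h (\<Psi> z)) = (LINT z|restrict_space lborel D. h (\<Psi> z))"
    using D_borel integral_completion[of g lborel] gm
    by (simp add: integral_restrict_space sets_completionI_sets g_def[abs_def])
  have w0: "AE z in \<mu>. 0 \<le> w z" by (rule AE_I2) (use w_pos R_sub in \<open>force intro: less_imp_le\<close>)
  have hd: "h \<in> borel_measurable MR" using h by (simp add: MR_def)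
  show "integrable (lebesgue_on D) (%z. h (\<Psi> z)) \<longleftrightarrow> integrable \<mu> (%z. w z * h z)"
    unfolding a using integrable_distr_eq[OF \<Psi>_measurable h] integrable_density[OF h w_measurable w0]
    unfolding distr_\<Psi> MR_def[symmetric] by simp
  show "(LINT z|lebesgue_on D. h (\<Psi> z)) = (LINT z|\<mu>. w z * h z)"
    unfolding b using integral_distr[OF \<Psi>_measurable h] integral_density[OF h w_measurable w0]
    unfolding distr_\<Psi> MR_def[symmetric] by simp
qed

text \<open>A Lebesgue measurable function agrees almost everywhere with a Borel one, and the latter
  can be composed with \<open>\<Phi>\<close> without losing measurability.\<close>

lemma rep_exists:
  fixes v :: "real \<times> real => real"
  assumes "v \<in> borel_measurable (lebesgue_on D)"
  obtains f where "f \<in> borel_measurable \<mu>" "AE z in lebesgue_on D. v z = f (\<Psi> z)"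
proof -
  have "(%z. indicator D z * v z) \<in> borel_measurable lebesgue"
    using assms D_borel by (subst (asm) borel_measurable_restrict_space_iff) (auto simp: sets_completionI_sets)
  from completion_ex_borel_measurable_real[OF this] obtain g where
    g: "g \<in> borel_measurable lborel" "AE z in lborel. indicator D z * v z = g z" by blast
  have "AE z in restrict_space lborel D. v z = g z"
    using g(2) D_borel by (subst AE_restrict_space_iff) (auto elim!: eventually_mono)
  then have 1: "AE z in lebesgue_on D. v z = g z" unfolding AE_lebesgue_D .
  have "(%z. g (\<Phi> z)) \<in> borel_measurable \<mu>"
    by (rule measurable_compose[OF \<Phi>_measurable]) (rule measurable_restrict_space1[OF g(1)])
  moreover have "AE z in lebesgue_on D. v z = g (\<Phi> (\<Psi> z))"
    using 1 AE_space[of "lebesgue_on D"] by eventually_elim (simp add: space_restrict_space \<Phi>_\<Psi>)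
  ultimately show ?thesis by (rule that)
qed

lemma finite_D: "finite_measure (lebesgue_on D)"
proof (rule finite_measureI)
  have "bounded (\<Phi> ` Rc)" by (intro compact_imp_bounded compact_continuous_image \<Phi>_cont compact_Times compact_Icc)
  then have "bounded D" using D_sub bounded_subset by blast
  then have "emeasure lborel D < \<infinity>" by (rule emeasure_bounded_finite)
  then show "emeasure (lebesgue_on D) (space (lebesgue_on D)) \<noteq> \<infinity>"
    using D_borel by (simp add: emeasure_restrict_space space_restrict_space sets_completionI_sets)
qed

lemma D_lebesgue: "D \<in> sets lebesgue" using D_borel by (simp add: sets_completionI_sets)

end

section \<open>From functions on the rectangle to weak gradients on the strip\<close>

context curved_strip
begin

text \<open>Gradient in the moving orthonormal frame. Lines of constant \<open>r\<close> are
  traversed at speed \<open>w\<close>, so the \<open>s\<close>-derivative \<open>p\<close>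
  contributes \<open>p / w\<close> along the tangent; the \<open>r\<close>-derivative
  \<open>q\<close> is taken along the unit vector \<open>(ty, - tx)\<close>.\<close>

definition frame :: "(real \<times> real => real) => (real \<times> real => real) => real \<times> real => real \<times> real" where
  "frame p q Z = (p Z / w Z * tx (fst Z) + q Z * ty (fst Z), p Z / w Z * ty (fst Z) - q Z * tx (fst Z))"

definition rep :: "(real \<times> real => real) => (real \<times> real => real \<times> real) => (real \<times> real => real) =>
    (real \<times> real => real) => (real \<times> real => real) => bool" where
  "rep v G f p q \<longleftrightarrow> Sob L \<delta> f p q \<and> (AE z in lebesgue_on D. v z = f (\<Psi> z) \<and> G z = frame p q (\<Psi> z))"

lemma fst_measurable_R: "continuous_on {0..L} f ==> (%z. f (fst z)) \<in> borel_measurable \<mu>" for f :: "real => real"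
  by (rule borel_measurable_iv2_continuous[OF continuous_on_subset[OF continuous_of_fst R_sub]])

lemma t_measurable [measurable]: "(%z. tx (fst z)) \<in> borel_measurable \<mu>" "(%z. ty (fst z)) \<in> borel_measurable \<mu>"
  by (rule fst_measurable_R, rule cont)+

lemma t_bound: "z \<in> R ==> \<bar>tx (fst z)\<bar> \<le> 1 \<and> \<bar>ty (fst z)\<bar> \<le> 1"
proof -
  assume z: "z \<in> R"
  then have u: "(tx (fst z))^2 + (ty (fst z))^2 = 1" by (intro unit) auto
  have "(tx (fst z))^2 \<le> 1" "(ty (fst z))^2 \<le> 1"
    using u zero_le_power2[of "tx (fst z)"] zero_le_power2[of "ty (fst z)"] by linarith+
  then show ?thesis by (simp add: abs_square_le_1)
qed

lemma unit_R: "z \<in> R ==> tx (fst z) * tx (fst z) + ty (fst z) * ty (fst z) = 1"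
  using unit[of "fst z"] by (auto simp: power2_eq_square)

lemma w_pos_R: "z \<in> R ==> 0 < w z"
  by (rule w_pos[OF subsetD[OF R_sub]])

lemma integrable_w:
  fixes h :: "real \<times> real => real"
  assumes [measurable]: "h \<in> borel_measurable \<mu>"
  shows "integrable \<mu> (%z. w z * h z) \<longleftrightarrow> integrable \<mu> h"
proof
  obtain c C where C: "0 < c" "0 < C" "\<And>z. z \<in> Rc ==> c \<le> w z" "\<And>z. z \<in> Rc ==> w z \<le> C" using w_bounds by metis
  have wR: "c \<le> w z" "w z \<le> C" if "z \<in> R" for z using C(3,4) subsetD[OF R_sub that] by auto
  assume i: "integrable \<mu> (%z. w z * h z)"
  have "integrable \<mu> (%z. (w z * h z) * (1 / w z))"
  proof (rule integrable_iv2_mult_bounded[OF i, of _ "1 / c"])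
    fix z assume "z \<in> R"
    then show "\<bar>1 / w z\<bar> \<le> 1 / c" using wR[of z] C(1) by (simp add: frac_le)
  qed measurable
  then show "integrable \<mu> h"
    by (subst (asm) Bochner_Integration.integrable_cong[OF refl, where g = h]) (use w_pos_R in force)+
next
  obtain c C where C: "0 < c" "0 < C" "\<And>z. z \<in> Rc ==> c \<le> w z" "\<And>z. z \<in> Rc ==> w z \<le> C" using w_bounds by metis
  assume i: "integrable \<mu> h"
  have "integrable \<mu> (%z. h z * w z)"
  proof (rule integrable_iv2_mult_bounded[OF i w_measurable])
    fix z assume z: "z \<in> R"
    show "\<bar>w z\<bar> \<le> C" using C(4)[OF subsetD[OF R_sub z]] w_pos_R[OF z] by simp
  qed
  then show "integrable \<mu> (%z. w z * h z)" by (simp add: mult.commute)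
qed

text \<open>The form needed in practice: an integrand on \<open>D\<close> is only Lebesgue
  measurable and matches a Borel function of the coordinates almost everywhere.\<close>

lemma integral_D_AE:
  fixes h :: "real \<times> real => real"
  assumes h: "h \<in> borel_measurable \<mu>" and u: "u \<in> borel_measurable (lebesgue_on D)"
    and ae: "AE z in lebesgue_on D. u z = h (\<Psi> z)"
  shows "(LINT z|lebesgue_on D. u z) = (LINT z|\<mu>. w z * h z)"
    "integrable (lebesgue_on D) u \<longleftrightarrow> integrable \<mu> h"
proof -
  note m = measurable_\<Psi>(2)[OF h]
  show "(LINT z|lebesgue_on D. u z) = (LINT z|\<mu>. w z * h z)"
    unfolding integral_D(2)[OF h, symmetric] by (rule integral_cong_AE[OF u m ae])
  show "integrable (lebesgue_on D) u \<longleftrightarrow> integrable \<mu> h"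
    unfolding integrable_w[OF h, symmetric] integral_D(1)[OF h, symmetric] by (rule integrable_cong_AE[OF u m ae])
qed

lemma frame_inner:
  assumes "z \<in> R"
  shows "frame p q z \<bullet> frame p' q' z = p z * p' z / (w z)^2 + q z * q' z"
proof -
  define a b where "a = tx (fst z)" and "b = ty (fst z)"
  have u: "a * a + b * b = 1" using unit_R[OF assms] by (simp add: a_def b_def)
  have "(P * a + Q * b) * (P' * a + Q' * b) + (P * b - Q * a) * (P' * b - Q' * a) = P * P' + Q * Q'" for P Q P' Q'
  proof -
    have "(P * a + Q * b) * (P' * a + Q' * b) + (P * b - Q * a) * (P' * b - Q' * a) = (P * P' + Q * Q') * (a * a + b * b)"
      by (simp add: algebra_simps)
    then show ?thesis using u by simp
  qed
  from this[of "p z / w z" "q z" "p' z / w z" "q' z"] show ?thesis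
    unfolding frame_def inner_prod_def inner_real_def fst_conv snd_conv a_def b_def by (simp add: power2_eq_square)
qed

lemma frame_measurable:
  assumes [measurable]: "p \<in> borel_measurable \<mu>" "q \<in> borel_measurable \<mu>"
  shows "frame p q \<in> borel_measurable \<mu>"
  unfolding frame_def[abs_def] borel_prod[symmetric] by measurable

lemma measurable_\<Psi>_plane:
  assumes "h \<in> borel_measurable \<mu>"
  shows "(%z. h (\<Psi> z) :: real \<times> real) \<in> borel_measurable (lebesgue_on D)"
proof -
  have "(%z. fst (h z)) \<in> borel_measurable \<mu>" "(%z. snd (h z)) \<in> borel_measurable \<mu>"
    by (rule measurable_compose[OF assms borel_measurable_continuous_onI], intro continuous_on_fst continuous_on_snd continuous_on_id)+
  from this[THEN measurable_\<Psi>(2)] have "(%z. (fst (h (\<Psi> z)), snd (h (\<Psi> z)))) \<in> borel_measurable (lebesgue_on D)"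
    by (rule borel_measurable_Pair)
  then show ?thesis by simp
qed

lemma rep_integrals:
  assumes r: "rep v G f p q" "rep v' G' f' p' q'" and W: "W12 D v G" "W12 D v' G'"
  shows "(LINT z|lebesgue_on D. v z * v' z) = (LINT z|\<mu>. w z * (f z * f' z))"
    "(LINT z|lebesgue_on D. G z \<bullet> G' z) = (LINT z|\<mu>. p z * p' z / w z + w z * (q z * q' z))"
    "(LINT z|lebesgue_on D. v z) = (LINT z|\<mu>. w z * f z)"
proof -
  have S: "Sob L \<delta> f p q" "Sob L \<delta> f' p' q'" using r by (auto simp: rep_def)
  note [measurable] = SobD(1,2,3)[OF S(1)] SobD(1,2,3)[OF S(2)]
  have [measurable]: "v \<in> borel_measurable (lebesgue_on D)" "v' \<in> borel_measurable (lebesgue_on D)"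
    "G \<in> borel_measurable (lebesgue_on D)" "G' \<in> borel_measurable (lebesgue_on D)"
    using W by (auto simp: W12_def square_integrable_def)
  have ae: "AE z in lebesgue_on D. v z = f (\<Psi> z) \<and> G z = frame p q (\<Psi> z)" "AE z in lebesgue_on D. v' z = f' (\<Psi> z) \<and> G' z = frame p' q' (\<Psi> z)"
    using r by (auto simp: rep_def)
  show "(LINT z|lebesgue_on D. v z * v' z) = (LINT z|\<mu>. w z * (f z * f' z))"
    by (rule integral_D_AE) (use ae in \<open>measurable; eventually_elim; simp\<close>)+
  show "(LINT z|lebesgue_on D. v z) = (LINT z|\<mu>. w z * f z)"
    by (rule integral_D_AE) (use ae(1) in \<open>measurable; eventually_elim; simp\<close>)+
  have "(LINT z|lebesgue_on D. G z \<bullet> G' z) = (LINT z|\<mu>. w z * (p z * p' z / (w z)^2 + q z * q' z))"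
  proof (rule integral_D_AE)
    show "AE z in lebesgue_on D. G z \<bullet> G' z = p (\<Psi> z) * p' (\<Psi> z) / (w (\<Psi> z))^2 + q (\<Psi> z) * q' (\<Psi> z)"
      using ae AE_space[of "lebesgue_on D"]
    proof eventually_elim
      case (elim z)
      then have "\<Psi> z \<in> R" by (intro \<Psi>_R) (simp add: space_restrict_space)
      then show ?case using elim frame_inner by simp
    qed
  qed measurable
  also have "\<dots> = (LINT z|\<mu>. p z * p' z / w z + w z * (q z * q' z))"
  proof (rule LINT_cong)
    fix z assume "z \<in> space \<mu>"
    then have "0 < w z" by (intro w_pos_R) simp
    then show "w z * (p z * p' z / (w z)^2 + q z * q' z) = p z * p' z / w z + w z * (q z * q' z)"
      by (simp add: field_simps power2_eq_square)
  qed simp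
  finally show "(LINT z|lebesgue_on D. G z \<bullet> G' z) = (LINT z|\<mu>. p z * p' z / w z + w z * (q z * q' z))" .
qed

text \<open>The direction \<open>e\<close> has components \<open>X\<close> along the tangent and
  \<open>Y\<close> along \<open>(ty, - tx)\<close>. Multiplied by \<open>w\<close>, the derivative
  of the test function in direction \<open>e\<close> is the sum of the \<open>s\<close>-derivative
  of \<open>X * \<psi>\<close> and the \<open>r\<close>-derivative of \<open>w * Y * \<psi>\<close>,
  because the two curvature terms cancel. Each summand is then integrated by parts on lines.\<close>

lemma Sob_W12:
  assumes S: "Sob L \<delta> f p q"
  shows "W12 D (%z. f (\<Psi> z)) (%z. frame p q (\<Psi> z))"
    "rep (%z. f (\<Psi> z)) (%z. frame p q (\<Psi> z)) f p q"
proof -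
  note [measurable] = SobD(1,2,3)[OF S]
  show "rep (%z. f (\<Psi> z)) (%z. frame p q (\<Psi> z)) f p q" using S by (simp add: rep_def)
  have sf: "square_integrable D (%z. f (\<Psi> z))"
    unfolding square_integrable_def
    using measurable_\<Psi>(2)[OF SobD(1)[OF S]] integral_D(1)[of "%z. (f z)^2"] integrable_w[of "%z. (f z)^2"] SobD(4)[OF S]
    by simp
  have wi: "\<exists>c. \<forall>z\<in>R. \<bar>1 / (w z)^2\<bar> \<le> c"
  proof -
    obtain c C where C: "0 < c" "\<And>z. z \<in> Rc ==> c \<le> w z" using w_bounds by metis
    have "\<bar>1 / (w z)^2\<bar> \<le> 1 / c^2" if "z \<in> R" for z
      using C(2)[OF subsetD[OF R_sub that]] C(1) by (simp add: frac_le power_mono)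
    then show ?thesis by blast
  qed
  have sg: "square_integrable D (%z. frame p q (\<Psi> z))"
    unfolding square_integrable_def
  proof
    show m: "(%z. frame p q (\<Psi> z)) \<in> borel_measurable (lebesgue_on D)"
      by (rule measurable_\<Psi>_plane[OF frame_measurable]) measurable
    obtain c where c: "\<And>z. z \<in> R ==> \<bar>1 / (w z)^2\<bar> \<le> c" using wi by blast
    have "integrable \<mu> (%z. (p z)^2 * (1 / (w z)^2) + (q z)^2)"
      by (intro Bochner_Integration.integrable_add SobD(6)[OF S] integrable_iv2_mult_bounded[OF SobD(5)[OF S] _ c]) measurable
    moreover have "AE z in lebesgue_on D. (norm (frame p q (\<Psi> z)))^2 = (p (\<Psi> z))^2 * (1 / (w (\<Psi> z))^2) + (q (\<Psi> z))^2"
    proof (rule AE_I2)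
      fix z assume "z \<in> space (lebesgue_on D)"
      then have zR: "\<Psi> z \<in> R" by (intro \<Psi>_R) (simp add: space_restrict_space)
      show "(norm (frame p q (\<Psi> z)))^2 = (p (\<Psi> z))^2 * (1 / (w (\<Psi> z))^2) + (q (\<Psi> z))^2"
        unfolding power2_norm_eq_inner frame_inner[OF zR] by (simp add: power2_eq_square)
    qed
    ultimately show "integrable (lebesgue_on D) (%z. (norm (frame p q (\<Psi> z)))^2)"
      using m by (subst integral_D_AE(2)[where h = "%z. (p z)^2 * (1 / (w z)^2) + (q z)^2"]) measurable
  qed
  have weak: "(LINT z|lebesgue_on D. f (\<Psi> z) * frechet_derivative \<phi> (at z) e) =
        - (LINT z|lebesgue_on D. (frame p q (\<Psi> z) \<bullet> e) * \<phi> z)"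
    if t: "test_function D \<phi>" and e: "e \<in> Basis" for \<phi> e
  proof -
    have e1: "(1, 0) \<in> (Basis :: (real \<times> real) set)" and e2: "(0, 1) \<in> (Basis :: (real \<times> real) set)" by (auto simp: Basis_plane)
    define gx gy where "gx z = frechet_derivative \<phi> (at z) (1, 0)" and "gy z = frechet_derivative \<phi> (at z) (0, 1)" for z
    obtain C1 where C1: "\<And>z. \<bar>\<phi> z\<bar> \<le> C1" "\<And>z. \<bar>gx z\<bar> \<le> C1" "continuous_on UNIV \<phi>" "continuous_on UNIV gx"
      by (rule test_function_facts[OF t e1, folded gx_def], rule that; assumption)
    obtain C2 where C2: "\<And>z. \<bar>\<phi> z\<bar> \<le> C2" "\<And>z. \<bar>gy z\<bar> \<le> C2" "continuous_on UNIV \<phi>" "continuous_on UNIV gy"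
      by (rule test_function_facts[OF t e2, folded gy_def], rule that; assumption)
    have fd: "(\<phi> has_derivative (%h. gx z * fst h + gy z * snd h)) (at z)" for z
    proof -
      have "Ck (Suc 0) \<phi>" using t by (simp only: test_function_def)
      then have "\<phi> differentiable (at z)" unfolding Ck.simps by blast
      then have d: "(\<phi> has_derivative frechet_derivative \<phi> (at z)) (at z)" by (simp add: frechet_derivative_works)
      have l: "linear (frechet_derivative \<phi> (at z))" by (rule has_derivative_linear[OF d])
      have "frechet_derivative \<phi> (at z) h = gx z * fst h + gy z * snd h" for h
      proof -
        have "h = fst h *\<^sub>R (1, 0) + snd h *\<^sub>R (0, 1)" by (cases h) simp
        then have "frechet_derivative \<phi> (at z) h = frechet_derivative \<phi> (at z) (fst h *\<^sub>R (1, 0) + snd h *\<^sub>R (0, 1))" by simp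
        then show ?thesis unfolding linear_add[OF l] linear_scale[OF l] gx_def gy_def by simp
      qed
      then have "frechet_derivative \<phi> (at z) = (%h. gx z * fst h + gy z * snd h)" by (rule ext)
      then show ?thesis using d by simp
    qed
    define b1 b2 where "b1 = fst e" and "b2 = snd e"
    have eb: "frechet_derivative \<phi> (at z) e = b1 * gx z + b2 * gy z" for z
      using fun_cong[OF frechet_derivative_at[OF fd[of z]], of e] by (simp add: b1_def b2_def mult.commute)
    have b: "\<bar>b1\<bar> \<le> 1" "\<bar>b2\<bar> \<le> 1" using e by (auto simp: b1_def b2_def Basis_plane)
    define X Y where "X s = b1 * tx s + b2 * ty s" and "Y s = b1 * ty s - b2 * tx s" for s
    have XY: "continuous_on {0..L} X" "continuous_on {0..L} Y" unfolding X_def Y_def by (intro continuous_intros cont)+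
    have X': "(X has_real_derivative - k s * Y s) (at s)" if "0 < s" "s < L" for s
      unfolding X_def Y_def using that by (auto intro!: derivative_eq_intros tx' ty' simp: algebra_simps)
    define K where "K = closure {z. \<phi> z \<noteq> 0}"
    have K: "compact K" "K \<subseteq> D" using t by (auto simp: K_def test_function_def)
    have zK: "\<phi> z = 0" if "z \<notin> K" for z
    proof (rule ccontr)
      assume "\<phi> z \<noteq> 0"
      then have "z \<in> {z. \<phi> z \<noteq> 0}" by simp
      from subsetD[OF closure_subset this] that show False unfolding K_def by contradiction
    qed
    \<comment> \<open>The support is compact in \<open>D\<close>, so its preimage is compact in the
      open rectangle; the projections give the intervals that make the boundary terms
      vanish.\<close>
    define K' where "K' = \<Psi> ` K"
    have K': "compact K'" "K' \<subseteq> R"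
    proof -
      show "compact K'" unfolding K'_def
        by (rule compact_continuous_image[OF continuous_on_subset[OF \<Psi>_cont] K(1)]) (rule order_trans[OF K(2) D_sub])
      show "K' \<subseteq> R" unfolding K'_def using K(2) \<Psi>_R by (intro image_subsetI) blast
    qed
    have K1: "compact (fst ` K')" "compact (snd ` K')"
      by (intro compact_continuous_image K' continuous_on_fst continuous_on_snd continuous_on_id)+
    have K2: "fst ` K' \<subseteq> {0<..<L}" "snd ` K' \<subseteq> {0<..<\<delta>}" using K'(2) by (auto simp: subset_eq)
    obtain \<alpha> \<beta> where ab: "0 < \<alpha>" "\<alpha> < \<beta>" "\<beta> < L" "fst ` K' \<subseteq> {\<alpha>..\<beta>}" by (rule compact_in_open_interval[OF K1(1) K2(1) L])
    obtain \<alpha>' \<beta>' where ab': "0 < \<alpha>'" "\<alpha>' < \<beta>'" "\<beta>' < \<delta>" "snd ` K' \<subseteq> {\<alpha>'..\<beta>'}" by (rule compact_in_open_interval[OF K1(2) K2(2) \<delta>])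
    define \<psi> where "\<psi> Z = (if Z \<in> R then \<phi> (\<Phi> Z) else 0)" for Z
    have zpsi: "\<psi> Z = 0" if "Z \<notin> K'" for Z
    proof (cases "Z \<in> R")
      case True
      have "\<Phi> Z \<notin> K"
      proof
        assume "\<Phi> Z \<in> K"
        then have "\<Psi> (\<Phi> Z) \<in> K'" unfolding K'_def by (rule imageI)
        then show False using that \<Psi>_\<Phi>[OF subsetD[OF R_sub True]] by simp
      qed
      then show ?thesis using zK by (simp add: \<psi>_def)
    qed (simp add: \<psi>_def)
    define ps pr where "ps Z = w Z * (gx (\<Phi> Z) * tx (fst Z) + gy (\<Phi> Z) * ty (fst Z))"
      and "pr Z = gx (\<Phi> Z) * ty (fst Z) - gy (\<Phi> Z) * tx (fst Z)" for Z
    have \<psi>_deriv: "(\<psi> has_derivative (%h. ps Z * fst h + pr Z * snd h)) (at Z)" if xi: "Z \<in> R" for Z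
    proof -
      have "((%Z. \<phi> (\<Phi> Z)) has_derivative (%h. ps Z * fst h + pr Z * snd h)) (at Z)"
        using has_derivative_compose[OF \<Phi>_deriv[OF xi] fd] by (rule has_derivative_eq_rhs) (auto simp: ps_def pr_def algebra_simps)
      then show ?thesis
        by (rule has_derivative_transform_within_open[OF _ R_open xi]) (simp add: \<psi>_def)
    qed
    have sec: "((%s. \<psi> (s, r)) has_real_derivative ps (s, r)) (at s)" "((%r. \<psi> (s, r)) has_real_derivative pr (s, r)) (at r)"
      if "(s, r) \<in> R" for s r
    proof -
      show "((%s. \<psi> (s, r)) has_real_derivative ps (s, r)) (at s)"
        unfolding has_field_derivative_def
        by (rule has_derivative_eq_rhs[OF has_derivative_compose[of "%s. (s, r)" "%h. (h, 0)" s UNIV \<psi>, OF _ \<psi>_deriv[OF that]]])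
          (auto intro!: derivative_eq_intros)
      show "((%r. \<psi> (s, r)) has_real_derivative pr (s, r)) (at r)"
        unfolding has_field_derivative_def
        by (rule has_derivative_eq_rhs[OF has_derivative_compose[of "%r. (s, r)" "%h. (0, h)" r UNIV \<psi>, OF _ \<psi>_deriv[OF that]]])
          (auto intro!: derivative_eq_intros)
    qed
    have cR: "continuous_on R (%Z. g (\<Phi> Z))" if "continuous_on UNIV g" for g :: "real \<times> real => real"
      by (rule continuous_on_compose2[OF that continuous_on_subset[OF \<Phi>_cont R_sub]]) simp
    have cf: "continuous_on R (%Z. g (fst Z))" if "continuous_on {0..L} g" for g :: "real => real"
      by (rule continuous_on_subset[OF continuous_of_fst[OF that] R_sub])
    have psc: "continuous_on R \<psi>"
      using cR[OF C1(3)] by (rule continuous_on_eq) (simp add: \<psi>_def)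
    have wc: "continuous_on R w" by (rule continuous_on_subset[OF w_cont R_sub])
    have psc': "continuous_on R ps" "continuous_on R pr" unfolding ps_def[abs_def] pr_def[abs_def]
      by (intro continuous_on_add continuous_on_diff continuous_on_mult wc cR C1(4) C2(4) cf cont)+
    \<comment> \<open>\<open>As\<close> is the \<open>s\<close>-derivative of
      \<open>X * \<psi>\<close> and \<open>Br\<close> the \<open>r\<close>-derivative of
      \<open>w * Y * \<psi>\<close>; \<open>X' = - k * Y\<close> and the \<open>r\<close>-derivative
      \<open>k\<close> of \<open>w\<close> produce opposite curvature terms.\<close>
    define As Br where "As Z = - k (fst Z) * Y (fst Z) * \<psi> Z + X (fst Z) * ps Z"
      and "Br Z = k (fst Z) * Y (fst Z) * \<psi> Z + w Z * Y (fst Z) * pr Z" for Z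
    have Ac: "continuous_on R As" "continuous_on R Br" unfolding As_def[abs_def] Br_def[abs_def]
      by (intro continuous_on_add continuous_on_minus continuous_on_mult wc psc psc' cf XY cont)+
    have Am[measurable]: "As \<in> borel_measurable \<mu>" "Br \<in> borel_measurable \<mu>" "\<psi> \<in> borel_measurable \<mu>"
      "ps \<in> borel_measurable \<mu>" "pr \<in> borel_measurable \<mu>"
      by (intro borel_measurable_iv2_continuous Ac psc psc')+
    have [measurable]: "(%z. X (fst z)) \<in> borel_measurable \<mu>" "(%z. Y (fst z)) \<in> borel_measurable \<mu>"
      by (intro fst_measurable_R XY)+
    have alg: "As Z + Br Z = w Z * (b1 * gx (\<Phi> Z) + b2 * gy (\<Phi> Z))" if xi: "Z \<in> R" for Z
    proof -
      define a c g1 g2 where "a = tx (fst Z)" and "c = ty (fst Z)" and "g1 = gx (\<Phi> Z)" and "g2 = gy (\<Phi> Z)"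
      have "As Z + Br Z = w Z * ((b1 * g1 + b2 * g2) * (a * a + c * c))"
        unfolding As_def Br_def ps_def pr_def X_def Y_def a_def[symmetric] c_def[symmetric] g1_def[symmetric] g2_def[symmetric]
        by (simp add: algebra_simps)
      then show ?thesis using unit_R[OF xi] by (simp add: a_def c_def g1_def g2_def)
    qed
    \<comment> \<open>Continuity on the open rectangle does not bound a function; vanishing off the
      compact set \<open>K'\<close> does.\<close>
    have bK: "\<exists>B. \<forall>Z\<in>R. \<bar>h Z\<bar> \<le> B" if h: "continuous_on R h" "\<And>Z. Z \<in> R ==> Z \<notin> K' ==> h Z = 0" for h :: "real \<times> real => real"
    proof -
      have "bounded (h ` K')" by (intro compact_imp_bounded compact_continuous_image continuous_on_subset[OF h(1)] K')
      then obtain B where B: "B > 0" "\<forall>u\<in>h ` K'. norm u \<le> B" unfolding bounded_pos by blast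
      have "\<bar>h Z\<bar> \<le> B" if "Z \<in> R" for Z using B h(2)[OF that] by (cases "Z \<in> K'") auto
      then show ?thesis by blast
    qed
    have z': "ps Z = 0 \<and> pr Z = 0" if xi: "Z \<in> R" "Z \<notin> K'" for Z
    proof -
      have "(\<psi> has_derivative (%h. 0)) (at Z)"
        by (rule has_derivative_transform_within_open[where s = "- K'" and f = "%_. 0"])
          (use xi zpsi compact_imp_closed[OF K'(1)] in auto)
      from has_derivative_unique[OF this \<psi>_deriv[OF xi(1)]] have "(%h. 0) = (%h. ps Z * fst h + pr Z * snd h)" .
      from fun_cong[OF this, of "(1, 0)"] fun_cong[OF this, of "(0, 1)"] show ?thesis by simp
    qed
    have "\<exists>B. \<forall>Z\<in>R. \<bar>As Z\<bar> \<le> B" by (rule bK[OF Ac(1)]) (simp add: As_def z' zpsi)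
    then obtain BA where BA: "\<And>Z. Z \<in> R ==> \<bar>As Z\<bar> \<le> BA" by blast
    have "\<exists>B. \<forall>Z\<in>R. \<bar>Br Z\<bar> \<le> B" by (rule bK[OF Ac(2)]) (simp add: Br_def z' zpsi)
    then obtain BB where BB: "\<And>Z. Z \<in> R ==> \<bar>Br Z\<bar> \<le> BB" by blast
    have Xpc: "continuous_on R (%Z. X (fst Z) * \<psi> Z)" "continuous_on R (%Z. w Z * Y (fst Z) * \<psi> Z)"
      by (intro continuous_on_mult wc psc cf XY)+
    have "\<exists>B. \<forall>Z\<in>R. \<bar>X (fst Z) * \<psi> Z\<bar> \<le> B" by (rule bK[OF Xpc(1)]) (simp add: zpsi)
    then obtain BX where BX: "\<And>Z. Z \<in> R ==> \<bar>X (fst Z) * \<psi> Z\<bar> \<le> BX" by blast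
    have "\<exists>B. \<forall>Z\<in>R. \<bar>w Z * Y (fst Z) * \<psi> Z\<bar> \<le> B" by (rule bK[OF Xpc(2)]) (simp add: zpsi)
    then obtain BY where BY: "\<And>Z. Z \<in> R ==> \<bar>w Z * Y (fst Z) * \<psi> Z\<bar> \<le> BY" by blast
    have i1: "integrable \<mu> (%Z. f Z * As Z)" "integrable \<mu> (%Z. f Z * Br Z)"
      by (intro integrable_iv2_mult_bounded[OF SobD(9)[OF S] Am(1) BA] integrable_iv2_mult_bounded[OF SobD(9)[OF S] Am(2) BB]; assumption)+
    have i2: "integrable \<mu> (%Z. p Z * (X (fst Z) * \<psi> Z))"
      by (rule integrable_iv2_mult_bounded[OF SobD(10)[OF S] _ BX]) measurable
    have i3: "integrable \<mu> (%Z. q Z * (w Z * Y (fst Z) * \<psi> Z))"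
      by (rule integrable_iv2_mult_bounded[OF SobD(11)[OF S] _ BY]) measurable
    have P1: "(LINT Z|\<mu>. f Z * As Z) = - (LINT Z|\<mu>. p Z * (X (fst Z) * \<psi> Z))"
    proof -
      have "(LINT Z|\<mu>. f Z * As Z) = (LINT r|iv \<delta>. LINT s|iv L. f (s, r) * As (s, r))"
        by (rule integral_iv2_snd(3)[OF i1(1)])
      also have "\<dots> = (LINT r|iv \<delta>. - (LINT s|iv L. p (s, r) * (X s * \<psi> (s, r))))"
      proof (rule integral_cong_AE)
        show "(%r. LINT s|iv L. f (s, r) * As (s, r)) \<in> borel_measurable (iv \<delta>)"
          "(%r. - (LINT s|iv L. p (s, r) * (X s * \<psi> (s, r)))) \<in> borel_measurable (iv \<delta>)"
          using integral_iv2_snd(2)[OF i1(1)] integral_iv2_snd(2)[OF i2] by auto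
        show "AE r in iv \<delta>. (LINT s|iv L. f (s, r) * As (s, r)) = - (LINT s|iv L. p (s, r) * (X s * \<psi> (s, r)))"
          using SobD(7)[OF S] AE_space[of "iv \<delta>"]
        proof eventually_elim
          case (elim r)
          have inR: "(s, r) \<in> R" if "0 < s" "s < L" for s using that elim(2) by simp
          have ac: "AC L (%s. X s * \<psi> (s, r)) (%s. As (s, r))"
          proof (rule AC_compact_support[OF _ _ ab(1-3)])
            fix s assume s: "0 < s" "s < L"
            show "((%s. X s * \<psi> (s, r)) has_real_derivative As (s, r)) (at s)"
              by (auto intro!: derivative_eq_intros X'[OF s] sec(1)[OF inR[OF s]] simp: As_def algebra_simps)
          next
            show "continuous_on {0<..<L} (%s. As (s, r))"
              by (rule continuous_on_compose2[OF Ac(1)]) (use inR in \<open>auto intro!: continuous_intros\<close>)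
            fix s assume "s \<notin> {\<alpha>..\<beta>}"
            then have "(s, r) \<notin> K'" using ab(4) by force
            then show "X s * \<psi> (s, r) = 0" using zpsi by simp
          qed
          have z0: "\<psi> (0, r) = 0" "\<psi> (L, r) = 0" by (simp_all add: \<psi>_def)
          show ?case
            by (rule wAC_by_parts[OF elim(1) ac less_imp_le[OF L] _ _ measurable_section_fst[OF SobD(1)[OF S] elim(2)]]) (simp_all add: z0)
        qed
      qed
      also have "\<dots> = - (LINT Z|\<mu>. p Z * (X (fst Z) * \<psi> Z))"
        using integral_iv2_snd(3)[OF i2] by simp
      finally show ?thesis .
    qed
    have P2: "(LINT Z|\<mu>. f Z * Br Z) = - (LINT Z|\<mu>. q Z * (w Z * Y (fst Z) * \<psi> Z))"
    proof -
      have "(LINT Z|\<mu>. f Z * Br Z) = (LINT s|iv L. LINT r|iv \<delta>. f (s, r) * Br (s, r))"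
        by (rule integral_iv2_fst(3)[OF i1(2)])
      also have "\<dots> = (LINT s|iv L. - (LINT r|iv \<delta>. q (s, r) * (w (s, r) * Y s * \<psi> (s, r))))"
      proof (rule integral_cong_AE)
        show "(%s. LINT r|iv \<delta>. f (s, r) * Br (s, r)) \<in> borel_measurable (iv L)"
          "(%s. - (LINT r|iv \<delta>. q (s, r) * (w (s, r) * Y s * \<psi> (s, r)))) \<in> borel_measurable (iv L)"
          using integral_iv2_fst(2)[OF i1(2)] integral_iv2_fst(2)[OF i3] by auto
        show "AE s in iv L. (LINT r|iv \<delta>. f (s, r) * Br (s, r)) = - (LINT r|iv \<delta>. q (s, r) * (w (s, r) * Y s * \<psi> (s, r)))"
          using SobD(8)[OF S] AE_space[of "iv L"]
        proof eventually_elim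
          case (elim s)
          have inR: "(s, r) \<in> R" if "0 < r" "r < \<delta>" for r using that elim(2) by simp
          have ac: "AC \<delta> (%r. w (s, r) * Y s * \<psi> (s, r)) (%r. Br (s, r))"
          proof (rule AC_compact_support[OF _ _ ab'(1-3)])
            fix r assume r: "0 < r" "r < \<delta>"
            have "((%r. w (s, r)) has_real_derivative k s) (at r)" unfolding w_def by (auto intro!: derivative_eq_intros)
            then show "((%r. w (s, r) * Y s * \<psi> (s, r)) has_real_derivative Br (s, r)) (at r)"
              by (auto intro!: derivative_eq_intros sec(2)[OF inR[OF r]] simp: Br_def algebra_simps)
          next
            show "continuous_on {0<..<\<delta>} (%r. Br (s, r))"
              by (rule continuous_on_compose2[OF Ac(2)]) (use inR in \<open>auto intro!: continuous_intros\<close>)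
            fix r assume "r \<notin> {\<alpha>'..\<beta>'}"
            then have "(s, r) \<notin> K'" using ab'(4) by force
            then show "w (s, r) * Y s * \<psi> (s, r) = 0" using zpsi by simp
          qed
          have z0: "\<psi> (s, 0) = 0" "\<psi> (s, \<delta>) = 0" by (simp_all add: \<psi>_def)
          show ?case
            by (rule wAC_by_parts[OF elim(1) ac less_imp_le[OF \<delta>] _ _ measurable_section_snd[OF SobD(1)[OF S] elim(2)]]) (simp_all add: z0)
        qed
      qed
      also have "\<dots> = - (LINT Z|\<mu>. q Z * (w Z * Y (fst Z) * \<psi> Z))"
        using integral_iv2_fst(3)[OF i3] by simp
      finally show ?thesis .
    qed
    have [measurable]: "(%Z. gx (\<Phi> Z)) \<in> borel_measurable \<mu>" "(%Z. gy (\<Phi> Z)) \<in> borel_measurable \<mu>"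
      by (intro borel_measurable_iv2_continuous cR C1 C2)+
    have "(LINT z|lebesgue_on D. f (\<Psi> z) * frechet_derivative \<phi> (at z) e) =
       (LINT z|lebesgue_on D. f (\<Psi> z) * (b1 * gx (\<Phi> (\<Psi> z)) + b2 * gy (\<Phi> (\<Psi> z))))"
      by (rule LINT_cong) (auto simp: eb space_restrict_space \<Phi>_\<Psi>)
    also have "\<dots> = (LINT Z|\<mu>. w Z * (f Z * (b1 * gx (\<Phi> Z) + b2 * gy (\<Phi> Z))))"
      by (rule integral_D(2)[of "%Z. f Z * (b1 * gx (\<Phi> Z) + b2 * gy (\<Phi> Z))"]) measurable
    also have "\<dots> = (LINT Z|\<mu>. f Z * As Z + f Z * Br Z)"
      by (rule LINT_cong) (use alg in \<open>auto simp flip: distrib_left\<close>)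
    also have "\<dots> = - (LINT Z|\<mu>. p Z * (X (fst Z) * \<psi> Z) + q Z * (w Z * Y (fst Z) * \<psi> Z))"
      using i1 i2 i3 P1 P2 by simp
    also have "(LINT Z|\<mu>. p Z * (X (fst Z) * \<psi> Z) + q Z * (w Z * Y (fst Z) * \<psi> Z))
      = (LINT Z|\<mu>. w Z * ((p Z / w Z * X (fst Z) + q Z * Y (fst Z)) * \<psi> Z))"
    proof (rule LINT_cong)
      fix Z assume "Z \<in> space \<mu>"
      then have "0 < w Z" by (intro w_pos_R) simp
      then show "p Z * (X (fst Z) * \<psi> Z) + q Z * (w Z * Y (fst Z) * \<psi> Z) = w Z * ((p Z / w Z * X (fst Z) + q Z * Y (fst Z)) * \<psi> Z)"
        by (simp add: field_simps)
    qed simp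
    also have "\<dots> = (LINT z|lebesgue_on D. (p (\<Psi> z) / w (\<Psi> z) * X (fst (\<Psi> z)) + q (\<Psi> z) * Y (fst (\<Psi> z))) * \<psi> (\<Psi> z))"
      by (rule integral_D(2)[symmetric]) measurable
    also have "\<dots> = (LINT z|lebesgue_on D. (frame p q (\<Psi> z) \<bullet> e) * \<phi> z)"
    proof (rule LINT_cong)
      fix z assume "z \<in> space (lebesgue_on D)"
      then have z: "z \<in> D" by (simp add: space_restrict_space)
      have "\<psi> (\<Psi> z) = \<phi> z" using \<Psi>_R[OF z] \<Phi>_\<Psi>[OF z] by (simp add: \<psi>_def)
      then show "(p (\<Psi> z) / w (\<Psi> z) * X (fst (\<Psi> z)) + q (\<Psi> z) * Y (fst (\<Psi> z))) * \<psi> (\<Psi> z) = (frame p q (\<Psi> z) \<bullet> e) * \<phi> z"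
        by (simp add: frame_def inner_prod_def X_def Y_def b1_def b2_def algebra_simps)
    qed simp
    finally show ?thesis .
  qed
  show "W12 D (%z. f (\<Psi> z)) (%z. frame p q (\<Psi> z))"
    unfolding W12_def using sf sg weak by blast
qed

end

section \<open>From weak gradients on the strip to partial derivatives on the rectangle\<close>

context curved_strip
begin

text \<open>\<open>\<zeta>\<close> in the coordinates \<open>\<Psi>\<close>, extended by 0, is a C1
  function with compact support in \<open>D\<close>. Its Cartesian gradient comes from the inverse
  Jacobian: the area factor cancels the division by \<open>w\<close> in the \<open>\<zeta>s\<close>
  term and stays in front of the \<open>\<zeta>r\<close> term.\<close>

lemma transported_test:
  assumes W: "W12 D v G" and ab: "0 < \<alpha>" "\<alpha> < \<beta>" "\<beta> < L" "0 < \<alpha>'" "\<alpha>' < \<beta>'" "\<beta>' < \<delta>"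
    and d: "\<And>Z. Z \<in> R ==> (\<zeta> has_derivative (%h. \<zeta>s Z * fst h + \<zeta>r Z * snd h)) (at Z)"
    and c: "continuous_on R \<zeta>s" "continuous_on R \<zeta>r"
    and z: "\<And>Z. Z \<notin> {\<alpha>..\<beta>} \<times> {\<alpha>'..\<beta>'} ==> \<zeta> Z = 0"
    and f: "f \<in> borel_measurable \<mu>" "AE z in lebesgue_on D. v z = f (\<Psi> z)"
    and g: "g1 \<in> borel_measurable \<mu>" "AE z in lebesgue_on D. fst (G z) = g1 (\<Psi> z)"
      "g2 \<in> borel_measurable \<mu>" "AE z in lebesgue_on D. snd (G z) = g2 (\<Psi> z)"
  shows "(LINT Z|\<mu>. f Z * (\<zeta>s Z * tx (fst Z) + w Z * \<zeta>r Z * ty (fst Z))) = - (LINT Z|\<mu>. w Z * (g1 Z * \<zeta> Z))"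
    "(LINT Z|\<mu>. f Z * (\<zeta>s Z * ty (fst Z) - w Z * \<zeta>r Z * tx (fst Z))) = - (LINT Z|\<mu>. w Z * (g2 Z * \<zeta> Z))"
proof -
  define Q where "Q = {\<alpha>..\<beta>} \<times> {\<alpha>'..\<beta>'}"
  have Q: "compact Q" "Q \<subseteq> R" using ab by (auto simp: Q_def intro!: compact_Times)
  define K where "K = \<Phi> ` Q"
  have K: "compact K" "K \<subseteq> D"
    unfolding K_def D_def using Q
    by (auto intro!: compact_continuous_image continuous_on_subset[OF \<Phi>_cont] image_mono simp: subset_eq simp del: split_paired_All split_paired_Ex)
  have Kc: "open (- K)" using compact_imp_closed[OF K(1)] by (rule open_Compl)
  have \<Psi>Q: "\<Psi> z \<notin> Q" if "z \<in> D" "z \<notin> K" for z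
  proof
    assume "\<Psi> z \<in> Q"
    then have "\<Phi> (\<Psi> z) \<in> K" unfolding K_def by (rule imageI)
    then show False using \<Phi>_\<Psi>[OF that(1)] that(2) by simp
  qed
  have z': "\<zeta>s Z = 0 \<and> \<zeta>r Z = 0" if xi: "Z \<in> R" "Z \<notin> Q" for Z
  proof -
    have "(\<zeta> has_derivative (%h. 0)) (at Z)"
      by (rule has_derivative_transform_within_open[where s = "- Q" and f = "%_. 0"])
        (use xi z compact_imp_closed[OF Q(1)] in \<open>auto simp: Q_def\<close>)
    from has_derivative_unique[OF this d[OF xi(1)]] have "(%h. 0) = (%h. \<zeta>s Z * fst h + \<zeta>r Z * snd h)" .
    from fun_cong[OF this, of "(1, 0)"] fun_cong[OF this, of "(0, 1)"] show ?thesis by simp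
  qed
  define \<phi> where "\<phi> z = (if z \<in> D then \<zeta> (\<Psi> z) else 0)" for z
  define \<phi>1 where "\<phi>1 z = (if z \<in> D then \<zeta>s (\<Psi> z) * tx (fst (\<Psi> z)) / w (\<Psi> z) + \<zeta>r (\<Psi> z) * ty (fst (\<Psi> z)) else 0)" for z
  define \<phi>2 where "\<phi>2 z = (if z \<in> D then \<zeta>s (\<Psi> z) * ty (fst (\<Psi> z)) / w (\<Psi> z) - \<zeta>r (\<Psi> z) * tx (fst (\<Psi> z)) else 0)" for z
  have zz: "\<phi> z = 0 \<and> \<phi>1 z = 0 \<and> \<phi>2 z = 0" if "z \<notin> K" for z
  proof (cases "z \<in> D")
    case True
    have "\<Psi> z \<notin> Q" by (rule \<Psi>Q[OF True that])
    then show ?thesis using z[of "\<Psi> z"] z'[OF \<Psi>_R[OF True]] by (simp add: \<phi>_def \<phi>1_def \<phi>2_def Q_def)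
  qed (simp add: \<phi>_def \<phi>1_def \<phi>2_def)
  have der: "(\<phi> has_derivative (%h. \<phi>1 z * fst h + \<phi>2 z * snd h)) (at z)" for z
  proof (cases "z \<in> D")
    case True
    have "((%z. \<zeta> (\<Psi> z)) has_derivative (%h. \<phi>1 z * fst h + \<phi>2 z * snd h)) (at z)"
      using has_derivative_compose[OF \<Psi>_deriv[OF True] d[OF \<Psi>_R[OF True]]]
      by (rule has_derivative_eq_rhs) (auto simp: \<phi>1_def \<phi>2_def True algebra_simps add_divide_distrib)
    then show ?thesis by (rule has_derivative_transform_within_open[OF _ D_open True]) (simp add: \<phi>_def)
  next
    case False
    then have zK: "z \<in> - K" using K(2) by blast
    have "((%_. 0) has_derivative (%h. \<phi>1 z * fst h + \<phi>2 z * snd h)) (at z)" using zz[of z] zK by simp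
    then show ?thesis by (rule has_derivative_transform_within_open[OF _ Kc zK]) (use zz in simp)
  qed
  \<comment> \<open>Continuity of the extensions is checked on two open sets covering the
    plane.\<close>
  have UN: "UNIV = D \<union> - K" using K(2) by blast
  have \<Psi>c: "continuous_on D \<Psi>" by (rule continuous_on_subset[OF \<Psi>_cont D_sub])
  have cD: "continuous_on D (%z. h (\<Psi> z))" if "continuous_on R h" for h :: "real \<times> real => real"
    by (rule continuous_on_compose2[OF that \<Psi>c]) (use \<Psi>_R in blast)
  have cf: "continuous_on R (%Z. g (fst Z))" if "continuous_on {0..L} g" for g :: "real => real"
    by (rule continuous_on_subset[OF continuous_of_fst[OF that] R_sub])
  have wc: "continuous_on R w" by (rule continuous_on_subset[OF w_cont R_sub])
  have ext: "continuous_on UNIV h" if "continuous_on R h'" "\<And>z. z \<in> D ==> h z = h' (\<Psi> z)" "\<And>z. z \<notin> K ==> h z = 0" for h h' :: "real \<times> real => real"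
    unfolding UN
  proof (rule continuous_on_open_Un[OF D_open Kc])
    show "continuous_on D h" using cD[OF that(1)] by (rule continuous_on_eq) (simp add: that(2))
    show "continuous_on (- K) h" using continuous_on_const[of "- K" 0] by (rule continuous_on_eq) (simp add: that(3))
  qed
  have wn: "\<forall>Z\<in>R. w Z \<noteq> 0" using w_pos_R by (metis less_irrefl)
  have r1: "continuous_on R (%Z. \<zeta>s Z * tx (fst Z) / w Z + \<zeta>r Z * ty (fst Z))"
    and r2: "continuous_on R (%Z. \<zeta>s Z * ty (fst Z) / w Z - \<zeta>r Z * tx (fst Z))"
    by (intro continuous_on_add continuous_on_diff continuous_on_mult continuous_on_divide c cf cont wc wn)+
  have c1: "continuous_on UNIV \<phi>1" by (rule ext[OF r1]) (simp_all add: \<phi>1_def zz[unfolded \<phi>1_def])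
  have c2: "continuous_on UNIV \<phi>2" by (rule ext[OF r2]) (simp_all add: \<phi>2_def zz[unfolded \<phi>2_def])
  note T = W12_C1_test[OF W D_open finite_D der c1 c2 K]
  have T1: "(LINT z|lebesgue_on D. v z * \<phi>1 z) = - (LINT z|lebesgue_on D. (G z \<bullet> (1, 0)) * \<phi> z)" by (rule T(1)) (simp add: zz)
  have T2: "(LINT z|lebesgue_on D. v z * \<phi>2 z) = - (LINT z|lebesgue_on D. (G z \<bullet> (0, 1)) * \<phi> z)" by (rule T(2)) (simp add: zz)
  have vm[measurable]: "v \<in> borel_measurable (lebesgue_on D)" and Gm[measurable]: "G \<in> borel_measurable (lebesgue_on D)"
    using W by (auto simp: W12_def square_integrable_def)
  have zc: "continuous_on R \<zeta>"
    by (intro continuous_at_imp_continuous_on ballI) (rule has_derivative_continuous[OF d])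
  have pc: "continuous_on UNIV \<phi>"
    by (intro continuous_at_imp_continuous_on ballI) (rule has_derivative_continuous[OF der])
  have lm: "h \<in> borel_measurable (lebesgue_on D)" if "continuous_on UNIV h" for h :: "real \<times> real => real"
    by (rule continuous_imp_measurable_on_sets_lebesgue[OF continuous_on_subset[OF that] D_lebesgue]) simp
  note [measurable] = lm[OF c1] lm[OF c2] lm[OF pc] f(1) g(1,3)
  have [measurable]: "\<zeta> \<in> borel_measurable \<mu>" "\<zeta>s \<in> borel_measurable \<mu>" "\<zeta>r \<in> borel_measurable \<mu>"
    by (intro borel_measurable_iv2_continuous zc c)+
  have I: "(LINT z|lebesgue_on D. v z * \<phi>1 z) = (LINT Z|\<mu>. w Z * (f Z * (\<zeta>s Z * tx (fst Z) / w Z + \<zeta>r Z * ty (fst Z))))"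
  proof (rule integral_D_AE)
    show "AE z in lebesgue_on D. v z * \<phi>1 z = f (\<Psi> z) * (\<zeta>s (\<Psi> z) * tx (fst (\<Psi> z)) / w (\<Psi> z) + \<zeta>r (\<Psi> z) * ty (fst (\<Psi> z)))"
      using f(2) AE_space[of "lebesgue_on D"] by eventually_elim (simp add: \<phi>1_def space_restrict_space)
  qed measurable
  have J: "(LINT z|lebesgue_on D. v z * \<phi>2 z) = (LINT Z|\<mu>. w Z * (f Z * (\<zeta>s Z * ty (fst Z) / w Z - \<zeta>r Z * tx (fst Z))))"
  proof (rule integral_D_AE)
    show "AE z in lebesgue_on D. v z * \<phi>2 z = f (\<Psi> z) * (\<zeta>s (\<Psi> z) * ty (fst (\<Psi> z)) / w (\<Psi> z) - \<zeta>r (\<Psi> z) * tx (fst (\<Psi> z)))"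
      using f(2) AE_space[of "lebesgue_on D"] by eventually_elim (simp add: \<phi>2_def space_restrict_space)
  qed measurable
  have I': "(LINT z|lebesgue_on D. (G z \<bullet> (1, 0)) * \<phi> z) = (LINT Z|\<mu>. w Z * (g1 Z * \<zeta> Z))"
  proof (rule integral_D_AE)
    show "AE z in lebesgue_on D. (G z \<bullet> (1, 0)) * \<phi> z = g1 (\<Psi> z) * \<zeta> (\<Psi> z)"
      using g(2) AE_space[of "lebesgue_on D"] by eventually_elim (simp add: \<phi>_def space_restrict_space inner_prod_def)
  qed measurable
  have J': "(LINT z|lebesgue_on D. (G z \<bullet> (0, 1)) * \<phi> z) = (LINT Z|\<mu>. w Z * (g2 Z * \<zeta> Z))"
  proof (rule integral_D_AE)
    show "AE z in lebesgue_on D. (G z \<bullet> (0, 1)) * \<phi> z = g2 (\<Psi> z) * \<zeta> (\<Psi> z)"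
      using g(4) AE_space[of "lebesgue_on D"] by eventually_elim (simp add: \<phi>_def space_restrict_space inner_prod_def)
  qed measurable
  have "(LINT Z|\<mu>. f Z * (\<zeta>s Z * tx (fst Z) + w Z * \<zeta>r Z * ty (fst Z))) =
    (LINT Z|\<mu>. w Z * (f Z * (\<zeta>s Z * tx (fst Z) / w Z + \<zeta>r Z * ty (fst Z))))"
    by (rule LINT_cong) (use wn in \<open>auto simp: field_simps\<close>)
  then show "(LINT Z|\<mu>. f Z * (\<zeta>s Z * tx (fst Z) + w Z * \<zeta>r Z * ty (fst Z))) = - (LINT Z|\<mu>. w Z * (g1 Z * \<zeta> Z))"
    using T1 I I' by simp
  have "(LINT Z|\<mu>. f Z * (\<zeta>s Z * ty (fst Z) - w Z * \<zeta>r Z * tx (fst Z))) =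
    (LINT Z|\<mu>. w Z * (f Z * (\<zeta>s Z * ty (fst Z) / w Z - \<zeta>r Z * tx (fst Z))))"
    by (rule LINT_cong) (use wn in \<open>auto simp: field_simps\<close>)
  then show "(LINT Z|\<mu>. f Z * (\<zeta>s Z * ty (fst Z) - w Z * \<zeta>r Z * tx (fst Z))) = - (LINT Z|\<mu>. w Z * (g2 Z * \<zeta> Z))"
    using T2 J J' by simp
qed

lemma integrable_mult_continuous_support:
  fixes h g :: "real \<times> real => real"
  assumes h: "integrable \<mu> h" and c: "continuous_on R g"
    and Q: "0 < \<alpha>" "\<beta> < L" "0 < \<alpha>'" "\<beta>' < \<delta>" and z: "\<And>Z. Z \<notin> {\<alpha>..\<beta>} \<times> {\<alpha>'..\<beta>'} ==> g Z = 0"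
  shows "integrable \<mu> (%Z. h Z * g Z)"
proof -
  have "bounded (g ` ({\<alpha>..\<beta>} \<times> {\<alpha>'..\<beta>'}))"
    by (intro compact_imp_bounded compact_continuous_image continuous_on_subset[OF c] compact_Times compact_Icc) (use Q in auto)
  then obtain B where B: "B > 0" "\<forall>u\<in>g ` ({\<alpha>..\<beta>} \<times> {\<alpha>'..\<beta>'}). norm u \<le> B" unfolding bounded_pos by blast
  have "\<bar>g Z\<bar> \<le> B" for Z
  proof (cases "Z \<in> {\<alpha>..\<beta>} \<times> {\<alpha>'..\<beta>'}")
    case True
    then have "g Z \<in> g ` ({\<alpha>..\<beta>} \<times> {\<alpha>'..\<beta>'})" by (rule imageI)
    then show ?thesis using B(2) by auto
  next
    case False then show ?thesis using z B(1) by simp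
  qed
  then show ?thesis by (intro integrable_iv2_mult_bounded[OF h borel_measurable_iv2_continuous[OF c]])
qed

text \<open>The two Cartesian identities are recombined into pure derivatives. Testing with
  \<open>A * B\<close> times the components of the tangent isolates the \<open>s\<close>-derivative;
  testing with \<open>A * B / w\<close> times the components of \<open>(ty, - tx)\<close> isolates
  the \<open>r\<close>-derivative. Curvature terms cancel, in the second case against the derivative
  of \<open>1 / w\<close>.\<close>

theorem W12_rep:
  assumes W: "W12 D v G"
  obtains f p q where "rep v G f p q"
proof -
  have vm: "v \<in> borel_measurable (lebesgue_on D)" and Gm: "G \<in> borel_measurable (lebesgue_on D)"
    using W by (auto simp: W12_def square_integrable_def)
  have G12: "(%z. fst (G z)) \<in> borel_measurable (lebesgue_on D)" "(%z. snd (G z)) \<in> borel_measurable (lebesgue_on D)"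
    by (rule measurable_compose[OF Gm borel_measurable_continuous_onI], intro continuous_on_fst continuous_on_snd continuous_on_id)+
  obtain f where f: "f \<in> borel_measurable \<mu>" "AE z in lebesgue_on D. v z = f (\<Psi> z)" by (rule rep_exists[OF vm])
  obtain g1 where g1: "g1 \<in> borel_measurable \<mu>" "AE z in lebesgue_on D. fst (G z) = g1 (\<Psi> z)" by (rule rep_exists[OF G12(1)])
  obtain g2 where g2: "g2 \<in> borel_measurable \<mu>" "AE z in lebesgue_on D. snd (G z) = g2 (\<Psi> z)" by (rule rep_exists[OF G12(2)])
  note [measurable] = f(1) g1(1) g2(1) vm Gm G12
  \<comment> \<open>Inverse of \<open>frame\<close>: the components of the gradient in the moving
    frame, the tangential one rescaled by the speed \<open>w\<close>.\<close>
  define p where "p Z = w Z * (g1 Z * tx (fst Z) + g2 Z * ty (fst Z))" for Z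
  define q where "q Z = g1 Z * ty (fst Z) - g2 Z * tx (fst Z)" for Z
  have [measurable]: "p \<in> borel_measurable \<mu>" "q \<in> borel_measurable \<mu>"
    unfolding p_def q_def by measurable
  have LG: "square_integrable D v" "square_integrable D G" using W by (auto simp: W12_def)
  have f2: "integrable \<mu> (%Z. (f Z)^2)"
  proof (rule integral_D_AE(2)[THEN iffD1])
    show "integrable (lebesgue_on D) (%z. (v z)^2)" using LG(1) by (simp add: square_integrable_def)
    show "AE z in lebesgue_on D. (v z)^2 = (f (\<Psi> z))^2" using f(2) by eventually_elim simp
  qed measurable
  have Gi: "(%z. G z \<bullet> (1,0)) = (%z. fst (G z))" "(%z. G z \<bullet> (0,1)) = (%z. snd (G z))" by (auto simp: inner_prod_def)
  have gi: "integrable \<mu> (%Z. (g1 Z)^2)" "integrable \<mu> (%Z. (g2 Z)^2)"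
  proof -
    have "square_integrable D (%z. fst (G z))" using square_integrable_inner[OF LG(2), of "(1, 0)"] by (simp add: Gi Basis_plane)
    then have 1: "integrable (lebesgue_on D) (%z. (fst (G z))^2)" by (simp add: square_integrable_def)
    have "square_integrable D (%z. snd (G z))" using square_integrable_inner[OF LG(2), of "(0, 1)"] by (simp add: Gi Basis_plane)
    then have 2: "integrable (lebesgue_on D) (%z. (snd (G z))^2)" by (simp add: square_integrable_def)
    show "integrable \<mu> (%Z. (g1 Z)^2)"
    proof (rule integral_D_AE(2)[THEN iffD1, OF _ _ _ 1])
      show "AE z in lebesgue_on D. (fst (G z))^2 = (g1 (\<Psi> z))^2" using g1(2) by eventually_elim simp
    qed measurable
    show "integrable \<mu> (%Z. (g2 Z)^2)"
    proof (rule integral_D_AE(2)[THEN iffD1, OF _ _ _ 2])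
      show "AE z in lebesgue_on D. (snd (G z))^2 = (g2 (\<Psi> z))^2" using g2(2) by eventually_elim simp
    qed measurable
  qed
  obtain C where C: "C > 0" "\<And>z. z \<in> Rc ==> w z \<le> C" using w_bounds by metis
  have sm: "integrable \<mu> (%Z. (h Z * m Z)^2)" if "integrable \<mu> (%Z. (h Z)^2)" "m \<in> borel_measurable \<mu>" "\<And>Z. Z \<in> R ==> \<bar>m Z\<bar> \<le> B" for h m :: "real \<times> real => real" and B
  proof -
    have [measurable]: "m \<in> borel_measurable \<mu>" by (rule that(2))
    have "integrable \<mu> (%Z. (h Z)^2 * (m Z)^2)"
    proof (rule integrable_iv2_mult_bounded[OF that(1), of _ "B^2"])
      fix Z assume "Z \<in> R"
      from that(3)[OF this] have "\<bar>m Z\<bar>^2 \<le> B^2" by (intro power_mono) auto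
      then show "\<bar>(m Z)^2\<bar> \<le> B^2" by simp
    qed measurable
    then show ?thesis by (simp add: power_mult_distrib)
  qed
  have ti: "integrable \<mu> (%Z. (g Z * tx (fst Z))^2)" "integrable \<mu> (%Z. (g Z * ty (fst Z))^2)" "integrable \<mu> (%Z. (g Z * (- tx (fst Z)))^2)"
    if "integrable \<mu> (%Z. (g Z)^2)" for g :: "real \<times> real => real"
    using t_bound by (intro sm[OF that, where B = 1]; simp)+
  have pq2: "integrable \<mu> (%Z. (p Z)^2)" "integrable \<mu> (%Z. (q Z)^2)"
  proof -
    have "integrable \<mu> (%Z. (g1 Z * tx (fst Z) + g2 Z * ty (fst Z))^2)"
      by (intro integrable_add_L2 ti gi) measurable
    then have "integrable \<mu> (%Z. ((g1 Z * tx (fst Z) + g2 Z * ty (fst Z)) * w Z)^2)"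
    proof (rule sm[where B = C])
      fix Z assume x: "Z \<in> R"
      show "\<bar>w Z\<bar> \<le> C" using C(2)[OF subsetD[OF R_sub x]] w_pos_R[OF x] by simp
    qed measurable
    then show "integrable \<mu> (%Z. (p Z)^2)" by (simp add: p_def mult.commute)
    have "integrable \<mu> (%Z. (g1 Z * ty (fst Z) + g2 Z * (- tx (fst Z)))^2)"
      by (intro integrable_add_L2 ti gi) measurable
    then show "integrable \<mu> (%Z. (q Z)^2)" by (simp add: q_def)
  qed
  note int = integrable_of_L2[OF finite_measure_iv2]
  have fi: "integrable \<mu> f" "integrable \<mu> p" "integrable \<mu> q" "integrable \<mu> g1" "integrable \<mu> g2"
    by (rule int; (rule f2 pq2 gi)?; measurable)+
  have wgi: "integrable \<mu> (%Z. w Z * g1 Z)" "integrable \<mu> (%Z. w Z * g2 Z)"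
    using fi(4,5) by (simp_all add: integrable_w)
  have k1: "(%Z. k' (fst Z)) \<in> borel_measurable \<mu>" by (rule fst_measurable_R[OF cont(6)])
  have cf: "continuous_on R (%Z. g (fst Z))" if "continuous_on {0..L} g" for g :: "real => real"
    by (rule continuous_on_subset[OF continuous_of_fst[OF that] R_sub])
  have wc: "continuous_on R w" by (rule continuous_on_subset[OF w_cont R_sub])
  have wn: "\<forall>Z\<in>R. w Z \<noteq> 0" using w_pos_R by (metis less_irrefl)
  have weak: "(LINT Z|\<mu>. f Z * (A' (fst Z) * B (snd Z))) = - (LINT Z|\<mu>. p Z * (A (fst Z) * B (snd Z)))"
    "(LINT Z|\<mu>. f Z * (A (fst Z) * B' (snd Z))) = - (LINT Z|\<mu>. q Z * (A (fst Z) * B (snd Z)))"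
    if A: "bump L A A'" and B: "bump \<delta> B B'" for A A' B B'
  proof -
    obtain \<alpha> \<beta> where ab: "0 < \<alpha>" "\<alpha> < \<beta>" "\<beta> < L" "\<And>s. s \<notin> {\<alpha>..\<beta>} ==> A s = 0" using A unfolding bump_def by blast
    obtain \<alpha>' \<beta>' where ab': "0 < \<alpha>'" "\<alpha>' < \<beta>'" "\<beta>' < \<delta>" "\<And>s. s \<notin> {\<alpha>'..\<beta>'} ==> B s = 0" using B unfolding bump_def by blast
    have dA: "(A has_real_derivative A' s) (at s)" for s using A by (simp add: bump_def)
    have dB: "(B has_real_derivative B' s) (at s)" for s using B by (simp add: bump_def)
    have c1: "continuous_on R (%Z. h (fst Z))" "continuous_on R (%Z. h (snd Z))" if "continuous_on UNIV h" for h :: "real => real"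
      using continuous_on_compose2[OF that, of R fst] continuous_on_compose2[OF that, of R snd] by (simp_all add: continuous_on_fst continuous_on_snd continuous_on_id)
    note AB = c1(1)[OF bump_continuous[OF A]] c1(1)[OF bump_continuous'[OF A]] c1(2)[OF bump_continuous[OF B]] c1(2)[OF bump_continuous'[OF B]]
    have D1: "((%Z. h (fst Z)) has_derivative (%u. h' * fst u)) (at Z)" if "(h has_real_derivative h') (at (fst Z))" for h h' and Z :: "real \<times> real"
      by (rule has_derivative_compose[of fst fst Z UNIV h, OF _ that[unfolded has_field_derivative_def]]) (auto intro!: derivative_eq_intros)
    have D2: "((%Z. h (snd Z)) has_derivative (%u. h' * snd u)) (at Z)" if "(h has_real_derivative h') (at (snd Z))" for h h' and Z :: "real \<times> real"
      by (rule has_derivative_compose[of snd snd Z UNIV h, OF _ that[unfolded has_field_derivative_def]]) (auto intro!: derivative_eq_intros)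
    have Dw: "(w has_derivative (%u. (snd Z * k' (fst Z)) * fst u + k (fst Z) * snd u)) (at Z)" if "Z \<in> R" for Z
    proof -
      have s: "0 < fst Z" "fst Z < L" using that by auto
      show ?thesis unfolding w_def[abs_def] by (auto intro!: derivative_eq_intros D1[OF k'[OF s]] simp: algebra_simps)
    qed
    have zAB: "A (fst Z) * B (snd Z) = 0" if "Z \<notin> {\<alpha>..\<beta>} \<times> {\<alpha>'..\<beta>'}" for Z
      using that ab(4) ab'(4) by (cases Z) auto
    note TT = transported_test[OF W ab(1-3) ab'(1-3) _ _ _ _ f(1,2) g1(1,2) g2(1,2)]
    have im: "integrable \<mu> (%Z. h Z * (m Z * (A (fst Z) * B (snd Z))))" if "integrable \<mu> h" "continuous_on R m" for h m :: "real \<times> real => real"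
      by (rule integrable_mult_continuous_support[OF that(1) _ ab(1,3) ab'(1,3)])
        (use zAB in \<open>auto intro!: continuous_on_mult that(2) AB simp del: mult_eq_0_iff\<close>)
    have im': "integrable \<mu> (%Z. h Z * g Z)" if "integrable \<mu> h" "continuous_on R g" "\<And>Z. Z \<notin> {\<alpha>..\<beta>} \<times> {\<alpha>'..\<beta>'} ==> g Z = 0" for h g :: "real \<times> real => real"
      by (rule integrable_mult_continuous_support[OF that(1,2) ab(1,3) ab'(1,3) that(3)])
    have zA': "A' s = 0" if "s \<notin> {\<alpha>..\<beta>}" for s
    proof -
      have "(A has_real_derivative 0) (at s)"
        by (rule has_field_derivative_transform_within_open[where S = "- {\<alpha>..\<beta>}" and f = "%_. 0"]) (use that ab(4) in auto)
      then show ?thesis using DERIV_unique[OF dA] by blast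
    qed
    have zB': "B' s = 0" if "s \<notin> {\<alpha>'..\<beta>'}" for s
    proof -
      have "(B has_real_derivative 0) (at s)"
        by (rule has_field_derivative_transform_within_open[where S = "- {\<alpha>'..\<beta>'}" and f = "%_. 0"]) (use that ab'(4) in auto)
      then show ?thesis using DERIV_unique[OF dB] by blast
    qed
    have zz: "A (fst Z) * B' (snd Z) = 0" "A' (fst Z) * B (snd Z) = 0" if "Z \<notin> {\<alpha>..\<beta>} \<times> {\<alpha>'..\<beta>'}" for Z
      using that ab(4) ab'(4) zA' zB' by (cases Z; auto)+
    define X1 where "X1 = (%Z. tx (fst Z) * (A (fst Z) * B (snd Z)))"
    define X1s where "X1s Z = - k (fst Z) * ty (fst Z) * (A (fst Z) * B (snd Z)) + tx (fst Z) * (A' (fst Z) * B (snd Z))" for Z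
    define X1r where "X1r Z = tx (fst Z) * (A (fst Z) * B' (snd Z))" for Z
    define X2 where "X2 = (%Z. ty (fst Z) * (A (fst Z) * B (snd Z)))"
    define X2s where "X2s Z = k (fst Z) * tx (fst Z) * (A (fst Z) * B (snd Z)) + ty (fst Z) * (A' (fst Z) * B (snd Z))" for Z
    define X2r where "X2r Z = ty (fst Z) * (A (fst Z) * B' (snd Z))" for Z
    have Xd: "(X1 has_derivative (%h. X1s Z * fst h + X1r Z * snd h)) (at Z)" "(X2 has_derivative (%h. X2s Z * fst h + X2r Z * snd h)) (at Z)"
      if "Z \<in> R" for Z
    proof -
      have s: "0 < fst Z" "fst Z < L" using that by auto
      show "(X1 has_derivative (%h. X1s Z * fst h + X1r Z * snd h)) (at Z)" unfolding X1_def
        by (auto intro!: derivative_eq_intros D1[OF dA] D2[OF dB] D1[OF tx'[OF s]] simp: X1s_def X1r_def algebra_simps)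
      show "(X2 has_derivative (%h. X2s Z * fst h + X2r Z * snd h)) (at Z)" unfolding X2_def
        by (auto intro!: derivative_eq_intros D1[OF dA] D2[OF dB] D1[OF ty'[OF s]] simp: X2s_def X2r_def algebra_simps)
    qed
    have Xc: "continuous_on R X1s" "continuous_on R X1r" "continuous_on R X2s" "continuous_on R X2r"
      unfolding X1s_def[abs_def] X1r_def[abs_def] X2s_def[abs_def] X2r_def[abs_def]
      by (intro continuous_on_add continuous_on_mult continuous_on_minus cf cont AB)+
    have Xz: "X1 Z = 0" "X2 Z = 0" "X1s Z = 0" "X2s Z = 0" "X1r Z = 0" "X2r Z = 0" if "Z \<notin> {\<alpha>..\<beta>} \<times> {\<alpha>'..\<beta>'}" for Z
      unfolding X1_def X2_def X1s_def X2s_def X1r_def X2r_def zAB[OF that] zz[OF that] by simp_all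
    note T1 = TT(1)[OF Xd(1) Xc(1,2) Xz(1)] and T2 = TT(2)[OF Xd(2) Xc(3,4) Xz(2)]
    have iT: "integrable \<mu> (%Z. f Z * (X1s Z * tx (fst Z) + w Z * X1r Z * ty (fst Z)))"
      "integrable \<mu> (%Z. f Z * (X2s Z * ty (fst Z) - w Z * X2r Z * tx (fst Z)))"
      by (rule im'[OF fi(1)], intro continuous_on_add continuous_on_diff continuous_on_mult cf cont wc Xc, simp add: Xz)+
    have iG: "integrable \<mu> (%Z. w Z * (g1 Z * X1 Z))" "integrable \<mu> (%Z. w Z * (g2 Z * X2 Z))"
      unfolding mult.assoc[symmetric]
      subgoal by (rule im'[OF wgi(1)], unfold X1_def, intro continuous_on_mult cf cont AB, simp add: zAB del: mult_eq_0_iff)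
      subgoal by (rule im'[OF wgi(2)], unfold X2_def, intro continuous_on_mult cf cont AB, simp add: zAB del: mult_eq_0_iff)
      done
    have "(LINT Z|\<mu>. f Z * (A' (fst Z) * B (snd Z))) =
      (LINT Z|\<mu>. f Z * (X1s Z * tx (fst Z) + w Z * X1r Z * ty (fst Z)) + f Z * (X2s Z * ty (fst Z) - w Z * X2r Z * tx (fst Z)))"
    proof (rule LINT_cong)
      fix Z assume "Z \<in> space \<mu>"
      then have u: "tx (fst Z) * tx (fst Z) + ty (fst Z) * ty (fst Z) = 1" by (intro unit_R) simp
      have "f Z * (X1s Z * tx (fst Z) + w Z * X1r Z * ty (fst Z)) + f Z * (X2s Z * ty (fst Z) - w Z * X2r Z * tx (fst Z))
        = f Z * (A' (fst Z) * B (snd Z)) * (tx (fst Z) * tx (fst Z) + ty (fst Z) * ty (fst Z))"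
        unfolding X1s_def X1r_def X2s_def X2r_def by (simp add: algebra_simps)
      then show "f Z * (A' (fst Z) * B (snd Z)) =
        f Z * (X1s Z * tx (fst Z) + w Z * X1r Z * ty (fst Z)) + f Z * (X2s Z * ty (fst Z) - w Z * X2r Z * tx (fst Z))"
        using u by simp
    qed simp
    also have "\<dots> = - (LINT Z|\<mu>. w Z * (g1 Z * X1 Z) + w Z * (g2 Z * X2 Z))"
      using iT iG T1 T2 by simp
    also have "(LINT Z|\<mu>. w Z * (g1 Z * X1 Z) + w Z * (g2 Z * X2 Z)) = (LINT Z|\<mu>. p Z * (A (fst Z) * B (snd Z)))"
      by (rule LINT_cong) (auto simp: p_def X1_def X2_def algebra_simps)
    finally show "(LINT Z|\<mu>. f Z * (A' (fst Z) * B (snd Z))) = - (LINT Z|\<mu>. p Z * (A (fst Z) * B (snd Z)))" .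
    \<comment> \<open>\<open>m\<close> and \<open>n\<close> are the negatives of the partial
      derivatives of \<open>1 / w\<close>.\<close>
    define m where "m Z = snd Z * k' (fst Z) / (w Z)^2" for Z
    define n where "n Z = k (fst Z) / (w Z)^2" for Z
    have w2: "\<forall>Z\<in>R. (w Z)^2 \<noteq> 0" using wn by simp
    have mc: "continuous_on R m" "continuous_on R n" "continuous_on R (%Z. 1 / w Z)" unfolding m_def[abs_def] n_def[abs_def]
      by (intro continuous_on_mult continuous_on_divide continuous_on_power continuous_on_snd continuous_on_id continuous_on_const cf cont wc w2 wn)+
    have Di: "((%Z. 1 / w Z) has_derivative (%h. - m Z * fst h + - n Z * snd h)) (at Z)" if "Z \<in> R" for Z
    proof -
      have "w Z \<noteq> 0" by (rule bspec[OF wn that])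
      then show ?thesis
        by (auto intro!: derivative_eq_intros Dw[OF that] simp: m_def n_def field_simps power2_eq_square)
    qed
    define Y1 where "Y1 Z = X2 Z * (1 / w Z)" for Z
    define Y1s where "Y1s Z = X2s Z * (1 / w Z) - X2 Z * m Z" for Z
    define Y1r where "Y1r Z = X2r Z * (1 / w Z) - X2 Z * n Z" for Z
    define Y2 where "Y2 Z = - X1 Z * (1 / w Z)" for Z
    define Y2s where "Y2s Z = - X1s Z * (1 / w Z) + X1 Z * m Z" for Z
    define Y2r where "Y2r Z = - X1r Z * (1 / w Z) + X1 Z * n Z" for Z
    have Yd: "(Y1 has_derivative (%h. Y1s Z * fst h + Y1r Z * snd h)) (at Z)" "(Y2 has_derivative (%h. Y2s Z * fst h + Y2r Z * snd h)) (at Z)"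
      if x: "Z \<in> R" for Z
    proof -
      show "(Y1 has_derivative (%h. Y1s Z * fst h + Y1r Z * snd h)) (at Z)" unfolding Y1_def[abs_def]
        by (rule has_derivative_eq_rhs[OF has_derivative_mult[OF Xd(2)[OF x] Di[OF x]]]) (auto simp: Y1s_def Y1r_def algebra_simps)
      show "(Y2 has_derivative (%h. Y2s Z * fst h + Y2r Z * snd h)) (at Z)" unfolding Y2_def[abs_def]
        by (rule has_derivative_eq_rhs[OF has_derivative_mult[OF has_derivative_minus[OF Xd(1)[OF x]] Di[OF x]]]) (auto simp: Y2s_def Y2r_def algebra_simps)
    qed
    have X12c: "continuous_on R X1" "continuous_on R X2" unfolding X1_def X2_def by (intro continuous_on_mult cf cont AB)+
    have Yc: "continuous_on R Y1s" "continuous_on R Y1r" "continuous_on R Y2s" "continuous_on R Y2r" "continuous_on R Y1" "continuous_on R Y2"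
      unfolding Y1s_def[abs_def] Y1r_def[abs_def] Y2s_def[abs_def] Y2r_def[abs_def] Y1_def[abs_def] Y2_def[abs_def]
      by (intro continuous_on_add continuous_on_diff continuous_on_mult continuous_on_minus Xc X12c mc)+
    have Yz: "Y1 Z = 0" "Y2 Z = 0" "Y1s Z = 0" "Y2s Z = 0" "Y1r Z = 0" "Y2r Z = 0" if "Z \<notin> {\<alpha>..\<beta>} \<times> {\<alpha>'..\<beta>'}" for Z
      unfolding Y1_def Y2_def Y1s_def Y2s_def Y1r_def Y2r_def Xz[OF that] by simp_all
    note U1 = TT(1)[OF Yd(1) Yc(1,2) Yz(1)] and U2 = TT(2)[OF Yd(2) Yc(3,4) Yz(2)]
    have iU: "integrable \<mu> (%Z. f Z * (Y1s Z * tx (fst Z) + w Z * Y1r Z * ty (fst Z)))"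
      "integrable \<mu> (%Z. f Z * (Y2s Z * ty (fst Z) - w Z * Y2r Z * tx (fst Z)))"
      by (rule im'[OF fi(1)], intro continuous_on_add continuous_on_diff continuous_on_mult cf cont wc Yc, simp add: Yz)+
    have iH: "integrable \<mu> (%Z. w Z * (g1 Z * Y1 Z))" "integrable \<mu> (%Z. w Z * (g2 Z * Y2 Z))"
      unfolding mult.assoc[symmetric]
      by (rule im'[OF wgi(1) Yc(5) Yz(1)] im'[OF wgi(2) Yc(6) Yz(2)]; assumption)+
    have "(LINT Z|\<mu>. f Z * (A (fst Z) * B' (snd Z))) =
      (LINT Z|\<mu>. f Z * (Y1s Z * tx (fst Z) + w Z * Y1r Z * ty (fst Z)) + f Z * (Y2s Z * ty (fst Z) - w Z * Y2r Z * tx (fst Z)))"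
    proof (rule LINT_cong)
      fix Z assume "Z \<in> space \<mu>"
      then have xR: "Z \<in> R" by simp
      define a c i where "a = tx (fst Z)" and "c = ty (fst Z)" and "i = 1 / w Z"
      have u: "a * a + c * c = 1" using unit_R[OF xR] by (simp add: a_def c_def)
      have wi: "w Z * i = 1" using bspec[OF wn xR] by (simp add: i_def)
      have nn: "w Z * n Z = k (fst Z) * i" using bspec[OF wn xR] by (simp add: n_def i_def power2_eq_square)
      have "Y1s Z * a + w Z * Y1r Z * c + (Y2s Z * c - w Z * Y2r Z * a)
         = i * (X2s Z * a - X1s Z * c) + (w Z * i) * (X2r Z * c + X1r Z * a) - (w Z * n Z) * (X2 Z * c + X1 Z * a)
           + m Z * (X1 Z * c - X2 Z * a)"
        unfolding Y1s_def Y1r_def Y2s_def Y2r_def i_def[symmetric] by (simp add: algebra_simps)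
      also have "X2s Z * a - X1s Z * c = k (fst Z) * (A (fst Z) * B (snd Z)) * (a * a + c * c)"
        unfolding X1s_def X2s_def a_def[symmetric] c_def[symmetric] by (simp add: algebra_simps)
      also have "X2r Z * c + X1r Z * a = A (fst Z) * B' (snd Z) * (a * a + c * c)"
        unfolding X1r_def X2r_def a_def[symmetric] c_def[symmetric] by (simp add: algebra_simps)
      also have "X2 Z * c + X1 Z * a = A (fst Z) * B (snd Z) * (a * a + c * c)"
        unfolding X1_def X2_def a_def[symmetric] c_def[symmetric] by (simp add: algebra_simps)
      also have "X1 Z * c - X2 Z * a = 0"
        unfolding X1_def X2_def a_def[symmetric] c_def[symmetric] by (simp add: algebra_simps)
      finally have "Y1s Z * a + w Z * Y1r Z * c + (Y2s Z * c - w Z * Y2r Z * a) = A (fst Z) * B' (snd Z)"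
        unfolding u wi nn by simp
      then show "f Z * (A (fst Z) * B' (snd Z)) =
        f Z * (Y1s Z * tx (fst Z) + w Z * Y1r Z * ty (fst Z)) + f Z * (Y2s Z * ty (fst Z) - w Z * Y2r Z * tx (fst Z))"
        unfolding a_def c_def by (simp flip: distrib_left)
    qed simp
    also have "\<dots> = - (LINT Z|\<mu>. w Z * (g1 Z * Y1 Z) + w Z * (g2 Z * Y2 Z))"
      using iU iH U1 U2 by simp
    also have "(LINT Z|\<mu>. w Z * (g1 Z * Y1 Z) + w Z * (g2 Z * Y2 Z)) = (LINT Z|\<mu>. q Z * (A (fst Z) * B (snd Z)))"
    proof (rule LINT_cong)
      fix Z assume "Z \<in> space \<mu>"
      then have "w Z \<noteq> 0" using bspec[OF wn, of Z] by simp
      then show "w Z * (g1 Z * Y1 Z) + w Z * (g2 Z * Y2 Z) = q Z * (A (fst Z) * B (snd Z))"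
        by (simp add: q_def Y1_def Y2_def X1_def X2_def algebra_simps)
    qed simp
    finally show "(LINT Z|\<mu>. f Z * (A (fst Z) * B' (snd Z))) = - (LINT Z|\<mu>. q Z * (A (fst Z) * B (snd Z)))" .
  qed
  have hor: "AE r in iv \<delta>. wAC L (%s. f (s, r)) (%s. p (s, r))"
    by (rule weak_imp_wAC[OF L fi(1,2) weak(1)])
  \<comment> \<open>The vertical direction is the horizontal statement with the two variables
    exchanged.\<close>
  have ver: "AE s in iv L. wAC \<delta> (%r. f (snd (r, s), fst (r, s))) (%r. q (snd (r, s), fst (r, s)))"
  proof (rule weak_imp_wAC[OF \<delta> integrable_iv2_swap[OF fi(1)] integrable_iv2_swap[OF fi(3)]])
    fix B B' A A' assume B: "bump \<delta> B B'" and A: "bump L A A'"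
    have swp: "(LINT z|iv2 \<delta> L. h (snd z, fst z)) = (LINT z|\<mu>. h z)" if "h \<in> borel_measurable \<mu>" for h :: "real \<times> real => real"
      using iv2.integral_product_swap[of h L \<delta>] that by (simp add: case_prod_beta')
    have [measurable]: "A \<in> borel_measurable borel" "B \<in> borel_measurable borel" "B' \<in> borel_measurable borel"
      by (rule borel_measurable_continuous_onI, rule bump_continuous[OF A] bump_continuous[OF B] bump_continuous'[OF B])+
    have "(LINT z|iv2 \<delta> L. f (snd z, fst z) * (B' (fst z) * A (snd z))) = (LINT z|\<mu>. f z * (A (fst z) * B' (snd z)))"
      using swp[of "%z. f z * (A (fst z) * B' (snd z))"] by (simp add: mult_ac)
    moreover have "(LINT z|iv2 \<delta> L. q (snd z, fst z) * (B (fst z) * A (snd z))) = (LINT z|\<mu>. q z * (A (fst z) * B (snd z)))"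
      using swp[of "%z. q z * (A (fst z) * B (snd z))"] by (simp add: mult_ac)
    ultimately show "(LINT z|iv2 \<delta> L. f (snd z, fst z) * (B' (fst z) * A (snd z))) = - (LINT z|iv2 \<delta> L. q (snd z, fst z) * (B (fst z) * A (snd z)))"
      using weak(2)[OF A B] by simp
  qed
  have "Sob L \<delta> f p q" unfolding Sob_def using f2 pq2 hor ver by simp
  moreover have "AE z in lebesgue_on D. v z = f (\<Psi> z) \<and> G z = frame p q (\<Psi> z)"
    using f(2) g1(2) g2(2) AE_space[of "lebesgue_on D"]
  proof eventually_elim
    case (elim z)
    then have zR: "\<Psi> z \<in> R" by (intro \<Psi>_R) (simp add: space_restrict_space)
    define a c where "a = tx (fst (\<Psi> z))" and "c = ty (fst (\<Psi> z))"
    have u: "a * a + c * c = 1" using unit_R[OF zR] by (simp add: a_def c_def)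
    have pw: "p (\<Psi> z) / w (\<Psi> z) = g1 (\<Psi> z) * a + g2 (\<Psi> z) * c" using w_pos_R[OF zR] by (simp add: p_def a_def c_def)
    have "(g1 (\<Psi> z) * a + g2 (\<Psi> z) * c) * a + (g1 (\<Psi> z) * c - g2 (\<Psi> z) * a) * c = g1 (\<Psi> z) * (a * a + c * c)"
      "(g1 (\<Psi> z) * a + g2 (\<Psi> z) * c) * c - (g1 (\<Psi> z) * c - g2 (\<Psi> z) * a) * a = g2 (\<Psi> z) * (a * a + c * c)"
      by (simp_all add: algebra_simps)
    then have "frame p q (\<Psi> z) = (g1 (\<Psi> z), g2 (\<Psi> z))"
      unfolding frame_def pw u a_def[symmetric] c_def[symmetric] by (simp add: q_def flip: a_def c_def)
    then show ?case using elim by (cases "G z") simp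
  qed
  ultimately have "rep v G f p q" by (simp add: rep_def)
  then show ?thesis by (rule that)
qed

end

lemma AE_False_iff: "(AE x in M. False) \<longleftrightarrow> emeasure M (space M) = 0"
  by (subst AE_iff_measurable[OF sets.top]) auto

text \<open>Source of explicit trial functions: the coordinate \<open>s\<close> shows nontriviality,
  a cosine gives the upper bound for flat strips.\<close>

lemma Sob_of_fst:
  assumes a: "0 < a" and b: "0 < b" and d: "\<And>s. (g has_real_derivative g' s) (at s)" and c: "continuous_on UNIV g'"
  shows "Sob a b (%z. g (fst z)) (%z. g' (fst z)) (%z. 0)"
proof -
  have cg: "continuous_on S g" for S
    by (rule continuous_on_subset[of UNIV]) (use d in \<open>auto intro!: continuous_at_imp_continuous_on DERIV_isCont\<close>)
  have cg': "continuous_on S g'" for S by (rule continuous_on_subset[OF c]) simp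
  have m: "(%z. h (fst z)) \<in> borel_measurable (iv2 a b)" "integrable (iv2 a b) (%z. (h (fst z))^2)"
    if h: "\<And>S. continuous_on S h" for h :: "real => real"
  proof -
    show "(%z. h (fst z)) \<in> borel_measurable (iv2 a b)"
      by (intro borel_measurable_iv2_continuous continuous_on_compose2[OF h[of UNIV]] continuous_on_fst continuous_on_id) auto
    show "integrable (iv2 a b) (%z. (h (fst z))^2)"
      by (rule integrable_iv2_of_fst[where h = "%s. (h s)^2"], intro integrable_iv_continuous continuous_on_power h)
  qed
  have "wAC a g g'"
    by (intro AC_imp_wAC AC_smooth cg d integrable_iv_continuous cg')
  moreover have "wAC b (%r. g s) (%r. 0)" for s by (intro AC_imp_wAC AC_const)
  ultimately show ?thesis using m[of g, OF cg] m[of g', OF cg'] unfolding Sob_def by simp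
qed

section \<open>Mass and energy forms, and the first nonzero eigenvalue of the strip\<close>

context curved_strip
begin

lemma one: "W12 D (%z. 1) (%z. 0)"
  using Sob_W12(1)[OF Sob_const[of L \<delta> 1]] by (simp add: frame_def zero_prod_def[symmetric])

definition mm :: "(real \<times> real => real) => (real \<times> real => real) => real" where
  "mm f g = (LINT Z|\<mu>. w Z * (f Z * g Z))"

text \<open>The factor \<open>1 / w\<close> at the first product is the area factor \<open>w\<close>
  times the two divisions by the speed in \<open>frame\<close>.\<close>

definition en :: "(real \<times> real => real) => (real \<times> real => real) => (real \<times> real => real) => (real \<times> real => real) => real" where
  "en p q p' q' = (LINT Z|\<mu>. p Z * p' Z / w Z + w Z * (q Z * q' Z))"

lemma integrable_div_w:
  fixes h :: "real \<times> real => real"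
  assumes h: "integrable \<mu> h"
  shows "integrable \<mu> (%Z. h Z / w Z)"
proof -
  obtain c where c: "0 < c" "\<And>z. z \<in> Rc ==> c \<le> w z" using w_bounds by metis
  have "integrable \<mu> (%Z. h Z * (1 / w Z))"
  proof (rule integrable_iv2_mult_bounded[OF h, where B = "1 / c"])
    fix Z assume x: "Z \<in> R"
    have "c \<le> w Z" by (rule c(2)[OF subsetD[OF R_sub x]])
    then show "\<bar>1 / w Z\<bar> \<le> 1 / c" using c(1) by (simp add: field_simps)
  qed measurable
  then show ?thesis by simp
qed

lemma Sob_integrable:
  assumes S: "Sob L \<delta> f p q" and T: "Sob L \<delta> f' p' q'"
  shows "integrable \<mu> (%Z. w Z * (f Z * f' Z))" "integrable \<mu> (%Z. p Z * p' Z / w Z)"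
    "integrable \<mu> (%Z. w Z * (q Z * q' Z))" "integrable \<mu> (%Z. w Z * f Z)"
proof -
  note s = SobD[OF S] and t = SobD[OF T]
  have [measurable]: "f \<in> borel_measurable \<mu>" "f' \<in> borel_measurable \<mu>" "q \<in> borel_measurable \<mu>" "q' \<in> borel_measurable \<mu>"
    by (rule s t)+
  have i: "integrable \<mu> (%Z. f Z * f' Z)" "integrable \<mu> (%Z. q Z * q' Z)" "integrable \<mu> (%Z. p Z * p' Z)"
    by (rule integrable_mult_L2[OF s(1) t(1) s(4) t(4)] integrable_mult_L2[OF s(2) t(2) s(5) t(5)] integrable_mult_L2[OF s(3) t(3) s(6) t(6)])+
  show "integrable \<mu> (%Z. w Z * (f Z * f' Z))"
    by (subst integrable_w) (use i(1) in measurable)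
  show "integrable \<mu> (%Z. p Z * p' Z / w Z)" by (rule integrable_div_w[OF i(3)])
  show "integrable \<mu> (%Z. w Z * (q Z * q' Z))"
    by (subst integrable_w) (use i(2) in measurable)
  show "integrable \<mu> (%Z. w Z * f Z)" by (subst integrable_w) (use s(9) in measurable)
qed

lemma Sob_values:
  assumes S: "Sob L \<delta> f p q"
  shows "mass D (%z. f (\<Psi> z)) = mm f f" "energy D (%z. frame p q (\<Psi> z)) = en p q p q"
    "mean_zero D (%z. f (\<Psi> z)) \<longleftrightarrow> (LINT Z|\<mu>. w Z * f Z) = 0"
  using rep_integrals[OF Sob_W12(2)[OF S] Sob_W12(2)[OF S] Sob_W12(1)[OF S] Sob_W12(1)[OF S]]
  by (simp_all add: mass_def energy_def mean_zero_def mm_def en_def)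

lemma rep_values:
  assumes r: "rep v G f p q" and W: "W12 D v G"
  shows "mass D v = mm f f" "energy D G = en p q p q" "mean_zero D v \<longleftrightarrow> (LINT Z|\<mu>. w Z * f Z) = 0"
  using rep_integrals[OF r r W W] by (simp_all add: mass_def energy_def mean_zero_def mm_def en_def)

lemma mm_eq_0_iff:
  assumes S: "Sob L \<delta> f p q"
  shows "mm f f = 0 \<longleftrightarrow> (AE Z in \<mu>. f Z = 0)" "0 \<le> mm f f"
proof -
  have nn: "AE Z in \<mu>. 0 \<le> w Z * (f Z * f Z)"
    by (rule AE_I2) (use w_pos_R in \<open>simp add: less_imp_le\<close>)
  have "mm f f = 0 \<longleftrightarrow> (AE Z in \<mu>. w Z * (f Z * f Z) = 0)"
    unfolding mm_def by (rule integral_nonneg_eq_0_iff_AE[OF Sob_integrable(1)[OF S S] nn])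
  also have "\<dots> \<longleftrightarrow> (AE Z in \<mu>. f Z = 0)"
  proof (rule AE_cong)
    fix Z assume "Z \<in> space \<mu>"
    then have "0 < w Z" by (intro w_pos_R) simp
    then show "w Z * (f Z * f Z) = 0 \<longleftrightarrow> f Z = 0" by simp
  qed
  finally show "mm f f = 0 \<longleftrightarrow> (AE Z in \<mu>. f Z = 0)" .
  show "0 \<le> mm f f" unfolding mm_def by (rule integral_nonneg_AE[OF nn])
qed

lemma not_AE_False: "\<not> (AE Z in \<mu>. False)"
proof
  assume "AE Z in \<mu>. False"
  then have "AE s in iv L. AE r in iv \<delta>. False" by (rule AE_iv2_fst)
  then have "AE s in iv L. False"
  proof (rule eventually_mono)
    fix s assume "AE r in iv \<delta>. False"
    then have "measure (iv \<delta>) (space (iv \<delta>)) = 0" by (simp add: AE_False_iff measure_def)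
    then show False using measure_iv_space[of \<delta>] \<delta> by simp
  qed
  then have "measure (iv L) (space (iv L)) = 0" by (simp add: AE_False_iff measure_def)
  then show False using measure_iv_space[of L] L by simp
qed

lemma w_integral_pos: "0 < (LINT Z|\<mu>. w Z)"
proof -
  have i: "integrable \<mu> w" using Sob_integrable(4)[OF Sob_const[of L \<delta> 1] Sob_const[of L \<delta> 1]] by simp
  have nn: "AE Z in \<mu>. 0 \<le> w Z" by (rule AE_I2) (use w_pos_R in \<open>simp add: less_imp_le\<close>)
  have "\<not> (AE Z in \<mu>. w Z = 0)"
  proof
    assume "AE Z in \<mu>. w Z = 0"
    then have "AE Z in \<mu>. False"
      by (rule AE_mp) (rule AE_I2, use w_pos_R in force)
    then show False using not_AE_False by simp
  qed
  then have "(LINT Z|\<mu>. w Z) \<noteq> 0" using integral_nonneg_eq_0_iff_AE[OF i nn] by simp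
  then show ?thesis using integral_nonneg_AE[OF nn] by simp
qed

text \<open>The coordinate \<open>s\<close> minus its weighted mean works: a single fibre is a null
  set, so this function is not 0 almost everywhere.\<close>

lemma nontrivial: "\<exists>v G. W12 D v G \<and> mean_zero D v \<and> mass D v \<noteq> 0"
proof -
  define m where "m = (LINT Z|\<mu>. w Z * fst Z) / (LINT Z|\<mu>. w Z)"
  have F: "Sob L \<delta> (%Z. fst Z) (%Z. 1) (%Z. 0)"
    by (rule Sob_of_fst[OF L \<delta>, of "%s. s" "%s. 1"]) (auto intro!: derivative_eq_intros)
  have S: "Sob L \<delta> (%Z. fst Z - m) (%Z. 1 - 0) (%Z. 0 - 0)" by (rule Sob_diff[OF F Sob_const])
  have i: "integrable \<mu> (%Z. w Z * fst Z)" "integrable \<mu> w"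
    using Sob_integrable(4)[OF F F] Sob_integrable(4)[OF Sob_const[of L \<delta> 1] Sob_const[of L \<delta> 1]] by simp_all
  have "(LINT Z|\<mu>. w Z * (fst Z - m)) = (LINT Z|\<mu>. w Z * fst Z - m * w Z)"
    by (rule LINT_cong) (auto simp: algebra_simps)
  also have "\<dots> = 0" using i w_integral_pos by (simp add: m_def)
  finally have z: "(LINT Z|\<mu>. w Z * (fst Z - m)) = 0" .
  have "\<not> (AE Z in \<mu>. fst Z - m = 0)"
  proof
    assume ae: "AE Z in \<mu>. fst Z - m = 0"
    have "AE Z in \<mu>. fst Z \<noteq> m" by (rule AE_iv2_of_fst[OF AE_iv_neq])
    with ae have "AE Z in \<mu>. False" by eventually_elim simp
    then show False using not_AE_False by simp
  qed
  then have "mass D (%z. fst (\<Psi> z) - m) \<noteq> 0" using mm_eq_0_iff(1)[OF S] Sob_values(1)[OF S] by simp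
  moreover have "mean_zero D (%z. fst (\<Psi> z) - m)" using Sob_values(3)[OF S] z by simp
  ultimately show ?thesis using Sob_W12(1)[OF S] by (intro exI conjI)
qed

text \<open>Poincare's inequality on a fine grid bounds the mass by a small multiple of the energy plus
  finitely many squared functionals; this replaces the Rellich compactness theorem.\<close>

lemma finite_rank_bound:
  assumes e: "\<epsilon> > 0"
  shows "\<exists>(n::nat) c. (\<forall>i<n. L2 (lebesgue_on D) (c i)) \<and>
     (\<forall>v G. W12 D v G \<longrightarrow> mass D v \<le> \<epsilon> * energy D G + (\<Sum>i<n. (LINT z|lebesgue_on D. v z * c i z)^2))"
proof -
  obtain c C where c: "0 < c" "0 < C" "\<And>z. z \<in> Rc ==> c \<le> w z" "\<And>z. z \<in> Rc ==> w z \<le> C" by (rule w_bounds, rule that; assumption)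
  \<comment> \<open>With \<open>c \<le> w \<le> C\<close> the energy dominates
    \<open>P2 / C + c * Q2\<close>; \<open>T\<close> is the threshold for the grid beyond which the
    Poincare coefficients, multiplied by \<open>C\<close>, are at most \<open>\<epsilon>\<close>
    times these two coefficients.\<close>
  define T where "T = max (C * C * (4 * L^2)) (C * (2 * \<delta>^2) / c)"
  obtain N0 :: nat where N0: "T / \<epsilon> < real N0" using reals_Archimedean2 by blast
  define N where "N = Suc N0"
  have N: "0 < N" "T \<le> \<epsilon> * (real N)^2"
  proof -
    show "0 < N" by (simp add: N_def)
    have "T < \<epsilon> * real N0" using N0 e by (simp add: field_simps)
    also have "\<dots> \<le> \<epsilon> * (real N)^2"
      by (rule mult_left_mono) (use e in \<open>auto simp: N_def power2_eq_square algebra_simps\<close>)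
    finally show "T \<le> \<epsilon> * (real N)^2" by simp
  qed
  have b1: "C * (4 * (L / real N)^2) \<le> \<epsilon> / C"
  proof -
    have "C * C * (4 * L^2) \<le> \<epsilon> * (real N)^2" using N(2) by (simp add: T_def)
    then show ?thesis using c(2) N(1) by (simp add: field_simps power_divide)
  qed
  have b2: "C * (2 * (\<delta> / real N)^2) \<le> \<epsilon> * c"
  proof -
    have "C * (2 * \<delta>^2) / c \<le> \<epsilon> * (real N)^2" using N(2) by (simp add: T_def)
    then show ?thesis using c(1) N(1) by (simp add: field_simps power_divide)
  qed
  define K where "K = C * (4 * (real N / L) * (real N / \<delta>))"
  have K: "0 \<le> K" using c(2) L \<delta> by (simp add: K_def)
  define cell where "cell m = piece L N (fst m) \<times> piece \<delta> N (snd m)" for m :: "nat \<times> nat"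
  \<comment> \<open>Dividing by \<open>w\<close> cancels the area factor, so pairing with
    \<open>h m\<close> on \<open>D\<close> gives \<open>sqrt K\<close> times the unweighted integral
    over a cell.\<close>
  define h where "h m Z = sqrt K * indicator (cell m) Z / w Z" for m and Z :: "real \<times> real"
  have cm [measurable]: "(%Z. indicator (cell m) Z :: real) \<in> borel_measurable \<mu>" for m
  proof -
    have "(%Z. indicator (piece L N (fst m)) (fst Z) * indicator (piece \<delta> N (snd m)) (snd Z) :: real) \<in> borel_measurable \<mu>"
      by measurable
    then show ?thesis by (simp add: cell_def indicator_times[abs_def])
  qed
  have hm [measurable]: "h m \<in> borel_measurable \<mu>" for m unfolding h_def[abs_def] by measurable
  have hL: "L2 (lebesgue_on D) (%z. h m (\<Psi> z))" for m
  proof -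
    have "integrable \<mu> (%Z. 1 * (K * indicator (cell m) Z))"
      by (rule integrable_iv2_mult_bounded[where B = K], simp, measurable) (use K in \<open>auto simp: indicator_def\<close>)
    then have "integrable \<mu> (%Z. (K * indicator (cell m) Z) / w Z)" by (intro integrable_div_w) simp
    also have "?this \<longleftrightarrow> integrable \<mu> (%Z. w Z * (h m Z)^2)"
    proof (rule Bochner_Integration.integrable_cong)
      fix Z assume "Z \<in> space \<mu>"
      then have "0 < w Z" by (intro w_pos_R) simp
      then show "(K * indicator (cell m) Z) / w Z = w Z * (h m Z)^2"
        using K by (simp add: h_def field_simps power2_eq_square indicator_def)
    qed simp
    finally have "integrable (lebesgue_on D) (%z. (h m (\<Psi> z))^2)"
      using integral_D(1)[of "%Z. (h m Z)^2"] by simp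
    then show ?thesis using measurable_\<Psi>(2)[OF hm[of m]] by (simp add: L2_def)
  qed
  obtain \<beta> where \<beta>: "bij_betw \<beta> {0..<card ({..<N} \<times> {..<N})} ({..<N} \<times> {..<N})"
    using ex_bij_betw_nat_finite[of "{..<N} \<times> {..<N}"] by auto
  have main: "mass D v \<le> \<epsilon> * energy D G + (\<Sum>i<card ({..<N} \<times> {..<N}). (LINT z|lebesgue_on D. v z * h (\<beta> i) (\<Psi> z))^2)"
    if W: "W12 D v G" for v G
  proof -
    obtain f p q where r: "rep v G f p q" using W by (rule W12_rep)
    have S: "Sob L \<delta> f p q" and ae: "AE z in lebesgue_on D. v z = f (\<Psi> z)" using r by (auto simp: rep_def)
    note s = SobD[OF S]
    have [measurable]: "f \<in> borel_measurable \<mu>" "v \<in> borel_measurable (lebesgue_on D)"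
      using s(1) W by (auto simp: W12_def square_integrable_def)
    define I where "I m = (LINT Z|\<mu>. indicator (cell m) Z * f Z)" for m
    have Ih: "(LINT z|lebesgue_on D. v z * h m (\<Psi> z)) = sqrt K * I m" for m
    proof -
      have "(LINT z|lebesgue_on D. v z * h m (\<Psi> z)) = (LINT Z|\<mu>. w Z * (f Z * h m Z))"
      proof (rule integral_D_AE(1))
        show "(%z. v z * h m (\<Psi> z)) \<in> borel_measurable (lebesgue_on D)"
          using measurable_\<Psi>(2)[OF hm[of m]] by measurable
        show "AE z in lebesgue_on D. v z * h m (\<Psi> z) = f (\<Psi> z) * h m (\<Psi> z)" using ae by eventually_elim simp
      qed measurable
      also have "\<dots> = (LINT Z|\<mu>. sqrt K * (indicator (cell m) Z * f Z))"
      proof (rule LINT_cong)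
        fix Z assume "Z \<in> space \<mu>"
        then have "0 < w Z" by (intro w_pos_R) simp
        then show "w Z * (f Z * h m Z) = sqrt K * (indicator (cell m) Z * f Z)" by (simp add: h_def)
      qed simp
      finally show ?thesis by (simp add: I_def)
    qed
    have sum: "(\<Sum>i<card ({..<N} \<times> {..<N}). (LINT z|lebesgue_on D. v z * h (\<beta> i) (\<Psi> z))^2) = K * (\<Sum>m\<in>{..<N} \<times> {..<N}. (I m)^2)"
    proof -
      have "(\<Sum>i<card ({..<N} \<times> {..<N}). (LINT z|lebesgue_on D. v z * h (\<beta> i) (\<Psi> z))^2) = (\<Sum>i<card ({..<N} \<times> {..<N}). K * (I (\<beta> i))^2)"
        using K by (simp add: Ih power_mult_distrib)
      also have "\<dots> = (\<Sum>m\<in>{..<N} \<times> {..<N}. K * (I m)^2)"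
        using sum.reindex_bij_betw[OF \<beta>, of "%m. K * (I m)^2"] by (simp add: atLeast0LessThan)
      finally show ?thesis by (simp add: sum_distrib_left)
    qed
    have dsum: "(\<Sum>j<N. \<Sum>i<N. (LINT z|\<mu>. indicator (piece L N i \<times> piece \<delta> N j) z * f z)^2) = (\<Sum>m\<in>{..<N} \<times> {..<N}. (I m)^2)"
      by (subst sum.swap) (simp add: sum.cartesian_product I_def cell_def case_prod_unfold)
    have P: "(LINT z|\<mu>. (f z)^2) \<le> 4 * (L / real N)^2 * (LINT z|\<mu>. (p z)^2) + 2 * (\<delta> / real N)^2 * (LINT z|\<mu>. (q z)^2)
      + 4 * (real N / L) * (real N / \<delta>) * (\<Sum>m\<in>{..<N} \<times> {..<N}. (I m)^2)"
      using Sob_Poincare[OF S L \<delta> N(1) N(1)] unfolding dsum .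
    define P2 Q2 where "P2 = (LINT z|\<mu>. (p z)^2)" and "Q2 = (LINT z|\<mu>. (q z)^2)"
    have PQ: "0 \<le> P2" "0 \<le> Q2" by (simp_all add: P2_def Q2_def)
    have "mm f f \<le> (LINT z|\<mu>. C * (f z)^2)" unfolding mm_def
    proof (rule integral_mono)
      show "integrable \<mu> (%Z. w Z * (f Z * f Z))" by (rule Sob_integrable(1)[OF S S])
      show "integrable \<mu> (%z. C * (f z)^2)" using s(4) by simp
      fix Z assume "Z \<in> space \<mu>"
      then have "w Z \<le> C" by (intro c(4) subsetD[OF R_sub]) simp
      then show "w Z * (f Z * f Z) \<le> C * (f Z)^2" by (simp add: power2_eq_square mult_right_mono)
    qed
    also have "\<dots> = C * (LINT z|\<mu>. (f z)^2)" by simp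
    also have "\<dots> \<le> C * (4 * (L / real N)^2 * P2 + 2 * (\<delta> / real N)^2 * Q2
      + 4 * (real N / L) * (real N / \<delta>) * (\<Sum>m\<in>{..<N} \<times> {..<N}. (I m)^2))"
      unfolding P2_def Q2_def by (rule mult_left_mono[OF P]) (use c(2) in simp)
    also have "\<dots> = C * (4 * (L / real N)^2) * P2 + C * (2 * (\<delta> / real N)^2) * Q2 + K * (\<Sum>m\<in>{..<N} \<times> {..<N}. (I m)^2)"
      by (simp add: K_def algebra_simps)
    also have "\<dots> \<le> \<epsilon> / C * P2 + \<epsilon> * c * Q2 + K * (\<Sum>m\<in>{..<N} \<times> {..<N}. (I m)^2)"
      using mult_right_mono[OF b1 PQ(1)] mult_right_mono[OF b2 PQ(2)] by simp
    finally have 1: "mm f f \<le> \<epsilon> * (P2 / C + c * Q2) + K * (\<Sum>m\<in>{..<N} \<times> {..<N}. (I m)^2)"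
      by (simp add: algebra_simps)
    have "P2 / C + c * Q2 = (LINT z|\<mu>. (p z)^2 / C + c * (q z)^2)" using s(5,6) by (simp add: P2_def Q2_def)
    also have "\<dots> \<le> en p q p q" unfolding en_def
    proof (rule integral_mono)
      show "integrable \<mu> (%z. (p z)^2 / C + c * (q z)^2)" using s(5,6) by simp
      show "integrable \<mu> (%Z. p Z * p Z / w Z + w Z * (q Z * q Z))"
        using Sob_integrable(2,3)[OF S S] by simp
      fix Z assume "Z \<in> space \<mu>"
      then have x: "Z \<in> R" by simp
      have b: "c \<le> w Z" "w Z \<le> C" "0 < w Z" using c(3,4)[OF subsetD[OF R_sub x]] w_pos_R[OF x] by auto
      show "(p Z)^2 / C + c * (q Z)^2 \<le> p Z * p Z / w Z + w Z * (q Z * q Z)"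
        unfolding power2_eq_square by (intro add_mono divide_left_mono mult_right_mono b) (use b c in auto)
    qed
    finally have "\<epsilon> * (P2 / C + c * Q2) \<le> \<epsilon> * en p q p q" using e by simp
    then show ?thesis unfolding rep_values(1,2)[OF r W] sum using 1 by linarith
  qed
  show ?thesis
    by (rule exI[of _ "card ({..<N} \<times> {..<N})"], rule exI[of _ "%i z. h (\<beta> i) (\<Psi> z)"]) (use hL main in blast)
qed

text \<open>Zero energy kills both partial derivatives, and the Poincare inequality on a single
  cell, applied to \<open>f\<close> minus its mean, then has right-hand side 0.\<close>

lemma zero_energy_constant:
  assumes S: "Sob L \<delta> f p q" and z: "en p q p q = 0"
  obtains c where "AE Z in \<mu>. f Z = c"
proof -
  note s = SobD[OF S]
  have i: "integrable \<mu> (%Z. p Z * p Z / w Z + w Z * (q Z * q Z))" using Sob_integrable(2,3)[OF S S] by simp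
  have nn: "AE Z in \<mu>. 0 \<le> p Z * p Z / w Z + w Z * (q Z * q Z)"
    by (rule AE_I2) (use w_pos_R in \<open>auto simp: less_imp_le intro!: add_nonneg_nonneg divide_nonneg_nonneg mult_nonneg_nonneg\<close>)
  have "AE Z in \<mu>. p Z * p Z / w Z + w Z * (q Z * q Z) = 0"
    using z integral_nonneg_eq_0_iff_AE[OF i nn] by (simp add: en_def)
  then have pq: "AE Z in \<mu>. (p Z)^2 = 0 \<and> (q Z)^2 = 0"
  proof (rule AE_mp, intro AE_I2 impI)
    fix Z assume "Z \<in> space \<mu>" and e: "p Z * p Z / w Z + w Z * (q Z * q Z) = 0"
    then have "0 < w Z" by (intro w_pos_R) simp
    then have "p Z * p Z / w Z = 0 \<and> w Z * (q Z * q Z) = 0"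
      using e by (subst add_nonneg_eq_0_iff[symmetric]) auto
    then show "(p Z)^2 = 0 \<and> (q Z)^2 = 0" using \<open>0 < w Z\<close> by simp
  qed
  have p0: "(LINT Z|\<mu>. (p Z)^2) = 0" by (rule integral_eq_zero_AE) (use pq in eventually_elim, simp)
  have q0: "(LINT Z|\<mu>. (q Z)^2) = 0" by (rule integral_eq_zero_AE) (use pq in eventually_elim, simp)
  define V where "V = measure \<mu> (space \<mu>)"
  have V: "V \<noteq> 0"
    using not_AE_False unfolding V_def by (simp add: AE_False_iff iv2.emeasure_eq_measure)
  define m where "m = (LINT Z|\<mu>. f Z) / V"
  have T: "Sob L \<delta> (%Z. f Z - m) (%Z. p Z - 0) (%Z. q Z - 0)" by (rule Sob_diff[OF S Sob_const])
  have fz: "(LINT Z|\<mu>. f Z - m) = 0"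
    using s(9) V by (simp add: m_def V_def)
  have "(LINT z|\<mu>. indicator (piece L 1 0 \<times> piece \<delta> 1 0) z * (f z - m)) = (LINT z|\<mu>. f z - m)"
    by (rule LINT_cong) (auto simp: piece_def indicator_def)
  then have "(LINT z|\<mu>. (f z - m)^2) \<le> 0"
    using Sob_Poincare[OF T L \<delta>, of 1 1] p0 q0 fz by simp
  then have "(LINT z|\<mu>. (f z - m)^2) = 0" by (simp add: order_antisym)
  then have "AE z in \<mu>. (f z - m)^2 = 0"
    using integral_nonneg_eq_0_iff_AE[OF SobD(4)[OF T]] by simp
  then have "AE z in \<mu>. f z = m" by eventually_elim simp
  then show thesis by (rule that)
qed

text \<open>Positivity is the point beyond \<open>minimizer_exists\<close>: a vanishing minimum
  would make the minimizer constant, hence 0 by its zero mean, against its unit mass.\<close>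

theorem first_eigenvalue:
  obtains \<Lambda> u where "rayleigh_bound D \<Lambda>" "\<Lambda> > 0" "neumann_eigenfunction D \<Lambda> u"
proof -
  obtain \<Lambda> u G where m: "rayleigh_bound D \<Lambda>" "W12 D u G" "mean_zero D u" "mass D u = 1" "energy D G = \<Lambda>"
    by (rule minimizer_exists[OF D_lebesgue finite_D one nontrivial finite_rank_bound])
  obtain f p q where r: "rep u G f p q" using m(2) by (rule W12_rep)
  note v = rep_values[OF r m(2)]
  have S: "Sob L \<delta> f p q" using r by (simp add: rep_def)
  have "\<Lambda> \<noteq> 0"
  proof
    assume "\<Lambda> = 0"
    then have "en p q p q = 0" using m(5) v(2) by simp
    then obtain c where c: "AE Z in \<mu>. f Z = c" by (rule zero_energy_constant[OF S])
    have [measurable]: "f \<in> borel_measurable \<mu>" by (rule SobD(1)[OF S])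
    have "0 = (LINT Z|\<mu>. w Z * f Z)" using v(3) m(3) by simp
    also have "\<dots> = (LINT Z|\<mu>. w Z * c)"
      by (rule integral_cong_AE) (use c in \<open>auto elim!: eventually_mono\<close>)
    finally have "c = 0" using w_integral_pos by simp
    then have "mm f f = 0" using mm_eq_0_iff(1)[OF S] c by simp
    then show False using m(4) v(1) by simp
  qed
  moreover have "0 \<le> \<Lambda>" using m(5) energy_nonneg[of D G] by simp
  ultimately have l: "0 < \<Lambda>" by simp
  have "neumann_eigenfunction D \<Lambda> u"
    by (rule minimizer_eigenfunction[OF D_lebesgue finite_D one m(1-3)]) (use m in simp_all)
  then show thesis using that m(1) l by blast
qed

lemma rect_rayleigh:
  assumes "rayleigh_bound D \<Lambda>" "Sob L \<delta> f p q" "(LINT Z|\<mu>. w Z * f Z) = 0"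
  shows "\<Lambda> * mm f f \<le> en p q p q"
  using assms(1,3) Sob_W12(1)[OF assms(2)] Sob_values[OF assms(2)] unfolding rayleigh_bound_def by metis

lemma rect_eigenfunction:
  assumes "rayleigh_bound D \<Lambda>" "Sob L \<delta> f p q" "(LINT Z|\<mu>. w Z * f Z) = 0" "en p q p q = \<Lambda> * mm f f" "mm f f \<noteq> 0"
  shows "neumann_eigenfunction D \<Lambda> (%z. f (\<Psi> z))"
  by (rule minimizer_eigenfunction[OF D_lebesgue finite_D one assms(1) Sob_W12(1)[OF assms(2)]])
    (use assms Sob_values[OF assms(2)] in simp_all)

lemma eigenfunction_rect:
  assumes u: "neumann_eigenfunction D \<Lambda> u" and l: "\<Lambda> \<noteq> 0"
  obtains f p q where "Sob L \<delta> f p q" "AE z in lebesgue_on D. u z = f (\<Psi> z)" "(LINT Z|\<mu>. w Z * f Z) = 0" "mm f f > 0"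
    "\<And>f' p' q'. Sob L \<delta> f' p' q' ==> en p q p' q' = \<Lambda> * mm f f'"
proof -
  obtain G where G: "W12 D u G" "mean_zero D u" "mass D u > 0"
    "\<And>v H. W12 D v H ==> (LINT z|lebesgue_on D. G z \<bullet> H z) = \<Lambda> * (LINT z|lebesgue_on D. u z * v z)"
    by (rule eigenfunction_facts[OF D_lebesgue finite_D one u l], rule that; assumption)
  obtain f p q where r: "rep u G f p q" using G(1) by (rule W12_rep)
  have S: "Sob L \<delta> f p q" and ae: "AE z in lebesgue_on D. u z = f (\<Psi> z)" using r by (auto simp: rep_def)
  have tt: "en p q p' q' = \<Lambda> * mm f f'" if T: "Sob L \<delta> f' p' q'" for f' p' q'
    using rep_integrals(1,2)[OF r Sob_W12(2)[OF T] G(1) Sob_W12(1)[OF T]] G(4)[OF Sob_W12(1)[OF T]]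
    by (simp add: en_def mm_def)
  have m: "(LINT Z|\<mu>. w Z * f Z) = 0" "mm f f > 0" using rep_values[OF r G(1)] G(2,3) by simp_all
  show thesis by (rule that[OF S ae m tt])
qed

end

section \<open>Odd first eigenfunctions\<close>

text \<open>Reversing the parameter of the curve corresponds to reflecting the plane in the
  \<open>y\<close>-axis. Reversal and reflection together keep the first tangent component and the
  curvature and negate the second tangent component.\<close>

locale symmetric_strip = curved_strip +
  assumes x_reflect: "\<And>s. 0 \<le> s ==> s \<le> L ==> x (L - s) = - x s"
    and y_reflect: "\<And>s. 0 \<le> s ==> s \<le> L ==> y (L - s) = y s"
    and tx_reflect: "\<And>s. 0 \<le> s ==> s \<le> L ==> tx (L - s) = tx s"
    and ty_reflect: "\<And>s. 0 \<le> s ==> s \<le> L ==> ty (L - s) = - ty s"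
    and k_reflect: "\<And>s. 0 \<le> s ==> s \<le> L ==> k (L - s) = k s"
begin

definition \<sigma> :: "real \<times> real => real \<times> real" where "\<sigma> Z = (L - fst Z, snd Z)"

lemma \<sigma>_\<sigma> [simp]: "\<sigma> (\<sigma> Z) = Z" by (simp add: \<sigma>_def)
lemma \<sigma>_Pair: "\<sigma> (s, r) = (L - s, r)" by (simp add: \<sigma>_def)
lemma \<sigma>_R: "Z \<in> R ==> \<sigma> Z \<in> R" by (cases Z) (simp add: \<sigma>_def)

lemma w_\<sigma>: "Z \<in> R ==> w (\<sigma> Z) = w Z"
  by (cases Z) (simp add: w_def \<sigma>_def k_reflect)

lemma \<Phi>_\<sigma>: "Z \<in> R ==> \<Phi> (\<sigma> Z) = (- fst (\<Phi> Z), snd (\<Phi> Z))"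
  by (cases Z) (simp add: \<Phi>_def \<sigma>_def x_reflect y_reflect tx_reflect ty_reflect)

lemma \<Psi>_reflect:
  assumes z: "z \<in> D"
  shows "\<Psi> (- fst z, snd z) = \<sigma> (\<Psi> z)"
proof -
  have x: "\<Psi> z \<in> R" by (rule \<Psi>_R[OF z])
  have "\<Phi> (\<sigma> (\<Psi> z)) = (- fst z, snd z)" using \<Phi>_\<sigma>[OF x] \<Phi>_\<Psi>[OF z] by simp
  then show ?thesis using \<Psi>_\<Phi>[OF subsetD[OF R_sub \<sigma>_R[OF x]]] by simp
qed

lemma distr_\<sigma>: "distr \<mu> \<mu> \<sigma> = \<mu>"
proof -
  have i: "distr (iv \<delta>) (iv \<delta>) (%r. r) = iv \<delta>" by (rule distr_id)
  have "distr (iv L) (iv L) (%s. L - s) \<Otimes>\<^sub>M distr (iv \<delta>) (iv \<delta>) (%r. r) = distr \<mu> \<mu> (%(s, r). (L - s, r))"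
    by (rule pair_measure_distr[OF measurable_iv_reflect]) (simp_all add: i iv.sigma_finite_measure_axioms)
  moreover have "(%(s, r). (L - s, r)) = \<sigma>" by (auto simp: \<sigma>_def)
  ultimately show ?thesis by (simp add: i distr_iv_reflect)
qed

lemma \<sigma>_measurable [measurable]: "\<sigma> \<in> \<mu> \<rightarrow>\<^sub>M \<mu>"
proof -
  have "(%Z. (L - fst Z, snd Z)) \<in> \<mu> \<rightarrow>\<^sub>M \<mu>"
    by (intro measurable_Pair measurable_compose[OF measurable_fst measurable_iv_reflect] measurable_snd)
  then show ?thesis by (simp add: \<sigma>_def[abs_def])
qed

lemma AE_\<sigma>: "AE Z in \<mu>. Q Z ==> AE Z in \<mu>. Q (\<sigma> Z)"
  by (rule AE_distrD[OF \<sigma>_measurable], subst distr_\<sigma>)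

lemma integral_\<sigma>:
  fixes f :: "real \<times> real => real"
  assumes f: "f \<in> borel_measurable \<mu>"
  shows "(LINT Z|\<mu>. f (\<sigma> Z)) = (LINT Z|\<mu>. f Z)"
    "integrable \<mu> (%Z. f (\<sigma> Z)) \<longleftrightarrow> integrable \<mu> f"
  using integral_distr[OF \<sigma>_measurable f] integrable_distr_eq[OF \<sigma>_measurable f] by (simp_all add: distr_\<sigma>)

lemma Sob_\<sigma>:
  assumes S: "Sob L \<delta> f p q"
  shows "Sob L \<delta> (%Z. f (\<sigma> Z)) (%Z. - p (\<sigma> Z)) (%Z. q (\<sigma> Z))"
proof -
  note s = SobD[OF S]
  note [measurable] = s(1-3)
  have "AE r in iv \<delta>. wAC L (%s. f (\<sigma> (s, r))) (%s. - p (\<sigma> (s, r)))"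
    using s(7) by eventually_elim (simp only: \<sigma>_Pair, rule wAC_reflect)
  moreover have "AE s in iv L. wAC \<delta> (%r. f (\<sigma> (s, r))) (%r. q (\<sigma> (s, r)))"
    using AE_iv_reflect[OF s(8)] by (simp only: \<sigma>_Pair)
  moreover have "integrable \<mu> (%Z. (f (\<sigma> Z))^2)" "integrable \<mu> (%Z. (p (\<sigma> Z))^2)" "integrable \<mu> (%Z. (q (\<sigma> Z))^2)"
    using integral_\<sigma>(2)[of "%Z. (f Z)^2"] integral_\<sigma>(2)[of "%Z. (p Z)^2"] integral_\<sigma>(2)[of "%Z. (q Z)^2"] s(4-6) by simp_all
  ultimately show ?thesis unfolding Sob_def by simp
qed

text \<open>Antisymmetrizing settles two side conditions at once: oddness, and mean zero because
  \<open>w\<close> is symmetric. The plus sign between the \<open>s\<close>-derivatives reflects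
  their change of sign under \<open>\<sigma>\<close>.\<close>

lemma odd_eigenfunction:
  assumes R: "rayleigh_bound D \<Lambda>" and S: "Sob L \<delta> h p q"
    and e: "en (%Z. p Z + p (\<sigma> Z)) (%Z. q Z - q (\<sigma> Z)) (%Z. p Z + p (\<sigma> Z)) (%Z. q Z - q (\<sigma> Z)) =
       \<Lambda> * mm (%Z. h Z - h (\<sigma> Z)) (%Z. h Z - h (\<sigma> Z))"
    and nz: "mm (%Z. h Z - h (\<sigma> Z)) (%Z. h Z - h (\<sigma> Z)) \<noteq> 0"
  shows "\<exists>u. neumann_eigenfunction D \<Lambda> u \<and> odd_wrt_y_axis D u"
proof -
  have T: "Sob L \<delta> (%Z. h Z - h (\<sigma> Z)) (%Z. p Z + p (\<sigma> Z)) (%Z. q Z - q (\<sigma> Z))"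
    using Sob_diff[OF S Sob_\<sigma>[OF S]] by simp
  have [measurable]: "h \<in> borel_measurable \<mu>" by (rule SobD(1)[OF S])
  have i: "integrable \<mu> (%Z. w Z * h Z)" by (rule Sob_integrable(4)[OF S S])
  have i': "integrable \<mu> (%Z. w (\<sigma> Z) * h (\<sigma> Z))" using integral_\<sigma>(2)[of "%Z. w Z * h Z"] i by simp
  have "(LINT Z|\<mu>. w Z * (h Z - h (\<sigma> Z))) = (LINT Z|\<mu>. w Z * h Z - w (\<sigma> Z) * h (\<sigma> Z))"
    by (rule LINT_cong) (simp_all add: w_\<sigma> right_diff_distrib)
  also have "\<dots> = 0" using i i' integral_\<sigma>(1)[of "%Z. w Z * h Z"] by simp
  finally have z: "(LINT Z|\<mu>. w Z * (h Z - h (\<sigma> Z))) = 0" .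
  have "odd_wrt_y_axis D (%z. h (\<Psi> z) - h (\<sigma> (\<Psi> z)))" unfolding odd_wrt_y_axis_def
    by (rule AE_I2) (simp add: \<Psi>_reflect)
  then show ?thesis using rect_eigenfunction[OF R T z e nz] by (intro exI conjI)
qed

lemma mm_diff:
  assumes S: "Sob L \<delta> f p q" and T: "Sob L \<delta> f' p' q'" and U: "Sob L \<delta> g a b"
  shows "mm (%Z. f Z - f' Z) g = mm f g - mm f' g"
    "en (%Z. p Z - p' Z) (%Z. q Z - q' Z) a b = en p q a b - en p' q' a b"
proof -
  note s = Sob_integrable[OF S U] and t = Sob_integrable[OF T U]
  have "mm (%Z. f Z - f' Z) g = (LINT Z|\<mu>. w Z * (f Z * g Z) - w Z * (f' Z * g Z))"
    unfolding mm_def by (simp add: algebra_simps)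
  then show "mm (%Z. f Z - f' Z) g = mm f g - mm f' g" using s(1) t(1) by (simp add: mm_def)
  have "en (%Z. p Z - p' Z) (%Z. q Z - q' Z) a b
    = (LINT Z|\<mu>. (p Z * a Z / w Z + w Z * (q Z * b Z)) - (p' Z * a Z / w Z + w Z * (q' Z * b Z)))"
    unfolding en_def by (simp add: algebra_simps diff_divide_distrib)
  also have "\<dots> = en p q a b - en p' q' a b" unfolding en_def
    by (rule Bochner_Integration.integral_diff; intro Bochner_Integration.integrable_add s t)
  finally show "en (%Z. p Z - p' Z) (%Z. q Z - q' Z) a b = en p q a b - en p' q' a b" .
qed

lemma mm_\<sigma>:
  assumes S: "Sob L \<delta> f p q" and T: "Sob L \<delta> f' p' q'"
  shows "mm (%Z. f (\<sigma> Z)) (%Z. f' (\<sigma> Z)) = mm f f'"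
    "en (%Z. - p (\<sigma> Z)) (%Z. q (\<sigma> Z)) (%Z. - p' (\<sigma> Z)) (%Z. q' (\<sigma> Z)) = en p q p' q'"
proof -
  note [measurable] = SobD(1-3)[OF S] SobD(1-3)[OF T]
  have "mm (%Z. f (\<sigma> Z)) (%Z. f' (\<sigma> Z)) = (LINT Z|\<mu>. w (\<sigma> Z) * (f (\<sigma> Z) * f' (\<sigma> Z)))"
    unfolding mm_def by (rule LINT_cong) (simp_all add: w_\<sigma>)
  also have "\<dots> = mm f f'" unfolding mm_def by (rule integral_\<sigma>(1)[of "%Z. w Z * (f Z * f' Z)"]) measurable
  finally show "mm (%Z. f (\<sigma> Z)) (%Z. f' (\<sigma> Z)) = mm f f'" .
  have "en (%Z. - p (\<sigma> Z)) (%Z. q (\<sigma> Z)) (%Z. - p' (\<sigma> Z)) (%Z. q' (\<sigma> Z)) =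
    (LINT Z|\<mu>. p (\<sigma> Z) * p' (\<sigma> Z) / w (\<sigma> Z) + w (\<sigma> Z) * (q (\<sigma> Z) * q' (\<sigma> Z)))"
    unfolding en_def by (rule LINT_cong) (simp_all add: w_\<sigma>)
  also have "\<dots> = en p q p' q'" unfolding en_def
    by (rule integral_\<sigma>(1)[of "%Z. p Z * p' Z / w Z + w Z * (q Z * q' Z)"]) measurable
  finally show "en (%Z. - p (\<sigma> Z)) (%Z. q (\<sigma> Z)) (%Z. - p' (\<sigma> Z)) (%Z. q' (\<sigma> Z)) = en p q p' q'" .
qed

text \<open>The equation of \<open>f\<close> is tested with the antisymmetrization of
  \<open>f\<close>. Reflecting the half that contains \<open>f (\<sigma> Z)\<close> reproduces the
  other half, so both forms double and the quotient \<open>\<Lambda>\<close> persists; failure of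
  evenness keeps the function nonzero.\<close>

lemma not_even_case:
  assumes R: "rayleigh_bound D \<Lambda>" and S: "Sob L \<delta> f p q"
    and eq: "\<And>f' p' q'. Sob L \<delta> f' p' q' ==> en p q p' q' = \<Lambda> * mm f f'"
    and ne: "\<not> (AE Z in \<mu>. f (\<sigma> Z) = f Z)"
  shows "\<exists>u. neumann_eigenfunction D \<Lambda> u \<and> odd_wrt_y_axis D u"
proof -
  let ?f = "%Z. f Z - f (\<sigma> Z)" and ?p = "%Z. p Z + p (\<sigma> Z)" and ?q = "%Z. q Z - q (\<sigma> Z)"
  note S' = Sob_\<sigma>[OF S]
  have T: "Sob L \<delta> ?f ?p ?q" using Sob_diff[OF S S'] by simp
  have N: "Sob L \<delta> (%Z. - 1 * ?f Z) (%Z. - 1 * ?p Z) (%Z. - 1 * ?q Z)" by (rule Sob_cmult[OF T])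
  have "mm (%Z. f (\<sigma> Z)) ?f = mm (%Z. f (\<sigma> Z)) (%Z. - 1 * ?f (\<sigma> Z))" by simp
  also have "\<dots> = mm f (%Z. - 1 * ?f Z)" by (rule mm_\<sigma>(1)[OF S N])
  also have m2: "\<dots> = - mm f ?f" unfolding mm_def mult_minus_left mult_minus_right mult_1_left by (rule integral_minus)
  finally have m1: "mm ?f ?f = 2 * mm f ?f" using mm_diff(1)[OF S S' T] by simp
  have "en (%Z. - p (\<sigma> Z)) (%Z. q (\<sigma> Z)) ?p ?q
    = en (%Z. - p (\<sigma> Z)) (%Z. q (\<sigma> Z)) (%Z. - (- 1 * ?p (\<sigma> Z))) (%Z. - 1 * ?q (\<sigma> Z))" by (simp add: add.commute)
  also have "\<dots> = en p q (%Z. - 1 * ?p Z) (%Z. - 1 * ?q Z)" by (rule mm_\<sigma>(2)[OF S N])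
  also have "\<dots> = \<Lambda> * mm f (%Z. - 1 * ?f Z)" by (rule eq[OF N])
  also have "\<dots> = - (\<Lambda> * mm f ?f)" unfolding m2 by simp
  finally have "en ?p ?q ?p ?q = 2 * (\<Lambda> * mm f ?f)" using mm_diff(2)[OF S S' T] eq[OF T] by simp
  then have e: "en ?p ?q ?p ?q = \<Lambda> * mm ?f ?f" using m1 by simp
  have "\<not> (AE Z in \<mu>. ?f Z = 0)"
  proof
    assume "AE Z in \<mu>. ?f Z = 0"
    then have "AE Z in \<mu>. f (\<sigma> Z) = f Z" by eventually_elim simp
    then show False using ne by simp
  qed
  then show ?thesis using mm_eq_0_iff(1)[OF T] by (intro odd_eigenfunction[OF R S e]) simp
qed

text \<open>Where \<open>h\<close> is nonzero it coincides with \<open>f\<close>, derivatives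
  included, so testing the equation of \<open>f\<close> with \<open>h\<close> yields the quotient
  \<open>\<Lambda>\<close> for \<open>h\<close> itself. Because \<open>s1 < L / 2\<close>, all mixed
  terms between \<open>h\<close> and its mirror image vanish, and antisymmetrizing keeps the
  quotient.\<close>

lemma truncation_case:
  assumes R: "rayleigh_bound D \<Lambda>" and S: "Sob L \<delta> f p q"
    and eq: "\<And>f' p' q'. Sob L \<delta> f' p' q' ==> en p q p' q' = \<Lambda> * mm f f'"
    and s: "0 < s0" "s0 < s1" "s1 < L / 2"
    and F: "AE Z in \<mu>. f Z = c (snd Z) + prim L p (fst Z) (snd Z)"
    and s0: "AE r in iv \<delta>. 0 < c r + prim L p s0 r" and s1: "AE r in iv \<delta>. c r + prim L p s1 r \<le> 0"
  shows "\<exists>u. neumann_eigenfunction D \<Lambda> u \<and> odd_wrt_y_axis D u"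
proof -
  note sob = SobD[OF S]
  note [measurable] = sob(1-3)
  define h where "h Z = (if fst Z < s1 then max 0 (f Z) else 0)" for Z
  define hp where "hp Z = (if fst Z < s1 \<and> f Z > 0 then p Z else 0)" for Z
  define hq where "hq Z = (if fst Z < s1 \<and> f Z > 0 then q Z else 0)" for Z
  have [measurable]: "h \<in> borel_measurable \<mu>" "hp \<in> borel_measurable \<mu>" "hq \<in> borel_measurable \<mu>"
    unfolding h_def[abs_def] hp_def[abs_def] hq_def[abs_def] by measurable
  have ac: "AE r in iv \<delta>. AC L (%s. c r + prim L p s r) (%s. p (s, r))"
    using integral_iv2_snd(1)[OF sob(10)]
  proof eventually_elim
    fix r assume "integrable (iv L) (%s. p (s, r))"
    from AC_add[OF AC_const prim_AC[OF this]] show "AC L (%s. c r + prim L p s r) (%s. p (s, r))" by simp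
  qed
  have T: "Sob L \<delta> h hp hq" unfolding Sob_def
  proof (intro conjI)
    show "integrable \<mu> (%z. (h z)^2)"
      by (rule Bochner_Integration.integrable_bound[OF sob(4)]) (auto simp: h_def max_def)
    show "integrable \<mu> (%z. (hp z)^2)"
      by (rule Bochner_Integration.integrable_bound[OF sob(5)]) (auto simp: hp_def)
    show "integrable \<mu> (%z. (hq z)^2)"
      by (rule Bochner_Integration.integrable_bound[OF sob(6)]) (auto simp: hq_def)
    show "AE r in iv \<delta>. wAC L (%s. h (s, r)) (%s. hp (s, r))"
      using ac AE_iv2_snd[OF F] s1 AE_space
    proof eventually_elim
      case (elim r)
      then have r: "0 < r" "r < \<delta>" by auto

      \<comment> \<open>Along the line the absolutely continuous representative is nonpositive at
        \<open>s1\<close>, which is what \<open>AC_truncate\<close> asks for.\<close>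
      have "wAC L (%s. if s < s1 then max 0 (c r + prim L p s r) else 0) (%s. if s < s1 \<and> c r + prim L p s r > 0 then p (s, r) else 0)"
        by (intro AC_imp_wAC AC_truncate elim(1)) (use s elim(3) in auto)
      then show "wAC L (%s. h (s, r)) (%s. hp (s, r))"
      proof (rule wAC_cong)
        show "AE s in iv L. (if s < s1 then max 0 (c r + prim L p s r) else 0) = h (s, r)"
          using elim(2) by eventually_elim (simp add: h_def)
        show "AE s in iv L. (if s < s1 \<and> c r + prim L p s r > 0 then p (s, r) else 0) = hp (s, r)"
          using elim(2) by eventually_elim (simp add: hp_def)
      qed (rule measurable_section_fst[where b = \<delta>]; use r in \<open>simp; measurable\<close>)
    qed
    \<comment> \<open>In the \<open>r\<close> direction the cut is invisible: a fibre carries either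
      the whole positive part or 0.\<close>
    show "AE s in iv L. wAC \<delta> (%r. h (s, r)) (%r. hq (s, r))"
      using SobD(8)[OF Sob_pos_part[OF S L \<delta>]]
    proof eventually_elim
      case (elim s)
      then show ?case
        using AC_imp_wAC[OF AC_const[of \<delta> 0]] by (cases "s < s1") (simp_all add: h_def hq_def)
    qed
  qed measurable
  have hh: "h Z * h Z = f Z * h Z" "hp Z * hp Z = p Z * hp Z" "hq Z * hq Z = q Z * hq Z" for Z
    by (auto simp: h_def hp_def hq_def max_def)
  have e: "en hp hq hp hq = \<Lambda> * mm h h"
    using eq[OF T] unfolding en_def mm_def hh .
  have dj: "h Z * h (\<sigma> Z) = 0" "hp Z * hp (\<sigma> Z) = 0" "hq Z * hq (\<sigma> Z) = 0" for Z
    using s(3) by (auto simp: h_def hp_def hq_def \<sigma>_def)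
  note T' = Sob_\<sigma>[OF T]
  have mg: "mm (%Z. h Z - h (\<sigma> Z)) (%Z. h Z - h (\<sigma> Z)) = 2 * mm h h"
  proof -
    have "mm (%Z. h Z - h (\<sigma> Z)) (%Z. h Z - h (\<sigma> Z)) = (LINT Z|\<mu>. w Z * (h Z * h Z) + w Z * (h (\<sigma> Z) * h (\<sigma> Z)))"
      unfolding mm_def
    proof (rule LINT_cong)
      fix Z
      have "(h Z - h (\<sigma> Z)) * (h Z - h (\<sigma> Z)) = h Z * h Z + h (\<sigma> Z) * h (\<sigma> Z) - 2 * (h Z * h (\<sigma> Z))" by (simp add: algebra_simps)
      then show "w Z * ((h Z - h (\<sigma> Z)) * (h Z - h (\<sigma> Z))) = w Z * (h Z * h Z) + w Z * (h (\<sigma> Z) * h (\<sigma> Z))"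
        unfolding dj by (simp only: distrib_left) (simp add: algebra_simps)
    qed simp
    also have "\<dots> = mm h h + mm (%Z. h (\<sigma> Z)) (%Z. h (\<sigma> Z))" unfolding mm_def
      by (rule Bochner_Integration.integral_add[OF Sob_integrable(1)[OF T T] Sob_integrable(1)[OF T' T']])
    finally show ?thesis using mm_\<sigma>(1)[OF T T] by simp
  qed
  have eg: "en (%Z. hp Z + hp (\<sigma> Z)) (%Z. hq Z - hq (\<sigma> Z)) (%Z. hp Z + hp (\<sigma> Z)) (%Z. hq Z - hq (\<sigma> Z)) = 2 * en hp hq hp hq"
  proof -
    have "en (%Z. hp Z + hp (\<sigma> Z)) (%Z. hq Z - hq (\<sigma> Z)) (%Z. hp Z + hp (\<sigma> Z)) (%Z. hq Z - hq (\<sigma> Z)) =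
      (LINT Z|\<mu>. (hp Z * hp Z / w Z + w Z * (hq Z * hq Z)) +
        (- hp (\<sigma> Z) * - hp (\<sigma> Z) / w Z + w Z * (hq (\<sigma> Z) * hq (\<sigma> Z))))"
      unfolding en_def
    proof (rule LINT_cong)
      fix Z
      have q: "(hq Z - hq (\<sigma> Z)) * (hq Z - hq (\<sigma> Z)) = hq Z * hq Z + hq (\<sigma> Z) * hq (\<sigma> Z) - 2 * (hq Z * hq (\<sigma> Z))"
        "(hp Z + hp (\<sigma> Z)) * (hp Z + hp (\<sigma> Z)) = hp Z * hp Z + hp (\<sigma> Z) * hp (\<sigma> Z) + 2 * (hp Z * hp (\<sigma> Z))"
        by (simp_all add: algebra_simps)
      show "(hp Z + hp (\<sigma> Z)) * (hp Z + hp (\<sigma> Z)) / w Z + w Z * ((hq Z - hq (\<sigma> Z)) * (hq Z - hq (\<sigma> Z))) =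
        (hp Z * hp Z / w Z + w Z * (hq Z * hq Z)) + (- hp (\<sigma> Z) * - hp (\<sigma> Z) / w Z + w Z * (hq (\<sigma> Z) * hq (\<sigma> Z)))"
        unfolding q dj by (simp add: add_divide_distrib distrib_left)
    qed simp
    also have "\<dots> = en hp hq hp hq + en (%Z. - hp (\<sigma> Z)) (%Z. hq (\<sigma> Z)) (%Z. - hp (\<sigma> Z)) (%Z. hq (\<sigma> Z))" unfolding en_def
      by (rule Bochner_Integration.integral_add; intro Bochner_Integration.integrable_add Sob_integrable[OF T T] Sob_integrable[OF T' T'])
    finally show ?thesis using mm_\<sigma>(2)[OF T T] by simp
  qed
  \<comment> \<open>On almost every line the continuous representative is positive at
    \<open>s0 < s1\<close>, hence also on an interval to the right of \<open>s0\<close>, where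
    \<open>h\<close> agrees with it almost everywhere.\<close>
  have "mm h h \<noteq> 0"
  proof
    assume "mm h h = 0"
    then have "AE Z in \<mu>. h Z = 0" using mm_eq_0_iff(1)[OF T] by simp
    from AE_iv2_snd[OF this] have "AE r in iv \<delta>. False" using ac AE_iv2_snd[OF F] s0
    proof eventually_elim
      case (elim r)
      define G where "G s = c r + prim L p s r" for s
      have ct: "continuous_on {0..L} G" unfolding G_def[abs_def] by (rule AC_continuous[OF elim(2)])
      have "isCont G s0"
        by (rule continuous_on_interior[OF ct]) (use s in auto)
      then obtain d where d: "d > 0" "\<And>y. dist y s0 < d ==> dist (G y) (G s0) < G s0"
        using elim(4) unfolding continuous_at_eps_delta G_def[symmetric] dist_norm by metis
      \<comment> \<open>Midpoint between \<open>s0\<close> and the smaller of \<open>s1\<close> and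
        \<open>s0 + d\<close>.\<close>
      define t where "t = min s1 (s0 + d) - (min s1 (s0 + d) - s0) / 2"
      have t: "s0 < t" "t < s1" "t < s0 + d" using s d(1) by (auto simp: t_def min_def field_simps)
      have "AE s in iv L. indicator {s0<..t} s = (0::real)"
        using elim(1,3)
      proof eventually_elim
        case (elim s)
        show ?case
        proof (cases "s \<in> {s0<..t}")
          case True
          then have "dist (G s) (G s0) < G s0" using t by (intro d(2)) (auto simp: dist_real_def)
          then have "0 < G s" by (simp add: dist_real_def)
          then have "0 < h (s, r)" using True t elim by (simp add: h_def G_def)
          then show ?thesis using elim by simp
        qed simp
      qed
      then have "(LINT s|iv L. indicator {s0<..t} s) = (0::real)" by (rule integral_eq_zero_AE)
      moreover have "(LINT s|iv L. indicator {s0<..t} s) = t - s0" by (rule measure_iv_Ioc) (use s t in auto)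
      ultimately show False using t by simp
    qed
    then have "measure (iv \<delta>) (space (iv \<delta>)) = 0" unfolding AE_False_iff by (simp add: measure_def)
    then show False using measure_iv_space[of \<delta>] \<delta> by simp
  qed
  then show ?thesis using e eg mg by (intro odd_eigenfunction[OF R T]) simp_all
qed

text \<open>Used in contrapositive form: \<open>\<Lambda> * K < 1\<close> forces fibres on which
  \<open>f\<close> is positive. On a cross-section \<open>w\<close> is affine in \<open>r\<close>,
  so it lies between its values 1 and \<open>1 + \<delta> * k s\<close> at the ends; this is where
  the ratio in the hypothesis on \<open>K\<close> comes from.\<close>

lemma fibre_case:
  assumes l: "0 < \<Lambda>" and S: "Sob L \<delta> f p q"
    and eq: "\<And>f' p' q'. Sob L \<delta> f' p' q' ==> en p q p' q' = \<Lambda> * mm f f'"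
    and z: "(LINT Z|\<mu>. w Z * f Z) = 0" and pos: "mm f f > 0"
    and n: "AE s in iv L. \<not> (AE r in iv \<delta>. f (s, r) > 0)"
    and K: "\<And>s. 0 < s ==> s < L ==> \<delta>^2 * max 1 (1 + \<delta> * k s) \<le> K * min 1 (1 + \<delta> * k s)"
  shows "1 \<le> \<Lambda> * K"
proof (rule ccontr)
  assume less: "\<not> 1 \<le> \<Lambda> * K"
  note sob = SobD[OF S]
  define h where "h Z = max 0 (f Z)" for Z
  define hp where "hp Z = (if f Z > 0 then p Z else 0)" for Z
  define hq where "hq Z = (if f Z > 0 then q Z else 0)" for Z
  have T: "Sob L \<delta> h hp hq" using Sob_pos_part[OF S L \<delta>] by (simp add: h_def[abs_def] hp_def[abs_def] hq_def[abs_def])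
  have hh: "h Z * h Z = f Z * h Z" "hp Z * hp Z = p Z * hp Z" "hq Z * hq Z = q Z * hq Z" for Z
    by (auto simp: h_def hp_def hq_def max_def)
  have e: "en hp hq hp hq = \<Lambda> * mm h h" using eq[OF T] unfolding en_def mm_def hh .
  note i = Sob_integrable[OF T T]
  have K0: "0 < K"
  proof -
    have "0 < \<delta>^2 * max 1 (1 + \<delta> * k (L/2))" using \<delta> by (simp add: max_def)
    also have "\<dots> \<le> K * min 1 (1 + \<delta> * k (L/2))" by (rule K) (use L in auto)
    finally show ?thesis using wpos[of "L/2" \<delta>] L \<delta> by (simp add: zero_less_mult_iff min_def split: if_splits)
  qed
  have fib: "AE s in iv L. (LINT r|iv \<delta>. w (s, r) * (h (s, r) * h (s, r))) \<le> K * (LINT r|iv \<delta>. w (s, r) * (hq (s, r) * hq (s, r)))"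
    using n sob(8) integral_iv2_fst(1)[OF i(1)] integral_iv2_fst(1)[OF i(3)] integral_iv2_fst(1)[OF sob(6)] integral_iv2_fst(1)[OF SobD(6)[OF T]] AE_space
  proof eventually_elim
    case (elim s)
    then have s: "0 < s" "s < L" by auto
    define a b where "a = min 1 (1 + \<delta> * k s)" and "b = max 1 (1 + \<delta> * k s)"
    have a: "0 < a" using wpos[of s \<delta>] s \<delta> by (simp add: a_def)
    have wb: "a \<le> w (s, r)" "w (s, r) \<le> b" if "0 < r" "r < \<delta>" for r
    proof -
      have c: "0 \<le> r * k s \<and> r * k s \<le> \<delta> * k s \<or> r * k s \<le> 0 \<and> \<delta> * k s \<le> r * k s"
      proof (cases "0 \<le> k s")
        case True
        then show ?thesis using that mult_right_mono[of r \<delta> "k s"] by simp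
      next
        case False
        then show ?thesis using that mult_right_mono_neg[of r \<delta> "k s"] by (simp add: mult_le_0_iff)
      qed
      show "a \<le> w (s, r)" "w (s, r) \<le> b" using c unfolding w_def a_def b_def min_le_iff_disj le_max_iff_disj by auto
    qed
    have [measurable]: "(%r. f (s, r)) \<in> borel_measurable (iv \<delta>)"
      by (rule measurable_section_snd[OF sob(1)]) (use s in simp)
    define Q where "Q = (LINT r|iv \<delta>. (hq (s, r))^2)"
    have "AE r in iv \<delta>. (max 0 (f (s, r)))^2 \<le> \<delta> * (LINT r|iv \<delta>. (if f (s, r) > 0 then q (s, r) else 0)^2)"
      by (rule wAC_zero_bound[OF elim(2,1) _ elim(5)]) measurable
    then have ub: "AE r in iv \<delta>. w (s, r) * (h (s, r) * h (s, r)) \<le> b * (\<delta> * Q)"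
      using AE_space
    proof eventually_elim
      case (elim r)
      then have r: "0 < r" "r < \<delta>" by auto
      have h2: "h (s, r) * h (s, r) \<le> \<delta> * Q" using elim by (simp add: h_def Q_def hq_def power2_eq_square)
      show ?case by (rule mult_mono) (use h2 wb[OF r] a in auto)
    qed
    have "(LINT r|iv \<delta>. w (s, r) * (h (s, r) * h (s, r))) \<le> (LINT r|iv \<delta>. b * (\<delta> * Q))"
      by (rule integral_mono_AE[OF elim(3) _ ub]) simp
    \<comment> \<open>One factor \<open>\<delta>\<close> is the length of the cross-section, the
      other comes from the pointwise bound.\<close>
    also have "\<dots> = \<delta>^2 * b * Q" using measure_iv_space[of \<delta>] \<delta> by (simp add: power2_eq_square)
    also have "\<dots> \<le> K * a * Q"
      by (rule mult_right_mono) (use K[OF s] in \<open>simp_all add: a_def b_def Q_def\<close>)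
    also have "\<dots> = K * (LINT r|iv \<delta>. a * (hq (s, r))^2)" by (simp add: Q_def)
    also have "\<dots> \<le> K * (LINT r|iv \<delta>. w (s, r) * (hq (s, r) * hq (s, r)))"
    proof (rule mult_left_mono[OF integral_mono])
      show "integrable (iv \<delta>) (%r. a * (hq (s, r))^2)" using elim(6) by simp
      show "integrable (iv \<delta>) (%r. w (s, r) * (hq (s, r) * hq (s, r)))" by (rule elim(4))
      show "a * (hq (s, r))^2 \<le> w (s, r) * (hq (s, r) * hq (s, r))" if "r \<in> space (iv \<delta>)" for r
        using wb[of r] that by (simp add: power2_eq_square mult_right_mono)
    qed (use K0 in simp)
    finally show ?case .
  qed
  have "mm h h = (LINT s|iv L. LINT r|iv \<delta>. w (s, r) * (h (s, r) * h (s, r)))"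
    unfolding mm_def by (rule integral_iv2_fst(3)[OF i(1)])
  also have "\<dots> \<le> (LINT s|iv L. K * (LINT r|iv \<delta>. w (s, r) * (hq (s, r) * hq (s, r))))"
    by (rule integral_mono_AE[OF integral_iv2_fst(2)[OF i(1)] _ fib]) (use integral_iv2_fst(2)[OF i(3)] in simp)
  also have "\<dots> = K * (LINT Z|\<mu>. w Z * (hq Z * hq Z))" using integral_iv2_fst(3)[OF i(3)] by simp
  also have "\<dots> \<le> K * en hp hq hp hq"
  proof (rule mult_left_mono)
    show "(LINT Z|\<mu>. w Z * (hq Z * hq Z)) \<le> en hp hq hp hq" unfolding en_def
    proof (rule integral_mono[OF i(3) Bochner_Integration.integrable_add[OF i(2,3)]])
      fix Z assume "Z \<in> space \<mu>"
      then have "0 < w Z" by (intro w_pos_R) simp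
      then show "w Z * (hq Z * hq Z) \<le> hp Z * hp Z / w Z + w Z * (hq Z * hq Z)" by simp
    qed
  qed (use K0 in simp)
  also have "\<dots> = \<Lambda> * K * mm h h" by (simp add: e)
  finally have "(1 - \<Lambda> * K) * mm h h \<le> 0" by (simp add: algebra_simps)
  then have "mm h h = 0" using less mm_eq_0_iff(2)[OF T] by (simp add: mult_le_0_iff)
  then have h0: "AE Z in \<mu>. h Z = 0" using mm_eq_0_iff(1)[OF T] by simp
  \<comment> \<open>With \<open>h = 0\<close> the function \<open>f\<close> is nonpositive, and its
    vanishing weighted mean makes it 0, against positive mass.\<close>
  have iw: "integrable \<mu> (%Z. w Z * f Z)" by (rule Sob_integrable(4)[OF S S])
  have nn: "AE Z in \<mu>. 0 \<le> - (w Z * f Z)"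
    using h0 AE_space
  proof eventually_elim
    case (elim Z)
    then have "0 < w Z" by (intro w_pos_R) simp
    then show ?case using elim by (simp add: h_def max_def mult_le_0_iff split: if_splits)
  qed
  have "AE Z in \<mu>. - (w Z * f Z) = 0"
    using integral_nonneg_eq_0_iff_AE[OF Bochner_Integration.integrable_minus[OF iw] nn] z by simp
  then have "AE Z in \<mu>. f Z = 0" using AE_space
  proof eventually_elim
    case (elim Z)
    then have "0 < w Z" by (intro w_pos_R) simp
    then show ?case using elim by simp
  qed
  then show False using mm_eq_0_iff(1)[OF S] pos by simp
qed

theorem odd_first_eigenfunction:
  assumes R: "rayleigh_bound D \<Lambda>" and l: "0 < \<Lambda>" and u: "neumann_eigenfunction D \<Lambda> u"
    and K: "\<And>s. 0 < s ==> s < L ==> \<delta>^2 * max 1 (1 + \<delta> * k s) \<le> K * min 1 (1 + \<delta> * k s)" and lK: "\<Lambda> * K < 1"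
  shows "\<exists>u. neumann_eigenfunction D \<Lambda> u \<and> odd_wrt_y_axis D u"
proof -
  obtain f p q where f: "Sob L \<delta> f p q" "(LINT Z|\<mu>. w Z * f Z) = 0" "mm f f > 0"
    "\<And>f' p' q'. Sob L \<delta> f' p' q' ==> en p q p' q' = \<Lambda> * mm f f'"
    by (rule eigenfunction_rect[OF u]) (use l in simp, rule that, assumption+)
  have m: "Sob L \<delta> (%Z. - f Z) (%Z. - p Z) (%Z. - q Z)" using Sob_cmult[OF f(1), of "- 1"] by simp
  have mz: "(LINT Z|\<mu>. w Z * - f Z) = 0" using f(2) by simp
  have mp: "mm (%Z. - f Z) (%Z. - f Z) > 0" using f(3) by (simp add: mm_def)
  have me: "en (%Z. - p Z) (%Z. - q Z) p' q' = \<Lambda> * mm (%Z. - f Z) f'" if "Sob L \<delta> f' p' q'" for f' p' q'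
  proof -
    have "en (%Z. - p Z) (%Z. - q Z) p' q' = (LINT Z|\<mu>. - (p Z * p' Z / w Z + w Z * (q Z * q' Z)))"
      unfolding en_def by simp
    also have "\<dots> = - en p q p' q'" unfolding en_def by (rule Bochner_Integration.integral_minus)
    finally show ?thesis using f(4)[OF that] by (simp add: mm_def)
  qed
  show ?thesis
  proof (cases "AE Z in \<mu>. f (\<sigma> Z) = f Z")
    case False
    show ?thesis by (rule not_even_case[OF R f(1) f(4) False])
  next
    case even: True
    have np: "\<not> (AE s in iv L. \<not> (AE r in iv \<delta>. f (s, r) > 0))"
      using fibre_case[OF l f(1) f(4) f(2,3) _ K] lK by force
    have nn: "\<not> (AE s in iv L. \<not> (AE r in iv \<delta>. - f (s, r) > 0))"
      using fibre_case[OF l m me mz mp _ K] lK by force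
    obtain c where c: "AE z in \<mu>. f z = c (snd z) + prim L p (fst z) (snd z)"
      by (rule wAC_joint_rep[OF L SobD(9,10,7)[OF f(1)]])
    \<comment> \<open>\<open>f\<close> is known only almost everywhere, whereas \<open>F\<close> can
      be evaluated on one chosen fibre; the truncation has to cut exactly there.\<close>
    define F where "F s r = c r + prim L p s r" for s r
    have c': "AE s in iv L. AE r in iv \<delta>. f (s, r) = F s r" using AE_iv2_fst[OF c] by (simp add: F_def)
    have ev: "AE s in iv L. AE r in iv \<delta>. f (L - s, r) = f (s, r)" using AE_iv2_fst[OF even] by (simp add: \<sigma>_Pair)
    \<comment> \<open>The fibres in question are not contained in a null set, so one can be chosen
      off all exceptional sets and off the midpoint; evenness of \<open>f\<close> moves it into the
      left half.\<close>
    have pick: "\<exists>s. 0 < s \<and> s < L / 2 \<and> (AE r in iv \<delta>. Q (F s r))"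
      if n: "\<not> (AE s in iv L. \<not> (AE r in iv \<delta>. Q (f (s, r))))" for Q :: "real => bool"
    proof (rule ccontr)
      assume no: "\<nexists>s. 0 < s \<and> s < L / 2 \<and> (AE r in iv \<delta>. Q (F s r))"
      have "AE s in iv L. \<not> (AE r in iv \<delta>. Q (f (s, r)))"
        using c' AE_iv_reflect[OF c'] ev AE_iv_neq[of "L / 2" L] AE_space
      proof eventually_elim
        case (elim s)
        then have s: "0 < s" "s < L" by auto
        show ?case
        proof
          assume Q: "AE r in iv \<delta>. Q (f (s, r))"
          have "AE r in iv \<delta>. Q (F s r)" using Q elim(1) by eventually_elim simp
          then have "L / 2 < s" using no s elim(4) by force
          moreover have "AE r in iv \<delta>. Q (F (L - s) r)" using Q elim(2,3) by eventually_elim simp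
          ultimately show False using no s by force
        qed
      qed
      then show False using n by simp
    qed
    obtain s0 where s0: "0 < s0" "s0 < L / 2" "AE r in iv \<delta>. F s0 r > 0" using pick[OF np] by blast
    obtain s1 where s1: "0 < s1" "s1 < L / 2" "AE r in iv \<delta>. - F s1 r > 0" using pick[of "%t. - t > 0", OF nn] by blast
    have "s0 \<noteq> s1"
    proof
      assume "s0 = s1"
      with s0(3) s1(3) have "AE r in iv \<delta>. False" by (auto elim!: eventually_elim2)
      then have "measure (iv \<delta>) (space (iv \<delta>)) = 0" unfolding AE_False_iff by (simp add: measure_def)
      then show False using measure_iv_space[of \<delta>] \<delta> by simp
    qed
    then consider "s0 < s1" | "s1 < s0" by linarith
    then show ?thesis
    proof cases
      case 1
      have le: "AE r in iv \<delta>. c r + prim L p s1 r \<le> 0" using s1(3) by eventually_elim (simp add: F_def)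
      show ?thesis
        by (rule truncation_case[OF R f(1) f(4) s0(1) 1 s1(2) c s0(3)[unfolded F_def] le])
    next
      case 2
      \<comment> \<open>Passing to \<open>- f\<close> exchanges the roles of the two fibres.\<close>
      have pm: "prim L (%Z. - p Z) s r = - prim L p s r" for s r by (simp add: prim_def)
      have c2: "AE Z in \<mu>. - f Z = - c (snd Z) + prim L (%Z. - p Z) (fst Z) (snd Z)"
        using c by eventually_elim (simp add: pm)
      have a: "AE r in iv \<delta>. 0 < - c r + prim L (%Z. - p Z) s1 r" using s1(3) by eventually_elim (simp add: pm F_def)
      have b: "AE r in iv \<delta>. - c r + prim L (%Z. - p Z) s0 r \<le> 0" using s0(3) by eventually_elim (simp add: pm F_def)
      show ?thesis by (rule truncation_case[OF R m me s1(1) 2 s0(2) c2 a b])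
    qed
  qed
qed

text \<open>For fixed \<open>r\<close> the weight is symmetric in \<open>s\<close> and nondecreasing
  on the left half, so the weighted Wirtinger inequality holds on almost every horizontal line.
  Comparing \<open>p^2 / w\<close> with \<open>A * p^2 * w\<close> and dropping the energy in the
  \<open>r\<close> direction gives the bound.\<close>

theorem odd_lower_bound:
  assumes u: "neumann_eigenfunction D \<Lambda> u" "odd_wrt_y_axis D u" and l: "0 < \<Lambda>"
    and k0: "\<And>s. 0 < s ==> s < L / 2 ==> 0 \<le> k' s"
    and A: "0 \<le> A" "\<And>Z. Z \<in> R ==> A \<le> 1 / (w Z)^2"
  shows "A * (pi / L)^2 \<le> \<Lambda>"
proof -
  obtain f p q where f: "Sob L \<delta> f p q" "AE z in lebesgue_on D. u z = f (\<Psi> z)" "mm f f > 0"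
    "\<And>f' p' q'. Sob L \<delta> f' p' q' ==> en p q p' q' = \<Lambda> * mm f f'"
    by (rule eigenfunction_rect[OF u(1)]) (use l in simp, rule that, assumption+)
  note sob = SobD[OF f(1)]
  note [measurable] = sob(1-3)
  have uf: "AE Z in \<mu>. u (\<Phi> Z) = f Z"
    using AE_D_imp[OF f(2)] AE_space
  proof eventually_elim
    case (elim Z)
    then show ?case using \<Psi>_\<Phi>[OF subsetD[OF R_sub], of Z] by simp
  qed
  have odd: "AE Z in \<mu>. f (\<sigma> Z) = - f Z"
    using uf AE_\<sigma>[OF uf] AE_D_imp[OF u(2)[unfolded odd_wrt_y_axis_def]] AE_space
  proof eventually_elim
    case (elim Z)
    then show ?case using \<Phi>_\<sigma>[of Z] by simp
  qed
  have pw: "integrable \<mu> (%Z. (p Z)^2 * w Z)"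
    using integrable_w[of "%Z. (p Z)^2"] sob(5) by (simp add: mult.commute)
  have fw: "integrable \<mu> (%Z. (f Z)^2 * w Z)"
    using integrable_w[of "%Z. (f Z)^2"] sob(4) by (simp add: mult.commute)
  have fib: "AE r in iv \<delta>. (pi / L)^2 * (LINT s|iv L. (f (s, r))^2 * w (s, r)) \<le> (LINT s|iv L. (p (s, r))^2 * w (s, r))"
    using sob(7) integral_iv2_snd(1)[OF sob(5)] AE_iv2_snd[OF odd] AE_space
  proof eventually_elim
    case (elim r)
    then have r: "0 < r" "r < \<delta>" by auto
    have ws: "w (s, r) = 1 + r * k s" for s by (simp add: w_def)
    have ac: "AC L (%s. 1 + r * k s) (%s. r * k' s)"
    proof (rule AC_smooth)
      show "continuous_on {0..L} (%s. 1 + r * k s)" by (intro continuous_intros cont)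
      show "integrable (iv L) (%s. r * k' s)" by (intro integrable_iv_continuous continuous_on_mult continuous_on_const cont)
      show "((%s. 1 + r * k s) has_real_derivative r * k' s) (at s)" if "0 < s" "s < L" for s
        by (auto intro!: derivative_eq_intros k' that)
    qed
    have m: "(%s. f (s, r)) \<in> borel_measurable (iv L)"
      by (rule measurable_section_fst[OF sob(1)]) (use r in simp)
    show ?case unfolding ws
    proof (rule wAC_odd_Wirtinger[OF elim(1,2) L _ ac _ _ _ m])
      show "AE s in iv L. f (L - s, r) = - f (s, r)" using elim(3) by (simp add: \<sigma>_Pair)
      show "0 \<le> 1 + r * k s" if "0 \<le> s" "s \<le> L" for s using wpos[OF that, of r] r by simp
      show "0 \<le> r * k' s" if "0 < s" "s < L / 2" for s using k0[OF that] r by simp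
      show "1 + r * k (L - s) = 1 + r * k s" if "0 \<le> s" "s \<le> L" for s using k_reflect[OF that] by simp
    qed
  qed
  have "(pi / L)^2 * mm f f = (LINT r|iv \<delta>. (pi / L)^2 * (LINT s|iv L. (f (s, r))^2 * w (s, r)))"
    using integral_iv2_snd(3)[OF fw] by (simp add: mm_def power2_eq_square mult.commute)
  also have "\<dots> \<le> (LINT r|iv \<delta>. LINT s|iv L. (p (s, r))^2 * w (s, r))"
    by (rule integral_mono_AE[OF _ integral_iv2_snd(2)[OF pw] fib]) (use integral_iv2_snd(2)[OF fw] in simp)
  also have "\<dots> = (LINT Z|\<mu>. (p Z)^2 * w Z)" using integral_iv2_snd(3)[OF pw] by simp
  finally have "A * ((pi / L)^2 * mm f f) \<le> A * (LINT Z|\<mu>. (p Z)^2 * w Z)" by (rule mult_left_mono[OF _ A(1)])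
  also have "\<dots> = (LINT Z|\<mu>. A * ((p Z)^2 * w Z))" by simp
  also have "\<dots> \<le> en p q p q" unfolding en_def
  proof (rule integral_mono)
    show "integrable \<mu> (%Z. A * ((p Z)^2 * w Z))" using pw by simp
    show "integrable \<mu> (%Z. p Z * p Z / w Z + w Z * (q Z * q Z))" using Sob_integrable(2,3)[OF f(1) f(1)] by simp
    fix Z assume "Z \<in> space \<mu>"
    then have x: "Z \<in> R" by simp
    note wp = w_pos_R[OF x]
    have "A * ((p Z)^2 * w Z) \<le> 1 / (w Z)^2 * ((p Z)^2 * w Z)"
      by (rule mult_right_mono[OF A(2)[OF x]]) (use wp in simp)
    also have "\<dots> = p Z * p Z / w Z" using wp by (simp add: power2_eq_square)
    also have "\<dots> \<le> p Z * p Z / w Z + w Z * (q Z * q Z)" using wp by simp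
    finally show "A * ((p Z)^2 * w Z) \<le> p Z * p Z / w Z + w Z * (q Z * q Z)" .
  qed
  also have "\<dots> = \<Lambda> * mm f f" by (rule f(4)[OF f(1)])
  finally show ?thesis using f(3) by (simp add: mult.assoc[symmetric])
qed

text \<open>The trial function \<open>cos (pi / L * s)\<close> is odd about the midpoint, hence of
  mean zero, and for \<open>w = 1\<close> its energy is exactly \<open>(pi / L)^2\<close> times its
  mass.\<close>

theorem flat_upper_bound:
  assumes R: "rayleigh_bound D \<Lambda>" and k0: "\<And>s. 0 < s ==> s < L ==> k s = 0"
  shows "\<Lambda> \<le> (pi / L)^2"
proof -
  define g where "g s = cos (pi / L * s)" for s
  define g' where "g' s = - (pi / L) * sin (pi / L * s)" for s
  have S: "Sob L \<delta> (%Z. g (fst Z)) (%Z. g' (fst Z)) (%Z. 0)"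
  proof (rule Sob_of_fst[OF L \<delta>])
    show "(g has_real_derivative g' s) (at s)" for s
      unfolding g_def[abs_def] g'_def using L by (auto intro!: derivative_eq_intros)
    show "continuous_on UNIV g'" unfolding g'_def[abs_def] by (intro continuous_intros)
  qed
  note [measurable] = SobD(1-3)[OF S]
  have w1: "w Z = 1" if "Z \<in> R" for Z using that k0[of "fst Z"] by (auto simp: w_def)
  have gL: "g (L - s) = - g s" "g' (L - s) = g' s" for s
  proof -
    have "pi / L * (L - s) = pi - pi / L * s" using L by (simp add: field_simps)
    then show "g (L - s) = - g s" "g' (L - s) = g' s" by (simp_all add: g_def g'_def)
  qed
  have "(LINT Z|\<mu>. w Z * g (fst Z)) = (LINT Z|\<mu>. w (\<sigma> Z) * g (fst (\<sigma> Z)))"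
    by (rule integral_\<sigma>(1)[of "%Z. w Z * g (fst Z)", symmetric]) measurable
  also have "\<dots> = (LINT Z|\<mu>. - (w Z * g (fst Z)))"
    by (rule LINT_cong) (simp_all add: w_\<sigma>, simp add: \<sigma>_def gL)
  finally have z: "(LINT Z|\<mu>. w Z * g (fst Z)) = 0" by simp
  define C where "C = (LINT Z|\<mu>. (g (fst Z))^2)"
  define E where "E = (LINT Z|\<mu>. (g' (fst Z))^2)"
  have mC: "mm (%Z. g (fst Z)) (%Z. g (fst Z)) = C" unfolding mm_def C_def
    by (rule LINT_cong) (simp_all add: w1 power2_eq_square)
  have eE: "en (%Z. g' (fst Z)) (%Z. 0) (%Z. g' (fst Z)) (%Z. 0) = E" unfolding en_def E_def
    by (rule LINT_cong) (simp_all add: w1 power2_eq_square)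
  \<comment> \<open>The difference of the squares is a cosine over one full period, which integrates
    to 0, so mass and energy are compared without computing either.\<close>
  have "C - (L / pi)^2 * E = (LINT Z|\<mu>. (g (fst Z))^2 - (L / pi)^2 * (g' (fst Z))^2)"
    using SobD(4,5)[OF S] by (simp add: C_def E_def)
  also have "\<dots> = (LINT Z|\<mu>. cos (2 * (pi / L * fst Z)))"
  proof (rule LINT_cong)
    fix Z :: "real \<times> real"
    have "(L / pi)^2 * (g' (fst Z))^2 = (sin (pi / L * fst Z))^2"
      using L by (simp add: g'_def power_mult_distrib power_divide)
    then show "(g (fst Z))^2 - (L / pi)^2 * (g' (fst Z))^2 = cos (2 * (pi / L * fst Z))"
      by (simp only: cos_double) (simp add: g_def)
  qed simp
  also have "\<dots> = (LINT s|iv L. LINT r|iv \<delta>. cos (2 * (pi / L * s)))"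
  proof -
    have "integrable \<mu> (%Z. cos (2 * (pi / L * fst Z)))"
      by (rule integrable_iv2_of_fst[where h = "%s. cos (2 * (pi / L * s))"]) (intro integrable_iv_continuous continuous_intros)
    from integral_iv2_fst(3)[OF this] show ?thesis by simp
  qed
  also have "\<dots> = \<delta> * (LINT s|iv L. cos (2 * (pi / L * s)))" using measure_iv_space[of \<delta>] \<delta> by simp
  also have "(LINT s|iv L. cos (2 * (pi / L * s))) = 0"
  proof -
    have ac: "AC L (%s. L / (2 * pi) * sin (2 * (pi / L * s))) (%s. cos (2 * (pi / L * s)))"
    proof (rule AC_smooth)
      show "((%s. L / (2 * pi) * sin (2 * (pi / L * s))) has_real_derivative cos (2 * (pi / L * s))) (at s)" for s
        using L by (auto intro!: derivative_eq_intros simp: field_simps)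
    qed (intro integrable_iv_continuous continuous_intros)+
    have "(LINT s|iv L. indicator {0<..L} s * cos (2 * (pi / L * s))) = (LINT s|iv L. cos (2 * (pi / L * s)))"
      by (rule LINT_cong) (auto simp: indicator_def)
    then show ?thesis using AC_diff_eq[OF ac, of 0 L] L by simp
  qed
  finally have CE: "E = (pi / L)^2 * C" using L by (simp add: field_simps power_divide)
  have "C \<noteq> 0"
  proof
    assume C0: "C = 0"
    then have "E = 0" using CE by simp
    have "AE Z in \<mu>. (g (fst Z))^2 = 0"
      using C0 integral_nonneg_eq_0_iff_AE[OF SobD(4)[OF S]] by (simp add: C_def)
    moreover have "AE Z in \<mu>. (g' (fst Z))^2 = 0"
      using \<open>E = 0\<close> integral_nonneg_eq_0_iff_AE[OF SobD(5)[OF S]] by (simp add: E_def)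
    ultimately have "AE Z in \<mu>. False"
    proof eventually_elim
      case (elim Z)
      then have "cos (pi / L * fst Z) = 0" "sin (pi / L * fst Z) = 0" using L by (simp_all add: g_def g'_def)
      then show False using sin_cos_squared_add[of "pi / L * fst Z"] by simp
    qed
    then show False using not_AE_False by simp
  qed
  moreover have "0 \<le> C" by (simp add: C_def)
  moreover have "\<Lambda> * C \<le> (pi / L)^2 * C" using rect_rayleigh[OF R S z] by (simp add: mC eE CE)
  ultimately show ?thesis by (simp add: mult_le_cancel_right)
qed

end

section \<open>From smooth curves to the geometric interface\<close>

lemma smooth_within_deriv: "smooth_within S f ==> smooth_within S (deriv_within S f)"
  unfolding smooth_within_def by (metis funpow_Suc_right comp_apply)

lemma smooth_within_has_derivative:
  assumes "smooth_within S f" "s \<in> S"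
  shows "(f has_real_derivative deriv_within S f s) (at s within S)"
proof -
  have "f differentiable (at s within S)" using assms unfolding smooth_within_def by (metis funpow_0)
  then show ?thesis
    by (simp add: has_real_derivative_iff_has_vector_derivative vector_derivative_works deriv_within_def)
qed

lemma smooth_within_continuous: "smooth_within S f ==> continuous_on S f"
  unfolding continuous_on_eq_continuous_within
  using smooth_within_has_derivative has_derivative_continuous has_field_derivative_def by blast

lemma deriv_within_unique:
  assumes "(f has_real_derivative c) (at s within {0..L})" "0 < L" "s \<in> {0..L}"
  shows "deriv_within {0..L} f s = c"
  using assms vector_derivative_within_cbox[of 0 L s f c]
  by (simp add: deriv_within_def has_real_derivative_iff_has_vector_derivative cbox_interval)

text \<open>\<open>c\<close> is the parity of \<open>f\<close> under reversal, and the chain rule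
  flips it. Derivatives are one-sided at the end points, so the reflected interval has to be
  recognized as the interval itself.\<close>

lemma deriv_within_reflect:
  assumes f: "smooth_within {0..L} f" and L: "0 < L" and r: "\<And>s. s \<in> {0..L} ==> f (L - s) = c * f s" and s: "s \<in> {0..L}"
  shows "deriv_within {0..L} f (L - s) = - c * deriv_within {0..L} f s"
proof -
  have im: "(%s. L - s) ` {0..L} = {0..L}"
    by (auto intro: image_eqI[of _ _ "L - _"])
  have "(f has_real_derivative deriv_within {0..L} f (L - s)) (at (L - s) within (%s. L - s) ` {0..L})"
    unfolding im by (rule smooth_within_has_derivative[OF f]) (use s in simp)
  moreover have "((%s. L - s) has_real_derivative - 1) (at s within {0..L})" by (auto intro!: derivative_eq_intros)
  ultimately have "(f \<circ> (%s. L - s) has_real_derivative deriv_within {0..L} f (L - s) * - 1) (at s within {0..L})"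
    by (rule DERIV_image_chain)
  then have 1: "((%s. c * f s) has_real_derivative - deriv_within {0..L} f (L - s)) (at s within {0..L})"
    unfolding mult_minus1_right by (rule has_field_derivative_transform_within[where d = 1]) (use r s in auto)
  have 2: "((%s. c * f s) has_real_derivative c * deriv_within {0..L} f s) (at s within {0..L})"
    by (rule DERIV_cmult[OF smooth_within_has_derivative[OF f s]])
  show ?thesis using deriv_within_unique[OF 1 L s] deriv_within_unique[OF 2 L s] by simp
qed

lemma deriv_within_const:
  assumes c: "\<And>s. s \<in> {0..L} ==> f s = c" and L: "0 < L" and s: "s \<in> {0..L}"
  shows "deriv_within {0..L} f s = (0::real)"
proof (rule deriv_within_unique[OF _ L s])
  have "((%s. c) has_real_derivative 0) (at s within {0..L})" by simp
  then show "(f has_real_derivative 0) (at s within {0..L})"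
    by (rule has_field_derivative_transform_within[where d = 1]) (use c s in auto)
qed

lemma closure_param_domain:
  assumes "0 < L" "0 < \<delta>"
  shows "closure (param_domain L \<delta>) = {0..L} \<times> {0..\<delta>}"
proof -
  have "param_domain L \<delta> = {0<..<L} \<times> {0<..<\<delta>}" by (auto simp: param_domain_def)
  then show ?thesis using assms by (simp add: closure_Times)
qed

text \<open>Differentiating the unit-speed relation makes the acceleration orthogonal to the
  tangent, so it is the curvature times the normal; this gives the Frenet equations. The parities of
  all derivatives descend from those of \<open>x\<close> and \<open>y\<close>.\<close>

lemma symmetric_strip_of_smooth:
  assumes L: "0 < L" and \<delta>: "0 < \<delta>"
    and smooth: "smooth_within {0..L} x" "smooth_within {0..L} y"
    and unit: "\<And>s. s \<in> {0..L} ==> (deriv_within {0..L} x s)^2 + (deriv_within {0..L} y s)^2 = 1"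
    and sym: "\<And>s. s \<in> {0..L / 2} ==> x (L - s) = - x s \<and> y (L - s) = y s"
    and inj: "inj_on (strip_map L x y) ({0..L} \<times> {0..\<delta>})"
    and wpos: "\<And>s r. s \<in> {0..L} ==> r \<in> {0..\<delta>} ==> 1 + r * signed_curvature L x y s > 0"
  obtains k' where "symmetric_strip L \<delta> x y (deriv_within {0..L} x) (deriv_within {0..L} y) (signed_curvature L x y) k'"
proof -
  let ?d = "deriv_within {0..L}"
  define tx ty ax ay where "tx = ?d x" and "ty = ?d y" and "ax = ?d tx" and "ay = ?d ty"
  define k' where "k' s = tx s * ?d ay s - ?d ax s * ty s" for s
  have k: "signed_curvature L x y = (%s. tx s * ay s - ax s * ty s)"
    by (simp add: signed_curvature_def fun_eq_iff Let_def tx_def ty_def ax_def ay_def)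
  have sm: "smooth_within {0..L} tx" "smooth_within {0..L} ty" "smooth_within {0..L} ax" "smooth_within {0..L} ay"
    unfolding tx_def ty_def ax_def ay_def by (intro smooth_within_deriv smooth)+
  note c = smooth[THEN smooth_within_continuous] sm[THEN smooth_within_continuous] sm(3,4)[THEN smooth_within_deriv, THEN smooth_within_continuous]
  have D: "(f has_real_derivative ?d f s) (at s)" if "smooth_within {0..L} f" "0 < s" "s < L" for f s
    using smooth_within_has_derivative[OF that(1), of s] that(2,3) by (simp add: at_within_Icc_at)
  \<comment> \<open>The symmetry is given on the left half; applied at \<open>L - s\<close> it
    covers the right half.\<close>
  have r: "x (L - s) = - 1 * x s" "y (L - s) = 1 * y s" if "s \<in> {0..L}" for s
    using sym[of s] sym[of "L - s"] that by (cases "s \<le> L / 2"; simp)+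
  have tr: "tx (L - s) = 1 * tx s" "ty (L - s) = - 1 * ty s" if "s \<in> {0..L}" for s
    using deriv_within_reflect[OF smooth(1) L r(1) that] deriv_within_reflect[OF smooth(2) L r(2) that] by (simp_all add: tx_def ty_def)
  have ar: "ax (L - s) = - ax s" "ay (L - s) = ay s" if "s \<in> {0..L}" for s
    using deriv_within_reflect[OF sm(1) L tr(1) that] deriv_within_reflect[OF sm(2) L tr(2) that] by (simp_all add: ax_def ay_def)
  have orth: "tx s * ax s + ty s * ay s = 0" if s: "0 < s" "s < L" for s
  proof -
    have "((%s. (tx s)^2 + (ty s)^2) has_real_derivative 2 * (tx s * ax s + ty s * ay s)) (at s)"
      unfolding ax_def ay_def
      by (rule derivative_eq_intros D sm s refl)+ (simp add: algebra_simps)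
    moreover have "((%s. (tx s)^2 + (ty s)^2) has_real_derivative 0) (at s)"
      by (rule has_field_derivative_transform_within_open[where S = "{0<..<L}" and f = "%_. 1"])
        (use s unit in \<open>auto simp: tx_def ty_def\<close>)
    ultimately show ?thesis using DERIV_unique by fastforce
  qed
  have fr: "ax s = - (tx s * ay s - ax s * ty s) * ty s" "ay s = (tx s * ay s - ax s * ty s) * tx s" if s: "0 < s" "s < L" for s
  proof -
    have u: "tx s * tx s + ty s * ty s = 1" using unit[of s] s by (simp add: tx_def ty_def power2_eq_square)
    have "- (tx s * ay s - ax s * ty s) * ty s = ax s * (tx s * tx s + ty s * ty s) - tx s * (tx s * ax s + ty s * ay s)"
      by (simp add: algebra_simps)
    then show "ax s = - (tx s * ay s - ax s * ty s) * ty s" using u orth[OF s] by simp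
    have "(tx s * ay s - ax s * ty s) * tx s = ay s * (tx s * tx s + ty s * ty s) - ty s * (tx s * ax s + ty s * ay s)"
      by (simp add: algebra_simps)
    then show "ay s = (tx s * ay s - ax s * ty s) * tx s" using u orth[OF s] by simp
  qed
  have "symmetric_strip L \<delta> x y tx ty (%s. tx s * ay s - ax s * ty s) k'"
  proof
    show "(x has_real_derivative tx s) (at s)" if "0 < s" "s < L" for s unfolding tx_def by (rule D[OF smooth(1) that])
    show "(y has_real_derivative ty s) (at s)" if "0 < s" "s < L" for s unfolding ty_def by (rule D[OF smooth(2) that])
    show "(tx has_real_derivative - (tx s * ay s - ax s * ty s) * ty s) (at s)" if "0 < s" "s < L" for s
      using D[OF sm(1) that] fr(1)[OF that] by (simp add: ax_def[symmetric])
    show "(ty has_real_derivative (tx s * ay s - ax s * ty s) * tx s) (at s)" if "0 < s" "s < L" for s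
      using D[OF sm(2) that] fr(2)[OF that] by (simp add: ay_def[symmetric])
    show "((%s. tx s * ay s - ax s * ty s) has_real_derivative k' s) (at s)" if s: "0 < s" "s < L" for s
      by (rule derivative_eq_intros D[OF sm(1) s] D[OF sm(2) s] D[OF sm(3) s] D[OF sm(4) s] refl)+
        (simp add: k'_def ax_def[symmetric] ay_def[symmetric])
    show "continuous_on {0..L} x" "continuous_on {0..L} y" "continuous_on {0..L} tx" "continuous_on {0..L} ty" by (rule c)+
    show "continuous_on {0..L} (%s. tx s * ay s - ax s * ty s)" "continuous_on {0..L} k'"
      unfolding k'_def[abs_def] by (intro continuous_on_diff continuous_on_mult c)+
    show "(tx s)^2 + (ty s)^2 = 1" if "0 \<le> s" "s \<le> L" for s using unit[of s] that by (simp add: tx_def ty_def)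
    show "0 < 1 + r * (tx s * ay s - ax s * ty s)" if "0 \<le> s" "s \<le> L" "0 \<le> r" "r \<le> \<delta>" for s r
      using wpos[of s r] that by (simp add: k)
    show "inj_on (%(s, r). (x s + r * ty s, y s - r * tx s)) ({0..L} \<times> {0..\<delta>})"
      using inj by (simp add: strip_map_def tx_def ty_def)
    show "x (L - s) = - x s" "y (L - s) = y s" "tx (L - s) = tx s" "ty (L - s) = - ty s" if "0 \<le> s" "s \<le> L" for s
      using r[of s] tr[of s] that by simp_all
    show "tx (L - s) * ay (L - s) - ax (L - s) * ty (L - s) = tx s * ay s - ax s * ty s" if "0 \<le> s" "s \<le> L" for s
      using tr[of s] ar[of s] that by simp
  qed (rule L \<delta>)+
  then show thesis unfolding tx_def ty_def using that unfolding k tx_def ty_def by blast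
qed

text \<open>If \<open>k\<close> decreased at \<open>s\<close>, it would drop below
  \<open>k s\<close> at some \<open>s + h\<close> between \<open>s\<close> and the mirror point
  \<open>L - s\<close>, where it has the same value as at \<open>s\<close>; concavity excludes that.
  \<open>\<theta>\<close> is the relative position of \<open>s + h\<close> between the two
  points.\<close>

lemma (in symmetric_strip) concave_curvature_increasing:
  assumes c: "concave_on {0..L} k" and s: "0 < s" "s < L / 2"
  shows "0 \<le> k' s"
proof (rule ccontr)
  assume "\<not> 0 \<le> k' s"
  then obtain d where d: "d > 0" "\<And>h. 0 < h ==> h < d ==> k (s + h) < k s"
    using DERIV_neg_dec_right[OF k', of s] s L by auto
  define h where "h = min (d / 2) (L / 2 - s)"
  have h: "0 < h" "h < d" "h \<le> L / 2 - s" using d(1) s by (auto simp: h_def)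
  define \<theta> where "\<theta> = h / (L - 2 * s)"
  have t: "0 \<le> \<theta>" "\<theta> \<le> 1" "\<theta> * (L - 2 * s) = h" using h s by (auto simp: \<theta>_def field_simps)
  have "(1 - \<theta>) * k s + \<theta> * k (L - s) \<le> k ((1 - \<theta>) *\<^sub>R s + \<theta> *\<^sub>R (L - s))"
    by (rule concave_onD[OF c t(1,2)]) (use s L in auto)
  moreover have "(1 - \<theta>) *\<^sub>R s + \<theta> *\<^sub>R (L - s) = s + h" unfolding t(3)[symmetric] by (simp add: algebra_simps)
  ultimately have "k s \<le> k (s + h)" using k_reflect[of s] s L by (simp add: algebra_simps)
  then show False using d(2)[OF h(1,2)] by simp
qed

text \<open>Links the constants of the three conditions to the fibre argument. The ratio of the
  extreme weights on a cross-section is \<open>1 + \<delta> * \<kappa>\<close> for nonnegative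
  curvature and its reciprocal for negative curvature; \<open>\<delta>^2\<close> times this ratio is
  dominated by the respective constant.\<close>

lemma strip_ratio_bound:
  fixes \<kappa> :: real
  assumes \<delta>: "0 < \<delta>" and w: "0 < 1 + \<delta> * \<kappa>"
    and K: "0 \<le> \<kappa> ==> (2 * \<delta> + \<delta>^2 * \<kappa>)^2 \<le> K" "\<kappa> < 0 ==> 4 * \<delta>^2 / (1 + \<delta> * \<kappa>)^2 \<le> K"
  shows "\<delta>^2 * max 1 (1 + \<delta> * \<kappa>) \<le> K * min 1 (1 + \<delta> * \<kappa>)"
proof (cases "0 \<le> \<kappa>")
  case True
  then have p: "0 \<le> \<delta> * \<kappa>" using \<delta> by simp
  have "(2 + \<delta> * \<kappa>)^2 - (1 + \<delta> * \<kappa>) = 3 * (1 + \<delta> * \<kappa>) + (\<delta> * \<kappa>)^2" by (simp add: power2_eq_square algebra_simps)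
  moreover have "0 \<le> 3 * (1 + \<delta> * \<kappa>) + (\<delta> * \<kappa>)^2" using p by simp
  ultimately have "1 + \<delta> * \<kappa> \<le> (2 + \<delta> * \<kappa>)^2" by linarith
  then have "\<delta>^2 * (1 + \<delta> * \<kappa>) \<le> \<delta>^2 * (2 + \<delta> * \<kappa>)^2" by (rule mult_left_mono) simp
  also have "\<dots> = (2 * \<delta> + \<delta>^2 * \<kappa>)^2" by (simp add: power2_eq_square algebra_simps)
  finally show ?thesis using K(1)[OF True] p by simp
next
  case False
  define m where "m = 1 + \<delta> * \<kappa>"
  have m: "0 < m" "m \<le> 1" using w False \<delta> by (simp_all add: m_def mult_le_0_iff)
  have "\<delta>^2 * m \<le> \<delta>^2 * 4" by (rule mult_left_mono) (use m in simp_all)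
  then have "\<delta>^2 \<le> 4 * \<delta>^2 / m^2 * m" using m by (simp add: field_simps power2_eq_square)
  also have "\<dots> \<le> K * m" by (rule mult_right_mono) (use K(2) False m in \<open>simp_all add: m_def\<close>)
  finally show ?thesis using m by (simp add: m_def[symmetric])
qed

theorem corollary1p1:
  fixes L \<delta> A2 :: real and x y k :: "real \<Rightarrow> real" and D\<^sub>F D :: "(real \<times> real) set"
  defines "k \<equiv> signed_curvature L x y"
    and "D\<^sub>F \<equiv> param_domain L \<delta>"
    and "D \<equiv> strip L \<delta> x y"
    and "A2 \<equiv> (INF (s, r)\<in>closure D\<^sub>F. 1 / (1 + r * k s)\<^sup>2)"
  assumes "L > 0" and "\<delta> > 0"
    and smooth: "smooth_within {0..L} x" "smooth_within {0..L} y"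
    and arc_length: "\<And>s. s \<in> {0..L} \<Longrightarrow>
          (deriv_within {0..L} x s)\<^sup>2 + (deriv_within {0..L} y s)\<^sup>2 = 1"
    and simple_nonclosed: "inj_on (\<lambda>s. (x s, y s)) {0..L}"
    and symmetric: "\<And>s. s \<in> {0..L / 2} \<Longrightarrow> x (L - s) = - x s \<and> y (L - s) = y s"
    and one_to_one: "bij_betw (strip_map L x y) (closure D\<^sub>F) (closure D)"
    and concave: "concave_on {0..L} k"
    and jacobian_pos: "\<And>s r. (s, r) \<in> closure D\<^sub>F \<Longrightarrow> 1 + r * k s > 0"
    and cases:
      "((\<forall>s\<in>{0..L}. k s \<ge> 0) \<and>
          mu1 D < 1 / (SUP s\<in>{0..L}. (2 * \<delta> + \<delta>\<^sup>2 * k s)\<^sup>2))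
       \<or> ((\<forall>s\<in>{0..L}. k s < 0) \<and>
          mu1 D < 1 / (SUP s\<in>{0..L}. 4 * \<delta>\<^sup>2 / (1 + \<delta> * k s)\<^sup>2))
       \<or> ((\<exists>s\<in>{0..L}. k s > 0) \<and> (\<exists>s\<in>{0..L}. k s < 0) \<and>
          mu1 D < 1 / max (SUP s\<in>{0..L}. (2 * \<delta> + \<delta>\<^sup>2 * k s)\<^sup>2)
                          (SUP s\<in>{0..L}. 4 * \<delta>\<^sup>2 / (1 + \<delta> * k s)\<^sup>2))"
  shows "mu1 D = mu1_odd D \<and> mu1_odd D \<ge> A2 * (pi / L)\<^sup>2 \<and>
    ((\<lambda>s. (x s, y s)) ` {0..L} = closed_segment (x 0, y 0) (x L, y L) \<and> mu1 D < 1 / (4 * \<delta>\<^sup>2)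
       \<longrightarrow> mu1 D = A2 * (pi / L)\<^sup>2)"
proof -
  note L = \<open>L > 0\<close> and \<delta> = \<open>\<delta> > 0\<close>
  have cl: "closure D\<^sub>F = {0..L} \<times> {0..\<delta>}" unfolding D\<^sub>F_def by (rule closure_param_domain[OF L \<delta>])
  have inj: "inj_on (strip_map L x y) ({0..L} \<times> {0..\<delta>})" using bij_betw_imp_inj_on[OF one_to_one] by (simp add: cl)
  have wpos: "1 + r * k s > 0" if "s \<in> {0..L}" "r \<in> {0..\<delta>}" for s r
    by (rule jacobian_pos) (use that in \<open>simp add: cl\<close>)
  obtain k' where ss: "symmetric_strip L \<delta> x y (deriv_within {0..L} x) (deriv_within {0..L} y) k k'"
    using symmetric_strip_of_smooth[OF L \<delta> smooth arc_length symmetric inj wpos[unfolded k_def]] unfolding k_def by metis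
  interpret S: symmetric_strip L \<delta> x y "deriv_within {0..L} x" "deriv_within {0..L} y" k k' by (rule ss)
  have DD: "S.D = D"
  proof -
    have "S.\<Phi> = strip_map L x y" by (auto simp: S.\<Phi>_def strip_map_def fun_eq_iff)
    moreover have "param_domain L \<delta> = {0<..<L} \<times> {0<..<\<delta>}" by (auto simp: param_domain_def)
    ultimately show ?thesis by (simp add: S.D_def D_def strip_def)
  qed
  obtain \<Lambda> u where R: "rayleigh_bound D \<Lambda>" and l: "\<Lambda> > 0" and u: "neumann_eigenfunction D \<Lambda> u"
    by (rule S.first_eigenvalue[unfolded DD])
  have mu: "mu1 D = \<Lambda>"
    using least_eigenvalue[OF S.D_lebesgue S.finite_D S.one, unfolded DD, OF R l u, of "%_. True"] by (simp add: mu1_def)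
  define K1 where "K1 = (SUP s\<in>{0..L}. (2 * \<delta> + \<delta>^2 * k s)^2)"
  define K2 where "K2 = (SUP s\<in>{0..L}. 4 * \<delta>^2 / (1 + \<delta> * k s)^2)"
  have bdd: "bdd_above (f ` {0..L})" if "continuous_on {0..L} f" for f :: "real => real"
    by (rule bounded_imp_bdd_above[OF compact_imp_bounded[OF compact_continuous_image[OF that]]]) simp
  have K1: "(2 * \<delta> + \<delta>^2 * k s)^2 \<le> K1" if "s \<in> {0..L}" for s
    unfolding K1_def by (rule cSUP_upper[OF that bdd]) (intro continuous_intros S.cont)
  have K2: "4 * \<delta>^2 / (1 + \<delta> * k s)^2 \<le> K2" if "s \<in> {0..L}" for s
    unfolding K2_def
  proof (rule cSUP_upper[OF that bdd])
    have "\<forall>s\<in>{0..L}. (1 + \<delta> * k s)^2 \<noteq> 0" using wpos[of _ \<delta>] \<delta> by fastforce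
    then show "continuous_on {0..L} (%s. 4 * \<delta>^2 / (1 + \<delta> * k s)^2)"
      by (intro continuous_on_divide continuous_on_power continuous_on_add continuous_on_mult continuous_on_const S.cont)
  qed
  \<comment> \<open>One number covers all three conditions: at each \<open>s\<close> it dominates
    the constant that belongs to the sign of \<open>k s\<close>.\<close>
  obtain K where K: "\<Lambda> < 1 / K" "\<And>s. s \<in> {0..L} ==> 0 \<le> k s ==> (2 * \<delta> + \<delta>^2 * k s)^2 \<le> K"
    "\<And>s. s \<in> {0..L} ==> k s < 0 ==> 4 * \<delta>^2 / (1 + \<delta> * k s)^2 \<le> K"
  proof -
    consider "\<forall>s\<in>{0..L}. k s \<ge> 0" "\<Lambda> < 1 / K1" | "\<forall>s\<in>{0..L}. k s < 0" "\<Lambda> < 1 / K2" | "\<Lambda> < 1 / max K1 K2"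
      using cases unfolding mu K1_def[symmetric] K2_def[symmetric] by blast
    then show thesis
    proof cases
      case 1
      show thesis by (rule that[OF 1(2)]) (use 1(1) K1 in \<open>auto simp: not_le[symmetric]\<close>)
    next
      case 2
      show thesis by (rule that[OF 2(2)]) (use 2(1) K2 in \<open>auto simp: not_le[symmetric]\<close>)
    next
      case 3
      show thesis by (rule that[OF 3]) (use K1 K2 in \<open>auto simp: le_max_iff_disj\<close>)
    qed
  qed
  \<comment> \<open>Positivity of \<open>K\<close> is read off from
    \<open>0 < \<Lambda> < 1 / K\<close>, which also rules out a division by 0.\<close>
  have lK: "\<Lambda> * K < 1"
  proof -
    have "0 < 1 / K" using l K(1) by (rule less_trans)
    then have "0 < K" by (simp only: zero_less_divide_1_iff)
    then show ?thesis using K(1) by (simp add: field_simps)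
  qed
  have "\<exists>u. neumann_eigenfunction S.D \<Lambda> u \<and> odd_wrt_y_axis S.D u"
  proof (rule S.odd_first_eigenfunction[unfolded DD, OF R l u _ lK, folded DD])
    fix s assume "0 < s" "s < L"
    then show "\<delta>^2 * max 1 (1 + \<delta> * k s) \<le> K * min 1 (1 + \<delta> * k s)"
      using wpos[of s \<delta>] \<delta> K(2,3)[of s] by (intro strip_ratio_bound) auto
  qed
  then obtain v where v: "neumann_eigenfunction D \<Lambda> v" "odd_wrt_y_axis D v" unfolding DD by blast
  have mo: "mu1_odd D = \<Lambda>"
    using least_eigenvalue[OF S.D_lebesgue S.finite_D S.one, unfolded DD, OF R l v(1), where P = "odd_wrt_y_axis D"] v(2) by (simp add: mu1_odd_def)
  have A_le: "A2 \<le> 1 / (1 + r * k s)^2" if "s \<in> {0..L}" "r \<in> {0..\<delta>}" for s r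
  proof -
    have "bdd_below ((%(s, r). 1 / (1 + r * k s)^2) ` closure D\<^sub>F)" by (rule bdd_belowI[of _ 0]) auto
    from cINF_lower[OF this, of "(s, r)"] show ?thesis using that by (simp add: A2_def cl)
  qed
  have ne: "closure D\<^sub>F \<noteq> {}" using L \<delta> by (auto simp: cl)
  have A0: "0 \<le> A2" unfolding A2_def by (rule cINF_greatest[OF ne]) auto
  have lower: "A2 * (pi / L)^2 \<le> \<Lambda>"
  proof (rule S.odd_lower_bound[unfolded DD, OF v l _ A0])
    show "0 \<le> k' s" if "0 < s" "s < L / 2" for s by (rule S.concave_curvature_increasing[OF concave that])
    show "A2 \<le> 1 / (S.w Z)^2" if "Z \<in> {0<..<L} \<times> {0<..<\<delta>}" for Z
      using A_le[of "fst Z" "snd Z"] that by (auto simp: S.w_def)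
  qed
  \<comment> \<open>By symmetry both end points have the same height, so the segment is horizontal
    and \<open>y\<close> is constant. Its derivatives and the curvature vanish, whence
    \<open>A2 \<ge> 1\<close>, and the lower bound meets the upper bound from the cosine.\<close>
  have sharp: "\<Lambda> = A2 * (pi / L)^2" if seg: "(%s. (x s, y s)) ` {0..L} = closed_segment (x 0, y 0) (x L, y L)"
  proof -
    have y0: "y s = y 0" if "s \<in> {0..L}" for s
    proof -
      have "y L = y 0" using S.y_reflect[of 0] L by simp
      moreover have "(x s, y s) \<in> closed_segment (x 0, y 0) (x L, y L)" using seg that by blast
      ultimately show ?thesis by (auto simp: in_segment algebra_simps)
    qed
    have ty: "deriv_within {0..L} y s = 0" if "s \<in> {0..L}" for s by (rule deriv_within_const[OF y0 L that])
    have ay: "deriv_within {0..L} (deriv_within {0..L} y) s = 0" if "s \<in> {0..L}" for s by (rule deriv_within_const[OF ty L that])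
    have k0: "k s = 0" if "s \<in> {0..L}" for s
      using ty[OF that] ay[OF that] by (simp add: k_def signed_curvature_def Let_def)
    have "1 \<le> A2" unfolding A2_def by (rule cINF_greatest[OF ne]) (auto simp: cl k0)
    then have "1 * (pi / L)^2 \<le> A2 * (pi / L)^2" by (rule mult_right_mono) simp
    moreover have "\<Lambda> \<le> (pi / L)^2" by (rule S.flat_upper_bound[unfolded DD, OF R]) (simp add: k0)
    ultimately show ?thesis using lower by simp
  qed
  show ?thesis using mu mo lower sharp by simp
qed

end
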